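(* Let $k$ be a field and let $H$ be a finite dimensional Hopf algebra over $k$. Let $\mathfrak{H}_1, \dots, \mathfrak{H}_n$ and $\mathfrak{H}'_1, \dots, \mathfrak{H}'_m$ be two composition series of $H$. Then there exists a bijection $f: \{1, \dots, n\} \to \{1, \dots, m\}$ such that $\mathfrak{H}_i \cong \mathfrak{H}'_{f(i)}$ as Hopf algebras for all $i$.
   Context: Let $H$ be a finite dimensional Hopf algebra over a field $k$, with counit $\epsilon$ and antipode $\mathcal S$. A Hopf subalgebra $A\subseteq H$ is normal if it is stable under the left and right adjoint actions of $H$, i.e. $h_{(1)}a\mathcal S(h_{(2)}) \in A$ and $\mathcal S(h_{(1)})ah_{(2)}\in A$ for all $h\in H$, $a\in A$. Write $A^+ = A\cap\ker\epsilon$. If $A$ is normal, then $HA^+$ is a Hopf ideal and $H/HA^+$ is a quotient Hopf algebra. $H$ is simple if it contains no proper nontrivial normal Hopf subalgebra (i.e. no normal Hopf subalgebra $A$ with $k\subsetneq A\subsetneq H$). A composition series of $H$ is a finite sequence of finite dimensional simple Hopf algebras $\mathfrak{H}_1,\dots,\mathfrak{H}_n$ defined recursively as follows. (1) If $H$ is simple, then $n=1$ and $\mathfrak{H}_1 = H$. (2) If $k\subsetneq A\subsetneq H$ is a normal Hopf subalgebra and $\mathfrak{A}_1,\dots,\mathfrak{A}_m$ and $\mathfrak{B}_1,\dots,\mathfrak{B}_l$ are composition series of $A$ and of $B = H/HA^+$, respectively, then $n=m+l$, $\mathfrak{H}_i=\mathfrak{A}_i$ for $1\le i\le m$ and $\mathfrak{H}_i=\mathfrak{B}_{i-m}$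 for $m<i\le m+l$. (Every series obtained from some choice of $A$ and of composition series of $A$ and $B$ is a composition series of $H$.) *)

theory Defs
  imports Complex_Main "HOL-Library.Poly_Mapping" "HOL-Algebra.Algebraic_Closure_Type"
    "HOL-Algebra.Ideal_Product"
begin

text \<open>
  The ground field is a type of class \<^class>\<open>field\<close>; vector spaces and algebras over it are
  HOL-Algebra records with explicit carriers, because the objects studied are subalgebras and
  quotients.
\<close>

abbreviation scalars :: "'k::field ring" where
  "scalars \<equiv> ring_of_type_algebra"

definition linear_map ::
    "('k, 'a, 'm) module_scheme \<Rightarrow> ('k, 'b, 'n) module_scheme \<Rightarrow> ('a \<Rightarrow> 'b) \<Rightarrow> bool" where
  "linear_map V W \<phi> \<longleftrightarrow>
     \<phi> \<in> carrier V \<rightarrow> carrier W \<and>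
     (\<forall>x\<in>carrier V. \<forall>y\<in>carrier V. \<phi> (x \<oplus>\<^bsub>V\<^esub> y) = \<phi> x \<oplus>\<^bsub>W\<^esub> \<phi> y) \<and>
     (\<forall>c. \<forall>x\<in>carrier V. \<phi> (c \<odot>\<^bsub>V\<^esub> x) = c \<odot>\<^bsub>W\<^esub> \<phi> x)"

definition finite_dimensional :: "('k::field, 'a, 'm) module_scheme \<Rightarrow> bool" where
  "finite_dimensional V \<longleftrightarrow>
     (\<exists>B. finite B \<and> B \<subseteq> carrier V \<and>
          (\<forall>x\<in>carrier V. \<exists>c :: 'a \<Rightarrow> 'k. x = (\<Oplus>\<^bsub>V\<^esub>b\<in>B. c b \<odot>\<^bsub>V\<^esub> b)))"


section \<open>Tensor products\<close>

text \<open>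
  \<open>V \<otimes> W\<close> is the free vector space on \<open>V \<times> W\<close> modulo the bilinearity relations. Formal linear
  combinations of pairs are finitely supported functions, and a tensor is a coset of them.
\<close>

type_synonym ('k, 'a, 'b) tensor = "(('a \<times> 'b) \<Rightarrow>\<^sub>0 'k) set"

definition fscale :: "'k::field \<Rightarrow> ('c \<Rightarrow>\<^sub>0 'k) \<Rightarrow> ('c \<Rightarrow>\<^sub>0 'k)" where
  "fscale c f = Poly_Mapping.map (\<lambda>a. c * a) f"

definition fsums :: "('a, 'm) ring_scheme \<Rightarrow> ('b, 'n) ring_scheme \<Rightarrow> (('a \<times> 'b) \<Rightarrow>\<^sub>0 'k::field) set" where
  "fsums V W = {f. Poly_Mapping.keys f \<subseteq> carrier V \<times> carrier W}"

definition bilinear_rels ::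
    "('k::field, 'a, 'm) module_scheme \<Rightarrow> ('k, 'b, 'n) module_scheme \<Rightarrow> (('a \<times> 'b) \<Rightarrow>\<^sub>0 'k) set" where
  "bilinear_rels V W =
     {Poly_Mapping.single (x \<oplus>\<^bsub>V\<^esub> x', y) 1 - Poly_Mapping.single (x, y) 1 - Poly_Mapping.single (x', y) 1
        | x x' y. x \<in> carrier V \<and> x' \<in> carrier V \<and> y \<in> carrier W} \<union>
     {Poly_Mapping.single (x, y \<oplus>\<^bsub>W\<^esub> y') 1 - Poly_Mapping.single (x, y) 1 - Poly_Mapping.single (x, y') 1
        | x y y'. x \<in> carrier V \<and> y \<in> carrier W \<and> y' \<in> carrier W} \<union>
     {Poly_Mapping.single (c \<odot>\<^bsub>V\<^esub> x, y) 1 - fscale c (Poly_Mapping.single (x, y) 1)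
        | c x y. x \<in> carrier V \<and> y \<in> carrier W} \<union>
     {Poly_Mapping.single (x, c \<odot>\<^bsub>W\<^esub> y) 1 - fscale c (Poly_Mapping.single (x, y) 1)
        | c x y. x \<in> carrier V \<and> y \<in> carrier W}"

definition tclass ::
    "('k::field, 'a, 'm) module_scheme \<Rightarrow> ('k, 'b, 'n) module_scheme \<Rightarrow>
     (('a \<times> 'b) \<Rightarrow>\<^sub>0 'k) \<Rightarrow> ('k, 'a, 'b) tensor" where
  "tclass V W f = {g \<in> fsums V W. g - f \<in> module.span fscale (bilinear_rels V W)}"

definition pure_tensor ::
    "('k::field, 'a, 'm) module_scheme \<Rightarrow> ('k, 'b, 'n) module_scheme \<Rightarrow> 'a \<Rightarrow> 'b \<Rightarrow> ('k, 'a, 'b) tensor" where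
  "pure_tensor V W x y = tclass V W (Poly_Mapping.single (x, y) 1)"

definition fmult ::
    "('a, 'm) ring_scheme \<Rightarrow> ('b, 'n) ring_scheme \<Rightarrow>
     (('a \<times> 'b) \<Rightarrow>\<^sub>0 'k::field) \<Rightarrow> (('a \<times> 'b) \<Rightarrow>\<^sub>0 'k) \<Rightarrow> (('a \<times> 'b) \<Rightarrow>\<^sub>0 'k)" where
  "fmult V W f g =
     (\<Sum>(x, y)\<in>Poly_Mapping.keys f. \<Sum>(x', y')\<in>Poly_Mapping.keys g.
        Poly_Mapping.single (x \<otimes>\<^bsub>V\<^esub> x', y \<otimes>\<^bsub>W\<^esub> y')
          (Poly_Mapping.lookup f (x, y) * Poly_Mapping.lookup g (x', y')))"

text \<open>
  The multiplicative part, \<open>(x \<otimes> y)(x' \<otimes> y') = xx' \<otimes> yy'\<close>, is meaningful when \<open>V\<close> and \<open>W\<close> are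
  algebras.
\<close>

definition tensor ::
    "('k::field, 'a, 'm) module_scheme \<Rightarrow> ('k, 'b, 'n) module_scheme \<Rightarrow> ('k, ('k, 'a, 'b) tensor) module" where
  "tensor V W =
     \<lparr> carrier = tclass V W ` fsums V W,
       monoid.mult = (\<lambda>s t. \<Union>f\<in>s. \<Union>g\<in>t. tclass V W (fmult V W f g)),
       one = pure_tensor V W \<one>\<^bsub>V\<^esub> \<one>\<^bsub>W\<^esub>,
       ring.zero = tclass V W 0,
       add = (\<lambda>s t. \<Union>f\<in>s. \<Union>g\<in>t. tclass V W (f + g)),
       module.smult = (\<lambda>c t. \<Union>f\<in>t. tclass V W (fscale c f)) \<rparr>"

text \<open>
  For \<open>t = \<Sum> x\<^sub>i \<otimes> y\<^sub>i\<close> this is \<open>\<Sum> b x\<^sub>i y\<^sub>i\<close>, computed in \<open>M\<close>; for bilinear \<open>b\<close> it does not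
  depend on the representative. With \<open>t = \<Delta>(h)\<close> it renders Sweedler's \<open>b(h\<^sub>(\<^sub>1\<^sub>), h\<^sub>(\<^sub>2\<^sub>))\<close>.
\<close>

definition sweedler ::
    "('k::field, 'c, 'm) module_scheme \<Rightarrow> ('a \<Rightarrow> 'b \<Rightarrow> 'c) \<Rightarrow> ('k, 'a, 'b) tensor \<Rightarrow> 'c" where
  "sweedler M b t =
     (let f = (SOME f. f \<in> t)
      in \<Oplus>\<^bsub>M\<^esub>p\<in>Poly_Mapping.keys f. Poly_Mapping.lookup f p \<odot>\<^bsub>M\<^esub> b (fst p) (snd p))"


section \<open>Hopf algebras\<close>

record (overloaded) ('k::zero, 'a) hopf = "('k, 'a) module" +
  comult :: "'a \<Rightarrow> ('k, 'a, 'a) tensor" (\<open>\<Delta>\<index>\<close>)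
  counit :: "'a \<Rightarrow> 'k" (\<open>\<epsilon>\<index>\<close>)
  antipode :: "'a \<Rightarrow> 'a" (\<open>\<S>\<index>\<close>)

locale hopf_algebra = module scalars H + ring H
  for H :: "('k::field, 'a) hopf" (structure) +
  assumes smult_mult_left:
      "\<lbrakk> x \<in> carrier H; y \<in> carrier H \<rbrakk> \<Longrightarrow> (c \<odot> x) \<otimes> y = c \<odot> (x \<otimes> y)"
    and smult_mult_right:
      "\<lbrakk> x \<in> carrier H; y \<in> carrier H \<rbrakk> \<Longrightarrow> x \<otimes> (c \<odot> y) = c \<odot> (x \<otimes> y)"
    and comult_hom: "\<Delta> \<in> ring_hom H (tensor H H)"
    and comult_linear: "linear_map H (tensor H H) \<Delta>"
    and counit_hom: "\<epsilon> \<in> ring_hom H scalars"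
    and counit_smult: "x \<in> carrier H \<Longrightarrow> \<epsilon> (c \<odot> x) = c * \<epsilon> x"
    and antipode_linear: "linear_map H H \<S>"
    \<comment> \<open>both sides in \<open>H \<otimes> (H \<otimes> H)\<close>\<close>
    and coassoc: "h \<in> carrier H \<Longrightarrow>
      sweedler (tensor H (tensor H H))
        (\<lambda>x z. sweedler (tensor H (tensor H H))
                 (\<lambda>u v. pure_tensor H (tensor H H) u (pure_tensor H H v z)) (\<Delta> x)) (\<Delta> h) =
      sweedler (tensor H (tensor H H)) (\<lambda>x z. pure_tensor H (tensor H H) x (\<Delta> z)) (\<Delta> h)"
    and counit_left: "h \<in> carrier H \<Longrightarrow> sweedler H (\<lambda>x y. \<epsilon> x \<odot> y) (\<Delta> h) = h"
    and counit_right: "h \<in> carrier H \<Longrightarrow> sweedler H (\<lambda>x y. \<epsilon> y \<odot> x) (\<Delta> h) = h"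
    and antipode_left: "h \<in> carrier H \<Longrightarrow> sweedler H (\<lambda>x y. \<S> x \<otimes> y) (\<Delta> h) = \<epsilon> h \<odot> \<one>"
    and antipode_right: "h \<in> carrier H \<Longrightarrow> sweedler H (\<lambda>x y. x \<otimes> \<S> y) (\<Delta> h) = \<epsilon> h \<odot> \<one>"

definition hopf_iso :: "('k::field, 'a) hopf \<Rightarrow> ('k, 'b) hopf \<Rightarrow> ('a \<Rightarrow> 'b) set" where
  "hopf_iso H L = {\<phi>. \<phi> \<in> ring_iso H L \<and> linear_map H L \<phi> \<and>
     (\<forall>h\<in>carrier H.
        \<Delta>\<^bsub>L\<^esub> (\<phi> h) = sweedler (tensor L L) (\<lambda>x y. pure_tensor L L (\<phi> x) (\<phi> y)) (\<Delta>\<^bsub>H\<^esub> h) \<and>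
        \<epsilon>\<^bsub>L\<^esub> (\<phi> h) = \<epsilon>\<^bsub>H\<^esub> h \<and>
        \<S>\<^bsub>L\<^esub> (\<phi> h) = \<phi> (\<S>\<^bsub>H\<^esub> h))}"

definition hopf_isomorphic :: "('k::field, 'a) hopf \<Rightarrow> ('k, 'b) hopf \<Rightarrow> bool" (infix \<open>\<cong>\<^sub>H\<close> 50) where
  "H \<cong>\<^sub>H L \<longleftrightarrow> hopf_iso H L \<noteq> {}"


section \<open>Hopf subalgebras and quotients\<close>

text \<open>
  \<open>\<Delta>(a)\<close> lies in the image of \<open>A \<otimes> A \<rightarrow> H \<otimes> H\<close> iff it has a representative supported on \<open>A \<times> A\<close>.
\<close>

definition hopf_subalgebra :: "'a set \<Rightarrow> ('k::field, 'a) hopf \<Rightarrow> bool" where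
  "hopf_subalgebra A H \<longleftrightarrow>
     subring A H \<and>
     (\<forall>c. \<forall>a\<in>A. c \<odot>\<^bsub>H\<^esub> a \<in> A) \<and>
     (\<forall>a\<in>A. \<exists>f\<in>\<Delta>\<^bsub>H\<^esub> a. Poly_Mapping.keys f \<subseteq> A \<times> A) \<and>
     (\<forall>a\<in>A. \<S>\<^bsub>H\<^esub> a \<in> A)"

definition normal_hopf_subalgebra :: "'a set \<Rightarrow> ('k::field, 'a) hopf \<Rightarrow> bool" where
  "normal_hopf_subalgebra A H \<longleftrightarrow>
     hopf_subalgebra A H \<and>
     (\<forall>h\<in>carrier H. \<forall>a\<in>A.
        sweedler H (\<lambda>x y. x \<otimes>\<^bsub>H\<^esub> a \<otimes>\<^bsub>H\<^esub> \<S>\<^bsub>H\<^esub> y) (\<Delta>\<^bsub>H\<^esub> h) \<in> A \<and>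
        sweedler H (\<lambda>x y. \<S>\<^bsub>H\<^esub> x \<otimes>\<^bsub>H\<^esub> a \<otimes>\<^bsub>H\<^esub> y) (\<Delta>\<^bsub>H\<^esub> h) \<in> A)"

text \<open>
  Over a field \<open>A \<otimes> A \<rightarrow> H \<otimes> H\<close> is injective, so the preimage of the coset \<open>\<Delta>(a)\<close> is the coset of
  all its representatives supported on \<open>A \<times> A\<close>.
\<close>

definition restrict_hopf :: "('k::field, 'a) hopf \<Rightarrow> 'a set \<Rightarrow> ('k, 'a) hopf" where
  "restrict_hopf H A =
     H\<lparr>carrier := A, comult := (\<lambda>a. {f \<in> \<Delta>\<^bsub>H\<^esub> a. Poly_Mapping.keys f \<subseteq> A \<times> A})\<rparr>"

definition quotient_algebra :: "('k::field, 'a) hopf \<Rightarrow> 'a set \<Rightarrow> ('k, 'a set) module" where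
  "quotient_algebra H I =
     \<lparr> carrier = carrier (H Quot I), monoid.mult = monoid.mult (H Quot I), one = \<one>\<^bsub>H Quot I\<^esub>,
       ring.zero = \<zero>\<^bsub>H Quot I\<^esub>, add = add (H Quot I),
       module.smult = (\<lambda>c C. \<Union>x\<in>C. I +>\<^bsub>H\<^esub> (c \<odot>\<^bsub>H\<^esub> x)) \<rparr>"

definition quotient_hopf :: "('k::field, 'a) hopf \<Rightarrow> 'a set \<Rightarrow> ('k, 'a set) hopf" where
  "quotient_hopf H I =
     module.extend (quotient_algebra H I)
       (hopf.fields
         (\<lambda>C. \<Union>x\<in>C. sweedler (tensor (quotient_algebra H I) (quotient_algebra H I))
            (\<lambda>u v. pure_tensor (quotient_algebra H I) (quotient_algebra H I)
                     (I +>\<^bsub>H\<^esub> u) (I +>\<^bsub>H\<^esub> v)) (\<Delta>\<^bsub>H\<^esub> x))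
         (\<lambda>C. \<epsilon>\<^bsub>H\<^esub> (SOME x. x \<in> C))
         (\<lambda>C. \<Union>x\<in>C. I +>\<^bsub>H\<^esub> \<S>\<^bsub>H\<^esub> x))"

text \<open>
  \<open>HA\<^sup>+\<close>, the additive span of the products \<open>ha\<close> with \<open>h \<in> H\<close> and \<open>a \<in> A\<^sup>+ = A \<inter> ker \<epsilon>\<close>;
  \<^const>\<open>ideal_prod\<close> is defined for arbitrary subsets.
\<close>

definition HAplus :: "('k::field, 'a) hopf \<Rightarrow> 'a set \<Rightarrow> 'a set" where
  "HAplus H A = ideal_prod H (carrier H) {a \<in> A. \<epsilon>\<^bsub>H\<^esub> a = 0}"

definition proper_nontrivial :: "'a set \<Rightarrow> ('k::field, 'a) hopf \<Rightarrow> bool" where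
  "proper_nontrivial A H \<longleftrightarrow> {c \<odot>\<^bsub>H\<^esub> \<one>\<^bsub>H\<^esub> | c. True} \<subset> A \<and> A \<subset> carrier H"

definition simple_hopf :: "('k::field, 'a) hopf \<Rightarrow> bool" where
  "simple_hopf H \<longleftrightarrow> \<not> (\<exists>A. normal_hopf_subalgebra A H \<and> proper_nontrivial A H)"


section \<open>Composition series\<close>

text \<open>
  The quotient \<open>H/HA\<^sup>+\<close> has carrier type \<^typ>\<open>'a set\<close>. To keep all members of a series over one
  type, \<open>B\<close> ranges over all isomorphic copies of it over \<^typ>\<open>'a\<close>; copies always exist, since
  one can transport the structure to a set of coset representatives.
\<close>

inductive composition_series :: "('k::field, 'a) hopf \<Rightarrow> ('k, 'a) hopf list \<Rightarrow> bool" where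
  simple: "simple_hopf H \<Longrightarrow> composition_series H [H]"
| extension:
    "\<lbrakk> normal_hopf_subalgebra A H; proper_nontrivial A H;
       hopf_algebra B; quotient_hopf H (HAplus H A) \<cong>\<^sub>H B;
       composition_series (restrict_hopf H A) As; composition_series B Bs \<rbrakk>
     \<Longrightarrow> composition_series H (As @ Bs)"

end

theory Submission
  imports Defs "HOL-Library.Multiset"
begin

text \<open>
  The proof follows the group-theoretic argument of Jordan and Hoelder, by induction on the dimension.
  Let two series of \<open>H\<close> start with the normal Hopf subalgebras \<open>A\<close> and \<open>A\<^sub>1\<close>. Their product
  \<open>E = A A\<^sub>1\<close> is a normal Hopf subalgebra again (\<open>prod_normal\<close>). If \<open>E \<noteq> H\<close>, both series are compared
  with a third one that passes through \<open>E\<close> (\<open>series_refine\<close>). If \<open>E = H\<close>, they are compared through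
  \<open>D = A \<inter> A\<^sub>1\<close>, because then \<open>A\<^sub>1 / D \<cong> H / A\<close> and \<open>A / D \<cong> H / A\<^sub>1\<close>, where \<open>H / A\<close> stands for
  \<open>H / HA\<^sup>+\<close> (\<open>series_complementary\<close>).

  This rests on the isomorphism theorems. That \<open>H / E\<close> is a quotient of \<open>H / A\<close> for \<open>A \<subseteq> E\<close> is a short
  computation with ideals (\<open>is_quotient_comp\<close>). The other one, \<open>E / (A \<inter> E) \<cong> \<pi>(E)\<close> for the projection
  \<open>\<pi>\<close> from \<open>H\<close> to \<open>H / A\<close>, says that \<open>E \<inter> HA\<^sup>+ = E (A \<inter> E)\<^sup>+\<close> (\<open>kernel_on_subalgebra\<close>). For groups
  this is trivial; for Hopf algebras it combines two facts about finite dimensional Hopf algebras.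

  First, the elements \<open>h\<close> with \<open>\<pi>(h\<^sub>(\<^sub>1\<^sub>)) \<otimes> h\<^sub>(\<^sub>2\<^sub>) = 1 \<otimes> h\<close> all lie in \<open>A\<close> (\<open>coinvariant_mem\<close>).
  The proof uses a retraction of \<open>H\<close> onto \<open>A\<close> that is linear over \<open>A\<close>, and such a retraction exists
  because a nonzero integral makes \<open>A\<close> a Frobenius algebra. Consequently \<open>HA\<^sup>+\<close> determines \<open>A\<close>, which is
  also the reason why proper inclusions \<open>A \<subset> E \<subset> H\<close> remain proper in \<open>H / A\<close>.

  Second, the kernel of a surjection \<open>\<pi>\<close> from \<open>K\<close> onto \<open>C\<close> is the left ideal generated by the
  coinvariants of augmentation \<open>0\<close> (\<open>kernel_generated_by_coinvariants\<close>). The proof uses a section of \<open>\<pi>\<close>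
  that is colinear over \<open>C\<close>; it is written down with an integral on \<open>C\<close> and an element dual to it.

  Nonzero integrals come from a trace formula (\<open>trace_integral\<close>, \<open>form_from_trace_integrals\<close>).

  All computations take place in the ground field. A tensor is determined by the values of the
  bilinear forms on it (\<open>tensor_eqI\<close>), and an element of a finite dimensional space by the values of
  the linear forms (\<open>eq_if_forms_eq\<close>). So an identity between Sweedler sums becomes an identity between
  scalars, and a membership such as \<open>\<Delta>(a) \<in> A \<otimes> A\<close> says that the forms vanishing on \<open>A \<times> A\<close> vanish on
  \<open>\<Delta>(a)\<close>. Likewise a quotient \<open>H / A\<close> is treated as a surjective homomorphism with kernel \<open>HA\<^sup>+\<close>, so
  that restrictions and composites of quotient maps are quotient maps.
\<close>

section \<open>Linear algebra over the ground field\<close>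

lemma scalars_simps [simp]:
  "carrier (scalars :: 'k::field ring) = UNIV"
  "monoid.mult (scalars :: 'k::field ring) = (*)"
  "add (scalars :: 'k::field ring) = (+)"
  "\<one>\<^bsub>(scalars :: 'k::field ring)\<^esub> = 1"
  "\<zero>\<^bsub>(scalars :: 'k::field ring)\<^esub> = 0"
  by (simp_all add: ring_of_type_algebra_def fun_eq_iff)

lemma scalars_minus [simp]: "\<ominus>\<^bsub>(scalars :: 'k::field ring)\<^esub> x = - x"
proof -
  interpret cring "scalars :: 'k ring" by (rule cring_from_type_algebra)
  show ?thesis
    using minus_equality[of "- x" x] by simp
qed

locale vspace = module scalars V
  for V :: "('k::field, 'a, 'm) module_scheme" (structure)
begin

lemma vs_simps [simp]:
  "x \<in> carrier V \<Longrightarrow> c \<odot> x \<in> carrier V"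
  "x \<in> carrier V \<Longrightarrow> 0 \<odot> x = \<zero>"
  "c \<odot> \<zero> = \<zero>"
  "x \<in> carrier V \<Longrightarrow> 1 \<odot> x = x"
  using smult_closed[of c x] smult_l_null[of x] smult_r_null[of c] smult_one[of x] by simp_all

lemma vs_distr:
  "x \<in> carrier V \<Longrightarrow> y \<in> carrier V \<Longrightarrow> c \<odot> (x \<oplus> y) = c \<odot> x \<oplus> c \<odot> y"
  "x \<in> carrier V \<Longrightarrow> (c + d) \<odot> x = c \<odot> x \<oplus> d \<odot> x"
  "x \<in> carrier V \<Longrightarrow> c \<odot> (d \<odot> x) = (c * d) \<odot> x"
  "x \<in> carrier V \<Longrightarrow> (- c) \<odot> x = \<ominus> (c \<odot> x)"
  "x \<in> carrier V \<Longrightarrow> c \<odot> (\<ominus> x) = \<ominus> (c \<odot> x)"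
  using smult_r_distr[of c x y] smult_l_distr[of c d x] smult_assoc1[of c d x]
    smult_l_minus[of c x] smult_r_minus[of c x] by simp_all

lemma minus_smult: "x \<in> carrier V \<Longrightarrow> \<ominus> x = (- 1) \<odot> x"
  by (simp add: vs_distr)

lemma subspaceI:
  assumes "W \<subseteq> carrier V" "\<zero> \<in> W" "\<And>x y. x \<in> W \<Longrightarrow> y \<in> W \<Longrightarrow> x \<oplus> y \<in> W"
    "\<And>c x. x \<in> W \<Longrightarrow> c \<odot> x \<in> W"
  shows "submodule W scalars V"
  using assms by (intro submoduleI) (auto simp: minus_smult subset_iff)

lemma subspaceD:
  assumes "submodule W scalars V"
  shows "W \<subseteq> carrier V" "\<zero> \<in> W" "\<And>x y. x \<in> W \<Longrightarrow> y \<in> W \<Longrightarrow> x \<oplus> y \<in> W"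
    "\<And>c x. x \<in> W \<Longrightarrow> c \<odot> x \<in> W" "\<And>x. x \<in> W \<Longrightarrow> \<ominus> x \<in> W"
    "\<And>x y. x \<in> W \<Longrightarrow> y \<in> W \<Longrightarrow> x \<ominus> y \<in> W"
proof -
  show *: "W \<subseteq> carrier V" "\<And>x y. x \<in> W \<Longrightarrow> y \<in> W \<Longrightarrow> x \<oplus> y \<in> W"
    "\<And>c x. x \<in> W \<Longrightarrow> c \<odot> x \<in> W" "\<And>x. x \<in> W \<Longrightarrow> \<ominus> x \<in> W"
    using submoduleE[OF assms] by auto
  show "\<zero> \<in> W"
    using submoduleE(2)[OF assms] *(3)[of _ 0] *(1) by (metis ex_in_conv subsetD vs_simps(2))
  show "\<And>x y. x \<in> W \<Longrightarrow> y \<in> W \<Longrightarrow> x \<ominus> y \<in> W"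
    using * by (simp add: a_minus_def)
qed

lemma subspace_finsum:
  assumes "submodule W scalars V" "\<And>i. i \<in> I \<Longrightarrow> f i \<in> W"
  shows "(\<Oplus>i\<in>I. f i) \<in> W"
  using assms(2)
proof (induction I rule: infinite_finite_induct)
  case (insert i I)
  then show ?case using subspaceD[OF assms(1)]
    by (subst finsum_insert) (auto simp: Pi_def subset_iff)
qed (use subspaceD[OF assms(1)] in auto)

lemma subspace_vspace:
  assumes "submodule W scalars V"
  shows "vspace (V\<lparr>carrier := W\<rparr>)"
  using submodule.submodule_is_module[OF assms module_axioms] by (simp add: vspace_def)

lemma carrier_subspace: "submodule (carrier V) scalars V"
  by (intro subspaceI) auto

lemma zero_subspace: "submodule {\<zero>} scalars V"
  by (intro subspaceI) auto

end

definition linear_form :: "('k::field, 'a, 'm) module_scheme \<Rightarrow> ('a \<Rightarrow> 'k) \<Rightarrow> bool" where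
  "linear_form V \<phi> \<longleftrightarrow>
     (\<forall>x\<in>carrier V. \<forall>y\<in>carrier V. \<phi> (x \<oplus>\<^bsub>V\<^esub> y) = \<phi> x + \<phi> y) \<and>
     (\<forall>c. \<forall>x\<in>carrier V. \<phi> (c \<odot>\<^bsub>V\<^esub> x) = c * \<phi> x)"

lemma linear_formD:
  assumes "linear_form V \<phi>"
  shows "x \<in> carrier V \<Longrightarrow> y \<in> carrier V \<Longrightarrow> \<phi> (x \<oplus>\<^bsub>V\<^esub> y) = \<phi> x + \<phi> y"
    "x \<in> carrier V \<Longrightarrow> \<phi> (c \<odot>\<^bsub>V\<^esub> x) = c * \<phi> x"
  using assms by (auto simp: linear_form_def)

lemma linear_mapD:
  assumes "linear_map V W p"
  shows "x \<in> carrier V \<Longrightarrow> p x \<in> carrier W"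
   "x \<in> carrier V \<Longrightarrow> y \<in> carrier V \<Longrightarrow> p (x \<oplus>\<^bsub>V\<^esub> y) = p x \<oplus>\<^bsub>W\<^esub> p y"
    "x \<in> carrier V \<Longrightarrow> p (c \<odot>\<^bsub>V\<^esub> x) = c \<odot>\<^bsub>W\<^esub> p x"
  using assms by (auto simp: linear_map_def)

lemma linear_mapI:
  assumes "\<And>x. x \<in> carrier V \<Longrightarrow> p x \<in> carrier W"
   "\<And>x y. x \<in> carrier V \<Longrightarrow> y \<in> carrier V \<Longrightarrow> p (x \<oplus>\<^bsub>V\<^esub> y) = p x \<oplus>\<^bsub>W\<^esub> p y"
    "\<And>c x. x \<in> carrier V \<Longrightarrow> p (c \<odot>\<^bsub>V\<^esub> x) = c \<odot>\<^bsub>W\<^esub> p x"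
  shows "linear_map V W p"
  using assms by (auto simp: linear_map_def)

context vspace
begin

lemma linear_form_zero: "linear_form V \<phi> \<Longrightarrow> \<phi> \<zero> = 0"
  using linear_formD(2)[of V \<phi> \<zero> 0] by simp

lemma linear_form_minus: "linear_form V \<phi> \<Longrightarrow> x \<in> carrier V \<Longrightarrow> y \<in> carrier V \<Longrightarrow> \<phi> (x \<ominus> y) = \<phi> x - \<phi> y"
  by (simp add: a_minus_def minus_smult linear_formD)

lemma linear_form_finsum:
  assumes "linear_form V \<phi>" "\<And>i. i \<in> I \<Longrightarrow> f i \<in> carrier V"
  shows "\<phi> (\<Oplus>i\<in>I. f i) = (\<Sum>i\<in>I. \<phi> (f i))"
  using assms(2)
proof (induction I rule: infinite_finite_induct)
  case (insert i I)
  then show ?case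
    by (subst finsum_insert) (auto simp: Pi_def linear_formD[OF assms(1)])
qed (use linear_form_zero[OF assms(1)] in auto)

lemma linear_map_zero:
  assumes "vspace W" "linear_map V W p" shows "p \<zero> = \<zero>\<^bsub>W\<^esub>"
proof -
  interpret W: vspace W by fact
  show ?thesis using linear_mapD(1,3)[OF assms(2), of \<zero> ] linear_mapD(3)[OF assms(2), of \<zero> 0]
      W.vs_simps(2)[of "p \<zero>"] by simp
qed

lemma linear_map_minus:
  assumes "vspace W" "linear_map V W p" "x \<in> carrier V" "y \<in> carrier V"
  shows "p (x \<ominus> y) = p x \<ominus>\<^bsub>W\<^esub> p y"
proof -
  interpret W: vspace W by fact
  show ?thesis using assms(3,4)
    by (simp add: a_minus_def minus_smult W.minus_smult linear_mapD[OF assms(2)])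
qed

end

text \<open>A basis of a complement of \<open>W\<close>: \<open>d\<close> are its coordinate forms and \<open>p\<close> is the projection onto \<open>W\<close> along
  this complement. One construction of these data yields both dual bases (\<open>W = 0\<close>) and projections.\<close>

definition basis_over ::
  "('k::field, 'a, 'm) module_scheme \<Rightarrow> 'a set \<Rightarrow> 'a set \<Rightarrow> ('a \<Rightarrow> 'a \<Rightarrow> 'k) \<Rightarrow> ('a \<Rightarrow> 'a) \<Rightarrow> bool" where
  "basis_over V W B d p \<longleftrightarrow>
     finite B \<and> B \<subseteq> carrier V \<and> linear_map V V p \<and> p ` carrier V \<subseteq> W \<and> (\<forall>w\<in>W. p w = w) \<and>
     (\<forall>b\<in>B. linear_form V (d b) \<and> p b = \<zero>\<^bsub>V\<^esub> \<and> (\<forall>w\<in>W. d b w = 0)) \<and>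
     (\<forall>b\<in>B. \<forall>b'\<in>B. d b b' = (if b = b' then 1 else 0)) \<and>
     (\<forall>x\<in>carrier V. x = p x \<oplus>\<^bsub>V\<^esub> (\<Oplus>\<^bsub>V\<^esub>b\<in>B. d b x \<odot>\<^bsub>V\<^esub> b))"

text \<open>Stated through subspaces instead of linear combinations, so that spanning sets can be transported
  along a linear map by taking preimages of subspaces.\<close>

definition spanning :: "('k::field, 'a, 'm) module_scheme \<Rightarrow> 'a set \<Rightarrow> bool" where
  "spanning V B \<longleftrightarrow> B \<subseteq> carrier V \<and> (\<forall>U. submodule U scalars V \<and> B \<subseteq> U \<longrightarrow> U = carrier V)"

context vspace
begin

lemma finsum_restrict:
  "U \<subseteq> carrier V \<Longrightarrow> finsum (V\<lparr>carrier := U\<rparr>) f B = finsum V f B" if "submodule U scalars V" "\<And>b. b \<in> B \<Longrightarrow> f b \<in> U"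
proof -
  interpret U: vspace "V\<lparr>carrier := U\<rparr>" by (rule subspace_vspace) fact
  show ?thesis using that(2)
  proof (induction B rule: infinite_finite_induct)
    case (infinite A)
    then show ?case by (simp add: finsum_def finprod_def)
  next
    case empty
    then show ?case using U.finsum_empty finsum_empty by simp
  next
    case (insert x F)
    then show ?case using subspaceD[OF that(1)]
      by (subst U.finsum_insert; (subst finsum_insert)?; auto simp: Pi_def)
  qed
qed

text \<open>The representation \<open>u + c b\<^sub>0\<close> of an element of \<open>U + k b\<^sub>0\<close> is unique, so \<open>c\<close> is a new coordinate, and
  the old ones are read off from \<open>u\<close>.\<close>

lemma basis_over_extend:
  assumes U: "submodule U scalars V" "W \<subseteq> U" and bo: "basis_over (V\<lparr>carrier := U\<rparr>) W B d p"
    and b0: "b0 \<in> carrier V" "b0 \<notin> U"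
  shows "\<exists>U' B' d' p'. submodule U' scalars V \<and> U \<subseteq> U' \<and> b0 \<in> U' \<and> basis_over (V\<lparr>carrier := U'\<rparr>) W B' d' p'"
proof -
  note UD = subspaceD[OF U(1)]
  have Uc: "u \<in> U \<Longrightarrow> u \<in> carrier V" for u using UD(1) by auto
  let ?U' = "{u \<oplus> c \<odot> b0 | u c. u \<in> U}"
  have sub': "submodule ?U' scalars V"
  proof (rule subspaceI)
    show "?U' \<subseteq> carrier V" using Uc b0 by auto
    show "\<zero> \<in> ?U'" using UD(2) b0 by (intro CollectI exI[of _ \<zero>] exI[of _ 0]) auto
  next
    fix x y assume "x \<in> ?U'" "y \<in> ?U'"
    then obtain u c v e where *: "x = u \<oplus> c \<odot> b0" "y = v \<oplus> e \<odot> b0" "u \<in> U" "v \<in> U" by auto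
    then have "x \<oplus> y = (u \<oplus> v) \<oplus> (c + e) \<odot> b0" using b0 Uc by (simp add: vs_distr a_ac)
    then show "x \<oplus> y \<in> ?U'" using * UD(3) by blast
  next
    fix c x assume "x \<in> ?U'"
    then obtain u e where *: "x = u \<oplus> e \<odot> b0" "u \<in> U" by auto
    then have "c \<odot> x = (c \<odot> u) \<oplus> (c * e) \<odot> b0" using b0 Uc by (simp add: vs_distr a_ac)
    then show "c \<odot> x \<in> ?U'" using * UD(4) by blast
  qed
  have uniq: "c = e \<and> u = v" if "u \<oplus> c \<odot> b0 = v \<oplus> e \<odot> b0" "u \<in> U" "v \<in> U" for u v c e
  proof -
    have uv: "u \<in> carrier V" "v \<in> carrier V" using that Uc by auto
    have "(c - e) \<odot> b0 = v \<ominus> u"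
    proof -
      have "(c - e) \<odot> b0 = c \<odot> b0 \<ominus> e \<odot> b0" using b0 vs_distr(2)[of b0 c "-e"]
        by (simp add: vs_distr a_minus_def)
      also have "\<dots> = (u \<oplus> c \<odot> b0) \<ominus> u \<ominus> e \<odot> b0" using uv b0 by (simp add: a_minus_def a_ac r_neg r_neg1 r_neg2)
      also have "\<dots> = v \<ominus> u" unfolding that(1) using uv b0
        by (simp add: a_minus_def a_assoc) (metis a_inv_closed a_lcomm add.inv_mult_group l_neg r_zero r_neg vs_simps(1) b0(1) uv(1))
      finally show ?thesis .
    qed
    then have mem: "(c - e) \<odot> b0 \<in> U" using UD(6) that by simp
    have "c = e"
    proof (rule ccontr)
      assume "c \<noteq> e"
      then have "b0 = inverse (c - e) \<odot> ((c - e) \<odot> b0)" using b0 by (simp add: vs_distr)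
      then show False using mem UD(4) b0 by metis
    qed
    then show ?thesis using that uv b0 by simp
  qed
  define cf where "cf v = (THE c. \<exists>u\<in>U. v = u \<oplus> c \<odot> b0)" for v
  define pr where "pr v = (THE u. u \<in> U \<and> v = u \<oplus> cf v \<odot> b0)" for v
  have cf: "cf (u \<oplus> c \<odot> b0) = c" if "u \<in> U" for u c
    unfolding cf_def using that uniq by (intro the_equality) blast+
  have pr: "pr (u \<oplus> c \<odot> b0) = u" if "u \<in> U" for u c
    unfolding pr_def cf[OF that] using that uniq by (intro the_equality) blast+
  have cfU: "cf u = 0" "pr u = u" if "u \<in> U" for u
    using cf[OF that, of 0] pr[OF that, of 0] b0 Uc that by auto
  have cf0: "cf b0 = 1" "pr b0 = \<zero>" using cf[of \<zero> 1] pr[of \<zero> 1] UD(2) b0 by auto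
  let ?R = "V\<lparr>carrier := ?U'\<rparr>"
  have boD: "finite B" "B \<subseteq> U" "\<And>u. u \<in> U \<Longrightarrow> p u \<in> W" "\<And>w. w \<in> W \<Longrightarrow> p w = w"
    "\<And>u v. u \<in> U \<Longrightarrow> v \<in> U \<Longrightarrow> p (u \<oplus> v) = p u \<oplus> p v" "\<And>c u. u \<in> U \<Longrightarrow> p (c \<odot> u) = c \<odot> p u"
    "\<And>b u v. b \<in> B \<Longrightarrow> u \<in> U \<Longrightarrow> v \<in> U \<Longrightarrow> d b (u \<oplus> v) = d b u + d b v"
    "\<And>b c u. b \<in> B \<Longrightarrow> u \<in> U \<Longrightarrow> d b (c \<odot> u) = c * d b u"
    "\<And>b. b \<in> B \<Longrightarrow> p b = \<zero>" "\<And>b w. b \<in> B \<Longrightarrow> w \<in> W \<Longrightarrow> d b w = 0"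
    "\<And>b b'. b \<in> B \<Longrightarrow> b' \<in> B \<Longrightarrow> d b b' = (if b = b' then 1 else 0)"
    "\<And>u. u \<in> U \<Longrightarrow> u = p u \<oplus> (\<Oplus>\<^bsub>V\<lparr>carrier := U\<rparr>\<^esub>b\<in>B. d b u \<odot> b)"
    using bo by (auto simp: basis_over_def linear_map_def linear_form_def)
  have dec: "u = p u \<oplus> (\<Oplus>b\<in>B. d b u \<odot> b)" if "u \<in> U" for u
  proof -
    have "finsum (V\<lparr>carrier := U\<rparr>) (\<lambda>b. d b u \<odot> b) B = finsum V (\<lambda>b. d b u \<odot> b) B"
      using UD boD(2) by (intro finsum_restrict[OF U(1)]) auto
    then show ?thesis using boD(12)[OF that] by simp
  qed
  have mem: "u \<oplus> c \<odot> b0 \<in> ?U'" if "u \<in> U" for u c using that by blast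
  have rep: "\<exists>u\<in>U. \<exists>c. v = u \<oplus> c \<odot> b0" if "v \<in> ?U'" for v using that by blast
  have add: "(u \<oplus> c \<odot> b0) \<oplus> (v \<oplus> e \<odot> b0) = (u \<oplus> v) \<oplus> (c + e) \<odot> b0" if "u \<in> U" "v \<in> U" for u v c e
    using that b0 Uc by (simp add: vs_distr a_ac)
  have scl: "e \<odot> (u \<oplus> c \<odot> b0) = (e \<odot> u) \<oplus> (e * c) \<odot> b0" if "u \<in> U" for u c e
    using that b0 Uc by (simp add: vs_distr a_ac)
  have b0B: "b0 \<notin> B" using b0 boD(2) by auto
  have bb: "b \<in> ?U'" if "b \<in> B \<or> b = b0" for b
    using that mem[of b 0] mem[of \<zero> 1] boD(2) Uc b0 UD(2) by (auto simp: subset_iff)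
  have W0: "w \<in> U" if "w \<in> W" for w using that U by auto
  have "basis_over ?R W (insert b0 B) (\<lambda>b v. if b = b0 then cf v else d b (pr v)) (\<lambda>v. p (pr v))"
    unfolding basis_over_def
  proof (intro conjI ballI)
    show "finite (insert b0 B)" using boD by simp
    show "insert b0 B \<subseteq> carrier ?R" using bb by auto
    show "linear_map ?R ?R (\<lambda>v. p (pr v))"
    proof (rule linear_mapI)
      fix x assume "x \<in> carrier ?R"
      then obtain u c where x: "x = u \<oplus> c \<odot> b0" "u \<in> U" by auto
      then have "p (pr x) \<in> U" using pr boD(3) W0 by auto
      then show "p (pr x) \<in> carrier ?R" using mem[of "p (pr x)" 0] Uc b0 by simp
    next
      fix x y assume "x \<in> carrier ?R" "y \<in> carrier ?R"
      then obtain u c v e where x: "x = u \<oplus> c \<odot> b0" "u \<in> U" "y = v \<oplus> e \<odot> b0" "v \<in> U" by auto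
      then show "p (pr (x \<oplus>\<^bsub>?R\<^esub> y)) = p (pr x) \<oplus>\<^bsub>?R\<^esub> p (pr y)"
        using pr UD(3) boD(5) by (simp add: add)
    next
      fix c x assume "x \<in> carrier ?R"
      then obtain u e where x: "x = u \<oplus> e \<odot> b0" "u \<in> U" by auto
      then show "p (pr (c \<odot>\<^bsub>?R\<^esub> x)) = c \<odot>\<^bsub>?R\<^esub> p (pr x)"
        using pr UD(4) boD(6) by (simp add: scl)
    qed
    show "(\<lambda>v. p (pr v)) ` carrier ?R \<subseteq> W" using pr boD(3) by auto
    show "p (pr w) = w" if "w \<in> W" for w using that W0 cfU boD(4) by auto
  next
    fix b assume b: "b \<in> insert b0 B"
    show "p (pr b) = \<zero>\<^bsub>?R\<^esub>" using b cf0 cfU boD(2,9) boD(6)[of \<zero> 0] UD(2) boD(3)[of \<zero>] W0 Uc by auto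
    show "linear_form ?R (\<lambda>v. if b = b0 then cf v else d b (pr v))"
      unfolding linear_form_def
    proof (intro conjI ballI allI)
      fix x y assume "x \<in> carrier ?R" "y \<in> carrier ?R"
      then obtain u c v e where x: "x = u \<oplus> c \<odot> b0" "u \<in> U" "y = v \<oplus> e \<odot> b0" "v \<in> U" by auto
      then show "(if b = b0 then cf (x \<oplus>\<^bsub>?R\<^esub> y) else d b (pr (x \<oplus>\<^bsub>?R\<^esub> y))) =
        (if b = b0 then cf x else d b (pr x)) + (if b = b0 then cf y else d b (pr y))"
        using pr cf UD(3) boD(7) b by (auto simp add: add)
    next
      fix c x assume "x \<in> carrier ?R"
      then obtain u e where x: "x = u \<oplus> e \<odot> b0" "u \<in> U" by auto
      then show "(if b = b0 then cf (c \<odot>\<^bsub>?R\<^esub> x) else d b (pr (c \<odot>\<^bsub>?R\<^esub> x))) =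
          c * (if b = b0 then cf x else d b (pr x))"
        using pr cf UD(4) boD(8) b by (auto simp add: scl)
    qed
    show "(if b = b0 then cf w else d b (pr w)) = 0" if "w \<in> W" for w
      using that cfU W0 boD(10) b by auto
    show "(if b = b0 then cf b' else d b (pr b')) = (if b = b' then 1 else 0)"
      if "b' \<in> insert b0 B" for b'
    proof -
      have "d b \<zero> = 0" if "b \<in> B" using boD(8)[OF that UD(2), of 0] by simp
      then show ?thesis using that b cf0 cfU boD(2,11) b0B by auto
    qed
  next
    fix x assume "x \<in> carrier ?R"
    then obtain u c where x: "x = u \<oplus> c \<odot> b0" "u \<in> U" by auto
    let ?f = "\<lambda>b. (if b = b0 then cf x else d b (pr x)) \<odot> b"
    have "finsum V ?f (insert b0 B) = c \<odot> b0 \<oplus> (\<Oplus>b\<in>B. ?f b)"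
      using boD(1,2) b0B cf x Uc b0 by (subst finsum_insert) (auto simp: subset_iff)
    also have "(\<Oplus>b\<in>B. ?f b) = (\<Oplus>b\<in>B. d b u \<odot> b)"
      using boD(2) b0B Uc x pr by (intro finsum_cong') auto
    finally have *: "finsum V ?f (insert b0 B) = c \<odot> b0 \<oplus> (\<Oplus>b\<in>B. d b u \<odot> b)" .
    have fc: "(\<Oplus>b\<in>B. d b u \<odot> b) \<in> carrier V" using boD(2) Uc by (intro finsum_closed) auto
    have pc: "p u \<in> carrier V" using x boD(3) W0 Uc by auto
    have fr: "(\<Oplus>\<^bsub>?R\<^esub>b\<in>insert b0 B. (if b = b0 then cf x else d b (pr x)) \<odot>\<^bsub>?R\<^esub> b) = finsum V ?f (insert b0 B)"
      using finsum_restrict[OF sub', of "insert b0 B" ?f] subspaceD(1,4)[OF sub'] bb by auto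
    have "p (pr x) \<oplus> finsum V ?f (insert b0 B) = (p u \<oplus> (\<Oplus>b\<in>B. d b u \<odot> b)) \<oplus> c \<odot> b0"
      unfolding * using x pr fc pc b0 by (simp add: a_ac)
    also have "\<dots> = x" using dec[OF x(2)] x(1) by simp
    finally show "x = p (pr x) \<oplus>\<^bsub>?R\<^esub> (\<Oplus>\<^bsub>?R\<^esub>b\<in>insert b0 B. (if b = b0 then cf x else d b (pr x)) \<odot>\<^bsub>?R\<^esub> b)"
      unfolding fr by simp
  qed
  moreover have "U \<subseteq> ?U'" using mem[of _ 0] Uc b0 by force
  ultimately show ?thesis using sub' bb[of b0] by blast
qed

lemma basis_over_exists:
  assumes W: "submodule W scalars V" and B: "finite B" "spanning V B"
  obtains C d p where "basis_over V W C d p"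
proof -
  have "\<exists>U. submodule U scalars V \<and> W \<subseteq> U \<and> S \<subseteq> U \<and> (\<exists>C d p. basis_over (V\<lparr>carrier := U\<rparr>) W C d p)"
    if "finite S" "S \<subseteq> carrier V" for S
    using that
  proof (induction S)
    case empty
    have "basis_over (V\<lparr>carrier := W\<rparr>) W {} (\<lambda>_ _. 0) (\<lambda>x. x)"
    proof -
      interpret W: vspace "V\<lparr>carrier := W\<rparr>" by (rule subspace_vspace[OF W])
      show ?thesis using subspaceD[OF W] W.finsum_empty
        by (auto simp: basis_over_def linear_map_def subset_iff)
    qed
    then show ?case using W by blast
  next
    case (insert b S)
    then obtain U C d p where U: "submodule U scalars V" "W \<subseteq> U" "S \<subseteq> U" "basis_over (V\<lparr>carrier := U\<rparr>) W C d p"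
      by auto
    show ?case
    proof (cases "b \<in> U")
      case True then show ?thesis using U by blast
    next
      case False
      obtain U' B' d' p' where "submodule U' scalars V" "U \<subseteq> U'" "b \<in> U'" "basis_over (V\<lparr>carrier := U'\<rparr>) W B' d' p'"
        using basis_over_extend[OF U(1,2,4) _ False] insert.prems by blast
      then show ?thesis using U(2,3) by (intro exI[of _ U']) blast
    qed
  qed
  from this[OF B(1)] B(2) obtain U C d p where "submodule U scalars V" "B \<subseteq> U" "basis_over (V\<lparr>carrier := U\<rparr>) W C d p"
    unfolding spanning_def by blast
  then have "basis_over (V\<lparr>carrier := carrier V\<rparr>) W C d p" using B(2) unfolding spanning_def by metis
  then show ?thesis using that by simp
qed

end

definition dual_basis :: "('k::field, 'a, 'm) module_scheme \<Rightarrow> 'a set \<Rightarrow> ('a \<Rightarrow> 'a \<Rightarrow> 'k) \<Rightarrow> bool" where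
  "dual_basis V B d \<longleftrightarrow> finite B \<and> B \<subseteq> carrier V \<and> (\<forall>b\<in>B. linear_form V (d b)) \<and>
     (\<forall>b\<in>B. \<forall>b'\<in>B. d b b' = (if b = b' then 1 else 0)) \<and>
     (\<forall>x\<in>carrier V. x = (\<Oplus>\<^bsub>V\<^esub>b\<in>B. d b x \<odot>\<^bsub>V\<^esub> b))"

lemma basis_overD:
  assumes "basis_over V W B d p"
  shows "finite B" "B \<subseteq> carrier V" "linear_map V V p" "p ` carrier V \<subseteq> W" "\<forall>w\<in>W. p w = w"
    "\<forall>b\<in>B. linear_form V (d b) \<and> p b = \<zero>\<^bsub>V\<^esub> \<and> (\<forall>w\<in>W. d b w = 0)"
    "\<forall>b\<in>B. \<forall>b'\<in>B. d b b' = (if b = b' then 1 else 0)"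
    "\<forall>x\<in>carrier V. x = p x \<oplus>\<^bsub>V\<^esub> (\<Oplus>\<^bsub>V\<^esub>b\<in>B. d b x \<odot>\<^bsub>V\<^esub> b)"
  using assms[unfolded basis_over_def] by - (elim conjE, assumption)+

context vspace
begin

lemma diff_eq_zero_iff:
  assumes "x \<in> carrier V" "y \<in> carrier V"
  shows "x \<ominus> y = \<zero> \<longleftrightarrow> x = y"
proof
  assume "x \<ominus> y = \<zero>"
  then have "(x \<ominus> y) \<oplus> y = y" using assms by simp
  then show "x = y" using assms by (simp add: a_minus_def M.a_assoc M.l_neg)
qed (use assms in \<open>simp add: a_minus_def M.r_neg\<close>)

lemma finsum_indicator:
  assumes "finite B" "B \<subseteq> carrier V" "b \<in> B"
  shows "(\<Oplus>i\<in>B. (if i = b then 1 else 0) \<odot> i) = b"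
proof -
  have "(\<Oplus>i\<in>B. (if i = b then 1 else 0) \<odot> i) = (\<Oplus>i\<in>B. if b = i then i else \<zero>)"
    using assms by (intro finsum_cong') auto
  then show ?thesis using finsum_singleton[OF assms(3,1), of "\<lambda>x. x"] assms by auto
qed

lemma spanning_representation:
  assumes B: "finite B" "spanning V B" and x: "x \<in> carrier V"
  shows "\<exists>c. x = (\<Oplus>b\<in>B. c b \<odot> b)"
proof -
  let ?U = "{\<Oplus>b\<in>B. c b \<odot> b | c. True}"
  have Bc: "b \<in> carrier V" if "b \<in> B" for b using that B unfolding spanning_def by auto
  have "submodule ?U scalars V"
  proof (rule subspaceI)
    show "?U \<subseteq> carrier V" using Bc by (auto intro!: finsum_closed)
    have "(\<Oplus>b\<in>B. 0 \<odot> b) = \<zero>" using Bc finsum_cong'[of B B "\<lambda>_. \<zero>" "\<lambda>b. 0 \<odot> b"] by simp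
    then show "\<zero> \<in> ?U" by (intro CollectI exI[of _ "\<lambda>_. 0"]) simp
  next
    fix x y assume "x \<in> ?U" "y \<in> ?U"
    then obtain c e where *: "x = (\<Oplus>b\<in>B. c b \<odot> b)" "y = (\<Oplus>b\<in>B. e b \<odot> b)" by auto
    have "x \<oplus> y = (\<Oplus>b\<in>B. c b \<odot> b \<oplus> e b \<odot> b)"
      unfolding * using Bc by (subst finsum_addf) auto
    also have "\<dots> = (\<Oplus>b\<in>B. (c b + e b) \<odot> b)"
      using Bc by (intro finsum_cong') (auto simp: vs_distr)
    finally show "x \<oplus> y \<in> ?U" by auto
  next
    fix k x assume "x \<in> ?U"
    then obtain c where *: "x = (\<Oplus>b\<in>B. c b \<odot> b)" by auto
    have "k \<odot> x = (\<Oplus>b\<in>B. k \<odot> (c b \<odot> b))"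
      unfolding * using Bc B by (intro finsum_smult_ldistr) auto
    also have "\<dots> = (\<Oplus>b\<in>B. (k * c b) \<odot> b)"
      using Bc by (intro finsum_cong') (auto simp: vs_distr)
    finally show "k \<odot> x \<in> ?U" by auto
  qed
  moreover have "B \<subseteq> ?U"
  proof
    fix b assume "b \<in> B"
    moreover have "B \<subseteq> carrier V" using Bc by auto
    ultimately show "b \<in> ?U" using finsum_indicator[OF B(1)]
      by (intro CollectI exI[of _ "\<lambda>i. if i = b then 1 else 0"]) auto
  qed
  ultimately have "?U = carrier V" using B(2) unfolding spanning_def by blast
  then show ?thesis using x by blast
qed

lemma finite_dimensional_iff: "finite_dimensional V \<longleftrightarrow> (\<exists>B. finite B \<and> spanning V B)"
proof
  assume "finite_dimensional V"
  then obtain B where B: "finite B" "B \<subseteq> carrier V"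
      "\<forall>x\<in>carrier V. \<exists>c. x = (\<Oplus>b\<in>B. c b \<odot> b)" unfolding finite_dimensional_def by blast
  have "spanning V B" unfolding spanning_def
  proof (intro conjI allI impI B)
    fix U assume U: "submodule U scalars V \<and> B \<subseteq> U"
    then have "(\<Oplus>b\<in>B. c b \<odot> b) \<in> U" for c
      using subspaceD(4) by (intro subspace_finsum) auto
    then have "carrier V \<subseteq> U" using B(3) by (metis subsetI)
    then show "U = carrier V" using subspaceD(1) U by blast
  qed
  then show "\<exists>B. finite B \<and> spanning V B" using B by blast
next
  assume "\<exists>B. finite B \<and> spanning V B"
  then obtain B where B: "finite B" "spanning V B" by blast
  moreover have "\<forall>x\<in>carrier V. \<exists>c. x = (\<Oplus>b\<in>B. c b \<odot> b)" using spanning_representation[OF B] by simp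
  ultimately show "finite_dimensional V"
    unfolding finite_dimensional_def spanning_def by (intro exI[of _ B]) simp
qed

lemma dual_basis_exists:
  assumes "finite_dimensional V"
  obtains B d where "dual_basis V B d"
proof -
  obtain S where "finite S" "spanning V S" using assms finite_dimensional_iff by auto
  from basis_over_exists[OF zero_subspace this] obtain C d p where *: "basis_over V {\<zero>} C d p" .
  note D = basis_overD[OF *]
  have "x = (\<Oplus>b\<in>C. d b x \<odot> b)" if x: "x \<in> carrier V" for x
  proof -
    have "(\<Oplus>b\<in>C. d b x \<odot> b) \<in> carrier V" using D(2) by (intro finsum_closed) auto
    moreover have "p x = \<zero>" using D(4) x by blast
    ultimately show ?thesis using bspec[OF D(8) x] by simp
  qed
  moreover have "\<forall>b\<in>C. linear_form V (d b)" using D(6) by blast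
  ultimately have "dual_basis V C d"
    unfolding dual_basis_def by (intro conjI D(1,2,7)) blast+
  then show ?thesis by (rule that)
qed

lemma projection_exists:
  assumes "finite_dimensional V" "submodule W scalars V"
  obtains p where "linear_map V V p" "\<And>x. x \<in> carrier V \<Longrightarrow> p x \<in> W" "\<And>x. x \<in> W \<Longrightarrow> p x = x"
proof -
  obtain S where "finite S" "spanning V S" using assms finite_dimensional_iff by auto
  from basis_over_exists[OF assms(2) this] obtain C d p where "basis_over V W C d p" .
  note D = basis_overD[OF this]
  show ?thesis by (rule that[of p]) (use D(3-5) in auto)
qed

lemma eq_if_forms_eq:
  assumes "finite_dimensional V" "x \<in> carrier V" "y \<in> carrier V"
    "\<And>\<phi>. linear_form V \<phi> \<Longrightarrow> \<phi> x = \<phi> y"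
  shows "x = y"
proof -
  obtain B d where B: "dual_basis V B d" using dual_basis_exists assms by blast
  have "x = (\<Oplus>b\<in>B. d b x \<odot> b)" "y = (\<Oplus>b\<in>B. d b y \<odot> b)" using assms B unfolding dual_basis_def by blast+
  moreover have "(\<Oplus>b\<in>B. d b x \<odot> b) = (\<Oplus>b\<in>B. d b y \<odot> b)"
  proof (rule finsum_cong')
    have Bc: "B \<subseteq> carrier V" "\<And>b. b \<in> B \<Longrightarrow> linear_form V (d b)" using B unfolding dual_basis_def by blast+
    then show "(\<lambda>b. d b y \<odot> b) \<in> B \<rightarrow> carrier V" by auto
    show "d i x \<odot> i = d i y \<odot> i" if "i \<in> B" for i using assms(4)[OF Bc(2)[OF that]] by simp
  qed simp
  ultimately show ?thesis by simp
qed

lemma mem_if_annihilated: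
  assumes "finite_dimensional V" "submodule W scalars V" "x \<in> carrier V"
    "\<And>\<phi>. linear_form V \<phi> \<Longrightarrow> (\<And>w. w \<in> W \<Longrightarrow> \<phi> w = 0) \<Longrightarrow> \<phi> x = 0"
  shows "x \<in> W"
proof -
  obtain p where p: "linear_map V V p" "\<And>x. x \<in> carrier V \<Longrightarrow> p x \<in> W" "\<And>x. x \<in> W \<Longrightarrow> p x = x"
    using projection_exists[OF assms(1,2)] by blast
  note pD = linear_mapD[OF p(1)]
  have Wc: "w \<in> carrier V" if "w \<in> W" for w using that subspaceD(1)[OF assms(2)] by auto
  have "x = p x"
  proof (rule eq_if_forms_eq[OF assms(1,3)])
    fix \<phi> assume \<phi>: "linear_form V \<phi>"
    have "linear_form V (\<lambda>x. \<phi> x - \<phi> (p x))"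
      using pD by (auto simp: linear_form_def linear_formD[OF \<phi>] algebra_simps)
    then have "\<phi> x - \<phi> (p x) = 0" by (rule assms(4)) (simp add: p)
    then show "\<phi> x = \<phi> (p x)" by simp
  qed (use assms p Wc in auto)
  then show ?thesis using p(2)[OF assms(3)] by simp
qed

lemma linear_form_extension:
  assumes "finite_dimensional V" "submodule W scalars V" "linear_form (V\<lparr>carrier := W\<rparr>) \<phi>"
  obtains \<psi> where "linear_form V \<psi>" "\<And>x. x \<in> W \<Longrightarrow> \<psi> x = \<phi> x"
proof -
  obtain p where p: "linear_map V V p" "\<And>x. x \<in> carrier V \<Longrightarrow> p x \<in> W" "\<And>x. x \<in> W \<Longrightarrow> p x = x"
    using projection_exists[OF assms(1,2)] by blast
  have "linear_form V (\<lambda>x. \<phi> (p x))"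
    unfolding linear_form_def
    using linear_formD[OF assms(3)] by (simp add: p(2) linear_mapD(2,3)[OF p(1)])
  then show ?thesis by (rule that) (simp add: p(3))
qed

end

text \<open>The dimension, as the least size of a spanning set: in this form its decrease under a surjection is a
  statement about images of spanning sets.\<close>

definition vdim :: "('k::field, 'a, 'm) module_scheme \<Rightarrow> nat" where
  "vdim V = (LEAST n. \<exists>B. finite B \<and> card B = n \<and> spanning V B)"

lemma linear_preimage_subspace:
  assumes "vspace V" "vspace W" "linear_map V W f" "submodule U scalars W"
  shows "submodule {x \<in> carrier V. f x \<in> U} scalars V"
proof -
  interpret V: vspace V by fact
  interpret W: vspace W by fact
  show ?thesis using W.subspaceD[OF assms(4)] linear_mapD[OF assms(3)] V.linear_map_zero[OF assms(2,3)]
    by (intro V.subspaceI) auto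
qed

lemma linear_image_subspace:
  assumes "vspace V" "vspace W" "linear_map V W f" "submodule U scalars V"
  shows "submodule (f ` U) scalars W"
proof -
  interpret V: vspace V by fact
  interpret W: vspace W by fact
  note UD = V.subspaceD[OF assms(4)] and fD = linear_mapD[OF assms(3)]
  show ?thesis
  proof (rule W.subspaceI)
    show "f ` U \<subseteq> carrier W" using UD fD by auto
    show "\<zero>\<^bsub>W\<^esub> \<in> f ` U" using UD(2) V.linear_map_zero[OF assms(2,3)] by force
  next
    fix x y assume "x \<in> f ` U" "y \<in> f ` U"
    then obtain u v where "x = f u" "y = f v" "u \<in> U" "v \<in> U" by auto
    then have "x \<oplus>\<^bsub>W\<^esub> y = f (u \<oplus>\<^bsub>V\<^esub> v)" "u \<oplus>\<^bsub>V\<^esub> v \<in> U" using UD(1,3) fD(2)[of u v] by (auto simp: subset_iff)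
    then show "x \<oplus>\<^bsub>W\<^esub> y \<in> f ` U" by blast
  next
    fix c x assume "x \<in> f ` U"
    then obtain u where "x = f u" "u \<in> U" by auto
    then have "c \<odot>\<^bsub>W\<^esub> x = f (c \<odot>\<^bsub>V\<^esub> u)" "c \<odot>\<^bsub>V\<^esub> u \<in> U" using UD(1,4) fD(3)[of u] by (auto simp: subset_iff)
    then show "c \<odot>\<^bsub>W\<^esub> x \<in> f ` U" by blast
  qed
qed

lemma vdim_witness:
  assumes "vspace V" "finite_dimensional V"
  obtains B where "finite B" "card B = vdim V" "spanning V B"
proof -
  obtain B where "finite B" "spanning V B"
    using assms(2) vspace.finite_dimensional_iff[OF assms(1)] by auto
  then have "\<exists>n B. finite B \<and> card B = n \<and> spanning V B" by (intro exI[of _ "card B"] exI[of _ B]) simp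
  then have "\<exists>B. finite B \<and> card B = vdim V \<and> spanning V B"
    unfolding vdim_def by (rule LeastI_ex)
  then show ?thesis using that by blast
qed

lemma spanning_image:
  assumes "vspace V" "vspace W" "linear_map V W f" "f ` carrier V = carrier W" "spanning V B"
  shows "spanning W (f ` B)"
  unfolding spanning_def
proof (intro conjI allI impI)
  show "f ` B \<subseteq> carrier W" using assms unfolding spanning_def by auto
  fix U assume U: "submodule U scalars W \<and> f ` B \<subseteq> U"
  then have "submodule {x \<in> carrier V. f x \<in> U} scalars V" "B \<subseteq> {x \<in> carrier V. f x \<in> U}"
    using linear_preimage_subspace[OF assms(1-3), of U] assms(5) unfolding spanning_def by auto
  then have "{x \<in> carrier V. f x \<in> U} = carrier V"
    using assms(5) unfolding spanning_def by blast
  then have "f ` carrier V \<subseteq> U" by blast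
  moreover have "U \<subseteq> carrier W" using vspace.subspaceD(1)[OF assms(2)] U by blast
  ultimately show "U = carrier W" unfolding assms(4) by (rule equalityI[rotated])
qed

lemma finite_dimensional_image:
  assumes "vspace V" "vspace W" "linear_map V W f" "f ` carrier V = carrier W" "finite_dimensional V"
  shows "finite_dimensional W"
proof -
  obtain B where "finite B" "spanning V B" using assms vspace.finite_dimensional_iff by blast
  then have "finite (f ` B)" "spanning W (f ` B)" using spanning_image[OF assms(1-4)] by auto
  then show ?thesis using vspace.finite_dimensional_iff[OF assms(2)] by blast
qed

lemma vdim_image_le:
  assumes "vspace V" "vspace W" "linear_map V W f" "f ` carrier V = carrier W" "finite_dimensional V"
  shows "vdim W \<le> vdim V"
proof -
  obtain B where B: "finite B" "card B = vdim V" "spanning V B"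
    using vdim_witness[OF assms(1,5)] by blast
  have "vdim W \<le> card (f ` B)" unfolding vdim_def
    using spanning_image[OF assms(1-4) B(3)] B(1) by (intro Least_le exI[of _ "f ` B"]) simp
  then show ?thesis using card_image_le[OF B(1), of f] B(2) by simp
qed

text \<open>Since \<open>x \<noteq> 0\<close>, some \<open>b\<^sub>0\<close> in a least spanning set has a nonzero coefficient in \<open>x\<close>. As \<open>f x = 0\<close>, its image is a
  combination of the images of the others and can be left out of a spanning set.\<close>

lemma vdim_image_less:
  assumes "vspace V" "vspace W" "linear_map V W f" "f ` carrier V = carrier W" "finite_dimensional V"
    and x: "x \<in> carrier V" "f x = \<zero>\<^bsub>W\<^esub>" "x \<noteq> \<zero>\<^bsub>V\<^esub>"
  shows "vdim W < vdim V"
proof -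
  interpret V: vspace V by fact
  interpret W: vspace W by fact
  obtain B where B: "finite B" "card B = vdim V" "spanning V B"
    using vdim_witness[OF assms(1,5)] by blast
  have Bc: "b \<in> carrier V" if "b \<in> B" for b using B(3) that unfolding spanning_def by auto
  obtain c where c: "x = (\<Oplus>\<^bsub>V\<^esub>b\<in>B. c b \<odot>\<^bsub>V\<^esub> b)" using V.spanning_representation B x by blast
  obtain b0 where b0: "b0 \<in> B" "c b0 \<noteq> 0"
  proof -
    have "\<exists>b\<in>B. c b \<noteq> 0"
    proof (rule ccontr)
      assume "\<not> ?thesis"
      then have "x = (\<Oplus>\<^bsub>V\<^esub>b\<in>B. \<zero>\<^bsub>V\<^esub>)" unfolding c using Bc by (intro V.finsum_cong') auto
      then show False using x(3) V.finsum_zero by auto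
    qed
    then show ?thesis using that by blast
  qed
  have "spanning W (f ` (B - {b0}))" unfolding spanning_def
  proof (intro conjI allI impI)
    show "f ` (B - {b0}) \<subseteq> carrier W" using Bc assms(4) by auto
    fix U assume U: "submodule U scalars W \<and> f ` (B - {b0}) \<subseteq> U"
    let ?P = "{x \<in> carrier V. f x \<in> U}"
    have P: "submodule ?P scalars V" using linear_preimage_subspace[OF assms(1-3)] U by blast
    note PD = V.subspaceD[OF P]
    have "x \<in> ?P" using x W.subspaceD(2) U by auto
    have rest: "(\<Oplus>\<^bsub>V\<^esub>b\<in>B - {b0}. c b \<odot>\<^bsub>V\<^esub> b) \<in> ?P"
    proof (rule V.subspace_finsum[OF P])
      fix b assume "b \<in> B - {b0}"
      then have "b \<in> ?P" using U Bc by auto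
      then show "c b \<odot>\<^bsub>V\<^esub> b \<in> ?P" by (rule PD(4))
    qed
    have "x = (\<Oplus>\<^bsub>V\<^esub>b\<in>insert b0 (B - {b0}). c b \<odot>\<^bsub>V\<^esub> b)" using c b0 by (simp add: insert_absorb)
    also have "\<dots> = c b0 \<odot>\<^bsub>V\<^esub> b0 \<oplus>\<^bsub>V\<^esub> (\<Oplus>\<^bsub>V\<^esub>b\<in>B - {b0}. c b \<odot>\<^bsub>V\<^esub> b)"
      using B(1) Bc b0 by (intro V.finsum_insert) auto
    finally have eq: "c b0 \<odot>\<^bsub>V\<^esub> b0 = x \<ominus>\<^bsub>V\<^esub> (\<Oplus>\<^bsub>V\<^esub>b\<in>B - {b0}. c b \<odot>\<^bsub>V\<^esub> b)"
      using rest PD(1) Bc b0 by (simp add: a_minus_def V.a_assoc V.r_neg)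
    then have "c b0 \<odot>\<^bsub>V\<^esub> b0 \<in> ?P" using PD(6)[OF \<open>x \<in> ?P\<close> rest] by simp
    then have "inverse (c b0) \<odot>\<^bsub>V\<^esub> (c b0 \<odot>\<^bsub>V\<^esub> b0) \<in> ?P" by (rule PD(4))
    then have "b0 \<in> ?P" using b0 Bc by (simp add: V.vs_distr)
    then have "B \<subseteq> ?P" using U Bc by blast
    then have "?P = carrier V" using B(3) P unfolding spanning_def by metis
    then have "f ` carrier V \<subseteq> U" by blast
    moreover have "U \<subseteq> carrier W" using W.subspaceD(1) U by blast
    ultimately show "U = carrier W" unfolding assms(4) by (rule equalityI[rotated])
  qed
  then have "vdim W \<le> card (f ` (B - {b0}))" unfolding vdim_def
    using B(1) by (intro Least_le exI[of _ "f ` (B - {b0})"]) simp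
  also have "\<dots> \<le> card (B - {b0})" using B(1) by (intro card_image_le) auto
  also have "\<dots> < card B" using B(1) b0(1) by (rule card_Diff1_less)
  finally show ?thesis using B(2) by simp
qed

context vspace
begin

lemma subspace_finite_dimensional:
  assumes "finite_dimensional V" "submodule W scalars V"
  shows "finite_dimensional (V\<lparr>carrier := W\<rparr>)"
    and "W \<noteq> carrier V \<Longrightarrow> vdim (V\<lparr>carrier := W\<rparr>) < vdim V"
proof -
  obtain p where p: "linear_map V V p" "\<And>x. x \<in> carrier V \<Longrightarrow> p x \<in> W" "\<And>x. x \<in> W \<Longrightarrow> p x = x"
    using projection_exists[OF assms(1,2)] by blast
  have W: "vspace (V\<lparr>carrier := W\<rparr>)" using subspace_vspace assms by blast
  note WD = subspaceD[OF assms(2)]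
  have lin: "linear_map V (V\<lparr>carrier := W\<rparr>) p" using p by (auto simp: linear_map_def)
  have im: "p ` carrier V = carrier (V\<lparr>carrier := W\<rparr>)"
  proof
    show "p ` carrier V \<subseteq> carrier (V\<lparr>carrier := W\<rparr>)" using p(2) by auto
    show "carrier (V\<lparr>carrier := W\<rparr>) \<subseteq> p ` carrier V"
    proof
      fix x assume "x \<in> carrier (V\<lparr>carrier := W\<rparr>)"
      then have "p x = x" "x \<in> carrier V" using p(3) WD(1) by auto
      then show "x \<in> p ` carrier V" by (metis imageI)
    qed
  qed
  show "finite_dimensional (V\<lparr>carrier := W\<rparr>)"
    by (rule finite_dimensional_image[OF vspace_axioms W lin im assms(1)])
  assume "W \<noteq> carrier V"
  then obtain x where x: "x \<in> carrier V" "x \<notin> W" using WD by auto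
  have px: "p x \<in> carrier V" "p x \<in> W" using p x WD by auto
  have "x \<ominus> p x \<noteq> \<zero>" using x px by (auto simp: diff_eq_zero_iff)
  moreover have "p (x \<ominus> p x) = \<zero>"
    using linear_map_minus[OF vspace_axioms p(1) x(1) px(1)] p(3)[OF px(2)] px diff_eq_zero_iff by simp
  ultimately show "vdim (V\<lparr>carrier := W\<rparr>) < vdim V"
    using vdim_image_less[OF vspace_axioms W lin im assms(1), of "x \<ominus> p x"] x px by simp
qed

text \<open>A proper subspace has smaller dimension, but the inverse of \<open>g\<close> maps the image of \<open>g\<close> onto \<open>V\<close>.\<close>

lemma injective_endomorphism_surjective:
  assumes fd: "finite_dimensional V" and g: "linear_map V V g"
    and inj: "\<And>x. x \<in> carrier V \<Longrightarrow> g x = \<zero> \<Longrightarrow> x = \<zero>"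
  shows "g ` carrier V = carrier V"
proof (rule ccontr)
  assume neq: "\<not> ?thesis"
  have "inj_on g (carrier V)"
  proof (rule inj_onI)
    fix x y assume xy: "x \<in> carrier V" "y \<in> carrier V" "g x = g y"
    then have "g (x \<ominus> y) = \<zero>" using linear_map_minus[OF vspace_axioms g] linear_mapD(1)[OF g]
      by (simp add: diff_eq_zero_iff)
    then show "x = y" using inj[of "x \<ominus> y"] xy by (simp add: diff_eq_zero_iff)
  qed
  then have inv: "inv_into (carrier V) g (g x) = x" if "x \<in> carrier V" for x
    using that by (rule inv_into_f_f)
  have "linear_map (V\<lparr>carrier := g ` carrier V\<rparr>) V (inv_into (carrier V) g)"
  proof (rule linear_mapI)
    fix x assume "x \<in> carrier (V\<lparr>carrier := g ` carrier V\<rparr>)"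
    then obtain u where u: "x = g u" "u \<in> carrier V" by auto
    then show "inv_into (carrier V) g x \<in> carrier V" using inv by simp
    fix c
    have "c \<odot> x = g (c \<odot> u)" using u linear_mapD(3)[OF g] by simp
    then show "inv_into (carrier V) g (c \<odot>\<^bsub>V\<lparr>carrier := g ` carrier V\<rparr>\<^esub> x) = c \<odot> inv_into (carrier V) g x"
      using u inv by simp
  next
    fix x y assume "x \<in> carrier (V\<lparr>carrier := g ` carrier V\<rparr>)" "y \<in> carrier (V\<lparr>carrier := g ` carrier V\<rparr>)"
    then obtain u v where u: "x = g u" "u \<in> carrier V" "y = g v" "v \<in> carrier V" by auto
    have "x \<oplus> y = g (u \<oplus> v)" using u linear_mapD(2)[OF g] by simp
    then show "inv_into (carrier V) g (x \<oplus>\<^bsub>V\<lparr>carrier := g ` carrier V\<rparr>\<^esub> y)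
        = inv_into (carrier V) g x \<oplus> inv_into (carrier V) g y"
      using u inv by simp
  qed
  moreover have sub: "submodule (g ` carrier V) scalars V"
    using linear_image_subspace[OF vspace_axioms vspace_axioms g carrier_subspace] .
  moreover have "inv_into (carrier V) g ` (g ` carrier V) = carrier V"
    using \<open>inj_on g (carrier V)\<close> by (rule inv_into_image_cancel) simp
  ultimately have "vdim V \<le> vdim (V\<lparr>carrier := g ` carrier V\<rparr>)"
    using vdim_image_le[of "V\<lparr>carrier := g ` carrier V\<rparr>" V] subspace_vspace[OF sub] vspace_axioms
       subspace_finite_dimensional(1)[OF fd sub] by simp
  then show False using subspace_finite_dimensional(2)[OF fd sub neq] by simp
qed

text \<open>The map from \<open>V\<close> to its dual given by \<open>\<beta>\<close> is injective. In coordinates it is the endomorphism \<open>G\<close> below,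
  which is therefore onto.\<close>

lemma nondegenerate_represents_forms:
  assumes fd: "finite_dimensional V"
    and \<beta>: "\<And>x. x \<in> carrier V \<Longrightarrow> linear_form V (\<beta> x)" "\<And>y. y \<in> carrier V \<Longrightarrow> linear_form V (\<lambda>x. \<beta> x y)"
    and nondeg: "\<And>x. x \<in> carrier V \<Longrightarrow> (\<And>y. y \<in> carrier V \<Longrightarrow> \<beta> x y = 0) \<Longrightarrow> x = \<zero>"
    and f: "linear_form V f"
  obtains x where "x \<in> carrier V" "\<And>y. y \<in> carrier V \<Longrightarrow> \<beta> x y = f y"
proof -
  obtain B d where B: "dual_basis V B d" using dual_basis_exists fd by blast
  have BD: "finite B" "B \<subseteq> carrier V" "\<And>b. b \<in> B \<Longrightarrow> linear_form V (d b)"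
     "\<And>b b'. b \<in> B \<Longrightarrow> b' \<in> B \<Longrightarrow> d b b' = (if b = b' then 1 else 0)"
     "\<And>x. x \<in> carrier V \<Longrightarrow> x = (\<Oplus>b\<in>B. d b x \<odot> b)"
    using B unfolding dual_basis_def by blast+
  have expand: "g x = (\<Sum>b\<in>B. d b x * g b)" if "linear_form V g" "x \<in> carrier V" for g x
    using linear_form_finsum[OF that(1), of B "\<lambda>b. d b x \<odot> b"] BD(2) BD(5)[OF that(2)] linear_formD(2)[OF that(1)]
    by (simp add: subset_iff)
  have coef: "d b' (\<Oplus>b\<in>B. c b \<odot> b) = c b'" if "b' \<in> B" for c b'
    using linear_form_finsum[OF BD(3)[OF that], of B "\<lambda>b. c b \<odot> b"] BD(1,2) that
    by (simp add: subset_iff linear_formD(2)[OF BD(3)[OF that]] BD(4) if_distrib cong: if_cong)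
  have cl: "(\<Oplus>b\<in>B. c b \<odot> b) \<in> carrier V" for c using BD by (intro finsum_closed) auto
  define G where "G x = (\<Oplus>b\<in>B. \<beta> x b \<odot> b)" for x
  have G: "linear_map V V G"
  proof (rule linear_mapI)
    show "G x \<in> carrier V" for x unfolding G_def by (rule cl)
    show "G (x \<oplus> y) = G x \<oplus> G y" if "x \<in> carrier V" "y \<in> carrier V" for x y
    proof -
      have "G x \<oplus> G y = (\<Oplus>b\<in>B. \<beta> x b \<odot> b \<oplus> \<beta> y b \<odot> b)" unfolding G_def
        using BD by (subst finsum_addf) auto
      also have "\<dots> = G (x \<oplus> y)" unfolding G_def using that BD(2)
        by (intro finsum_cong') (auto simp: vs_distr linear_formD[OF \<beta>(2)] subset_iff)
      finally show ?thesis by simp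
    qed
    show "G (c \<odot> x) = c \<odot> G x" if "x \<in> carrier V" for c x
    proof -
      have "c \<odot> G x = (\<Oplus>b\<in>B. c \<odot> (\<beta> x b \<odot> b))" unfolding G_def
        using BD by (intro finsum_smult_ldistr) auto
      also have "\<dots> = G (c \<odot> x)" unfolding G_def using that BD(2)
        by (intro finsum_cong') (auto simp: vs_distr linear_formD[OF \<beta>(2)] subset_iff)
      finally show ?thesis by simp
    qed
  qed
  have "x = \<zero>" if "x \<in> carrier V" "G x = \<zero>" for x
  proof (rule nondeg[OF that(1)])
    fix y assume y: "y \<in> carrier V"
    have "\<beta> x b = 0" if "b \<in> B" for b
      using coef[OF that, of "\<beta> x"] \<open>G x = \<zero>\<close> linear_form_zero[OF BD(3)[OF that]] unfolding G_def by simp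
    then show "\<beta> x y = 0" using expand[OF \<beta>(1)[OF that(1)] y] by simp
  qed
  then have "G ` carrier V = carrier V" using injective_endomorphism_surjective[OF fd G] by blast
  then have "(\<Oplus>b\<in>B. f b \<odot> b) \<in> G ` carrier V" using cl[of f] by simp
  then obtain x where x: "x \<in> carrier V" "(\<Oplus>b\<in>B. f b \<odot> b) = G x" by auto
  have "\<beta> x b = f b" if "b \<in> B" for b using coef[OF that, of f] coef[OF that, of "\<beta> x"] x(2) unfolding G_def by simp
  then have "\<beta> x y = f y" if "y \<in> carrier V" for y
    using expand[OF \<beta>(1)[OF x(1)] that] expand[OF f that] by simp
  then show ?thesis using that x by blast
qed

end

section \<open>Tensors and bilinear forms\<close>

definition bilinear_form ::
  "('k::field, 'a, 'm) module_scheme \<Rightarrow> ('k, 'b, 'n) module_scheme \<Rightarrow> ('a \<Rightarrow> 'b \<Rightarrow> 'k) \<Rightarrow> bool" where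
  "bilinear_form V W b \<longleftrightarrow> (\<forall>y\<in>carrier W. linear_form V (\<lambda>x. b x y)) \<and> (\<forall>x\<in>carrier V. linear_form W (b x))"

lemma bilinear_formD:
  assumes "bilinear_form V W b"
  shows "y \<in> carrier W \<Longrightarrow> linear_form V (\<lambda>x. b x y)" "x \<in> carrier V \<Longrightarrow> linear_form W (b x)"
    "x \<in> carrier V \<Longrightarrow> x' \<in> carrier V \<Longrightarrow> y \<in> carrier W \<Longrightarrow> b (x \<oplus>\<^bsub>V\<^esub> x') y = b x y + b x' y"
    "x \<in> carrier V \<Longrightarrow> y \<in> carrier W \<Longrightarrow> y' \<in> carrier W \<Longrightarrow> b x (y \<oplus>\<^bsub>W\<^esub> y') = b x y + b x y'"
    "x \<in> carrier V \<Longrightarrow> y \<in> carrier W \<Longrightarrow> b (c \<odot>\<^bsub>V\<^esub> x) y = c * b x y"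
    "x \<in> carrier V \<Longrightarrow> y \<in> carrier W \<Longrightarrow> b x (c \<odot>\<^bsub>W\<^esub> y) = c * b x y"
  using assms by (auto simp: bilinear_form_def linear_form_def)

lemma bilinear_formI:
  assumes "\<And>x x' y. x \<in> carrier V \<Longrightarrow> x' \<in> carrier V \<Longrightarrow> y \<in> carrier W \<Longrightarrow> b (x \<oplus>\<^bsub>V\<^esub> x') y = b x y + b x' y"
    "\<And>x y y'. x \<in> carrier V \<Longrightarrow> y \<in> carrier W \<Longrightarrow> y' \<in> carrier W \<Longrightarrow> b x (y \<oplus>\<^bsub>W\<^esub> y') = b x y + b x y'"
    "\<And>c x y. x \<in> carrier V \<Longrightarrow> y \<in> carrier W \<Longrightarrow> b (c \<odot>\<^bsub>V\<^esub> x) y = c * b x y"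
    "\<And>c x y. x \<in> carrier V \<Longrightarrow> y \<in> carrier W \<Longrightarrow> b x (c \<odot>\<^bsub>W\<^esub> y) = c * b x y"
  shows "bilinear_form V W b"
  using assms by (auto simp: bilinear_form_def linear_form_def)

subsection \<open>Formal sums\<close>

lemma lookup_fscale [simp]: "Poly_Mapping.lookup (fscale c f) p = c * Poly_Mapping.lookup f p"
  by (simp add: fscale_def Poly_Mapping.map.rep_eq when_def)

interpretation fscale: vector_space "fscale :: 'k::field \<Rightarrow> ('c \<Rightarrow>\<^sub>0 'k) \<Rightarrow> ('c \<Rightarrow>\<^sub>0 'k)"
  by unfold_locales (auto intro!: poly_mapping_eqI simp: lookup_add algebra_simps)

definition eval_form :: "('a \<Rightarrow> 'b \<Rightarrow> 'k::field) \<Rightarrow> (('a \<times> 'b) \<Rightarrow>\<^sub>0 'k) \<Rightarrow> 'k" where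
  "eval_form b f = (\<Sum>p\<in>Poly_Mapping.keys f. Poly_Mapping.lookup f p * b (fst p) (snd p))"

lemma eval_form_superset:
  assumes "finite S" "Poly_Mapping.keys f \<subseteq> S"
  shows "eval_form b f = (\<Sum>p\<in>S. Poly_Mapping.lookup f p * b (fst p) (snd p))"
  unfolding eval_form_def
  using assms by (intro sum.mono_neutral_left) (auto simp: in_keys_iff)

lemma eval_form_simps [simp]:
  "eval_form b 0 = 0"
  "eval_form b (Poly_Mapping.single (x, y) c) = c * b x y"
  "eval_form b (f + g) = eval_form b f + eval_form b g"
  "eval_form b (- f) = - eval_form b f"
  "eval_form b (f - g) = eval_form b f - eval_form b g"
  "eval_form b (fscale c f) = c * eval_form b f"
proof -
  show "eval_form b 0 = 0" by (simp add: eval_form_def)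
  show "eval_form b (Poly_Mapping.single (x, y) c) = c * b x y" by (auto simp: eval_form_def)
  let ?S = "Poly_Mapping.keys f \<union> Poly_Mapping.keys g"
  have S: "finite ?S" by simp
  have "Poly_Mapping.keys (f + g) \<subseteq> ?S" "Poly_Mapping.keys (f - g) \<subseteq> ?S" "Poly_Mapping.keys (- f) \<subseteq> ?S"
     "Poly_Mapping.keys (fscale c f) \<subseteq> ?S"
    by (auto simp: in_keys_iff lookup_add lookup_minus)
  note * = this[THEN eval_form_superset[OF S]]
  have f: "eval_form b f = (\<Sum>p\<in>?S. Poly_Mapping.lookup f p * b (fst p) (snd p))"
    and g: "eval_form b g = (\<Sum>p\<in>?S. Poly_Mapping.lookup g p * b (fst p) (snd p))"
    by (intro eval_form_superset S; simp)+
  show "eval_form b (f + g) = eval_form b f + eval_form b g"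
    unfolding * f g by (simp add: lookup_add ring_distribs sum.distrib)
  show "eval_form b (f - g) = eval_form b f - eval_form b g"
    unfolding * f g by (simp add: lookup_minus ring_distribs sum_subtractf)
  show "eval_form b (- f) = - eval_form b f"
    unfolding * f by (simp add: sum_negf)
  show "eval_form b (fscale c f) = c * eval_form b f"
    unfolding * f by (simp only: lookup_fscale sum_distrib_left mult.assoc)
qed

lemma eval_form_cong:
  assumes "\<And>x y. (x, y) \<in> Poly_Mapping.keys f \<Longrightarrow> b x y = b' x y"
  shows "eval_form b f = eval_form b' f"
  using assms unfolding eval_form_def by (intro sum.cong) auto

lemma fsum_eq_sum_singles:
  "f = (\<Sum>p\<in>Poly_Mapping.keys f. fscale (Poly_Mapping.lookup f p) (Poly_Mapping.single p 1))"
proof (rule poly_mapping_eqI)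
  fix q
  show "Poly_Mapping.lookup f q = Poly_Mapping.lookup (\<Sum>p\<in>Poly_Mapping.keys f.
      fscale (Poly_Mapping.lookup f p) (Poly_Mapping.single p 1)) q"
    by (simp add: lookup_sum lookup_single when_def in_keys_iff if_distrib cong: if_cong)
qed

lemma linear_on_fsums_eq_eval_form:
  assumes "Vector_Spaces.linear fscale (*) \<Psi>"
  shows "\<Psi> f = eval_form (\<lambda>x y. \<Psi> (Poly_Mapping.single (x, y) 1)) f"
proof -
  interpret \<Psi>: Vector_Spaces.linear fscale "(*)" \<Psi> by fact
  have "\<Psi> f = \<Psi> (\<Sum>p\<in>Poly_Mapping.keys f. fscale (Poly_Mapping.lookup f p) (Poly_Mapping.single p 1))"
    using fsum_eq_sum_singles[of f] by simp
  also have "\<dots> = eval_form (\<lambda>x y. \<Psi> (Poly_Mapping.single (x, y) 1)) f"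
    by (simp add: \<Psi>.sum \<Psi>.scale eval_form_def)
  finally show ?thesis .
qed

text \<open>Together with \<open>g\<close>, a basis of the span is still independent, so its elements can be sent to \<open>0\<close> and \<open>g\<close>
  to \<open>1\<close>.\<close>

lemma form_separating_span:
  fixes g :: "'c \<Rightarrow>\<^sub>0 'k::field"
  assumes "g \<notin> fscale.span S"
  obtains \<Psi> where "Vector_Spaces.linear fscale (*) \<Psi>" "\<And>f. f \<in> fscale.span S \<Longrightarrow> \<Psi> f = 0" "\<Psi> g = (1 :: 'k)"
proof -
  interpret fscale_scalar: vector_space_pair "fscale :: 'k \<Rightarrow> ('c \<Rightarrow>\<^sub>0 'k) \<Rightarrow> ('c \<Rightarrow>\<^sub>0 'k)" "(*) :: 'k \<Rightarrow> 'k \<Rightarrow> 'k"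
    by unfold_locales (auto simp: algebra_simps)
  obtain B where B: "B \<subseteq> S" "fscale.independent B" "S \<subseteq> fscale.span B"
    using fscale.maximal_independent_subset[of S] by blast
  have gB: "g \<notin> fscale.span B" using assms B fscale.span_mono by blast
  then have "fscale.independent (insert g B)" using B by (intro fscale.independent_insertI)
  then obtain \<Psi> where \<Psi>: "Vector_Spaces.linear fscale (*) \<Psi>" "\<forall>x\<in>insert g B. \<Psi> x = (if x = g then 1 else 0)"
    using fscale_scalar.linear_independent_extend[of "insert g B" "\<lambda>x. if x = g then 1 else 0"] by blast
  interpret \<Psi>: Vector_Spaces.linear fscale "(*)" \<Psi> by fact
  have "g \<notin> B" using gB fscale.span_base by blast
  have "\<Psi> f = 0" if "f \<in> fscale.span S" for f
  proof -
    have "f \<in> fscale.span B" using that B(3) by (metis fscale.span_minimal fscale.subspace_span subsetD)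
    then show ?thesis
    proof (induction rule: fscale.span_induct_alt)
      case base show ?case by (rule \<Psi>.zero)
    next
      case (step c x y)
      have "\<Psi> x = 0" using \<Psi>(2) \<open>g \<notin> B\<close> step(1) by auto
      then show ?case using step(2) by (simp add: \<Psi>.add \<Psi>.scale)
    qed
  qed
  then show ?thesis using that[of \<Psi>] \<Psi> by simp
qed

lemma bilinear_rels_form:
  assumes "Vector_Spaces.linear fscale (*) \<Psi>" "\<And>f. f \<in> fscale.span (bilinear_rels V W) \<Longrightarrow> \<Psi> f = 0"
  shows "bilinear_form V W (\<lambda>x y. \<Psi> (Poly_Mapping.single (x, y) 1))"
proof -
  interpret \<Psi>: Vector_Spaces.linear fscale "(*)" \<Psi> by fact
  have z: "\<Psi> f = 0" if "f \<in> bilinear_rels V W" for f using assms(2) that fscale.span_base by blast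
  show ?thesis
  proof (rule bilinear_formI)
    fix x x' y assume "x \<in> carrier V" "x' \<in> carrier V" "y \<in> carrier W"
    then have "\<Psi> (Poly_Mapping.single (x \<oplus>\<^bsub>V\<^esub> x', y) 1 - Poly_Mapping.single (x, y) 1 - Poly_Mapping.single (x', y) 1) = 0"
      by (intro z) (unfold bilinear_rels_def, blast)
    then show "\<Psi> (Poly_Mapping.single (x \<oplus>\<^bsub>V\<^esub> x', y) 1) = \<Psi> (Poly_Mapping.single (x, y) 1) + \<Psi> (Poly_Mapping.single (x', y) 1)"
      unfolding \<Psi>.diff by (simp add: diff_eq_eq add.commute)
  next
    fix x y y' assume "x \<in> carrier V" "y \<in> carrier W" "y' \<in> carrier W"
    then have "\<Psi> (Poly_Mapping.single (x, y \<oplus>\<^bsub>W\<^esub> y') 1 - Poly_Mapping.single (x, y) 1 - Poly_Mapping.single (x, y') 1) = 0"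
      by (intro z) (unfold bilinear_rels_def, blast)
    then show "\<Psi> (Poly_Mapping.single (x, y \<oplus>\<^bsub>W\<^esub> y') 1) = \<Psi> (Poly_Mapping.single (x, y) 1) + \<Psi> (Poly_Mapping.single (x, y') 1)"
      unfolding \<Psi>.diff by (simp add: diff_eq_eq add.commute)
  next
    fix c x y assume "x \<in> carrier V" "y \<in> carrier W"
    then have "\<Psi> (Poly_Mapping.single (c \<odot>\<^bsub>V\<^esub> x, y) 1 - fscale c (Poly_Mapping.single (x, y) 1)) = 0"
      "\<Psi> (Poly_Mapping.single (x, c \<odot>\<^bsub>W\<^esub> y) 1 - fscale c (Poly_Mapping.single (x, y) 1)) = 0"
      by - ((rule z, unfold bilinear_rels_def, blast)+)
    then show "\<Psi> (Poly_Mapping.single (c \<odot>\<^bsub>V\<^esub> x, y) 1) = c * \<Psi> (Poly_Mapping.single (x, y) 1)"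
      "\<Psi> (Poly_Mapping.single (x, c \<odot>\<^bsub>W\<^esub> y) 1) = c * \<Psi> (Poly_Mapping.single (x, y) 1)"
      by (simp_all add: \<Psi>.diff \<Psi>.scale)
  qed
qed

lemma eval_form_span_rels:
  assumes "bilinear_form V W b" "f \<in> fscale.span (bilinear_rels V W)"
  shows "eval_form b f = 0"
  using assms(2)
proof (induction rule: fscale.span_induct_alt)
  case (step c x y)
  have "eval_form b x = 0" using step(1) unfolding bilinear_rels_def
    by (auto simp: bilinear_formD[OF assms(1)])
  then show ?case using step by simp
qed simp

text \<open>A linear form that separates \<open>f\<close> from the span restricts on pairs to a bilinear form that vanishes on
  \<open>P\<close> but not at \<open>f\<close>. With \<open>P\<close> empty this describes the relations of the tensor product; with
  \<open>P = A \<times> A\<close> it will detect the tensors in \<open>A \<otimes> A\<close>.\<close>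

lemma in_span_if_forms_vanish:
  assumes "\<And>b. bilinear_form V W b \<Longrightarrow> (\<And>x y. (x, y) \<in> P \<Longrightarrow> b x y = 0) \<Longrightarrow> eval_form b f = 0"
  shows "f \<in> fscale.span (bilinear_rels V W \<union> (\<lambda>p. Poly_Mapping.single p 1) ` P)"
proof (rule ccontr)
  assume "\<not> ?thesis"
  from form_separating_span[OF this] obtain \<Psi> where \<Psi>: "Vector_Spaces.linear fscale (*) \<Psi>"
    "\<And>f. f \<in> fscale.span (bilinear_rels V W \<union> (\<lambda>p. Poly_Mapping.single p 1) ` P) \<Longrightarrow> \<Psi> f = 0" "\<Psi> f = 1"
    by blast
  let ?b = "\<lambda>x y. \<Psi> (Poly_Mapping.single (x, y) 1)"
  have "fscale.span (bilinear_rels V W) \<subseteq> fscale.span (bilinear_rels V W \<union> (\<lambda>p. Poly_Mapping.single p 1) ` P)"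
    by (rule fscale.span_mono) simp
  then have "bilinear_form V W ?b"
    by (intro bilinear_rels_form[OF \<Psi>(1)] \<Psi>(2)) (rule subsetD)
  moreover have "?b x y = 0" if "(x, y) \<in> P" for x y
    using that by (intro \<Psi>(2) fscale.span_base) simp
  ultimately have "eval_form ?b f = 0" by (rule assms)
  then show False using linear_on_fsums_eq_eval_form[OF \<Psi>(1), of f] \<Psi>(3) by simp
qed

lemma span_rels_iff:
  "f \<in> fscale.span (bilinear_rels V W) \<longleftrightarrow> (\<forall>b. bilinear_form V W b \<longrightarrow> eval_form b f = 0)"
  using in_span_if_forms_vanish[of V W "{}" f] eval_form_span_rels[of V W _ f] by auto

subsection \<open>The tensor product as a vector space\<close>

lemma fsums_closed:
  "0 \<in> fsums V W" "f \<in> fsums V W \<Longrightarrow> g \<in> fsums V W \<Longrightarrow> f + g \<in> fsums V W"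
  "f \<in> fsums V W \<Longrightarrow> - f \<in> fsums V W"
  "f \<in> fsums V W \<Longrightarrow> fscale c f \<in> fsums V W"
  "x \<in> carrier V \<Longrightarrow> y \<in> carrier W \<Longrightarrow> Poly_Mapping.single (x, y) c \<in> fsums V W"
proof -
  show "f \<in> fsums V W \<Longrightarrow> g \<in> fsums V W \<Longrightarrow> f + g \<in> fsums V W"
    unfolding fsums_def using Poly_Mapping.keys_add[of f g] by blast
  show "f \<in> fsums V W \<Longrightarrow> fscale c f \<in> fsums V W"
    unfolding fsums_def by (auto simp: in_keys_iff)
qed (auto simp: fsums_def)

lemma tclass_self: "f \<in> fsums V W \<Longrightarrow> f \<in> tclass V W f"
  unfolding tclass_def using fscale.span_zero by simp

lemma tclass_mem: "g \<in> tclass V W f \<longleftrightarrow> g \<in> fsums V W \<and> (\<forall>b. bilinear_form V W b \<longrightarrow> eval_form b g = eval_form b f)"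
  unfolding tclass_def by (simp add: span_rels_iff)

lemma tclass_eq_iff:
  assumes "f \<in> fsums V W"
  shows "tclass V W f = tclass V W g \<longleftrightarrow> (\<forall>b. bilinear_form V W b \<longrightarrow> eval_form b f = eval_form b g)"
proof
  assume "tclass V W f = tclass V W g"
  then show "\<forall>b. bilinear_form V W b \<longrightarrow> eval_form b f = eval_form b g"
    using tclass_self[OF assms] by (simp add: tclass_mem)
qed (auto simp: tclass_mem)

lemma tensor_carrier: "carrier (tensor V W) = tclass V W ` fsums V W" by (simp add: tensor_def)

lemma tensor_cases:
  assumes "t \<in> carrier (tensor V W)"
  obtains f where "f \<in> fsums V W" "t = tclass V W f"
  using assms by (auto simp: tensor_carrier)

lemma UN_const: "a \<in> A \<Longrightarrow> (\<And>x. x \<in> A \<Longrightarrow> F x = c) \<Longrightarrow> (\<Union>x\<in>A. F x) = c" by blast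

lemma tensor_add:
  assumes "f \<in> fsums V W" "g \<in> fsums V W"
  shows "tclass V W f \<oplus>\<^bsub>tensor V W\<^esub> tclass V W g = tclass V W (f + g)"
proof -
  have *: "tclass V W (f' + g') = tclass V W (f + g)" if "f' \<in> tclass V W f" "g' \<in> tclass V W g" for f' g'
    using that by (subst tclass_eq_iff) (auto simp: tclass_mem fsums_closed)
  have "tclass V W f \<oplus>\<^bsub>tensor V W\<^esub> tclass V W g
      = (\<Union>f'\<in>tclass V W f. \<Union>g'\<in>tclass V W g. tclass V W (f' + g'))" by (simp add: tensor_def)
  also have "\<dots> = tclass V W (f + g)"
    by (rule UN_const[OF tclass_self[OF assms(1)] UN_const[OF tclass_self[OF assms(2)] *]])
  finally show ?thesis .
qed

lemma tensor_smult:
  assumes "f \<in> fsums V W"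
  shows "c \<odot>\<^bsub>tensor V W\<^esub> tclass V W f = tclass V W (fscale c f)"
proof -
  have *: "tclass V W (fscale c f') = tclass V W (fscale c f)" if "f' \<in> tclass V W f" for f'
    using that by (subst tclass_eq_iff) (auto simp: tclass_mem fsums_closed)
  have "c \<odot>\<^bsub>tensor V W\<^esub> tclass V W f = (\<Union>f'\<in>tclass V W f. tclass V W (fscale c f'))"
    by (simp add: tensor_def)
  also have "\<dots> = tclass V W (fscale c f)" by (rule UN_const[OF tclass_self[OF assms(1)] *])
  finally show ?thesis .
qed

lemma tensor_zero: "\<zero>\<^bsub>tensor V W\<^esub> = tclass V W 0" by (simp add: tensor_def)

lemma tensor_vspace:
  fixes V :: "('k::field, 'a, 'm) module_scheme" and W :: "('k, 'b, 'n) module_scheme"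
  shows "vspace (tensor V W)"
  unfolding vspace_def
proof (rule moduleI)
  show "cring (scalars :: 'k ring)" by (rule cring_from_type_algebra)
  show "abelian_group (tensor V W)"
  proof (rule abelian_groupI)
    fix x assume "x \<in> carrier (tensor V W)"
    then obtain f where f: "f \<in> fsums V W" "x = tclass V W f" by (rule tensor_cases)
    then show "\<exists>y\<in>carrier (tensor V W). y \<oplus>\<^bsub>tensor V W\<^esub> x = \<zero>\<^bsub>tensor V W\<^esub>"
      by (intro bexI[of _ "tclass V W (- f)"]) (auto simp: tensor_add tensor_zero fsums_closed tensor_carrier)
  qed (auto simp: tensor_carrier tensor_add tensor_zero fsums_closed ac_simps)
qed (auto simp: tensor_carrier tensor_add tensor_smult fsums_closed fscale.scale_left_distrib fscale.scale_right_distrib)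

text \<open>The linear form on \<open>V \<otimes> W\<close> induced by a bilinear form \<open>b\<close>. The choice of the representative is harmless,
  since bilinear forms vanish on the relations.\<close>

definition tensor_form :: "('a \<Rightarrow> 'b \<Rightarrow> 'k::field) \<Rightarrow> ('k, 'a, 'b) tensor \<Rightarrow> 'k" where
  "tensor_form b t = eval_form b (SOME f. f \<in> t)"

lemma tensor_some:
  assumes "t \<in> carrier (tensor V W)"
  shows "(SOME f. f \<in> t) \<in> t" "(SOME f. f \<in> t) \<in> fsums V W"
proof -
  obtain f where f: "f \<in> fsums V W" "t = tclass V W f" using assms by (rule tensor_cases)
  then have "f \<in> t" using tclass_self by blast
  then show "(SOME f. f \<in> t) \<in> t" by (rule someI)
  then show "(SOME f. f \<in> t) \<in> fsums V W" using f by (simp add: tclass_mem)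
qed

lemma tensor_form_eval:
  assumes "t \<in> carrier (tensor V W)" "bilinear_form V W b" "f \<in> t"
  shows "tensor_form b t = eval_form b f"
proof -
  obtain g where g: "g \<in> fsums V W" "t = tclass V W g" using assms(1) by (rule tensor_cases)
  then show ?thesis using tensor_some[OF assms(1)] assms(2,3) by (auto simp: tclass_mem tensor_form_def)
qed

lemma tensor_form_tclass:
  "bilinear_form V W b \<Longrightarrow> f \<in> fsums V W \<Longrightarrow> tensor_form b (tclass V W f) = eval_form b f"
  by (intro tensor_form_eval) (auto simp: tensor_carrier intro: tclass_self)

lemma tensor_form_linear: "bilinear_form V W b \<Longrightarrow> linear_form (tensor V W) (tensor_form b)"
  unfolding linear_form_def
  by (auto simp: tensor_carrier tensor_add tensor_smult tensor_form_tclass fsums_closed)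

lemma pure_tensor_closed: "x \<in> carrier V \<Longrightarrow> y \<in> carrier W \<Longrightarrow> pure_tensor V W x y \<in> carrier (tensor V W)"
  by (auto simp: pure_tensor_def tensor_carrier fsums_closed)

lemma tensor_form_pure:
  "bilinear_form V W b \<Longrightarrow> x \<in> carrier V \<Longrightarrow> y \<in> carrier W \<Longrightarrow> tensor_form b (pure_tensor V W x y) = b x y"
  by (simp add: pure_tensor_def tensor_form_tclass fsums_closed)

lemma tensor_eqI:
  assumes "s \<in> carrier (tensor V W)" "t \<in> carrier (tensor V W)"
    "\<And>b. bilinear_form V W b \<Longrightarrow> tensor_form b s = tensor_form b t"
  shows "s = t"
proof -
  obtain f g where fg: "f \<in> fsums V W" "s = tclass V W f" "g \<in> fsums V W" "t = tclass V W g"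
    using assms(1,2) tensor_cases by metis
  then show ?thesis using assms(3) by (simp add: tclass_eq_iff tensor_form_tclass)
qed

lemma tensor_form_cong:
  assumes "t \<in> carrier (tensor V W)" "\<And>x y. x \<in> carrier V \<Longrightarrow> y \<in> carrier W \<Longrightarrow> b x y = b' x y"
  shows "tensor_form b t = tensor_form b' t"
proof -
  have "(SOME f. f \<in> t) \<in> fsums V W" using tensor_some[OF assms(1)] by simp
  then have "Poly_Mapping.keys (SOME f. f \<in> t) \<subseteq> carrier V \<times> carrier W" by (simp add: fsums_def)
  then show ?thesis unfolding tensor_form_def by (intro eval_form_cong assms(2)) auto
qed


subsection \<open>Sweedler sums\<close>

lemma sweedler_closed:
  assumes "vspace M" "t \<in> carrier (tensor V W)"
    "\<And>x y. x \<in> carrier V \<Longrightarrow> y \<in> carrier W \<Longrightarrow> \<beta> x y \<in> carrier M"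
  shows "sweedler M \<beta> t \<in> carrier M"
proof -
  interpret M: vspace M by fact
  have "Poly_Mapping.keys (SOME f. f \<in> t) \<subseteq> carrier V \<times> carrier W"
    using tensor_some[OF assms(2)] by (simp add: fsums_def)
  then show ?thesis unfolding sweedler_def Let_def using assms(3)
    by (intro M.finsum_closed) (auto simp: subset_iff)
qed

lemma sweedler_form:
  assumes "vspace M" "t \<in> carrier (tensor V W)" "linear_form M \<phi>"
    "\<And>x y. x \<in> carrier V \<Longrightarrow> y \<in> carrier W \<Longrightarrow> \<beta> x y \<in> carrier M"
  shows "\<phi> (sweedler M \<beta> t) = tensor_form (\<lambda>x y. \<phi> (\<beta> x y)) t"
proof -
  interpret M: vspace M by fact
  let ?f = "SOME f. f \<in> t"
  have "Poly_Mapping.keys ?f \<subseteq> carrier V \<times> carrier W"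
    using tensor_some[OF assms(2)] by (simp add: fsums_def)
  then have *: "\<beta> (fst p) (snd p) \<in> carrier M" if "p \<in> Poly_Mapping.keys ?f" for p
    using assms(4) that by auto
  show ?thesis unfolding sweedler_def Let_def tensor_form_def eval_form_def
    by (subst M.linear_form_finsum[OF assms(3)]) (auto simp: * linear_formD(2)[OF assms(3)])
qed

section \<open>Hopf algebras through their linear and bilinear forms\<close>

lemma eval_form_sum_fun: "eval_form (\<lambda>x y. \<Sum>i\<in>I. b i x y) f = (\<Sum>i\<in>I. eval_form (b i) f)"
  unfolding eval_form_def by (simp add: sum_distrib_left) (rule sum.swap)

lemma eval_form_sum: "eval_form b (\<Sum>i\<in>I. f i) = (\<Sum>i\<in>I. eval_form b (f i))"
  by (induction I rule: infinite_finite_induct) auto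

text \<open>Both sides are evaluated at the same representative of \<open>t\<close>, so that \<open>b\<close> can be arbitrary.\<close>

lemma tensor_form_fun_simps:
  "tensor_form (\<lambda>x y. b x y + b' x y) t = tensor_form b t + tensor_form b' t"
  "tensor_form (\<lambda>x y. b x y - b' x y) t = tensor_form b t - tensor_form b' t"
  "tensor_form (\<lambda>x y. c * b x y) t = c * tensor_form b t"
  "tensor_form (\<lambda>x y. b x y * c) t = tensor_form b t * c"
  "tensor_form (\<lambda>x y. 0) t = 0"
  "tensor_form (\<lambda>x y. \<Sum>i\<in>I. bb i x y) t = (\<Sum>i\<in>I. tensor_form (bb i) t)"
proof -
  show "tensor_form (\<lambda>x y. b x y + b' x y) t = tensor_form b t + tensor_form b' t"
    by (simp add: tensor_form_def eval_form_def distrib_left sum.distrib)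
  show "tensor_form (\<lambda>x y. b x y - b' x y) t = tensor_form b t - tensor_form b' t"
    by (simp add: tensor_form_def eval_form_def right_diff_distrib sum_subtractf)
  show "tensor_form (\<lambda>x y. c * b x y) t = c * tensor_form b t"
    by (simp only: tensor_form_def eval_form_def sum_distrib_left mult.left_commute)
  show "tensor_form (\<lambda>x y. b x y * c) t = tensor_form b t * c"
    by (simp only: tensor_form_def eval_form_def sum_distrib_right mult.assoc)
  show "tensor_form (\<lambda>x y. 0) t = 0"
    by (simp add: tensor_form_def eval_form_def)
  show "tensor_form (\<lambda>x y. \<Sum>i\<in>I. bb i x y) t = (\<Sum>i\<in>I. tensor_form (bb i) t)"
    unfolding tensor_form_def by (rule eval_form_sum_fun)
qed

lemma linear_form_tensor_form_fun:
  assumes "t \<in> carrier (tensor V W)"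
    "\<And>y z. y \<in> carrier V \<Longrightarrow> z \<in> carrier W \<Longrightarrow> linear_form U (\<lambda>x. b x y z)"
    "vspace U"
  shows "linear_form U (\<lambda>x. tensor_form (b x) t)"
proof -
  interpret U: vspace U by fact
  show ?thesis unfolding linear_form_def
  proof (intro conjI ballI allI)
    fix x x' assume x: "x \<in> carrier U" "x' \<in> carrier U"
    have "tensor_form (b (x \<oplus>\<^bsub>U\<^esub> x')) t = tensor_form (\<lambda>y z. b x y z + b x' y z) t"
      by (rule tensor_form_cong[OF assms(1)]) (use x linear_formD(1)[OF assms(2)] in auto)
    then show "tensor_form (b (x \<oplus>\<^bsub>U\<^esub> x')) t = tensor_form (b x) t + tensor_form (b x') t"
      by (simp add: tensor_form_fun_simps)
  next
    fix c x assume x: "x \<in> carrier U"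
    have "tensor_form (b (c \<odot>\<^bsub>U\<^esub> x)) t = tensor_form (\<lambda>y z. c * b x y z) t"
      by (rule tensor_form_cong[OF assms(1)]) (use x linear_formD(2)[OF assms(2)] in auto)
    then show "tensor_form (b (c \<odot>\<^bsub>U\<^esub> x)) t = c * tensor_form (b x) t"
      by (simp add: tensor_form_fun_simps)
  qed
qed

locale kalgebra = vspace V + ring V for V :: "('k::field, 'a, 'm) module_scheme" (structure) +
  assumes smult_mult: "\<lbrakk>x \<in> carrier V; y \<in> carrier V\<rbrakk> \<Longrightarrow> (c \<odot> x) \<otimes> y = c \<odot> (x \<otimes> y)"
    "\<lbrakk>x \<in> carrier V; y \<in> carrier V\<rbrakk> \<Longrightarrow> x \<otimes> (c \<odot> y) = c \<odot> (x \<otimes> y)"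

lemma eval_form_fmult:
  "eval_form b (fmult V W f g) = eval_form (\<lambda>x y. eval_form (\<lambda>x' y'. b (x \<otimes>\<^bsub>V\<^esub> x') (y \<otimes>\<^bsub>W\<^esub> y')) g) f"
proof -
  have "eval_form b (fmult V W f g) = (\<Sum>p\<in>Poly_Mapping.keys f. \<Sum>q\<in>Poly_Mapping.keys g.
      Poly_Mapping.lookup f p * Poly_Mapping.lookup g q * b (fst p \<otimes>\<^bsub>V\<^esub> fst q) (snd p \<otimes>\<^bsub>W\<^esub> snd q))"
    unfolding fmult_def by (simp add: eval_form_sum case_prod_unfold)
  also have "\<dots> = eval_form (\<lambda>x y. eval_form (\<lambda>x' y'. b (x \<otimes>\<^bsub>V\<^esub> x') (y \<otimes>\<^bsub>W\<^esub> y')) g) f"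
    unfolding eval_form_def by (simp only: sum_distrib_left mult.assoc)
  finally show ?thesis .
qed

lemma fsums_sum: "(\<And>i. i \<in> I \<Longrightarrow> f i \<in> fsums V W) \<Longrightarrow> (\<Sum>i\<in>I. f i) \<in> fsums V W"
  by (induction I rule: infinite_finite_induct) (auto simp: fsums_closed)

lemma tensor_mult:
  fixes V :: "('k::field, 'a, 'm) module_scheme" and W :: "('k, 'b, 'n) module_scheme"
  assumes "kalgebra V" "kalgebra W" and f: "f \<in> fsums V W" and g: "g \<in> fsums V W"
  shows "tclass V W f \<otimes>\<^bsub>tensor V W\<^esub> tclass V W g = tclass V W (fmult V W f g)" "fmult V W f g \<in> fsums V W"
proof -
  interpret V: kalgebra V by fact
  interpret W: kalgebra W by fact
  have cl: "fmult V W f g \<in> fsums V W" if "f \<in> fsums V W" "g \<in> fsums V W" for f g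
    unfolding fmult_def case_prod_unfold using that
    by (intro fsums_sum fsums_closed) (auto simp: fsums_def subset_iff)
  have bl: "bilinear_form V W (\<lambda>x y. b (x \<otimes>\<^bsub>V\<^esub> x') (y \<otimes>\<^bsub>W\<^esub> y'))"
    "bilinear_form V W (\<lambda>x y. b (x' \<otimes>\<^bsub>V\<^esub> x) (y' \<otimes>\<^bsub>W\<^esub> y))"
    if "bilinear_form V W b" "x' \<in> carrier V" "y' \<in> carrier W" for b x' y'
    using that by (auto intro!: bilinear_formI simp: V.l_distr V.r_distr W.l_distr W.r_distr V.smult_mult W.smult_mult
       bilinear_formD[OF that(1)])
  have *: "tclass V W (fmult V W f' g') = tclass V W (fmult V W f g)"
    if "f' \<in> tclass V W f" "g' \<in> tclass V W g" for f' g'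
  proof (subst tclass_eq_iff, intro cl, use that in \<open>simp_all add: tclass_mem\<close>, intro allI impI)
    fix b assume b: "bilinear_form V W b"
    have k: "(x, y) \<in> Poly_Mapping.keys h \<Longrightarrow> x \<in> carrier V \<and> y \<in> carrier W" if "h \<in> fsums V W" for h x y
      using that by (auto simp: fsums_def)
    have swap: "eval_form (\<lambda>x y. eval_form (\<lambda>x' y'. b (x \<otimes>\<^bsub>V\<^esub> x') (y \<otimes>\<^bsub>W\<^esub> y')) g) h
       = eval_form (\<lambda>x' y'. eval_form (\<lambda>x y. b (x \<otimes>\<^bsub>V\<^esub> x') (y \<otimes>\<^bsub>W\<^esub> y')) h) g" for h g
      unfolding eval_form_def by (simp only: sum_distrib_left, subst sum.swap) (simp only: mult.left_commute)
    have "eval_form b (fmult V W f' g') = eval_form (\<lambda>x y. eval_form (\<lambda>x' y'. b (x \<otimes>\<^bsub>V\<^esub> x') (y \<otimes>\<^bsub>W\<^esub> y')) g) f'"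
      unfolding eval_form_fmult using that k[of f'] bl(2)[OF b]
      by (intro eval_form_cong) (auto simp: tclass_mem)
    also have "\<dots> = eval_form (\<lambda>x y. eval_form (\<lambda>x' y'. b (x \<otimes>\<^bsub>V\<^esub> x') (y \<otimes>\<^bsub>W\<^esub> y')) g) f"
      unfolding swap using that k[of g] bl(1)[OF b] g
      by (intro eval_form_cong) (auto simp: tclass_mem)
    finally show "eval_form b (fmult V W f' g') = eval_form b (fmult V W f g)"
      unfolding eval_form_fmult .
  qed
  have "tclass V W f \<otimes>\<^bsub>tensor V W\<^esub> tclass V W g
      = (\<Union>f'\<in>tclass V W f. \<Union>g'\<in>tclass V W g. tclass V W (fmult V W f' g'))" by (simp add: tensor_def)
  also have "\<dots> = tclass V W (fmult V W f g)"
    by (rule UN_const[OF tclass_self[OF f] UN_const[OF tclass_self[OF g] *]])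
  finally show "tclass V W f \<otimes>\<^bsub>tensor V W\<^esub> tclass V W g = tclass V W (fmult V W f g)" .
  show "fmult V W f g \<in> fsums V W" by (rule cl) fact+
qed

lemma tensor_form_mult:
  fixes V :: "('k::field, 'a, 'm) module_scheme" and W :: "('k, 'b, 'n) module_scheme"
  assumes "kalgebra V" "kalgebra W" and st: "s \<in> carrier (tensor V W)" "t \<in> carrier (tensor V W)"
  shows "s \<otimes>\<^bsub>tensor V W\<^esub> t \<in> carrier (tensor V W)"
    and "bilinear_form V W b \<Longrightarrow> tensor_form b (s \<otimes>\<^bsub>tensor V W\<^esub> t)
      = tensor_form (\<lambda>x y. tensor_form (\<lambda>x' y'. b (x \<otimes>\<^bsub>V\<^esub> x') (y \<otimes>\<^bsub>W\<^esub> y')) t) s"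
proof -
  interpret V: kalgebra V by fact
  interpret W: kalgebra W by fact
  let ?f = "SOME f. f \<in> s" and ?g = "SOME g. g \<in> t"
  have m: "?f \<in> s" "?f \<in> fsums V W" "?g \<in> t" "?g \<in> fsums V W" using tensor_some st by blast+
  have st': "s = tclass V W ?f" "t = tclass V W ?g"
    using st m by (auto elim!: tensor_cases simp: tclass_eq_iff) (auto simp: tclass_mem tclass_eq_iff)
  have mult: "s \<otimes>\<^bsub>tensor V W\<^esub> t = tclass V W (fmult V W ?f ?g)"
    using tensor_mult(1)[OF assms(1,2) m(2,4)] st' by simp
  then show "s \<otimes>\<^bsub>tensor V W\<^esub> t \<in> carrier (tensor V W)"
    using tensor_mult(2)[OF assms(1,2) m(2,4)] by (simp add: tensor_carrier)
  assume "bilinear_form V W b"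
  then have "tensor_form b (s \<otimes>\<^bsub>tensor V W\<^esub> t) = eval_form b (fmult V W ?f ?g)"
    unfolding mult by (rule tensor_form_tclass) (rule tensor_mult(2)[OF assms(1,2) m(2,4)])
  then show "tensor_form b (s \<otimes>\<^bsub>tensor V W\<^esub> t)
      = tensor_form (\<lambda>x y. tensor_form (\<lambda>x' y'. b (x \<otimes>\<^bsub>V\<^esub> x') (y \<otimes>\<^bsub>W\<^esub> y')) t) s"
    unfolding eval_form_fmult tensor_form_def .
qed

definition trilinear_form :: "('k::field, 'a, 'm) module_scheme \<Rightarrow> ('a \<Rightarrow> 'a \<Rightarrow> 'a \<Rightarrow> 'k) \<Rightarrow> bool" where
  "trilinear_form V t \<longleftrightarrow> (\<forall>x\<in>carrier V. bilinear_form V V (t x)) \<and>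
     (\<forall>y\<in>carrier V. \<forall>z\<in>carrier V. linear_form V (\<lambda>x. t x y z))"

lemma trilinear_formD:
  assumes "trilinear_form V t"
  shows "x \<in> carrier V \<Longrightarrow> bilinear_form V V (t x)"
    "y \<in> carrier V \<Longrightarrow> z \<in> carrier V \<Longrightarrow> linear_form V (\<lambda>x. t x y z)"
    "x \<in> carrier V \<Longrightarrow> z \<in> carrier V \<Longrightarrow> linear_form V (\<lambda>y. t x y z)"
    "x \<in> carrier V \<Longrightarrow> y \<in> carrier V \<Longrightarrow> linear_form V (\<lambda>z. t x y z)"
    "z \<in> carrier V \<Longrightarrow> bilinear_form V V (\<lambda>x y. t x y z)"
  using assms by (auto simp: trilinear_form_def bilinear_form_def)

context hopf_algebra
begin

sublocale kalgebra H
  by unfold_locales (auto intro: smult_mult_left smult_mult_right)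

lemma comult_closed: "h \<in> carrier H \<Longrightarrow> \<Delta> h \<in> carrier (tensor H H)"
  using comult_linear by (rule linear_mapD)

lemma counit_simps [simp]:
  "x \<in> carrier H \<Longrightarrow> y \<in> carrier H \<Longrightarrow> \<epsilon> (x \<oplus> y) = \<epsilon> x + \<epsilon> y"
  "x \<in> carrier H \<Longrightarrow> y \<in> carrier H \<Longrightarrow> \<epsilon> (x \<otimes> y) = \<epsilon> x * \<epsilon> y"
  "\<epsilon> \<one> = 1" "x \<in> carrier H \<Longrightarrow> \<epsilon> (c \<odot> x) = c * \<epsilon> x"
  using ring_hom_add[OF counit_hom] ring_hom_mult[OF counit_hom] ring_hom_one[OF counit_hom]
    counit_smult by auto

lemma counit_form: "linear_form H \<epsilon>" by (simp add: linear_form_def)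

lemma antipode_closed [simp]: "x \<in> carrier H \<Longrightarrow> \<S> x \<in> carrier H"
  using antipode_linear by (rule linear_mapD)

lemma antipode_lin:
  "x \<in> carrier H \<Longrightarrow> y \<in> carrier H \<Longrightarrow> \<S> (x \<oplus> y) = \<S> x \<oplus> \<S> y"
  "x \<in> carrier H \<Longrightarrow> \<S> (c \<odot> x) = c \<odot> \<S> x"
  using linear_mapD[OF antipode_linear] by auto

lemma form_comult:
  assumes "bilinear_form H H b"
  shows "linear_form H (\<lambda>h. tensor_form b (\<Delta> h))"
    and "x \<in> carrier H \<Longrightarrow> y \<in> carrier H \<Longrightarrow> tensor_form b (\<Delta> (x \<otimes> y)) =
       tensor_form (\<lambda>u v. tensor_form (\<lambda>u' v'. b (u \<otimes> u') (v \<otimes> v')) (\<Delta> y)) (\<Delta> x)"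
    and "tensor_form b (\<Delta> \<one>) = b \<one> \<one>"
proof -
  note T = tensor_form_linear[OF assms]
  show "linear_form H (\<lambda>h. tensor_form b (\<Delta> h))"
    using linear_mapD[OF comult_linear] by (simp add: linear_form_def linear_formD[OF T])
  show "tensor_form b (\<Delta> (x \<otimes> y)) =
       tensor_form (\<lambda>u v. tensor_form (\<lambda>u' v'. b (u \<otimes> u') (v \<otimes> v')) (\<Delta> y)) (\<Delta> x)"
    if "x \<in> carrier H" "y \<in> carrier H"
    using that tensor_form_mult(2)[OF kalgebra_axioms kalgebra_axioms comult_closed comult_closed assms]
    by (simp add: ring_hom_mult[OF comult_hom])
  show "tensor_form b (\<Delta> \<one>) = b \<one> \<one>"
    using ring_hom_one[OF comult_hom] tensor_form_pure[OF assms, of \<one> \<one>] by (simp add: tensor_def)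
qed

lemma form_counit_antipode:
  assumes "linear_form H \<phi>" and h: "h \<in> carrier H"
  shows "tensor_form (\<lambda>x y. \<epsilon> x * \<phi> y) (\<Delta> h) = \<phi> h"
    "tensor_form (\<lambda>x y. \<epsilon> y * \<phi> x) (\<Delta> h) = \<phi> h"
    "tensor_form (\<lambda>x y. \<phi> (\<S> x \<otimes> y)) (\<Delta> h) = \<epsilon> h * \<phi> \<one>"
    "tensor_form (\<lambda>x y. \<phi> (x \<otimes> \<S> y)) (\<Delta> h) = \<epsilon> h * \<phi> \<one>"
proof -
  note s = sweedler_form[OF vspace_axioms comult_closed[OF h] assms(1)]
  note cong = tensor_form_cong[OF comult_closed[OF h]]
  note \<phi> = linear_formD[OF assms(1)]
  have "\<phi> (sweedler H (\<lambda>x y. \<epsilon> x \<odot> y) (\<Delta> h)) = tensor_form (\<lambda>x y. \<epsilon> x * \<phi> y) (\<Delta> h)"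
    using s[of "\<lambda>x y. \<epsilon> x \<odot> y"] cong[of "\<lambda>x y. \<phi> (\<epsilon> x \<odot> y)" "\<lambda>x y. \<epsilon> x * \<phi> y"] by (simp add: \<phi>)
  then show "tensor_form (\<lambda>x y. \<epsilon> x * \<phi> y) (\<Delta> h) = \<phi> h" using counit_left[OF h] by simp
  have "\<phi> (sweedler H (\<lambda>x y. \<epsilon> y \<odot> x) (\<Delta> h)) = tensor_form (\<lambda>x y. \<epsilon> y * \<phi> x) (\<Delta> h)"
    using s[of "\<lambda>x y. \<epsilon> y \<odot> x"] cong[of "\<lambda>x y. \<phi> (\<epsilon> y \<odot> x)" "\<lambda>x y. \<epsilon> y * \<phi> x"] by (simp add: \<phi>)
  then show "tensor_form (\<lambda>x y. \<epsilon> y * \<phi> x) (\<Delta> h) = \<phi> h" using counit_right[OF h] by simp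
  show "tensor_form (\<lambda>x y. \<phi> (\<S> x \<otimes> y)) (\<Delta> h) = \<epsilon> h * \<phi> \<one>"
    using s[of "\<lambda>x y. \<S> x \<otimes> y"] antipode_left[OF h] by (simp add: \<phi>)
  show "tensor_form (\<lambda>x y. \<phi> (x \<otimes> \<S> y)) (\<Delta> h) = \<epsilon> h * \<phi> \<one>"
    using s[of "\<lambda>x y. x \<otimes> \<S> y"] antipode_right[OF h] by (simp add: \<phi>)
qed

text \<open>A trilinear form \<open>t\<close> induces a linear form on \<open>H \<otimes> (H \<otimes> H)\<close>. Applied to both sides of the coassociativity
  axiom, it turns this axiom into an identity between scalars.\<close>

lemma form_coassoc:
  assumes t: "trilinear_form H t" and h: "h \<in> carrier H"
  shows "tensor_form (\<lambda>x z. tensor_form (\<lambda>u v. t u v z) (\<Delta> x)) (\<Delta> h) =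
    tensor_form (\<lambda>x z. tensor_form (\<lambda>u v. t x u v) (\<Delta> z)) (\<Delta> h)"
proof -
  let ?HH = "tensor H H" and ?H3 = "tensor H (tensor H H)"
  interpret HH: vspace ?HH by (rule tensor_vspace)
  interpret H3: vspace ?H3 by (rule tensor_vspace)
  let ?b = "\<lambda>x w. tensor_form (t x) w"
  have b: "bilinear_form H ?HH ?b"
    unfolding bilinear_form_def
  proof (intro conjI ballI)
    show "linear_form H (\<lambda>x. tensor_form (t x) w)" if "w \<in> carrier ?HH" for w
      using that trilinear_formD(2)[OF t] vspace_axioms by (rule linear_form_tensor_form_fun)
    show "linear_form ?HH (tensor_form (t x))" if "x \<in> carrier H" for x
      using that trilinear_formD(1)[OF t] by (intro tensor_form_linear) blast
  qed
  let ?F = "tensor_form ?b"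
  have F: "linear_form ?H3 ?F" using tensor_form_linear[OF b] .
  let ?p3 = "\<lambda>u v z. pure_tensor H ?HH u (pure_tensor H H v z)"
  have pc: "?p3 u v z \<in> carrier ?H3" if "u \<in> carrier H" "v \<in> carrier H" "z \<in> carrier H" for u v z
    using that by (intro pure_tensor_closed)
  have Fp: "?F (?p3 u v z) = t u v z" if "u \<in> carrier H" "v \<in> carrier H" "z \<in> carrier H" for u v z
    using that b trilinear_formD(1)[OF t]
    by (simp add: tensor_form_pure[OF b] pure_tensor_closed tensor_form_pure)
  have Fp': "?F (pure_tensor H ?HH x (\<Delta> z)) = tensor_form (t x) (\<Delta> z)" if "x \<in> carrier H" "z \<in> carrier H" for x z
    using that by (simp add: tensor_form_pure[OF b] comult_closed)
  let ?L = "\<lambda>x z. sweedler ?H3 (\<lambda>u v. ?p3 u v z) (\<Delta> x)"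
  have L: "?L x z \<in> carrier ?H3" "?F (?L x z) = tensor_form (\<lambda>u v. t u v z) (\<Delta> x)"
    if "x \<in> carrier H" "z \<in> carrier H" for x z
  proof -
    show "?L x z \<in> carrier ?H3" using that pc
      by (intro sweedler_closed[OF H3.vspace_axioms comult_closed]) auto
    have "?F (?L x z) = tensor_form (\<lambda>u v. ?F (?p3 u v z)) (\<Delta> x)" using that pc
      by (intro sweedler_form[OF H3.vspace_axioms comult_closed F]) auto
    also have "\<dots> = tensor_form (\<lambda>u v. t u v z) (\<Delta> x)" using that Fp
      by (intro tensor_form_cong[OF comult_closed]) auto
    finally show "?F (?L x z) = tensor_form (\<lambda>u v. t u v z) (\<Delta> x)" .
  qed
  have "tensor_form (\<lambda>x z. tensor_form (\<lambda>u v. t u v z) (\<Delta> x)) (\<Delta> h) = tensor_form (\<lambda>x z. ?F (?L x z)) (\<Delta> h)"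
    using L h by (intro tensor_form_cong[OF comult_closed]) auto
  also have "\<dots> = ?F (sweedler ?H3 ?L (\<Delta> h))"
    using L h by (intro sweedler_form[symmetric, OF H3.vspace_axioms comult_closed F]) auto
  also have "\<dots> = ?F (sweedler ?H3 (\<lambda>x z. pure_tensor H ?HH x (\<Delta> z)) (\<Delta> h))"
    using coassoc[OF h] by simp
  also have "\<dots> = tensor_form (\<lambda>x z. ?F (pure_tensor H ?HH x (\<Delta> z))) (\<Delta> h)"
    using h by (intro sweedler_form[OF H3.vspace_axioms comult_closed F]) (auto intro: pure_tensor_closed comult_closed)
  also have "\<dots> = tensor_form (\<lambda>x z. tensor_form (t x) (\<Delta> z)) (\<Delta> h)"
    using Fp' h by (intro tensor_form_cong[OF comult_closed]) auto
  finally show ?thesis .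
qed

end

text \<open>As forms separate tensors, the axioms of a Hopf algebra follow back from the scalar identities derived
  above. Subalgebras and images are recognized as Hopf algebras in this way.\<close>

lemma hopf_algebraI:
  fixes L :: "('k::field, 'a) hopf" (structure)
  assumes "kalgebra L" and fd: "finite_dimensional L"
    and cl: "\<And>h. h \<in> carrier L \<Longrightarrow> \<Delta> h \<in> carrier (tensor L L)"
    and form: "\<And>b. bilinear_form L L b \<Longrightarrow> linear_form L (\<lambda>h. tensor_form b (\<Delta> h))"
    and mult: "\<And>b x y. bilinear_form L L b \<Longrightarrow> x \<in> carrier L \<Longrightarrow> y \<in> carrier L \<Longrightarrow>
       tensor_form b (\<Delta> (x \<otimes> y)) = tensor_form (\<lambda>u v. tensor_form (\<lambda>u' v'. b (u \<otimes> u') (v \<otimes> v')) (\<Delta> y)) (\<Delta> x)"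
    and one: "\<And>b. bilinear_form L L b \<Longrightarrow> tensor_form b (\<Delta> \<one>) = b \<one> \<one>"
    and eps: "linear_form L \<epsilon>" "\<And>x y. x \<in> carrier L \<Longrightarrow> y \<in> carrier L \<Longrightarrow> \<epsilon> (x \<otimes> y) = \<epsilon> x * \<epsilon> y" "\<epsilon> \<one> = 1"
    and S: "linear_map L L \<S>"
    and coassoc: "\<And>t h. trilinear_form L t \<Longrightarrow> h \<in> carrier L \<Longrightarrow>
       tensor_form (\<lambda>x z. tensor_form (\<lambda>u v. t u v z) (\<Delta> x)) (\<Delta> h) =
       tensor_form (\<lambda>x z. tensor_form (\<lambda>u v. t x u v) (\<Delta> z)) (\<Delta> h)"
    and counit: "\<And>\<phi> h. linear_form L \<phi> \<Longrightarrow> h \<in> carrier L \<Longrightarrow> tensor_form (\<lambda>x y. \<epsilon> x * \<phi> y) (\<Delta> h) = \<phi> h"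
      "\<And>\<phi> h. linear_form L \<phi> \<Longrightarrow> h \<in> carrier L \<Longrightarrow> tensor_form (\<lambda>x y. \<epsilon> y * \<phi> x) (\<Delta> h) = \<phi> h"
    and antipode: "\<And>\<phi> h. linear_form L \<phi> \<Longrightarrow> h \<in> carrier L \<Longrightarrow> tensor_form (\<lambda>x y. \<phi> (\<S> x \<otimes> y)) (\<Delta> h) = \<epsilon> h * \<phi> \<one>"
      "\<And>\<phi> h. linear_form L \<phi> \<Longrightarrow> h \<in> carrier L \<Longrightarrow> tensor_form (\<lambda>x y. \<phi> (x \<otimes> \<S> y)) (\<Delta> h) = \<epsilon> h * \<phi> \<one>"
  shows "hopf_algebra L"
proof -
  interpret kalgebra L by fact
  let ?LL = "tensor L L" and ?L3 = "tensor L (tensor L L)"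
  interpret LL: vspace ?LL by (rule tensor_vspace)
  interpret L3: vspace ?L3 by (rule tensor_vspace)
  note Scl = linear_mapD(1)[OF S]
  have lin: "linear_map L ?LL \<Delta>"
  proof (rule linear_mapI[OF cl])
    fix x y c assume x: "x \<in> carrier L"
    show "\<Delta> (c \<odot> x) = c \<odot>\<^bsub>?LL\<^esub> \<Delta> x"
      by (rule tensor_eqI[of _ L L])
       (use x cl in \<open>simp_all add: linear_formD(2)[OF form] linear_formD(2)[OF tensor_form_linear]\<close>)
    assume y: "y \<in> carrier L"
    show "\<Delta> (x \<oplus> y) = \<Delta> x \<oplus>\<^bsub>?LL\<^esub> \<Delta> y"
      by (rule tensor_eqI[of _ L L])
       (use x y cl in \<open>simp_all add: linear_formD(1)[OF form] linear_formD(1)[OF tensor_form_linear]\<close>)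
  qed
  have hom: "\<Delta> \<in> ring_hom L ?LL"
  proof (rule ring_hom_memI)
    fix x y assume xy: "x \<in> carrier L" "y \<in> carrier L"
    note tm = tensor_form_mult[OF kalgebra_axioms kalgebra_axioms cl[OF xy(1)] cl[OF xy(2)]]
    show "\<Delta> (x \<otimes> y) = \<Delta> x \<otimes>\<^bsub>?LL\<^esub> \<Delta> y"
      by (rule tensor_eqI[of _ L L]) (use xy cl tm mult in \<open>auto\<close>)
    show "\<Delta> (x \<oplus> y) = \<Delta> x \<oplus>\<^bsub>?LL\<^esub> \<Delta> y" using lin xy by (auto simp: linear_map_def)
  next
    have "pure_tensor L L \<one> \<one> \<in> carrier ?LL" by (intro pure_tensor_closed) auto
    then have "\<Delta> \<one> = pure_tensor L L \<one> \<one>"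
      by (intro tensor_eqI[of _ L L]) (use cl one in \<open>auto simp: tensor_form_pure\<close>)
    then show "\<Delta> \<one> = \<one>\<^bsub>?LL\<^esub>" by (simp add: tensor_def)
  qed (rule cl)
  have e: "\<epsilon> \<in> ring_hom L scalars"
    by (rule ring_hom_memI) (auto simp: eps linear_formD[OF eps(1)])
  have assoc: "sweedler ?L3 (\<lambda>x z. sweedler ?L3 (\<lambda>u v. pure_tensor L ?LL u (pure_tensor L L v z)) (\<Delta> x)) (\<Delta> h) =
      sweedler ?L3 (\<lambda>x z. pure_tensor L ?LL x (\<Delta> z)) (\<Delta> h)" (is "?A = ?B") if h: "h \<in> carrier L" for h
  proof (rule tensor_eqI[of _ L ?LL])
    let ?p3 = "\<lambda>u v z. pure_tensor L ?LL u (pure_tensor L L v z)"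
    have pc: "?p3 u v z \<in> carrier ?L3" if "u \<in> carrier L" "v \<in> carrier L" "z \<in> carrier L" for u v z
      using that by (intro pure_tensor_closed)
    have pc': "pure_tensor L ?LL x (\<Delta> z) \<in> carrier ?L3" if "x \<in> carrier L" "z \<in> carrier L" for x z
      using that by (intro pure_tensor_closed cl)
    have inner: "sweedler ?L3 (\<lambda>u v. ?p3 u v z) (\<Delta> x) \<in> carrier ?L3" if "x \<in> carrier L" "z \<in> carrier L" for x z
      using that pc by (intro sweedler_closed[OF L3.vspace_axioms cl]) auto
    show "?A \<in> carrier ?L3" by (rule sweedler_closed[OF L3.vspace_axioms cl[OF h]]) (rule inner)
    show "?B \<in> carrier ?L3" by (rule sweedler_closed[OF L3.vspace_axioms cl[OF h]]) (rule pc')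
    fix b assume b: "bilinear_form L ?LL b"
    let ?F = "tensor_form b"
    have F: "linear_form ?L3 ?F" by (rule tensor_form_linear[OF b])
    let ?t = "\<lambda>u v z. b u (pure_tensor L L v z)"
    have bp: "bilinear_form L L (\<lambda>v z. \<phi> (pure_tensor L L v z))" if \<phi>: "linear_form ?LL \<phi>" for \<phi>
    proof -
      have eq: "pure_tensor L L (v \<oplus> v') z = pure_tensor L L v z \<oplus>\<^bsub>?LL\<^esub> pure_tensor L L v' z"
        "pure_tensor L L z (v \<oplus> v') = pure_tensor L L z v \<oplus>\<^bsub>?LL\<^esub> pure_tensor L L z v'"
        "pure_tensor L L (c \<odot> v) z = c \<odot>\<^bsub>?LL\<^esub> pure_tensor L L v z"
        "pure_tensor L L z (c \<odot> v) = c \<odot>\<^bsub>?LL\<^esub> pure_tensor L L z v"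
        if "v \<in> carrier L" "v' \<in> carrier L" "z \<in> carrier L" for v v' z c
        using that by - ((rule tensor_eqI[of _ L L], auto
            simp: linear_formD[OF tensor_form_linear] pure_tensor_closed tensor_form_pure bilinear_formD)[])+
      show ?thesis using linear_formD[OF \<phi>]
        by (intro bilinear_formI) (simp_all add: eq pure_tensor_closed)
    qed
    have t: "trilinear_form L ?t"
      unfolding trilinear_form_def
      by (intro conjI ballI bp bilinear_formD(2)[OF b] bilinear_formD(1)[OF b] pure_tensor_closed)
    have b\<Delta>: "b x (\<Delta> z) = tensor_form (\<lambda>u v. ?t x u v) (\<Delta> z)" if "x \<in> carrier L" "z \<in> carrier L" for x z
    proof -
      have bx: "linear_form ?LL (b x)" using bilinear_formD(2)[OF b] that by blast
      have "\<Delta> z = sweedler ?LL (\<lambda>u v. pure_tensor L L u v) (\<Delta> z)"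
      proof (rule tensor_eqI[of _ L L])
        show "\<Delta> z \<in> carrier ?LL" using that cl by simp
        show "sweedler ?LL (pure_tensor L L) (\<Delta> z) \<in> carrier ?LL" using that
          by (intro sweedler_closed[OF LL.vspace_axioms cl]) (auto intro: pure_tensor_closed)
        fix b assume b: "bilinear_form L L b"
        have "tensor_form b (sweedler ?LL (pure_tensor L L) (\<Delta> z)) =
            tensor_form (\<lambda>u v. tensor_form b (pure_tensor L L u v)) (\<Delta> z)"
          using that by (intro sweedler_form[OF LL.vspace_axioms cl tensor_form_linear[OF b]]) (auto intro: pure_tensor_closed)
        also have "\<dots> = tensor_form b (\<Delta> z)"
          using that by (intro tensor_form_cong[OF cl]) (auto simp: tensor_form_pure[OF b])
        finally show "tensor_form b (\<Delta> z) = tensor_form b (sweedler ?LL (pure_tensor L L) (\<Delta> z))" ..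
      qed
      then have "b x (\<Delta> z) = b x (sweedler ?LL (\<lambda>u v. pure_tensor L L u v) (\<Delta> z))" by simp
      also have "\<dots> = tensor_form (\<lambda>u v. ?t x u v) (\<Delta> z)"
        using that by (intro sweedler_form[OF LL.vspace_axioms cl bx]) (auto intro: pure_tensor_closed)
      finally show ?thesis .
    qed
    have Fp: "?F (?p3 u v z) = ?t u v z" if "u \<in> carrier L" "v \<in> carrier L" "z \<in> carrier L" for u v z
      using that by (simp add: tensor_form_pure[OF b] pure_tensor_closed)
    have Finner: "?F (sweedler ?L3 (\<lambda>u v. ?p3 u v z) (\<Delta> x)) = tensor_form (\<lambda>u v. ?t u v z) (\<Delta> x)"
      if "x \<in> carrier L" "z \<in> carrier L" for x z
    proof -
      have "?F (sweedler ?L3 (\<lambda>u v. ?p3 u v z) (\<Delta> x)) = tensor_form (\<lambda>u v. ?F (?p3 u v z)) (\<Delta> x)"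
        using that pc by (intro sweedler_form[OF L3.vspace_axioms cl F]) auto
      also have "\<dots> = tensor_form (\<lambda>u v. ?t u v z) (\<Delta> x)"
        using that Fp by (intro tensor_form_cong[OF cl]) auto
      finally show ?thesis .
    qed
    have "?F ?A = tensor_form (\<lambda>x z. ?F (sweedler ?L3 (\<lambda>u v. ?p3 u v z) (\<Delta> x))) (\<Delta> h)"
      using h inner by (intro sweedler_form[OF L3.vspace_axioms cl F]) auto
    also have "\<dots> = tensor_form (\<lambda>x z. tensor_form (\<lambda>u v. ?t u v z) (\<Delta> x)) (\<Delta> h)"
      using h Finner by (intro tensor_form_cong[OF cl]) auto
    also have "\<dots> = tensor_form (\<lambda>x z. tensor_form (\<lambda>u v. ?t x u v) (\<Delta> z)) (\<Delta> h)"
      by (rule coassoc[OF t h])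
    also have "\<dots> = tensor_form (\<lambda>x z. ?F (pure_tensor L ?LL x (\<Delta> z))) (\<Delta> h)"
      using h b\<Delta> cl by (intro tensor_form_cong[OF cl]) (auto simp: tensor_form_pure[OF b])
    also have "\<dots> = ?F ?B"
      using h pc' by (intro sweedler_form[symmetric, OF L3.vspace_axioms cl F]) auto
    finally show "?F ?A = ?F ?B" .
  qed
  have elem: "sweedler L \<beta> (\<Delta> h) = g"
    if "h \<in> carrier L" "g \<in> carrier L" "\<And>x y. x \<in> carrier L \<Longrightarrow> y \<in> carrier L \<Longrightarrow> \<beta> x y \<in> carrier L"
      "\<And>\<phi>. linear_form L \<phi> \<Longrightarrow> tensor_form (\<lambda>x y. \<phi> (\<beta> x y)) (\<Delta> h) = \<phi> g" for \<beta> h g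
  proof (rule eq_if_forms_eq[OF fd])
    show "sweedler L \<beta> (\<Delta> h) \<in> carrier L" using that by (intro sweedler_closed[OF vspace_axioms cl]) auto
    fix \<phi> assume \<phi>: "linear_form L \<phi>"
    show "\<phi> (sweedler L \<beta> (\<Delta> h)) = \<phi> g"
      using sweedler_form[OF vspace_axioms cl \<phi>, of h \<beta>] that \<phi> by simp
  qed fact
  show ?thesis
  proof (intro hopf_algebra.intro hopf_algebra_axioms.intro)
    show "module scalars L" "Ring.ring L" by unfold_locales
  next
    fix h assume h: "h \<in> carrier L"
    show "sweedler L (\<lambda>x y. \<epsilon> x \<odot> y) (\<Delta> h) = h"
    proof (rule elem[OF h h])
      fix \<phi> assume \<phi>: "linear_form L \<phi>"
      have "tensor_form (\<lambda>x y. \<phi> (\<epsilon> x \<odot> y)) (\<Delta> h) = tensor_form (\<lambda>x y. \<epsilon> x * \<phi> y) (\<Delta> h)"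
        using h by (intro tensor_form_cong[OF cl]) (auto simp: linear_formD[OF \<phi>])
      then show "tensor_form (\<lambda>x y. \<phi> (\<epsilon> x \<odot> y)) (\<Delta> h) = \<phi> h" using counit(1)[OF \<phi> h] by simp
    qed simp
    show "sweedler L (\<lambda>x y. \<epsilon> y \<odot> x) (\<Delta> h) = h"
    proof (rule elem[OF h h])
      fix \<phi> assume \<phi>: "linear_form L \<phi>"
      have "tensor_form (\<lambda>x y. \<phi> (\<epsilon> y \<odot> x)) (\<Delta> h) = tensor_form (\<lambda>x y. \<epsilon> y * \<phi> x) (\<Delta> h)"
        using h by (intro tensor_form_cong[OF cl]) (auto simp: linear_formD[OF \<phi>])
      then show "tensor_form (\<lambda>x y. \<phi> (\<epsilon> y \<odot> x)) (\<Delta> h) = \<phi> h" using counit(2)[OF \<phi> h] by simp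
    qed simp
    show "sweedler L (\<lambda>x y. \<S> x \<otimes> y) (\<Delta> h) = \<epsilon> h \<odot> \<one>"
      using h Scl by (intro elem) (auto simp: antipode linear_formD)
    show "sweedler L (\<lambda>x y. x \<otimes> \<S> y) (\<Delta> h) = \<epsilon> h \<odot> \<one>"
      using h Scl by (intro elem) (auto simp: antipode linear_formD)
  qed (use smult_mult hom lin e S assoc linear_formD(2)[OF eps(1)] in auto)
qed

section \<open>Sweedler calculus in a finite dimensional Hopf algebra\<close>

lemma trilinear_formI:
  assumes "\<And>x x' y z. x \<in> carrier V \<Longrightarrow> x' \<in> carrier V \<Longrightarrow> y \<in> carrier V \<Longrightarrow> z \<in> carrier V \<Longrightarrow> t (x \<oplus>\<^bsub>V\<^esub> x') y z = t x y z + t x' y z"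
    "\<And>x y y' z. x \<in> carrier V \<Longrightarrow> y \<in> carrier V \<Longrightarrow> y' \<in> carrier V \<Longrightarrow> z \<in> carrier V \<Longrightarrow> t x (y \<oplus>\<^bsub>V\<^esub> y') z = t x y z + t x y' z"
    "\<And>x y z z'. x \<in> carrier V \<Longrightarrow> y \<in> carrier V \<Longrightarrow> z \<in> carrier V \<Longrightarrow> z' \<in> carrier V \<Longrightarrow> t x y (z \<oplus>\<^bsub>V\<^esub> z') = t x y z + t x y z'"
    "\<And>c x y z. x \<in> carrier V \<Longrightarrow> y \<in> carrier V \<Longrightarrow> z \<in> carrier V \<Longrightarrow> t (c \<odot>\<^bsub>V\<^esub> x) y z = c * t x y z"
    "\<And>c x y z. x \<in> carrier V \<Longrightarrow> y \<in> carrier V \<Longrightarrow> z \<in> carrier V \<Longrightarrow> t x (c \<odot>\<^bsub>V\<^esub> y) z = c * t x y z"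
    "\<And>c x y z. x \<in> carrier V \<Longrightarrow> y \<in> carrier V \<Longrightarrow> z \<in> carrier V \<Longrightarrow> t x y (c \<odot>\<^bsub>V\<^esub> z) = c * t x y z"
  shows "trilinear_form V t"
  unfolding trilinear_form_def bilinear_form_def linear_form_def using assms by auto

locale fd_hopf = hopf_algebra H for H :: "('k::field, 'a) hopf" (structure) +
  fixes B :: "'a set" and d :: "'a \<Rightarrow> 'a \<Rightarrow> 'k"
  assumes basis: "dual_basis H B d"
begin

lemma fd: "finite_dimensional H"
  unfolding finite_dimensional_def
proof (intro exI[of _ B] conjI ballI)
  show "finite B" "B \<subseteq> carrier H" using basis unfolding dual_basis_def by blast+
  fix x assume "x \<in> carrier H"
  then have "x = (\<Oplus>b\<in>B. d b x \<odot> b)" using basis unfolding dual_basis_def by blast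
  then show "\<exists>c. x = (\<Oplus>b\<in>B. c b \<odot> b)" by (rule exI[of _ "\<lambda>b. d b x"])
qed

lemma basis_props: "finite B" "b \<in> B \<Longrightarrow> b \<in> carrier H" "b \<in> B \<Longrightarrow> linear_form H (d b)"
  using basis unfolding dual_basis_def by blast+

lemma form_expand:
  assumes "linear_form H \<phi>" "x \<in> carrier H"
  shows "\<phi> x = (\<Sum>b\<in>B. d b x * \<phi> b)"
proof -
  have "x = (\<Oplus>b\<in>B. d b x \<odot> b)" using basis assms(2) unfolding dual_basis_def by blast
  then have "\<phi> x = \<phi> (\<Oplus>b\<in>B. d b x \<odot> b)" by simp
  also have "\<dots> = (\<Sum>b\<in>B. \<phi> (d b x \<odot> b))"
    using basis_props(2) by (intro linear_form_finsum[OF assms(1)]) auto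
  also have "\<dots> = (\<Sum>b\<in>B. d b x * \<phi> b)"
    using basis_props(2) linear_formD(2)[OF assms(1)] by (intro sum.cong) auto
  finally show ?thesis .
qed

text \<open>Sweedler's \<open>b(h\<^sub>(\<^sub>1\<^sub>), h\<^sub>(\<^sub>2\<^sub>))\<close> in coordinates. For bilinear \<open>b\<close> it is \<open>tensor_form b (\<Delta> h)\<close>. Written as a
  finite sum it is, for every \<open>b\<close>, linear in \<open>b\<close> and in \<open>h\<close>, commutes with other such sums, and depends only on the
  values of \<open>b\<close> on the carrier.\<close>

definition sw :: "'a \<Rightarrow> ('a \<Rightarrow> 'a \<Rightarrow> 'k) \<Rightarrow> 'k" where
  "sw h b = (\<Sum>i\<in>B. \<Sum>j\<in>B. tensor_form (\<lambda>x y. d i x * d j y) (\<Delta> h) * b i j)"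

lemma coord_form: "i \<in> B \<Longrightarrow> j \<in> B \<Longrightarrow> bilinear_form H H (\<lambda>x y. d i x * d j y)"
  by (intro bilinear_formI)
    (simp_all add: linear_formD[OF basis_props(3)] distrib_left distrib_right mult.assoc mult.left_commute)

lemma sw_eq:
  assumes b: "bilinear_form H H b" and h: "h \<in> carrier H"
  shows "sw h b = tensor_form b (\<Delta> h)"
proof -
  have "tensor_form b (\<Delta> h) = tensor_form (\<lambda>x y. \<Sum>i\<in>B. \<Sum>j\<in>B. d i x * d j y * b i j) (\<Delta> h)"
  proof (rule tensor_form_cong[OF comult_closed[OF h]])
    fix x y assume x: "x \<in> carrier H" and y: "y \<in> carrier H"
    have "b x y = (\<Sum>i\<in>B. d i x * b i y)"
      using form_expand[OF bilinear_formD(1)[OF b y] x] .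
    also have "\<dots> = (\<Sum>i\<in>B. \<Sum>j\<in>B. d i x * (d j y * b i j))"
      using form_expand[OF bilinear_formD(2)[OF b] y] basis_props(2)
      by (intro sum.cong refl) (simp only: sum_distrib_left[symmetric])
    finally show "b x y = (\<Sum>i\<in>B. \<Sum>j\<in>B. d i x * d j y * b i j)" by (simp only: mult.assoc)
  qed
  then show ?thesis by (simp add: sw_def tensor_form_fun_simps)
qed

lemma sw_cong [cong]:
  assumes "h = h'" "\<And>x y. x \<in> carrier H \<Longrightarrow> y \<in> carrier H \<Longrightarrow> b x y = b' x y"
  shows "sw h b = sw h' b'"
  unfolding sw_def using assms basis_props(2) by (intro sum.cong arg_cong2[of _ _ _ _ "(*)"] refl) auto

lemma sw_fun [simp]:
  "sw h (\<lambda>x y. b x y + b' x y) = sw h b + sw h b'"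
  "sw h (\<lambda>x y. b x y - b' x y) = sw h b - sw h b'"
  "sw h (\<lambda>x y. c * b x y) = c * sw h b"
  "sw h (\<lambda>x y. b x y * c) = sw h b * c"
  "sw h (\<lambda>x y. 0) = 0"
  unfolding sw_def
  by (simp_all only: distrib_left right_diff_distrib sum.distrib sum_subtractf sum_distrib_left sum_distrib_right
     mult.left_commute mult.assoc mult_zero_right sum.neutral_const)

lemma sw_sum: "sw h (\<lambda>x y. \<Sum>i\<in>I. b i x y) = (\<Sum>i\<in>I. sw h (b i))"
  by (induction I rule: infinite_finite_induct) auto

lemma sw_swap: "sw h (\<lambda>x y. sw g (\<lambda>u v. t x y u v)) = sw g (\<lambda>u v. sw h (\<lambda>x y. t x y u v))"
proof -
  have "sw h (\<lambda>x y. sw g (\<lambda>u v. t x y u v)) =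
     (\<Sum>i\<in>B. \<Sum>j\<in>B. tensor_form (\<lambda>x y. d i x * d j y) (\<Delta> g) * sw h (\<lambda>x y. t x y i j))"
    by (subst (2) sw_def) (simp only: sw_sum sw_fun)
  then show ?thesis by (simp only: sw_def[of g])
qed

lemma sw_elem [simp]:
  "h \<in> carrier H \<Longrightarrow> g \<in> carrier H \<Longrightarrow> sw (h \<oplus> g) b = sw h b + sw g b"
  "h \<in> carrier H \<Longrightarrow> sw (c \<odot> h) b = c * sw h b"
proof -
  note F = linear_formD[OF form_comult(1)[OF coord_form]]
  show "sw (h \<oplus> g) b = sw h b + sw g b" if "h \<in> carrier H" "g \<in> carrier H"
    using that unfolding sw_def by (simp add: F distrib_right sum.distrib)
  show "sw (c \<odot> h) b = c * sw h b" if "h \<in> carrier H"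
    using that unfolding sw_def by (simp add: F) (simp only: sum_distrib_left mult.assoc)
qed

lemmas lin = l_distr r_distr smult_mult antipode_lin linear_formD[OF counit_form] distrib_left distrib_right mult.assoc mult.left_commute

lemma coassoc_sw:
  assumes "trilinear_form H t" "h \<in> carrier H"
  shows "sw h (\<lambda>x z. sw x (\<lambda>u v. t u v z)) = sw h (\<lambda>x z. sw z (\<lambda>u v. t x u v))"
proof -
  note D = trilinear_formD[OF assms(1)]
  have "bilinear_form H H (\<lambda>x z. sw x (\<lambda>u v. t u v z))"
    by (intro bilinear_formI) (simp_all add: linear_formD[OF D(4)])
  then have "sw h (\<lambda>x z. sw x (\<lambda>u v. t u v z)) = tensor_form (\<lambda>x z. sw x (\<lambda>u v. t u v z)) (\<Delta> h)"
    using assms(2) by (rule sw_eq)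
  also have "\<dots> = tensor_form (\<lambda>x z. tensor_form (\<lambda>u v. t u v z) (\<Delta> x)) (\<Delta> h)"
    using assms(2) sw_eq[OF D(5)] by (intro tensor_form_cong[OF comult_closed]) auto
  also have "\<dots> = tensor_form (\<lambda>x z. tensor_form (\<lambda>u v. t x u v) (\<Delta> z)) (\<Delta> h)"
    by (rule form_coassoc[OF assms])
  also have "\<dots> = tensor_form (\<lambda>x z. sw z (\<lambda>u v. t x u v)) (\<Delta> h)"
    using assms(2) sw_eq[OF D(1)] by (intro tensor_form_cong[OF comult_closed]) auto
  also have "\<dots> = sw h (\<lambda>x z. sw z (\<lambda>u v. t x u v))"
  proof (rule sw_eq[symmetric, OF _ assms(2)])
    show "bilinear_form H H (\<lambda>x z. sw z (\<lambda>u v. t x u v))"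
      by (intro bilinear_formI) (simp_all add: linear_formD[OF D(2)])
  qed
  finally show ?thesis .
qed

lemma sw_mult:
  assumes "bilinear_form H H b" "x \<in> carrier H" "y \<in> carrier H"
  shows "sw (x \<otimes> y) b = sw x (\<lambda>u v. sw y (\<lambda>u' v'. b (u \<otimes> u') (v \<otimes> v')))"
proof -
  note b = bilinear_formD[OF assms(1)]
  have 1: "bilinear_form H H (\<lambda>u' v'. b (u \<otimes> u') (v \<otimes> v'))" if "u \<in> carrier H" "v \<in> carrier H" for u v
    using that by (intro bilinear_formI) (simp_all add: lin b)
  have 2: "bilinear_form H H (\<lambda>u v. sw y (\<lambda>u' v'. b (u \<otimes> u') (v \<otimes> v')))"
    by (intro bilinear_formI) (simp_all add: lin b)
  have "sw (x \<otimes> y) b = tensor_form b (\<Delta> (x \<otimes> y))" using assms by (intro sw_eq) auto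
  also have "\<dots> = tensor_form (\<lambda>u v. tensor_form (\<lambda>u' v'. b (u \<otimes> u') (v \<otimes> v')) (\<Delta> y)) (\<Delta> x)"
    using assms by (intro form_comult)
  also have "\<dots> = tensor_form (\<lambda>u v. sw y (\<lambda>u' v'. b (u \<otimes> u') (v \<otimes> v'))) (\<Delta> x)"
    using assms sw_eq[OF 1] by (intro tensor_form_cong[OF comult_closed]) auto
  also have "\<dots> = sw x (\<lambda>u v. sw y (\<lambda>u' v'. b (u \<otimes> u') (v \<otimes> v')))"
    using sw_eq[OF 2] assms by simp
  finally show ?thesis .
qed

lemma sw_one: "bilinear_form H H b \<Longrightarrow> sw \<one> b = b \<one> \<one>"
  by (simp add: sw_eq form_comult)

lemma counit_sw:
  assumes \<phi>: "linear_form H \<phi>" and h: "h \<in> carrier H"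
  shows "sw h (\<lambda>x y. \<epsilon> x * \<phi> y) = \<phi> h" "sw h (\<lambda>x y. \<epsilon> y * \<phi> x) = \<phi> h"
    "sw h (\<lambda>x y. \<phi> y * \<epsilon> x) = \<phi> h" "sw h (\<lambda>x y. \<phi> x * \<epsilon> y) = \<phi> h"
proof -
  have "bilinear_form H H (\<lambda>x y. \<epsilon> x * \<phi> y)" "bilinear_form H H (\<lambda>x y. \<epsilon> y * \<phi> x)"
    by (intro bilinear_formI; simp add: lin linear_formD[OF \<phi>])+
  then show "sw h (\<lambda>x y. \<epsilon> x * \<phi> y) = \<phi> h" "sw h (\<lambda>x y. \<epsilon> y * \<phi> x) = \<phi> h"
    using form_counit_antipode[OF assms] h by (simp_all add: sw_eq)
  then show "sw h (\<lambda>x y. \<phi> y * \<epsilon> x) = \<phi> h" "sw h (\<lambda>x y. \<phi> x * \<epsilon> y) = \<phi> h"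
    by (simp_all only: mult.commute)
qed

lemma antipode_sw:
  assumes \<phi>: "linear_form H \<phi>" and h: "h \<in> carrier H"
  shows "sw h (\<lambda>x y. \<phi> (\<S> x \<otimes> y)) = \<epsilon> h * \<phi> \<one>" "sw h (\<lambda>x y. \<phi> (x \<otimes> \<S> y)) = \<epsilon> h * \<phi> \<one>"
proof -
  have "bilinear_form H H (\<lambda>x y. \<phi> (\<S> x \<otimes> y))" "bilinear_form H H (\<lambda>x y. \<phi> (x \<otimes> \<S> y))"
    by (intro bilinear_formI; simp add: lin linear_formD[OF \<phi>])+
  then show "sw h (\<lambda>x y. \<phi> (\<S> x \<otimes> y)) = \<epsilon> h * \<phi> \<one>" "sw h (\<lambda>x y. \<phi> (x \<otimes> \<S> y)) = \<epsilon> h * \<phi> \<one>"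
    using form_counit_antipode[OF assms] h by (simp_all add: sw_eq)
qed

subsection \<open>The antipode\<close>

lemma linI:
  assumes "\<And>x y. x \<in> carrier H \<Longrightarrow> y \<in> carrier H \<Longrightarrow> \<phi> (x \<oplus> y) = \<phi> x + \<phi> y"
    "\<And>c x. x \<in> carrier H \<Longrightarrow> \<phi> (c \<odot> x) = c * \<phi> x"
  shows "linear_form H \<phi>"
  using assms by (simp add: linear_form_def)

text \<open>Both sides are convolution inverses of the multiplication: the sum \<open>?P\<close> of
  \<open>S(x\<^sub>1 y\<^sub>1) (x\<^sub>2 y\<^sub>2) (S(y\<^sub>3) S(x\<^sub>3))\<close> collapses to \<open>S(x y)\<close> from the right and to \<open>S(y) S(x)\<close> from the left.\<close>

lemma antipode_mult:
  assumes x: "x \<in> carrier H" and y: "y \<in> carrier H"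
  shows "\<S> (x \<otimes> y) = \<S> y \<otimes> \<S> x"
proof (rule eq_if_forms_eq[OF fd])
  fix \<phi> assume \<phi>': "linear_form H \<phi>"
  note \<phi> = linear_formD[OF \<phi>']
  let ?T = "\<lambda>x1 y1 x2 y2 x3 y3. \<phi> (\<S> (x1 \<otimes> y1) \<otimes> ((x2 \<otimes> y2) \<otimes> (\<S> y3 \<otimes> \<S> x3)))"
  let ?P = "sw x (\<lambda>x1 x'. sw y (\<lambda>y1 y'. sw x' (\<lambda>x2 x3. sw y' (\<lambda>y2 y3. ?T x1 y1 x2 y2 x3 y3))))"
  have inner: "sw x' (\<lambda>x2 x3. sw y' (\<lambda>y2 y3. \<phi> (z \<otimes> ((x2 \<otimes> y2) \<otimes> (\<S> y3 \<otimes> \<S> x3))))) = \<epsilon> x' * (\<epsilon> y' * \<phi> z)"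
    if "x' \<in> carrier H" "y' \<in> carrier H" "z \<in> carrier H" for x' y' z
  proof -
    have "sw y' (\<lambda>y2 y3. \<phi> (z \<otimes> ((x2 \<otimes> y2) \<otimes> (\<S> y3 \<otimes> \<S> x3)))) = \<epsilon> y' * \<phi> (z \<otimes> (x2 \<otimes> \<S> x3))"
      if "x2 \<in> carrier H" "x3 \<in> carrier H" for x2 x3
    proof -
      have "linear_form H (\<lambda>w. \<phi> (z \<otimes> (x2 \<otimes> (w \<otimes> \<S> x3))))"
        using that \<open>z \<in> _\<close> by (intro linI) (simp_all add: lin \<phi>)
      from antipode_sw(2)[OF this \<open>y' \<in> _\<close>] show ?thesis using that \<open>z \<in> _\<close> by (simp add: m_assoc)
    qed
    moreover have "linear_form H (\<lambda>w. \<phi> (z \<otimes> w))"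
      using that by (intro linI) (simp_all add: lin \<phi>)
    ultimately show ?thesis using antipode_sw(2)[of "\<lambda>w. \<phi> (z \<otimes> w)" x'] that by (simp add: mult.left_commute)
  qed
  have "?P = sw x (\<lambda>x1 x'. \<epsilon> x' * sw y (\<lambda>y1 y'. \<epsilon> y' * \<phi> (\<S> (x1 \<otimes> y1))))"
    using x y by (simp add: inner)
  also have "\<dots> = sw x (\<lambda>x1 x'. \<epsilon> x' * \<phi> (\<S> (x1 \<otimes> y)))"
  proof (intro sw_cong refl)
    fix x1 x' assume *: "x1 \<in> carrier H" "x' \<in> carrier H"
    have "linear_form H (\<lambda>y1. \<phi> (\<S> (x1 \<otimes> y1)))" using * by (intro linI) (simp_all add: lin \<phi>)
    from counit_sw(2)[OF this y] show "\<epsilon> x' * sw y (\<lambda>y1 y'. \<epsilon> y' * \<phi> (\<S> (x1 \<otimes> y1))) = \<epsilon> x' * \<phi> (\<S> (x1 \<otimes> y))"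
      by simp
  qed
  also have "\<dots> = \<phi> (\<S> (x \<otimes> y))"
    using x y by (intro counit_sw(2) linI) (simp_all add: lin \<phi>)
  finally have 1: "?P = \<phi> (\<S> (x \<otimes> y))" .
  have "?P = sw x (\<lambda>x1 x'. sw x' (\<lambda>x2 x3. sw y (\<lambda>y1 y'. sw y' (\<lambda>y2 y3. ?T x1 y1 x2 y2 x3 y3))))"
    by (rule sw_cong[OF refl], rule sw_swap)
  also have "\<dots> = sw x (\<lambda>x1 x'. sw x' (\<lambda>x2 x3. sw y (\<lambda>y' y3. sw y' (\<lambda>y1 y2. ?T x1 y1 x2 y2 x3 y3))))"
    by (rule sw_cong[OF refl], rule sw_cong[OF refl], rule coassoc_sw[symmetric, OF _ y])
       (intro trilinear_formI; simp add: lin \<phi>)+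
  also have "\<dots> = sw x (\<lambda>x' x3. sw x' (\<lambda>x1 x2. sw y (\<lambda>y' y3. sw y' (\<lambda>y1 y2. ?T x1 y1 x2 y2 x3 y3))))"
    using x y by (intro coassoc_sw[symmetric] trilinear_formI) (simp_all add: lin \<phi>)
  also have "\<dots> = sw x (\<lambda>x' x3. sw y (\<lambda>y' y3. sw x' (\<lambda>x1 x2. sw y' (\<lambda>y1 y2. ?T x1 y1 x2 y2 x3 y3))))"
    by (rule sw_cong[OF refl], rule sw_swap)
  also have "\<dots> = sw x (\<lambda>x' x3. sw y (\<lambda>y' y3. \<epsilon> x' * (\<epsilon> y' * \<phi> (\<S> y3 \<otimes> \<S> x3))))"
  proof (intro sw_cong refl)
    fix x' x3 y' y3 assume *: "x' \<in> carrier H" "x3 \<in> carrier H" "y' \<in> carrier H" "y3 \<in> carrier H"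
    have l: "linear_form H (\<lambda>w. \<phi> (w \<otimes> (\<S> y3 \<otimes> \<S> x3)))" using * by (intro linI) (simp_all add: lin \<phi>)
    have "bilinear_form H H (\<lambda>u v. \<phi> ((\<S> u \<otimes> v) \<otimes> (\<S> y3 \<otimes> \<S> x3)))"
      using * by (intro bilinear_formI) (simp_all add: lin \<phi>)
    from sw_mult[OF this *(1,3)] antipode_sw(1)[OF l, of "x' \<otimes> y'"]
    show "sw x' (\<lambda>x1 x2. sw y' (\<lambda>y1 y2. ?T x1 y1 x2 y2 x3 y3)) = \<epsilon> x' * (\<epsilon> y' * \<phi> (\<S> y3 \<otimes> \<S> x3))"
      using * by (simp add: m_assoc)
  qed
  also have "\<dots> = sw x (\<lambda>x' x3. \<epsilon> x' * \<phi> (\<S> y \<otimes> \<S> x3))"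
  proof (intro sw_cong refl)
    fix x' x3 assume *: "x' \<in> carrier H" "x3 \<in> carrier H"
    have "linear_form H (\<lambda>y3. \<phi> (\<S> y3 \<otimes> \<S> x3))" using * by (intro linI) (simp_all add: lin \<phi>)
    from counit_sw(1)[OF this y] show "sw y (\<lambda>y' y3. \<epsilon> x' * (\<epsilon> y' * \<phi> (\<S> y3 \<otimes> \<S> x3))) = \<epsilon> x' * \<phi> (\<S> y \<otimes> \<S> x3)"
      by simp
  qed
  also have "\<dots> = \<phi> (\<S> y \<otimes> \<S> x)"
    using x y by (intro counit_sw(1) linI) (simp_all add: lin \<phi>)
  finally show "\<phi> (\<S> (x \<otimes> y)) = \<phi> (\<S> y \<otimes> \<S> x)" using 1 by simp
qed (use assms in auto)

text \<open>Dual to the preceding lemma: \<open>\<Delta>(S(h))\<close> and \<open>S(h\<^sub>2) \<otimes> S(h\<^sub>1)\<close> are both convolution inverses of \<open>\<Delta>\<close>.\<close>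

lemma sw_antipode:
  assumes b': "bilinear_form H H b" and h: "h \<in> carrier H"
  shows "sw (\<S> h) b = sw h (\<lambda>x y. b (\<S> y) (\<S> x))"
proof -
  note b = bilinear_formD(3-)[OF b']
  let ?T = "\<lambda>u v p q h3 h4. b ((u \<otimes> p) \<otimes> \<S> h4) ((v \<otimes> q) \<otimes> \<S> h3)"
  let ?K = "\<lambda>h1 h2 h''. sw h'' (\<lambda>h3 h4. sw (\<S> h1) (\<lambda>u v. sw h2 (\<lambda>p q. ?T u v p q h3 h4)))"
  let ?P = "sw h (\<lambda>h1 h'. sw h' (\<lambda>h2 h''. ?K h1 h2 h''))"
  have inner: "sw h' (\<lambda>h2 h''. sw h'' (\<lambda>h3 h4. sw h2 (\<lambda>p q. \<beta> (p \<otimes> \<S> h4) (q \<otimes> \<S> h3)))) = \<epsilon> h' * \<beta> \<one> \<one>"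
    if \<beta>': "bilinear_form H H \<beta>" and h': "h' \<in> carrier H" for \<beta> h'
  proof -
    note \<beta> = bilinear_formD(3-)[OF \<beta>']
    have "sw h' (\<lambda>h2 h''. sw h'' (\<lambda>h3 h4. sw h2 (\<lambda>p q. \<beta> (p \<otimes> \<S> h4) (q \<otimes> \<S> h3)))) =
       sw h' (\<lambda>h2 h''. sw h2 (\<lambda>p q. sw h'' (\<lambda>h3 h4. \<beta> (p \<otimes> \<S> h4) (q \<otimes> \<S> h3))))"
      by (rule sw_cong[OF refl], rule sw_swap)
    also have "\<dots> = sw h' (\<lambda>p r. sw r (\<lambda>q h''. sw h'' (\<lambda>h3 h4. \<beta> (p \<otimes> \<S> h4) (q \<otimes> \<S> h3))))"
      using h' by (intro coassoc_sw trilinear_formI) (simp_all add: lin \<beta>)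
    also have "\<dots> = sw h' (\<lambda>p r. sw r (\<lambda>r' h4. sw r' (\<lambda>q h3. \<beta> (p \<otimes> \<S> h4) (q \<otimes> \<S> h3))))"
      by (rule sw_cong[OF refl], rule coassoc_sw[symmetric], intro trilinear_formI) (simp_all add: lin \<beta>)
    also have "\<dots> = sw h' (\<lambda>p r. \<beta> (p \<otimes> \<S> r) \<one>)"
    proof (intro sw_cong refl)
      fix p r assume *: "p \<in> carrier H" "r \<in> carrier H"
      have "sw r (\<lambda>r' h4. sw r' (\<lambda>q h3. \<beta> (p \<otimes> \<S> h4) (q \<otimes> \<S> h3))) = sw r (\<lambda>r' h4. \<epsilon> r' * \<beta> (p \<otimes> \<S> h4) \<one>)"
        using * by (intro sw_cong refl antipode_sw(2) linI) (simp_all add: lin \<beta>)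
      also have "\<dots> = \<beta> (p \<otimes> \<S> r) \<one>"
        using * by (intro counit_sw(1) linI) (simp_all add: lin \<beta>)
      finally show "sw r (\<lambda>r' h4. sw r' (\<lambda>q h3. \<beta> (p \<otimes> \<S> h4) (q \<otimes> \<S> h3))) = \<beta> (p \<otimes> \<S> r) \<one>" .
    qed
    also have "\<dots> = \<epsilon> h' * \<beta> \<one> \<one>"
      using h' by (intro antipode_sw(2) linI) (simp_all add: lin \<beta>)
    finally show ?thesis .
  qed
  have "?P = sw h (\<lambda>h1 h'. sw (\<S> h1) (\<lambda>u v. sw h' (\<lambda>h2 h''. sw h'' (\<lambda>h3 h4. sw h2 (\<lambda>p q. ?T u v p q h3 h4)))))"
  proof (rule sw_cong[OF refl])
    fix h1 h' assume "h1 \<in> carrier H" "h' \<in> carrier H"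
    have "sw h' (\<lambda>h2 h''. ?K h1 h2 h'') =
        sw h' (\<lambda>h2 h''. sw (\<S> h1) (\<lambda>u v. sw h'' (\<lambda>h3 h4. sw h2 (\<lambda>p q. ?T u v p q h3 h4))))"
      by (rule sw_cong[OF refl], rule sw_swap)
    also have "\<dots> = sw (\<S> h1) (\<lambda>u v. sw h' (\<lambda>h2 h''. sw h'' (\<lambda>h3 h4. sw h2 (\<lambda>p q. ?T u v p q h3 h4))))"
      by (rule sw_swap)
    finally show "sw h' (\<lambda>h2 h''. ?K h1 h2 h'') = \<dots>" .
  qed
  also have "\<dots> = sw h (\<lambda>h1 h'. sw (\<S> h1) (\<lambda>u v. \<epsilon> h' * b u v))"
  proof (intro sw_cong refl)
    fix h1 h' u v assume *: "h1 \<in> carrier H" "h' \<in> carrier H" "u \<in> carrier H" "v \<in> carrier H"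
    have "bilinear_form H H (\<lambda>p q. b (u \<otimes> p) (v \<otimes> q))"
      using * by (intro bilinear_formI) (simp_all add: lin b)
    from inner[OF this *(2)]
    show "sw h' (\<lambda>h2 h''. sw h'' (\<lambda>h3 h4. sw h2 (\<lambda>p q. ?T u v p q h3 h4))) = \<epsilon> h' * b u v"
      using * by (simp add: m_assoc)
  qed
  also have "\<dots> = sw (\<S> h) b"
  proof -
    have "linear_form H (\<lambda>h. sw (\<S> h) b)" by (intro linI) (simp_all add: lin)
    from counit_sw(2)[OF this h] show ?thesis by simp
  qed
  finally have 1: "?P = sw (\<S> h) b" .
  have "?P = sw h (\<lambda>k h''. sw k (\<lambda>h1 h2. ?K h1 h2 h''))"
    using h by (intro coassoc_sw[symmetric] trilinear_formI) (simp_all add: lin b)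
  also have "\<dots> = sw h (\<lambda>k h''. \<epsilon> k * sw h'' (\<lambda>h3 h4. b (\<S> h4) (\<S> h3)))"
  proof (intro sw_cong refl)
    fix k h'' assume *: "k \<in> carrier H" "h'' \<in> carrier H"
    let ?\<Phi> = "\<lambda>z. sw h'' (\<lambda>h3 h4. sw z (\<lambda>w z. b (w \<otimes> \<S> h4) (z \<otimes> \<S> h3)))"
    have \<Phi>: "linear_form H ?\<Phi>" by (intro linI) simp_all
    have bl: "bilinear_form H H (\<lambda>w z. b (w \<otimes> \<S> h4) (z \<otimes> \<S> h3))" if "h3 \<in> carrier H" "h4 \<in> carrier H" for h3 h4
      using that by (intro bilinear_formI) (simp_all add: lin b)
    have "sw k (\<lambda>h1 h2. ?K h1 h2 h'') = sw k (\<lambda>h1 h2. ?\<Phi> (\<S> h1 \<otimes> h2))"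
      by (rule sw_cong[OF refl]) (simp add: sw_mult[OF bl])
    also have "\<dots> = \<epsilon> k * ?\<Phi> \<one>" by (rule antipode_sw(1)[OF \<Phi> *(1)])
    also have "?\<Phi> \<one> = sw h'' (\<lambda>h3 h4. b (\<S> h4) (\<S> h3))" by (simp add: sw_one[OF bl])
    finally show "sw k (\<lambda>h1 h2. ?K h1 h2 h'') = \<epsilon> k * sw h'' (\<lambda>h3 h4. b (\<S> h4) (\<S> h3))" .
  qed
  also have "\<dots> = sw h (\<lambda>h3 h4. b (\<S> h4) (\<S> h3))"
    using h by (intro counit_sw(1) linI) (simp_all add: lin)
  finally show ?thesis using 1 by simp
qed

lemma antipode_one [simp]: "\<S> \<one> = \<one>"
proof (rule eq_if_forms_eq[OF fd])
  fix \<phi> assume \<phi>': "linear_form H \<phi>"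
  note \<phi> = linear_formD[OF \<phi>']
  have "bilinear_form H H (\<lambda>x y. \<phi> (\<S> x \<otimes> y))" by (intro bilinear_formI) (simp_all add: lin \<phi>)
  from sw_one[OF this] antipode_sw(1)[OF \<phi>', of \<one>] show "\<phi> (\<S> \<one>) = \<phi> \<one>" by simp
qed auto

lemma counit_antipode [simp]:
  assumes h: "h \<in> carrier H" shows "\<epsilon> (\<S> h) = \<epsilon> h"
proof -
  have "linear_form H (\<lambda>x. \<epsilon> (\<S> x))" by (intro linI) (simp_all add: lin)
  from counit_sw(4)[OF this h] antipode_sw(1)[OF counit_form h] h show ?thesis by simp
qed

end

section \<open>Integrals\<close>

context fd_hopf
begin

text \<open>\<open>h\<^sub>1 l(h\<^sub>2) = l(h) 1\<close>, tested by the linear forms \<open>\<phi>\<close>.\<close>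

definition left_integral :: "('a \<Rightarrow> 'k) \<Rightarrow> bool" where
  "left_integral l \<longleftrightarrow> linear_form H l \<and>
     (\<forall>\<phi> h. linear_form H \<phi> \<longrightarrow> h \<in> carrier H \<longrightarrow> sw h (\<lambda>x y. \<phi> x * l y) = \<phi> \<one> * l h)"

text \<open>The trace of the endomorphism sending \<open>x\<close> to \<open>w\<^sub>1 f(w\<^sub>2)\<close>, where \<open>w = h S\<^sup>2(x)\<close>. The twist by \<open>S\<^sup>2\<close> is what
  makes the trace an integral as a function of \<open>h\<close>.\<close>

definition trace_integral :: "('a \<Rightarrow> 'k) \<Rightarrow> 'a \<Rightarrow> 'k" where
  "trace_integral f h = (\<Sum>i\<in>B. sw (h \<otimes> \<S> (\<S> i)) (\<lambda>x y. d i x * f y))"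

lemma dual_sum:
  assumes "linear_form H \<phi>" "x \<in> carrier H"
  shows "(\<Sum>i\<in>B. d i x * \<phi> i) = \<phi> x" "(\<Sum>i\<in>B. \<phi> i * d i x) = \<phi> x"
  using form_expand[OF assms] by (simp_all add: mult.commute)

lemma sw_basis: "h \<in> carrier H \<Longrightarrow> sw h b = (\<Sum>i\<in>B. \<Sum>j\<in>B. sw h (\<lambda>x y. d i x * d j y) * b i j)"
  unfolding sw_def[of h b] using sw_eq[OF coord_form] by (intro sum.cong refl) simp

lemma trace_integral_form: "linear_form H (trace_integral f)"
proof (rule linI)
  show "trace_integral f (x \<oplus> y) = trace_integral f x + trace_integral f y" if "x \<in> carrier H" "y \<in> carrier H" for x y
    unfolding trace_integral_def sum.distrib[symmetric]
    using that basis_props(2) by (intro sum.cong refl) (simp add: lin)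
  show "trace_integral f (c \<odot> x) = c * trace_integral f x" if "x \<in> carrier H" for x c
    unfolding trace_integral_def sum_distrib_left
    using that basis_props(2) by (intro sum.cong refl) (simp add: lin)
qed

text \<open>With \<open>\<Delta>(e) = a \<otimes> b\<close>, the first leg of \<open>h S\<^sup>2(b)\<close> ends in a factor \<open>S\<^sup>2(b\<^sub>1)\<close>, and multiplied by \<open>S(a)\<close> it
  cancels because \<open>S\<^sup>2(b\<^sub>1) S(a) = S(a S(b\<^sub>1))\<close>. So \<open>S\<^sup>2(e)\<close>, when multiplied to the second leg
  of \<open>\<Delta>(h)\<close> alone, can be moved inside \<open>\<Delta>\<close>.\<close>

lemma antipode_square_cancel:
  assumes \<phi>': "linear_form H \<phi>" and h: "h \<in> carrier H" and e: "e \<in> carrier H" and M': "linear_form H M"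
  shows "sw h (\<lambda>x y. \<phi> x * M (y \<otimes> \<S> (\<S> e))) =
    sw e (\<lambda>a b. sw (h \<otimes> \<S> (\<S> b)) (\<lambda>z z'. \<phi> (z \<otimes> \<S> a) * M z'))"
proof -
  note \<phi> = linear_formD[OF \<phi>'] and M = linear_formD[OF M']
  have "sw (h \<otimes> \<S> (\<S> b)) (\<lambda>z z'. \<phi> (z \<otimes> \<S> a) * M z') =
      sw h (\<lambda>x y. sw b (\<lambda>p q. \<phi> (x \<otimes> (\<S> (\<S> p) \<otimes> \<S> a)) * M (y \<otimes> \<S> (\<S> q))))"
    if ab: "a \<in> carrier H" "b \<in> carrier H" for a b
  proof -
    have 1: "bilinear_form H H (\<lambda>z z'. \<phi> (z \<otimes> \<S> a) * M z')"
      using ab by (intro bilinear_formI) (simp_all add: lin \<phi> M)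
    have 2: "bilinear_form H H (\<lambda>p q. \<phi> (x \<otimes> (p \<otimes> \<S> a)) * M (y \<otimes> q))"
      "bilinear_form H H (\<lambda>p q. \<phi> (x \<otimes> (\<S> q \<otimes> \<S> a)) * M (y \<otimes> \<S> p))" if "x \<in> carrier H" "y \<in> carrier H" for x y
      using ab that by - ((intro bilinear_formI; simp add: lin \<phi> M)+)
    show ?thesis using ab h
      by (simp add: sw_mult[OF 1] m_assoc) (simp add: sw_antipode[OF 2(1)] sw_antipode[OF 2(2)])
  qed
  then have "sw e (\<lambda>a b. sw (h \<otimes> \<S> (\<S> b)) (\<lambda>z z'. \<phi> (z \<otimes> \<S> a) * M z')) =
     sw e (\<lambda>a b. sw h (\<lambda>x y. sw b (\<lambda>p q. \<phi> (x \<otimes> (\<S> (\<S> p) \<otimes> \<S> a)) * M (y \<otimes> \<S> (\<S> q)))))"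
    by (rule sw_cong[OF refl])
  also have "\<dots> = sw h (\<lambda>x y. sw e (\<lambda>a b. sw b (\<lambda>p q. \<phi> (x \<otimes> (\<S> (\<S> p) \<otimes> \<S> a)) * M (y \<otimes> \<S> (\<S> q)))))"
    by (rule sw_swap)
  also have "\<dots> = sw h (\<lambda>x y. \<phi> x * M (y \<otimes> \<S> (\<S> e)))"
  proof (rule sw_cong[OF refl])
    fix x y assume xy: "x \<in> carrier H" "y \<in> carrier H"
    have "sw e (\<lambda>a b. sw b (\<lambda>p q. \<phi> (x \<otimes> (\<S> (\<S> p) \<otimes> \<S> a)) * M (y \<otimes> \<S> (\<S> q)))) =
        sw e (\<lambda>r q. sw r (\<lambda>a p. \<phi> (x \<otimes> (\<S> (\<S> p) \<otimes> \<S> a)) * M (y \<otimes> \<S> (\<S> q))))"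
      using xy by (intro coassoc_sw[symmetric, OF _ e] trilinear_formI) (simp_all add: lin \<phi> M)
    also have "\<dots> = sw e (\<lambda>r q. \<epsilon> r * (\<phi> x * M (y \<otimes> \<S> (\<S> q))))"
    proof (rule sw_cong[OF refl])
      fix r q assume rq: "r \<in> carrier H" "q \<in> carrier H"
      have "linear_form H (\<lambda>w. \<phi> (x \<otimes> \<S> w))" using xy by (intro linI) (simp_all add: lin \<phi>)
      from antipode_sw(2)[OF this rq(1)]
      have "sw r (\<lambda>a p. \<phi> (x \<otimes> (\<S> (\<S> p) \<otimes> \<S> a))) = \<epsilon> r * \<phi> x" using xy by (simp add: antipode_mult)
      then show "sw r (\<lambda>a p. \<phi> (x \<otimes> (\<S> (\<S> p) \<otimes> \<S> a)) * M (y \<otimes> \<S> (\<S> q))) = \<epsilon> r * (\<phi> x * M (y \<otimes> \<S> (\<S> q)))"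
        by simp
    qed
    also have "\<dots> = \<phi> x * M (y \<otimes> \<S> (\<S> e))"
      using xy e by (intro counit_sw(1) linI) (simp_all add: lin \<phi> M)
    finally show "sw e (\<lambda>a b. sw b (\<lambda>p q. \<phi> (x \<otimes> (\<S> (\<S> p) \<otimes> \<S> a)) * M (y \<otimes> \<S> (\<S> q)))) = \<phi> x * M (y \<otimes> \<S> (\<S> e))" .
  qed
  finally show ?thesis by simp
qed

text \<open>After the preceding lemma, the comultiplication of the basis vector \<open>i\<close> is transferred to the coordinate
  forms (\<open>?\<delta>\<close>). There it produces \<open>w\<^sub>1 S(w\<^sub>2)\<close> with \<open>w = h S\<^sup>2(l)\<close>, and this cancels.\<close>

lemma trace_integral:
  assumes f': "linear_form H f"
  shows "left_integral (trace_integral f)"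
  unfolding left_integral_def
proof (intro conjI allI impI trace_integral_form)
  fix \<phi> h assume \<phi>': "linear_form H \<phi>" and h: "h \<in> carrier H"
  note f = linear_formD[OF f'] and \<phi> = linear_formD[OF \<phi>'] and Bc = basis_props(2)
  note db = linear_formD[OF basis_props(3)]
  let ?\<delta> = "\<lambda>j l x. sw x (\<lambda>s t. d j s * d l t)"
  have \<delta>: "linear_form H (?\<delta> j l)" for j l by (intro linI) simp_all
  let ?M = "\<lambda>i z. sw z (\<lambda>x y. d i x * f y)"
  have M: "linear_form H (?M i)" for i by (intro linI) simp_all
  have "sw h (\<lambda>x y. \<phi> x * trace_integral f y) = (\<Sum>i\<in>B. sw h (\<lambda>x y. \<phi> x * ?M i (y \<otimes> \<S> (\<S> i))))"
    unfolding trace_integral_def sum_distrib_left by (rule sw_sum)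
  also have "\<dots> = (\<Sum>i\<in>B. sw i (\<lambda>a b. sw (h \<otimes> \<S> (\<S> b)) (\<lambda>z z'. \<phi> (z \<otimes> \<S> a) * ?M i z')))"
    using Bc by (intro sum.cong refl antipode_square_cancel \<phi>' h M)
  also have "\<dots> = (\<Sum>i\<in>B. \<Sum>j\<in>B. \<Sum>l\<in>B. ?\<delta> j l i * sw (h \<otimes> \<S> (\<S> l)) (\<lambda>z z'. \<phi> (z \<otimes> \<S> j) * ?M i z'))"
    using Bc by (intro sum.cong refl sw_basis)
  also have "\<dots> = (\<Sum>l\<in>B. \<Sum>j\<in>B. \<Sum>i\<in>B. ?\<delta> j l i * sw (h \<otimes> \<S> (\<S> l)) (\<lambda>z z'. \<phi> (z \<otimes> \<S> j) * ?M i z'))"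
    by (subst sum.swap, subst sum.swap[of _ B B], rule sum.cong[OF refl], subst sum.swap, subst sum.swap) (rule sum.swap)
  also have "\<dots> = (\<Sum>l\<in>B. \<phi> \<one> * ?M l (h \<otimes> \<S> (\<S> l)))"
  proof (rule sum.cong[OF refl])
    fix l assume l: "l \<in> B"
    define w where "w = h \<otimes> \<S> (\<S> l)"
    have w: "w \<in> carrier H" using h l Bc by (simp add: w_def)
    have "(\<Sum>j\<in>B. \<Sum>i\<in>B. ?\<delta> j l i * sw w (\<lambda>z z'. \<phi> (z \<otimes> \<S> j) * ?M i z')) =
       (\<Sum>j\<in>B. sw w (\<lambda>z z'. \<phi> (z \<otimes> \<S> j) * sw z' (\<lambda>x y. ?\<delta> j l x * f y)))"
    proof (rule sum.cong[OF refl])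
      fix j assume j: "j \<in> B"
      have "(\<Sum>i\<in>B. ?\<delta> j l i * sw w (\<lambda>z z'. \<phi> (z \<otimes> \<S> j) * ?M i z')) =
         sw w (\<lambda>z z'. \<phi> (z \<otimes> \<S> j) * sw z' (\<lambda>x y. (\<Sum>i\<in>B. d i x * ?\<delta> j l i) * f y))"
        by (simp only: sw_fun[symmetric] sw_sum[symmetric] sum_distrib_left sum_distrib_right mult.assoc mult.left_commute)
      also have "\<dots> = sw w (\<lambda>z z'. \<phi> (z \<otimes> \<S> j) * sw z' (\<lambda>x y. ?\<delta> j l x * f y))"
        using w by (simp add: dual_sum(1)[OF \<delta>])
      finally show "(\<Sum>i\<in>B. ?\<delta> j l i * sw w (\<lambda>z z'. \<phi> (z \<otimes> \<S> j) * ?M i z')) =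
         sw w (\<lambda>z z'. \<phi> (z \<otimes> \<S> j) * sw z' (\<lambda>x y. ?\<delta> j l x * f y))" .
    qed
    also have "\<dots> = sw w (\<lambda>z z'. sw z' (\<lambda>x y. sw x (\<lambda>s t. (\<Sum>j\<in>B. d j s * \<phi> (z \<otimes> \<S> j)) * (d l t * f y))))"
      by (simp only: sw_fun[symmetric] sw_sum[symmetric] sum_distrib_left sum_distrib_right mult.assoc mult.left_commute)
    also have "\<dots> = sw w (\<lambda>z z'. sw z' (\<lambda>x y. sw x (\<lambda>s t. \<phi> (z \<otimes> \<S> s) * (d l t * f y))))"
    proof (rule sw_cong[OF refl])
      fix z z' assume z: "z \<in> carrier H" "z' \<in> carrier H"
      then have "linear_form H (\<lambda>s. \<phi> (z \<otimes> \<S> s))" by (intro linI) (simp_all add: lin \<phi>)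
      note * = dual_sum(1)[OF this]
      show "sw z' (\<lambda>x y. sw x (\<lambda>s t. (\<Sum>j\<in>B. d j s * \<phi> (z \<otimes> \<S> j)) * (d l t * f y))) =
          sw z' (\<lambda>x y. sw x (\<lambda>s t. \<phi> (z \<otimes> \<S> s) * (d l t * f y)))"
        by (simp only: * cong: sw_cong)
    qed
    also have "\<dots> = sw w (\<lambda>z z'. sw z' (\<lambda>s r. sw r (\<lambda>t y. \<phi> (z \<otimes> \<S> s) * (d l t * f y))))"
      by (rule sw_cong[OF refl], rule coassoc_sw, intro trilinear_formI) (simp_all add: lin \<phi> f db[OF l])
    also have "\<dots> = sw w (\<lambda>z z'. sw z' (\<lambda>s r. \<phi> (z \<otimes> \<S> s) * ?M l r))" by simp
    also have "\<dots> = sw w (\<lambda>x r. sw x (\<lambda>z s. \<phi> (z \<otimes> \<S> s) * ?M l r))"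
      using w by (intro coassoc_sw[symmetric] trilinear_formI) (simp_all add: lin \<phi>)
    also have "\<dots> = sw w (\<lambda>x r. \<epsilon> x * (\<phi> \<one> * ?M l r))"
      by (rule sw_cong[OF refl]) (simp add: antipode_sw(2)[OF \<phi>'] mult.assoc)
    also have "\<dots> = \<phi> \<one> * ?M l w"
      using w by (intro counit_sw(1) linI) (simp_all add: lin)
    finally show "(\<Sum>j\<in>B. \<Sum>i\<in>B. ?\<delta> j l i * sw (h \<otimes> \<S> (\<S> l)) (\<lambda>z z'. \<phi> (z \<otimes> \<S> j) * ?M i z')) = \<phi> \<one> * ?M l (h \<otimes> \<S> (\<S> l))"
      unfolding w_def .
  qed
  also have "\<dots> = \<phi> \<one> * trace_integral f h" unfolding trace_integral_def by (simp only: sum_distrib_left)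
  finally show "sw h (\<lambda>x y. \<phi> x * trace_integral f y) = \<phi> \<one> * trace_integral f h" .
qed

text \<open>Summing trace integrals over a dual basis produces \<open>S(a\<^sub>1) a\<^sub>2\<close> inside the antipode, which cancels and
  leaves \<open>f\<close>. Hence not all trace integrals vanish.\<close>

lemma form_from_trace_integrals:
  assumes f': "linear_form H f" and h: "h \<in> carrier H"
  shows "f h = (\<Sum>i\<in>B. trace_integral (\<lambda>y. sw y (\<lambda>p q. d i p * f q)) (h \<otimes> \<S> i))"
proof -
  note f = linear_formD[OF f'] and Bc = basis_props(2)
  note db = linear_formD[OF basis_props(3)]
  let ?\<delta> = "\<lambda>j l x. sw x (\<lambda>s t. d j s * d l t)"
  have \<delta>: "linear_form H (?\<delta> j l)" for j l by (intro linI) simp_all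
  let ?R = "\<lambda>m w. sw w (\<lambda>z y. d m z * f y)"
  have R: "linear_form H (?R m)" for m by (intro linI) simp_all
  have Rexp: "sw w (\<lambda>z y. \<zeta> z * f y) = (\<Sum>m\<in>B. \<zeta> m * ?R m w)" if \<zeta>: "linear_form H \<zeta>" and w: "w \<in> carrier H" for \<zeta> w
  proof -
    have "sw w (\<lambda>z y. \<zeta> z * f y) = sw w (\<lambda>z y. (\<Sum>m\<in>B. \<zeta> m * d m z) * f y)"
      using dual_sum(2)[OF \<zeta>] by (intro sw_cong refl) simp
    then show ?thesis by (simp only: sw_fun[symmetric] sw_sum[symmetric] sum_distrib_right mult.assoc)
  qed
  have "(\<Sum>i\<in>B. trace_integral (\<lambda>y. sw y (\<lambda>p q. d i p * f q)) (h \<otimes> \<S> i)) =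
    (\<Sum>i\<in>B. \<Sum>j\<in>B. sw (h \<otimes> \<S> (\<S> j \<otimes> i)) (\<lambda>x y. sw y (\<lambda>p q. d j x * (d i p * f q))))"
    unfolding trace_integral_def using h Bc
    by (intro sum.cong refl) (simp add: antipode_mult m_assoc)
  also have "\<dots> = (\<Sum>i\<in>B. \<Sum>j\<in>B. sw (h \<otimes> \<S> (\<S> j \<otimes> i)) (\<lambda>z y. ?\<delta> j i z * f y))"
  proof (intro sum.cong refl)
    fix i j assume ij: "i \<in> B" "j \<in> B"
    have "sw (h \<otimes> \<S> (\<S> j \<otimes> i)) (\<lambda>x y. sw y (\<lambda>p q. d j x * (d i p * f q))) =
        sw (h \<otimes> \<S> (\<S> j \<otimes> i)) (\<lambda>z q. sw z (\<lambda>x p. d j x * (d i p * f q)))"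
      using h ij Bc by (intro coassoc_sw[symmetric] trilinear_formI) (simp_all add: lin f db)
    also have "\<dots> = sw (h \<otimes> \<S> (\<S> j \<otimes> i)) (\<lambda>z y. ?\<delta> j i z * f y)"
      by (simp only: sw_fun[symmetric] mult.assoc)
    finally show "sw (h \<otimes> \<S> (\<S> j \<otimes> i)) (\<lambda>x y. sw y (\<lambda>p q. d j x * (d i p * f q))) = \<dots>" .
  qed
  also have "\<dots> = (\<Sum>i\<in>B. \<Sum>j\<in>B. \<Sum>m\<in>B. ?\<delta> j i m * ?R m (h \<otimes> \<S> (\<S> j \<otimes> i)))"
    using h Bc by (intro sum.cong refl Rexp \<delta>) simp
  also have "\<dots> = (\<Sum>m\<in>B. \<Sum>j\<in>B. \<Sum>i\<in>B. ?\<delta> j i m * ?R m (h \<otimes> \<S> (\<S> j \<otimes> i)))"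
    by (subst sum.swap, subst (2) sum.swap, subst sum.swap, rule refl)
  also have "\<dots> = (\<Sum>m\<in>B. sw m (\<lambda>a b. ?R m (h \<otimes> \<S> (\<S> a \<otimes> b))))"
    using Bc by (intro sum.cong refl sw_basis[symmetric])
  also have "\<dots> = (\<Sum>m\<in>B. \<epsilon> m * ?R m h)"
  proof (intro sum.cong refl)
    fix m assume m: "m \<in> B"
    have "linear_form H (\<lambda>w. ?R m (h \<otimes> \<S> w))" using h by (intro linI) (simp_all add: lin)
    from antipode_sw(1)[OF this] show "sw m (\<lambda>a b. ?R m (h \<otimes> \<S> (\<S> a \<otimes> b))) = \<epsilon> m * ?R m h"
      using m Bc h by simp
  qed
  also have "\<dots> = sw h (\<lambda>z y. \<epsilon> z * f y)" using Rexp[OF counit_form h] by simp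
  also have "\<dots> = f h" by (rule counit_sw(1)[OF f' h])
  finally show ?thesis by simp
qed

lemma nonzero_integral_exists:
  obtains l h where "left_integral l" "h \<in> carrier H" "l h \<noteq> 0"
proof -
  have "\<exists>f h. linear_form H f \<and> h \<in> carrier H \<and> trace_integral f h \<noteq> 0"
  proof (rule ccontr)
    assume *: "\<not> ?thesis"
    have "trace_integral (\<lambda>y. sw y (\<lambda>p q. d i p * \<epsilon> q)) (\<one> \<otimes> \<S> i) = 0" if "i \<in> B" for i
    proof -
      have "linear_form H (\<lambda>y. sw y (\<lambda>p q. d i p * \<epsilon> q))" by (intro linI) simp_all
      moreover have "\<one> \<otimes> \<S> i \<in> carrier H" using that basis_props(2) by simp
      ultimately show ?thesis using * by blast
    qed
    then have "\<epsilon> \<one> = 0" using form_from_trace_integrals[OF counit_form, of \<one>] by simp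
    then show False by simp
  qed
  then show ?thesis using that trace_integral by blast
qed

text \<open>Invariance of \<open>l\<close> at \<open>q x\<close> gives \<open>S(y\<^sub>1) l(y\<^sub>2 x) = S(y\<^sub>1) y\<^sub>2 x\<^sub>1 l(y\<^sub>3 x\<^sub>2)\<close>, and \<open>S(y\<^sub>1) y\<^sub>2\<close> cancels.\<close>

lemma integral_shift:
  assumes l: "left_integral l" and \<phi>': "linear_form H \<phi>" and x: "x \<in> carrier H" and y: "y \<in> carrier H"
  shows "sw x (\<lambda>u v. \<phi> u * l (y \<otimes> v)) = sw y (\<lambda>p q. \<phi> (\<S> p) * l (q \<otimes> x))"
proof -
  have l': "linear_form H l" using l by (simp add: left_integral_def)
  note \<phi> = linear_formD[OF \<phi>'] and lf = linear_formD[OF l']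
  have "sw y (\<lambda>p q. \<phi> (\<S> p) * l (q \<otimes> x)) =
      sw y (\<lambda>p q. sw q (\<lambda>q1 q2. sw x (\<lambda>u v. \<phi> (\<S> p \<otimes> q1 \<otimes> u) * l (q2 \<otimes> v))))"
  proof (rule sw_cong[OF refl])
    fix p q assume pq: "p \<in> carrier H" "q \<in> carrier H"
    have 1: "linear_form H (\<lambda>w. \<phi> (\<S> p \<otimes> w))" using pq by (intro linI) (simp_all add: lin \<phi>)
    have 2: "bilinear_form H H (\<lambda>w z. \<phi> (\<S> p \<otimes> w) * l z)" using pq by (intro bilinear_formI) (simp_all add: lin \<phi> lf)
    have "\<phi> (\<S> p) * l (q \<otimes> x) = sw (q \<otimes> x) (\<lambda>w z. \<phi> (\<S> p \<otimes> w) * l z)"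
      using l 1 pq x unfolding left_integral_def by simp
    also have "\<dots> = sw q (\<lambda>q1 q2. sw x (\<lambda>u v. \<phi> (\<S> p \<otimes> q1 \<otimes> u) * l (q2 \<otimes> v)))"
      using pq x by (simp add: sw_mult[OF 2] m_assoc)
    finally show "\<phi> (\<S> p) * l (q \<otimes> x) = \<dots>" .
  qed
  also have "\<dots> = sw y (\<lambda>r q2. sw r (\<lambda>p q1. sw x (\<lambda>u v. \<phi> (\<S> p \<otimes> q1 \<otimes> u) * l (q2 \<otimes> v))))"
    by (intro coassoc_sw[symmetric, OF _ y] trilinear_formI) (simp_all add: lin \<phi> lf)
  also have "\<dots> = sw y (\<lambda>r q2. \<epsilon> r * sw x (\<lambda>u v. \<phi> u * l (q2 \<otimes> v)))"
  proof (rule sw_cong[OF refl])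
    fix r q2 assume *: "r \<in> carrier H" "q2 \<in> carrier H"
    have "linear_form H (\<lambda>w. sw x (\<lambda>u v. \<phi> (w \<otimes> u) * l (q2 \<otimes> v)))"
      using * by (intro linI) (simp_all add: lin \<phi>)
    from antipode_sw(1)[OF this *(1)]
    show "sw r (\<lambda>p q1. sw x (\<lambda>u v. \<phi> (\<S> p \<otimes> q1 \<otimes> u) * l (q2 \<otimes> v))) = \<epsilon> r * sw x (\<lambda>u v. \<phi> u * l (q2 \<otimes> v))"
      by simp
  qed
  also have "\<dots> = sw x (\<lambda>u v. \<phi> u * l (y \<otimes> v))"
    by (intro counit_sw(1)[OF _ y] linI) (simp_all add: lin lf)
  finally show ?thesis by simp
qed

text \<open>Invariance of \<open>l\<close> at \<open>c S(u)\<close>; since \<open>\<Delta>\<close> reverses the legs of \<open>S(u)\<close>, the factor \<open>S(x\<^sub>2) x\<^sub>3\<close> appears and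
  cancels.\<close>

lemma integral_antipode_shift:
  assumes l: "left_integral l" and \<phi>': "linear_form H \<phi>" and x: "x \<in> carrier H" and c: "c \<in> carrier H"
  shows "sw x (\<lambda>u v. l (c \<otimes> \<S> u) * \<phi> v) = sw c (\<lambda>p q. \<phi> p * l (q \<otimes> \<S> x))"
proof -
  have l': "linear_form H l" using l by (simp add: left_integral_def)
  note \<phi> = linear_formD[OF \<phi>'] and lf = linear_formD[OF l']
  have "sw x (\<lambda>u v. l (c \<otimes> \<S> u) * \<phi> v) =
     sw x (\<lambda>u v. sw u (\<lambda>a b. sw c (\<lambda>p q. \<phi> (p \<otimes> (\<S> b \<otimes> v)) * l (q \<otimes> \<S> a))))"
  proof (rule sw_cong[OF refl])
    fix u v assume uv: "u \<in> carrier H" "v \<in> carrier H"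
    have 1: "linear_form H (\<lambda>w. \<phi> (w \<otimes> v))" using uv by (intro linI) (simp_all add: lin \<phi>)
    have 2: "bilinear_form H H (\<lambda>w z. \<phi> (w \<otimes> v) * l z)" using uv by (intro bilinear_formI) (simp_all add: lin \<phi> lf)
    have 3: "bilinear_form H H (\<lambda>a b. \<phi> (p \<otimes> (a \<otimes> v)) * l (q \<otimes> b))" if "p \<in> carrier H" "q \<in> carrier H" for p q
      using uv that by (intro bilinear_formI) (simp_all add: lin \<phi> lf)
    have "l (c \<otimes> \<S> u) * \<phi> v = sw (c \<otimes> \<S> u) (\<lambda>w z. \<phi> (w \<otimes> v) * l z)"
      using l 1 uv c unfolding left_integral_def by simp
    also have "\<dots> = sw c (\<lambda>p q. sw u (\<lambda>a b. \<phi> (p \<otimes> (\<S> b \<otimes> v)) * l (q \<otimes> \<S> a)))"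
      using uv c by (simp add: sw_mult[OF 2] m_assoc) (simp add: sw_antipode[OF 3])
    also have "\<dots> = sw u (\<lambda>a b. sw c (\<lambda>p q. \<phi> (p \<otimes> (\<S> b \<otimes> v)) * l (q \<otimes> \<S> a)))" by (rule sw_swap)
    finally show "l (c \<otimes> \<S> u) * \<phi> v = \<dots>" .
  qed
  also have "\<dots> = sw x (\<lambda>a r. sw r (\<lambda>b v. sw c (\<lambda>p q. \<phi> (p \<otimes> (\<S> b \<otimes> v)) * l (q \<otimes> \<S> a))))"
    by (intro coassoc_sw[OF _ x] trilinear_formI) (simp_all add: lin \<phi> lf)
  also have "\<dots> = sw x (\<lambda>a r. \<epsilon> r * sw c (\<lambda>p q. \<phi> p * l (q \<otimes> \<S> a)))"
  proof (rule sw_cong[OF refl])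
    fix a r assume *: "a \<in> carrier H" "r \<in> carrier H"
    have "linear_form H (\<lambda>w. sw c (\<lambda>p q. \<phi> (p \<otimes> w) * l (q \<otimes> \<S> a)))"
      using * by (intro linI) (simp_all add: lin \<phi>)
    from antipode_sw(1)[OF this *(2)]
    show "sw r (\<lambda>b v. sw c (\<lambda>p q. \<phi> (p \<otimes> (\<S> b \<otimes> v)) * l (q \<otimes> \<S> a))) = \<epsilon> r * sw c (\<lambda>p q. \<phi> p * l (q \<otimes> \<S> a))"
      by simp
  qed
  also have "\<dots> = sw c (\<lambda>p q. \<phi> p * l (q \<otimes> \<S> x))"
    by (intro counit_sw(2)[OF _ x] linI) (simp_all add: lin lf)
  finally show ?thesis .
qed

text \<open>If \<open>l\<close> vanishes on \<open>H x\<close>, the shift lemma gives \<open>x\<^sub>1 l(y x\<^sub>2) = 0\<close> for all \<open>y\<close>. Applied to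
  \<open>y = k S(x\<^sub>2)\<close> inside \<open>x\<^sub>1 l(k S(x\<^sub>2) x\<^sub>3) = x l(k)\<close>, this shows \<open>x l(k) = 0\<close>.\<close>

lemma integral_nondegenerate:
  assumes l: "left_integral l" and k: "k \<in> carrier H" "l k \<noteq> 0"
    and x: "x \<in> carrier H" and zero: "\<And>y. y \<in> carrier H \<Longrightarrow> l (y \<otimes> x) = 0"
  shows "x = \<zero>"
proof (rule eq_if_forms_eq[OF fd x])
  have l': "linear_form H l" using l by (simp add: left_integral_def)
  note lf = linear_formD[OF l']
  fix \<phi> assume \<phi>': "linear_form H \<phi>"
  note \<phi> = linear_formD[OF \<phi>']
  have z: "sw x (\<lambda>u v. \<psi> u * l (y \<otimes> v)) = 0" if "linear_form H \<psi>" "y \<in> carrier H" for \<psi> y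
    using integral_shift[OF l that(1) x that(2)] zero by simp
  have "\<phi> x * l k = sw x (\<lambda>u v. \<phi> u * \<epsilon> v) * l k" using counit_sw(4)[OF \<phi>' x] by simp
  also have "\<dots> = sw x (\<lambda>u v. \<phi> u * sw v (\<lambda>a b. l (k \<otimes> (\<S> a \<otimes> b))))"
  proof -
    have "linear_form H (\<lambda>w. l (k \<otimes> w))" using k by (intro linI) (simp_all add: lin lf)
    from antipode_sw(1)[OF this] k show ?thesis by (simp add: mult.assoc flip: sw_fun(4))
  qed
  also have "\<dots> = sw x (\<lambda>u v. sw v (\<lambda>a b. \<phi> u * l (k \<otimes> (\<S> a \<otimes> b))))" by simp
  also have "\<dots> = sw x (\<lambda>w b. sw w (\<lambda>u a. \<phi> u * l (k \<otimes> (\<S> a \<otimes> b))))"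
    using k by (intro coassoc_sw[symmetric, OF _ x] trilinear_formI) (simp_all add: lin \<phi> lf)
  \<comment> \<open>\<open>a\<close> is a leg of \<open>w\<close>; expanding \<open>w\<close> in the basis makes it independent of \<open>x\<close>.\<close>
  also have "\<dots> = sw x (\<lambda>w b. \<Sum>i\<in>B. d i w * sw i (\<lambda>u a. \<phi> u * l (k \<otimes> (\<S> a \<otimes> b))))"
  proof (rule sw_cong[OF refl])
    fix w b assume wb: "w \<in> carrier H" "b \<in> carrier H"
    have "linear_form H (\<lambda>w. sw w (\<lambda>u a. \<phi> u * l (k \<otimes> (\<S> a \<otimes> b))))"
      by (intro linI) simp_all
    from dual_sum(1)[OF this wb(1)]
    show "sw w (\<lambda>u a. \<phi> u * l (k \<otimes> (\<S> a \<otimes> b))) = (\<Sum>i\<in>B. d i w * sw i (\<lambda>u a. \<phi> u * l (k \<otimes> (\<S> a \<otimes> b))))" by simp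
  qed
  also have "\<dots> = (\<Sum>i\<in>B. sw i (\<lambda>u a. \<phi> u * sw x (\<lambda>w b. d i w * l ((k \<otimes> \<S> a) \<otimes> b))))"
  proof (subst sw_sum, rule sum.cong[OF refl])
    fix i assume "i \<in> B"
    have "sw x (\<lambda>w b. d i w * sw i (\<lambda>u a. \<phi> u * l (k \<otimes> (\<S> a \<otimes> b)))) =
        sw i (\<lambda>u a. sw x (\<lambda>w b. d i w * (\<phi> u * l (k \<otimes> (\<S> a \<otimes> b)))))"
      by (simp only: sw_fun(3)[symmetric]) (rule sw_swap)
    also have "\<dots> = sw i (\<lambda>u a. \<phi> u * sw x (\<lambda>w b. d i w * l ((k \<otimes> \<S> a) \<otimes> b)))"
      using k by (simp add: m_assoc mult.left_commute)
    finally show "sw x (\<lambda>w b. d i w * sw i (\<lambda>u a. \<phi> u * l (k \<otimes> (\<S> a \<otimes> b)))) = \<dots>" .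
  qed
  also have "\<dots> = 0" using z basis_props(3) k by simp
  finally show "\<phi> x = \<phi> \<zero>" using k linear_form_zero[OF \<phi>'] by simp
qed auto

lemma integral_represents_forms:
  assumes l: "left_integral l" and k: "k \<in> carrier H" "l k \<noteq> 0" and f: "linear_form H f"
  obtains z where "z \<in> carrier H" "\<And>y. y \<in> carrier H \<Longrightarrow> l (y \<otimes> z) = f y"
proof -
  have l': "linear_form H l" using l by (simp add: left_integral_def)
  note lf = linear_formD[OF l']
  have 1: "linear_form H (\<lambda>y. l (y \<otimes> x))" if "x \<in> carrier H" for x
    using that by (intro linI) (simp_all add: lin lf)
  have 2: "linear_form H (\<lambda>x. l (y \<otimes> x))" if "y \<in> carrier H" for y
    using that by (intro linI) (simp_all add: lin lf)
  show ?thesis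
    by (rule nondegenerate_represents_forms[of "\<lambda>x y. l (y \<otimes> x)" f, OF fd 1 2 integral_nondegenerate[OF l k] f])
      (blast intro: that)+
qed

text \<open>Nondegeneracy on either side yields \<open>T\<close> and \<open>\<Lambda>\<close> with \<open>l(y T) = \<epsilon>(y) = l(\<Lambda> y)\<close>. The shift lemma for the pair
  \<open>T\<close>, \<open>\<Lambda>\<close> then reads \<open>S(\<Lambda>) = T\<close>.\<close>

lemma frobenius_element:
  assumes l: "left_integral l" and k: "k \<in> carrier H" "l k \<noteq> 0"
  obtains \<Lambda> where "\<Lambda> \<in> carrier H" "\<And>y. y \<in> carrier H \<Longrightarrow> l (y \<otimes> \<S> \<Lambda>) = \<epsilon> y"
proof -
  have l': "linear_form H l" using l by (simp add: left_integral_def)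
  note lf = linear_formD[OF l']
  obtain T where T: "T \<in> carrier H" "\<And>y. y \<in> carrier H \<Longrightarrow> l (y \<otimes> T) = \<epsilon> y"
    using integral_represents_forms[OF l k counit_form] by blast
  have 1: "linear_form H (\<lambda>y. l (y \<otimes> x))" if "x \<in> carrier H" for x
    using that by (intro linI) (simp_all add: lin lf)
  have 2: "linear_form H (\<lambda>x. l (y \<otimes> x))" if "y \<in> carrier H" for y
    using that by (intro linI) (simp_all add: lin lf)
  have nd: "x = \<zero>" if x: "x \<in> carrier H" "\<And>y. y \<in> carrier H \<Longrightarrow> l (x \<otimes> y) = 0" for x
  proof (rule eq_if_forms_eq[OF fd x(1)])
    fix f assume f: "linear_form H f"
    obtain z where "z \<in> carrier H" "\<And>y. y \<in> carrier H \<Longrightarrow> l (y \<otimes> z) = f y"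
      using integral_represents_forms[OF l k f] by blast
    then have "f x = l (x \<otimes> z)" "z \<in> carrier H" using x(1) by simp_all
    then show "f x = f \<zero>" using x(2) linear_form_zero[OF f] by simp
  qed simp
  obtain \<Lambda> where \<Lambda>: "\<Lambda> \<in> carrier H" "\<And>y. y \<in> carrier H \<Longrightarrow> l (\<Lambda> \<otimes> y) = \<epsilon> y"
    by (rule nondegenerate_represents_forms[of "\<lambda>x y. l (x \<otimes> y)" \<epsilon>, OF fd 2 1 nd counit_form])
      (blast intro: that)+
  have "\<S> \<Lambda> = T"
  proof (rule eq_if_forms_eq[OF fd])
    fix \<phi> assume \<phi>: "linear_form H \<phi>"
    have "\<phi> (\<S> \<Lambda>) = sw \<Lambda> (\<lambda>p q. \<phi> (\<S> p) * \<epsilon> q)"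
    proof -
      have "linear_form H (\<lambda>x. \<phi> (\<S> x))" by (intro linI) (simp_all add: lin linear_formD[OF \<phi>])
      from counit_sw(4)[OF this \<Lambda>(1)] show ?thesis by simp
    qed
    also have "\<dots> = sw \<Lambda> (\<lambda>p q. \<phi> (\<S> p) * l (q \<otimes> T))" by (simp add: T)
    also have "\<dots> = sw T (\<lambda>u v. \<phi> u * l (\<Lambda> \<otimes> v))" using integral_shift[OF l \<phi> T(1) \<Lambda>(1)] by simp
    also have "\<dots> = \<phi> T" using counit_sw(4)[OF \<phi> T(1)] by (simp add: \<Lambda>)
    finally show "\<phi> (\<S> \<Lambda>) = \<phi> T" .
  qed (use T \<Lambda> in auto)
  then show ?thesis using that[of \<Lambda>] \<Lambda> T by simp
qed

end

section \<open>Hopf subalgebras\<close>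

definition fdhopf :: "('k::field, 'a) hopf \<Rightarrow> bool" where
  "fdhopf H \<longleftrightarrow> hopf_algebra H \<and> finite_dimensional H"

lemma fdhopf_basis:
  assumes "fdhopf H"
  obtains B d where "fd_hopf H B d"
proof -
  interpret hopf_algebra H using assms by (simp add: fdhopf_def)
  obtain B d where "dual_basis H B d" using dual_basis_exists assms by (auto simp: fdhopf_def)
  then have "fd_hopf H B d" by unfold_locales
  then show ?thesis by (rule that)
qed

context fd_hopf
begin

text \<open>\<open>\<Delta>(A) \<subseteq> A \<otimes> A\<close>, tested by the bilinear forms that vanish on \<open>A \<times> A\<close>.\<close>

definition subcoalgebra :: "'a set \<Rightarrow> bool" where
  "subcoalgebra A \<longleftrightarrow> submodule A scalars H \<and>
     (\<forall>a\<in>A. \<forall>b. bilinear_form H H b \<longrightarrow> (\<forall>x\<in>A. \<forall>y\<in>A. b x y = 0) \<longrightarrow> sw a b = 0)"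

lemma subcoalgebraD:
  assumes "subcoalgebra A"
  shows "submodule A scalars H" "a \<in> A \<Longrightarrow> bilinear_form H H b \<Longrightarrow> (\<And>x y. x \<in> A \<Longrightarrow> y \<in> A \<Longrightarrow> b x y = 0) \<Longrightarrow> sw a b = 0"
  using assms unfolding subcoalgebra_def by blast+

lemma bilinear_form_diff:
  "bilinear_form V W b \<Longrightarrow> bilinear_form V W b' \<Longrightarrow> bilinear_form V W (\<lambda>x y. b x y - b' x y)"
  by (intro bilinear_formI) (simp_all add: bilinear_formD(3-) algebra_simps)

lemma subcoalgebra_sw_cong:
  assumes "subcoalgebra A" "a \<in> A" "bilinear_form H H b" "bilinear_form H H b'"
    "\<And>x y. x \<in> A \<Longrightarrow> y \<in> A \<Longrightarrow> b x y = b' x y"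
  shows "sw a b = sw a b'"
proof -
  have "sw a (\<lambda>x y. b x y - b' x y) = 0"
    by (rule subcoalgebraD(2)[OF assms(1,2) bilinear_form_diff[OF assms(3,4)]]) (simp add: assms(5))
  then show ?thesis by simp
qed

lemma hopf_subalgebraD:
  assumes "hopf_subalgebra A H"
  shows "submodule A scalars H" "A \<subseteq> carrier H" "\<one> \<in> A" "x \<in> A \<Longrightarrow> y \<in> A \<Longrightarrow> x \<otimes> y \<in> A" "x \<in> A \<Longrightarrow> \<S> x \<in> A"
    "subcoalgebra A"
proof -
  have sr: "subring A H" using assms by (simp add: hopf_subalgebra_def)
  show sub: "submodule A scalars H"
    using assms subringE[OF sr] by (intro subspaceI) (auto simp: hopf_subalgebra_def)
  show "A \<subseteq> carrier H" "\<one> \<in> A" "x \<in> A \<Longrightarrow> y \<in> A \<Longrightarrow> x \<otimes> y \<in> A" using subringE[OF sr] by auto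
  show "x \<in> A \<Longrightarrow> \<S> x \<in> A" using assms by (simp add: hopf_subalgebra_def)
  show "subcoalgebra A"
    unfolding subcoalgebra_def
  proof (intro conjI sub ballI allI impI)
    fix a b assume a: "a \<in> A" and b: "bilinear_form H H b" and z: "\<forall>x\<in>A. \<forall>y\<in>A. b x y = 0"
    obtain f where f: "f \<in> \<Delta> a" "Poly_Mapping.keys f \<subseteq> A \<times> A"
      using assms a by (auto simp: hopf_subalgebra_def)
    have ac: "a \<in> carrier H" using a \<open>A \<subseteq> carrier H\<close> by auto
    have "sw a b = eval_form b f" using sw_eq[OF b ac] tensor_form_eval[OF comult_closed[OF ac] b f(1)] by simp
    also have "\<dots> = eval_form (\<lambda>_ _. 0) f" using f(2) z by (intro eval_form_cong) auto
    also have "\<dots> = 0" by (simp add: eval_form_def)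
    finally show "sw a b = 0" .
  qed
qed

text \<open>A representative of \<open>\<Delta>(a)\<close> lies in the span of the relations and the pairs in \<open>A \<times> A\<close>, because no bilinear
  form can separate it from them. Dropping the relations leaves a representative supported on \<open>A \<times> A\<close>.\<close>

lemma subcoalgebra_representative:
  assumes A: "subcoalgebra A" "a \<in> A"
  shows "\<exists>f\<in>\<Delta> a. Poly_Mapping.keys f \<subseteq> A \<times> A"
proof -
  note Asub = subcoalgebraD(1)[OF A(1)]
  have ac: "a \<in> carrier H" using A subspaceD(1)[OF Asub] by auto
  note \<Delta>a = comult_closed[OF ac]
  let ?f = "SOME f. f \<in> \<Delta> a"
  have f: "?f \<in> \<Delta> a" "?f \<in> fsums H H" using tensor_some[OF \<Delta>a] by auto
  have "?f \<in> fscale.span (bilinear_rels H H \<union> (\<lambda>p. Poly_Mapping.single p 1) ` (A \<times> A))"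
  proof (rule in_span_if_forms_vanish)
    fix b assume b: "bilinear_form H H b" and z: "\<And>x y. (x, y) \<in> A \<times> A \<Longrightarrow> b x y = 0"
    show "eval_form b ?f = 0"
      using subcoalgebraD(2)[OF A b] z sw_eq[OF b ac] tensor_form_eval[OF \<Delta>a b f(1)] by simp
  qed
  then obtain r g where rg: "?f = r + g" "r \<in> fscale.span (bilinear_rels H H)"
      "g \<in> fscale.span ((\<lambda>p. Poly_Mapping.single p 1) ` (A \<times> A))"
    unfolding fscale.span_Un by auto
  have "Poly_Mapping.keys g \<subseteq> A \<times> A" using rg(3)
  proof (induction rule: fscale.span_induct_alt)
    case (step c x y)
    then have "Poly_Mapping.keys (fscale c x) \<subseteq> A \<times> A" by (auto simp: in_keys_iff lookup_single when_def split: if_splits)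
    then show ?case using step Poly_Mapping.keys_add[of "fscale c x" y] by blast
  qed simp
  moreover have "g \<in> \<Delta> a"
  proof -
    obtain f0 where f0: "f0 \<in> fsums H H" "\<Delta> a = tclass H H f0" using \<Delta>a by (rule tensor_cases)
    have "A \<times> A \<subseteq> carrier H \<times> carrier H" using subspaceD(1)[OF Asub] by auto
    then have "g \<in> fsums H H" using \<open>Poly_Mapping.keys g \<subseteq> A \<times> A\<close> by (simp add: fsums_def)
    moreover have "eval_form b g = eval_form b f0" if b: "bilinear_form H H b" for b
    proof -
      have "eval_form b ?f = eval_form b f0" using f(1) b unfolding f0(2) by (simp add: tclass_mem)
      moreover have "eval_form b ?f = eval_form b r + eval_form b g"
        by (subst rg(1)) simp
      ultimately show ?thesis using eval_form_span_rels[OF b rg(2)] by simp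
    qed
    ultimately show ?thesis unfolding f0(2) by (simp add: tclass_mem)
  qed
  ultimately show ?thesis by blast
qed

lemma hopf_subalgebraI:
  assumes "subcoalgebra A" "\<one> \<in> A" "\<And>x y. x \<in> A \<Longrightarrow> y \<in> A \<Longrightarrow> x \<otimes> y \<in> A" "\<And>x. x \<in> A \<Longrightarrow> \<S> x \<in> A"
  shows "hopf_subalgebra A H"
proof -
  note Asub = subspaceD[OF subcoalgebraD(1)[OF assms(1)]]
  have "subring A H" using Asub assms by (intro subringI) auto
  then show ?thesis unfolding hopf_subalgebra_def
    using Asub(4) assms(4) subcoalgebra_representative[OF assms(1)] by blast
qed

lemma mem_if_annihilated':
  assumes "submodule W scalars H" "x \<in> carrier H"
    "\<And>\<phi>. linear_form H \<phi> \<Longrightarrow> (\<And>w. w \<in> W \<Longrightarrow> \<phi> w = 0) \<Longrightarrow> \<phi> x = 0"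
  shows "x \<in> W"
  by (rule mem_if_annihilated[OF fd assms(1,2)]) (rule assms(3))

definition contract_left :: "('a \<Rightarrow> 'k) \<Rightarrow> 'a \<Rightarrow> 'a" where
  "contract_left f h = sweedler H (\<lambda>x y. f x \<odot> y) (\<Delta> h)"

definition contract_right :: "('a \<Rightarrow> 'k) \<Rightarrow> 'a \<Rightarrow> 'a" where
  "contract_right f h = sweedler H (\<lambda>x y. f y \<odot> x) (\<Delta> h)"

lemma contract_closed:
  "h \<in> carrier H \<Longrightarrow> contract_left f h \<in> carrier H" "h \<in> carrier H \<Longrightarrow> contract_right f h \<in> carrier H"
  unfolding contract_left_def contract_right_def
  by (auto intro!: sweedler_closed[OF vspace_axioms comult_closed])

lemma sweedler_sw:
  assumes "h \<in> carrier H" "linear_form H \<phi>" "\<And>x y. x \<in> carrier H \<Longrightarrow> y \<in> carrier H \<Longrightarrow> \<beta> x y \<in> carrier H"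
    "bilinear_form H H (\<lambda>x y. \<phi> (\<beta> x y))"
  shows "\<phi> (sweedler H \<beta> (\<Delta> h)) = sw h (\<lambda>x y. \<phi> (\<beta> x y))"
  using sweedler_form[OF vspace_axioms comult_closed[OF assms(1)] assms(2), of \<beta>] assms(3)
    sw_eq[OF assms(4,1)] by simp

lemma contract_form:
  assumes h: "h \<in> carrier H" and f: "linear_form H f" and \<phi>: "linear_form H \<phi>"
  shows "\<phi> (contract_left f h) = sw h (\<lambda>x y. f x * \<phi> y)" "\<phi> (contract_right f h) = sw h (\<lambda>x y. \<phi> x * f y)"
proof -
  note fD = linear_formD[OF f] and \<phi>D = linear_formD[OF \<phi>]
  have "bilinear_form H H (\<lambda>x y. \<phi> (f x \<odot> y))" "bilinear_form H H (\<lambda>x y. \<phi> (f y \<odot> x))"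
    by (intro bilinear_formI; simp add: lin fD \<phi>D)+
  then show "\<phi> (contract_left f h) = sw h (\<lambda>x y. f x * \<phi> y)" "\<phi> (contract_right f h) = sw h (\<lambda>x y. \<phi> x * f y)"
    unfolding contract_left_def contract_right_def using h
    by (simp_all add: sweedler_sw \<phi> \<phi>D mult.commute)
qed

lemma contract_mem:
  assumes A: "subcoalgebra A" "a \<in> A" and f: "linear_form H f"
  shows "contract_left f a \<in> A" "contract_right f a \<in> A"
proof -
  note Asub = subcoalgebraD(1)[OF A(1)]
  have ac: "a \<in> carrier H" using A subspaceD(1)[OF Asub] by auto
  note fD = linear_formD[OF f]
  show "contract_left f a \<in> A"
  proof (rule mem_if_annihilated'[OF Asub contract_closed(1)[OF ac]])
    fix \<phi> assume \<phi>: "linear_form H \<phi>" "\<And>w. w \<in> A \<Longrightarrow> \<phi> w = 0"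
    have "bilinear_form H H (\<lambda>x y. f x * \<phi> y)"
      by (intro bilinear_formI) (simp_all add: lin fD linear_formD[OF \<phi>(1)])
    from subcoalgebraD(2)[OF A this] show "\<phi> (contract_left f a) = 0"
      using \<phi>(2) by (simp add: contract_form[OF ac f \<phi>(1)])
  qed
  show "contract_right f a \<in> A"
  proof (rule mem_if_annihilated'[OF Asub contract_closed(2)[OF ac]])
    fix \<phi> assume \<phi>: "linear_form H \<phi>" "\<And>w. w \<in> A \<Longrightarrow> \<phi> w = 0"
    have "bilinear_form H H (\<lambda>x y. \<phi> x * f y)"
      by (intro bilinear_formI) (simp_all add: lin fD linear_formD[OF \<phi>(1)])
    from subcoalgebraD(2)[OF A this] show "\<phi> (contract_right f a) = 0"
      using \<phi>(2) by (simp add: contract_form[OF ac f \<phi>(1)])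
  qed
qed

lemma sw_contract:
  assumes h: "h \<in> carrier H" and b: "bilinear_form H H b"
  shows "sw h b = (\<Sum>i\<in>B. b i (contract_left (d i) h))" "sw h b = (\<Sum>i\<in>B. b (contract_right (d i) h) i)"
proof -
  note Bc = basis_props(2,3)
  have "sw h b = sw h (\<lambda>x y. \<Sum>i\<in>B. d i x * b i y)"
    using dual_sum(1)[OF bilinear_formD(1)[OF b]] by (intro sw_cong refl) simp
  also have "\<dots> = (\<Sum>i\<in>B. b i (contract_left (d i) h))"
    unfolding sw_sum using Bc by (intro sum.cong refl contract_form(1)[OF h, symmetric] bilinear_formD(2)[OF b]) auto
  finally show "sw h b = (\<Sum>i\<in>B. b i (contract_left (d i) h))" .
  have "sw h b = sw h (\<lambda>x y. \<Sum>i\<in>B. b x i * d i y)"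
    using dual_sum(2)[OF bilinear_formD(2)[OF b]] by (intro sw_cong refl) simp
  also have "\<dots> = (\<Sum>i\<in>B. b (contract_right (d i) h) i)"
    unfolding sw_sum using Bc by (intro sum.cong refl contract_form(2)[OF h, symmetric] bilinear_formD(1)[OF b]) auto
  finally show "sw h b = (\<Sum>i\<in>B. b (contract_right (d i) h) i)" .
qed

text \<open>\<open>(A \<otimes> A) \<inter> (E \<otimes> E) = (A \<inter> E) \<otimes> (A \<inter> E)\<close>: all contractions \<open>f(a\<^sub>1) a\<^sub>2\<close> and \<open>a\<^sub>1 f(a\<^sub>2)\<close> lie in \<open>A \<inter> E\<close>, so a
  projection onto \<open>A \<inter> E\<close> may be inserted in the second leg, after which the first leg is contracted.\<close>

lemma subcoalgebra_Int:
  assumes A: "subcoalgebra A" and E: "subcoalgebra E"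
  shows "subcoalgebra (A \<inter> E)"
proof -
  note AD = subspaceD[OF subcoalgebraD(1)[OF A]] and ED = subspaceD[OF subcoalgebraD(1)[OF E]]
  have sub: "submodule (A \<inter> E) scalars H" using AD ED by (intro subspaceI) auto
  obtain p where p: "linear_map H H p" "\<And>x. x \<in> carrier H \<Longrightarrow> p x \<in> A \<inter> E" "\<And>x. x \<in> A \<inter> E \<Longrightarrow> p x = x"
    using projection_exists[OF fd sub] by blast
  note pD = linear_mapD[OF p(1)]
  show ?thesis unfolding subcoalgebra_def
  proof (intro conjI sub ballI allI impI)
    fix a b assume a: "a \<in> A \<inter> E" and b: "bilinear_form H H b" and z: "\<forall>x\<in>A \<inter> E. \<forall>y\<in>A \<inter> E. b x y = 0"
    have ac: "a \<in> carrier H" using a AD(1) by auto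
    have c: "contract_left (d i) a \<in> A \<inter> E" "contract_right (d i) a \<in> A \<inter> E" if "i \<in> B" for i
      using contract_mem[OF A _ basis_props(3)[OF that], of a] contract_mem[OF E _ basis_props(3)[OF that], of a] a
      by auto
    have b': "bilinear_form H H (\<lambda>x y. b x (p y))"
      using pD by (intro bilinear_formI) (simp_all add: bilinear_formD(3-)[OF b])
    have "sw a b = (\<Sum>i\<in>B. b i (p (contract_left (d i) a)))"
      using sw_contract(1)[OF ac b] p(3)[OF c(1)] by simp
    also have "\<dots> = sw a (\<lambda>x y. b x (p y))" using sw_contract(1)[OF ac b'] by simp
    also have "\<dots> = (\<Sum>i\<in>B. b (contract_right (d i) a) (p i))" by (rule sw_contract(2)[OF ac b'])
    also have "\<dots> = 0" using c(2) z p(2) basis_props(2) by (intro sum.neutral) blast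
    finally show "sw a b = 0" .
  qed
qed

lemma hopf_subalgebra_Int:
  assumes "hopf_subalgebra A H" "hopf_subalgebra E H"
  shows "hopf_subalgebra (A \<inter> E) H"
  using hopf_subalgebraD[OF assms(1)] hopf_subalgebraD[OF assms(2)]
  by (intro hopf_subalgebraI subcoalgebra_Int) auto

end

subsection \<open>Restriction\<close>

lemma restrict_hopf_simps [simp]:
  "carrier (restrict_hopf H A) = A" "monoid.mult (restrict_hopf H A) = monoid.mult H"
  "\<one>\<^bsub>restrict_hopf H A\<^esub> = \<one>\<^bsub>H\<^esub>" "\<zero>\<^bsub>restrict_hopf H A\<^esub> = \<zero>\<^bsub>H\<^esub>"
  "add (restrict_hopf H A) = add H" "module.smult (restrict_hopf H A) = module.smult H"
  "counit (restrict_hopf H A) = counit H" "antipode (restrict_hopf H A) = antipode H"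
  "comult (restrict_hopf H A) a = {f \<in> comult H a. Poly_Mapping.keys f \<subseteq> A \<times> A}"
  by (simp_all add: restrict_hopf_def)

context fd_hopf
begin

lemma restrict_vspace:
  assumes "submodule A scalars H" shows "vspace (restrict_hopf H A)"
proof -
  interpret A: vspace "H\<lparr>carrier := A\<rparr>" by (rule subspace_vspace[OF assms])
  have "module scalars (H\<lparr>carrier := A\<rparr>)" by (rule A.module_axioms)
  then show ?thesis unfolding vspace_def module_def module_axioms_def abelian_group_def abelian_group_axioms_def
     abelian_monoid_def restrict_hopf_def by simp
qed

lemma bilinear_form_restrict:
  "A \<subseteq> carrier H \<Longrightarrow> bilinear_form H H b \<Longrightarrow> bilinear_form (restrict_hopf H A) (restrict_hopf H A) b"
  by (intro bilinear_formI) (auto simp: bilinear_formD(3-) subset_iff)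

lemma bilinear_form_extend:
  assumes A: "submodule A scalars H" and b: "bilinear_form (restrict_hopf H A) (restrict_hopf H A) b"
  obtains b' where "bilinear_form H H b'" "\<And>x y. x \<in> A \<Longrightarrow> y \<in> A \<Longrightarrow> b' x y = b x y"
proof -
  obtain p where p: "linear_map H H p" "\<And>x. x \<in> carrier H \<Longrightarrow> p x \<in> A" "\<And>x. x \<in> A \<Longrightarrow> p x = x"
    using projection_exists[OF fd A] by blast
  have "bilinear_form H H (\<lambda>x y. b (p x) (p y))"
    using bilinear_formD(3-)[OF b] by (intro bilinear_formI) (simp_all add: linear_mapD(2,3)[OF p(1)] p(2))
  then show ?thesis by (rule that) (simp add: p(3))
qed

text \<open>Bilinear forms on \<open>A\<close> are the restrictions of those on \<open>H\<close>, so two formal sums over \<open>A \<times> A\<close> that agree modulo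
  the relations of \<open>H\<close> agree modulo those of \<open>A\<close>.\<close>

lemma restrict_comult:
  assumes A: "hopf_subalgebra A H" and a: "a \<in> A"
  shows "\<Delta>\<^bsub>restrict_hopf H A\<^esub> a \<in> carrier (tensor (restrict_hopf H A) (restrict_hopf H A))"
    and "bilinear_form H H b \<Longrightarrow> tensor_form b (\<Delta>\<^bsub>restrict_hopf H A\<^esub> a) = sw a b"
proof -
  let ?K = "restrict_hopf H A"
  note AD = hopf_subalgebraD[OF A]
  have ac: "a \<in> carrier H" using a AD by auto
  obtain f where f: "f \<in> \<Delta> a" "Poly_Mapping.keys f \<subseteq> A \<times> A"
    using subcoalgebra_representative[OF AD(6) a] by blast
  have fK: "f \<in> fsums ?K ?K" using f by (simp add: fsums_def)
  obtain f0 where f0: "f0 \<in> fsums H H" "\<Delta> a = tclass H H f0" using comult_closed[OF ac] by (rule tensor_cases)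
  have "\<Delta>\<^bsub>?K\<^esub> a = tclass ?K ?K f"
  proof (rule Set.set_eqI)
    fix g
    have "(\<forall>b. bilinear_form H H b \<longrightarrow> eval_form b g = eval_form b f) \<longleftrightarrow>
        (\<forall>b. bilinear_form ?K ?K b \<longrightarrow> eval_form b g = eval_form b f)" if g: "Poly_Mapping.keys g \<subseteq> A \<times> A"
    proof (intro iffI allI impI)
      fix b assume *: "\<forall>b. bilinear_form H H b \<longrightarrow> eval_form b g = eval_form b f" and b: "bilinear_form ?K ?K b"
      obtain b' where b': "bilinear_form H H b'" "\<And>x y. x \<in> A \<Longrightarrow> y \<in> A \<Longrightarrow> b' x y = b x y"
        using bilinear_form_extend[OF AD(1) b] by blast
      have "eval_form b g = eval_form b' g" "eval_form b f = eval_form b' f"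
        using g f(2) b'(2) by (auto intro!: eval_form_cong)
      then show "eval_form b g = eval_form b f" using * b'(1) by simp
    next
      fix b assume *: "\<forall>b. bilinear_form ?K ?K b \<longrightarrow> eval_form b g = eval_form b f" and b: "bilinear_form H H b"
      then show "eval_form b g = eval_form b f" using bilinear_form_restrict[OF AD(2) b] by simp
    qed
    moreover have "Poly_Mapping.keys g \<subseteq> carrier H \<times> carrier H" if "Poly_Mapping.keys g \<subseteq> A \<times> A"
      using that AD(2) by blast
    moreover have "\<forall>b. bilinear_form H H b \<longrightarrow> eval_form b f = eval_form b f0"
      using f(1) unfolding f0(2) by (simp add: tclass_mem)
    ultimately show "g \<in> \<Delta>\<^bsub>?K\<^esub> a \<longleftrightarrow> g \<in> tclass ?K ?K f"
      unfolding restrict_hopf_simps f0(2) mem_Collect_eq tclass_mem fsums_def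
      by (cases "Poly_Mapping.keys g \<subseteq> A \<times> A") simp_all
  qed
  then show closed: "\<Delta>\<^bsub>?K\<^esub> a \<in> carrier (tensor ?K ?K)" using fK by (simp add: tensor_carrier)
  assume b: "bilinear_form H H b"
  have "f \<in> \<Delta>\<^bsub>?K\<^esub> a" using f by simp
  then have "tensor_form b (\<Delta>\<^bsub>?K\<^esub> a) = eval_form b f"
    by (rule tensor_form_eval[OF closed bilinear_form_restrict[OF AD(2) b]])
  also have "\<dots> = sw a b" using sw_eq[OF b ac] tensor_form_eval[OF comult_closed[OF ac] b f(1)] by simp
  finally show "tensor_form b (\<Delta>\<^bsub>?K\<^esub> a) = sw a b" .
qed

lemma restrict_form_cong:
  assumes A: "hopf_subalgebra A H" and a: "a \<in> A" and "bilinear_form H H b" "\<And>x y. x \<in> A \<Longrightarrow> y \<in> A \<Longrightarrow> b' x y = b x y"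
  shows "tensor_form b' (\<Delta>\<^bsub>restrict_hopf H A\<^esub> a) = sw a b"
  using tensor_form_cong[OF restrict_comult(1)[OF A a], of b' b] restrict_comult(2)[OF A a assms(3)] assms(4) by simp

text \<open>Forms on \<open>A\<close> are extended to \<open>H\<close> by composing them with a projection \<open>p\<close>; the identities of \<open>H\<close> for the
  extended forms are those of \<open>A\<close>.\<close>

lemma fdhopf_restrict:
  assumes A: "hopf_subalgebra A H"
  shows "fdhopf (restrict_hopf H A)"
proof -
  let ?K = "restrict_hopf H A"
  note AD = hopf_subalgebraD[OF A]
  have Ac: "x \<in> A \<Longrightarrow> x \<in> carrier H" for x using AD(2) by auto
  obtain p where p: "linear_map H H p" "\<And>x. x \<in> carrier H \<Longrightarrow> p x \<in> A" "\<And>x. x \<in> A \<Longrightarrow> p x = x"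
    using projection_exists[OF fd AD(1)] by blast
  note pD = linear_mapD[OF p(1)]
  interpret K: vspace ?K by (rule restrict_vspace[OF AD(1)])
  have "ring (H\<lparr>carrier := A\<rparr>)" using A by (intro subring_is_ring) (simp add: hopf_subalgebra_def)
  then have ringK: "ring ?K"
    unfolding ring_def ring_axioms_def abelian_group_def abelian_monoid_def abelian_group_axioms_def monoid_def restrict_hopf_def
    by simp
  have alg: "kalgebra ?K"
    by (intro kalgebra.intro kalgebra_axioms.intro ringK K.vspace_axioms) (simp_all add: Ac smult_mult)
  have fdK: "finite_dimensional ?K"
  proof (rule finite_dimensional_image[OF vspace_axioms K.vspace_axioms _ _ fd])
    show "linear_map H ?K p" using p(2) pD by (intro linear_mapI) simp_all
    have "x \<in> p ` carrier H" if "x \<in> A" for x using imageI[OF Ac[OF that], of p] p(3)[OF that] by simp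
    then show "p ` carrier H = carrier ?K" using p(2) by auto
  qed
  have ext1: "linear_form H (\<lambda>x. \<phi> (p x))" if "linear_form ?K \<phi>" for \<phi>
    using linear_formD[OF that] by (intro linI) (simp_all add: pD p(2))
  have ext2: "bilinear_form H H (\<lambda>x y. b (p x) (p y))" if "bilinear_form ?K ?K b" for b
    using bilinear_formD(3-)[OF that] by (intro bilinear_formI) (simp_all add: pD p(2))
  note rc = restrict_form_cong[OF A]
  have "hopf_algebra ?K"
  proof (rule hopf_algebraI[OF alg fdK])
    show "\<Delta>\<^bsub>?K\<^esub> h \<in> carrier (tensor ?K ?K)" if "h \<in> carrier ?K" for h
      using restrict_comult(1)[OF A] that by simp
  next
    fix b assume b: "bilinear_form ?K ?K b"
    let ?b = "\<lambda>x y. b (p x) (p y)"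
    have sw: "tensor_form b (\<Delta>\<^bsub>?K\<^esub> a) = sw a ?b" if "a \<in> A" for a
      using that by (rule rc[OF _ ext2[OF b]]) (simp add: p(3))
    show "linear_form ?K (\<lambda>h. tensor_form b (\<Delta>\<^bsub>?K\<^esub> h))"
      unfolding linear_form_def using subspaceD(3,4)[OF AD(1)] by (simp add: sw Ac del: restrict_hopf_simps(9))
    show "tensor_form b (\<Delta>\<^bsub>?K\<^esub> \<one>\<^bsub>?K\<^esub>) = b \<one>\<^bsub>?K\<^esub> \<one>\<^bsub>?K\<^esub>"
      using sw[OF AD(3)] sw_one[OF ext2[OF b]] p(3)[OF AD(3)] by (simp del: restrict_hopf_simps(9))
    fix x y assume "x \<in> carrier ?K" "y \<in> carrier ?K"
    then have xy: "x \<in> A" "y \<in> A" by auto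
    note b2 = bilinear_formD(3-)[OF ext2[OF b]]
    have "tensor_form (\<lambda>u v. tensor_form (\<lambda>u' v'. b (u \<otimes> u') (v \<otimes> v')) (\<Delta>\<^bsub>?K\<^esub> y)) (\<Delta>\<^bsub>?K\<^esub> x) =
        sw x (\<lambda>u v. sw y (\<lambda>u' v'. ?b (u \<otimes> u') (v \<otimes> v')))"
    proof (rule rc[OF xy(1)])
      show "bilinear_form H H (\<lambda>u v. sw y (\<lambda>u' v'. ?b (u \<otimes> u') (v \<otimes> v')))"
        by (intro bilinear_formI) (simp_all add: lin b2)
      fix u v assume uv: "u \<in> A" "v \<in> A"
      show "tensor_form (\<lambda>u' v'. b (u \<otimes> u') (v \<otimes> v')) (\<Delta>\<^bsub>?K\<^esub> y) = sw y (\<lambda>u' v'. ?b (u \<otimes> u') (v \<otimes> v'))"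
      proof (rule rc[OF xy(2)])
        show "bilinear_form H H (\<lambda>u' v'. ?b (u \<otimes> u') (v \<otimes> v'))"
          using uv Ac by (intro bilinear_formI) (simp_all add: lin b2)
      qed (use uv AD(4) p(3) in simp)
    qed
    also have "\<dots> = sw (x \<otimes> y) ?b" using sw_mult[OF ext2[OF b]] xy Ac by simp
    also have "\<dots> = tensor_form b (\<Delta>\<^bsub>?K\<^esub> (x \<otimes> y))" using sw[OF AD(4)[OF xy]] by simp
    finally show "tensor_form b (\<Delta>\<^bsub>?K\<^esub> (x \<otimes>\<^bsub>?K\<^esub> y)) =
      tensor_form (\<lambda>u v. tensor_form (\<lambda>u' v'. b (u \<otimes>\<^bsub>?K\<^esub> u') (v \<otimes>\<^bsub>?K\<^esub> v')) (\<Delta>\<^bsub>?K\<^esub> y)) (\<Delta>\<^bsub>?K\<^esub> x)"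
      by (simp del: restrict_hopf_simps(9))
  next
    show "linear_form ?K \<epsilon>\<^bsub>?K\<^esub>" using Ac by (simp add: linear_form_def)
    show "\<epsilon>\<^bsub>?K\<^esub> (x \<otimes>\<^bsub>?K\<^esub> y) = \<epsilon>\<^bsub>?K\<^esub> x * \<epsilon>\<^bsub>?K\<^esub> y" if "x \<in> carrier ?K" "y \<in> carrier ?K" for x y
      using that Ac by simp
    show "\<epsilon>\<^bsub>?K\<^esub> \<one>\<^bsub>?K\<^esub> = 1" by simp
    show "linear_map ?K ?K \<S>\<^bsub>?K\<^esub>" using Ac AD(5) antipode_lin by (simp add: linear_map_def)
  next
    fix t h assume t: "trilinear_form ?K t" and "h \<in> carrier ?K"
    then have h: "h \<in> A" by simp
    let ?t = "\<lambda>x y z. t (p x) (p y) (p z)"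
    have t3: "trilinear_form H ?t"
      using bilinear_formD(3-)[OF trilinear_formD(1)[OF t]] linear_formD[OF trilinear_formD(2)[OF t]]
      by (intro trilinear_formI) (simp_all add: pD p(2))
    have "tensor_form (\<lambda>x z. tensor_form (\<lambda>u v. t u v z) (\<Delta>\<^bsub>?K\<^esub> x)) (\<Delta>\<^bsub>?K\<^esub> h) = sw h (\<lambda>x z. sw x (\<lambda>u v. ?t u v z))"
    proof (rule rc[OF h])
      show "bilinear_form H H (\<lambda>x z. sw x (\<lambda>u v. ?t u v z))"
        by (intro bilinear_formI) (simp_all add: linear_formD[OF trilinear_formD(4)[OF t3]])
      show "tensor_form (\<lambda>u v. t u v z) (\<Delta>\<^bsub>?K\<^esub> x) = sw x (\<lambda>u v. ?t u v z)" if "x \<in> A" "z \<in> A" for x z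
        using that by (intro rc trilinear_formD(5)[OF t3]) (simp_all add: p(3) Ac)
    qed
    also have "\<dots> = sw h (\<lambda>x z. sw z (\<lambda>u v. ?t x u v))" using h Ac by (intro coassoc_sw t3) auto
    also have "\<dots> = tensor_form (\<lambda>x z. tensor_form (\<lambda>u v. t x u v) (\<Delta>\<^bsub>?K\<^esub> z)) (\<Delta>\<^bsub>?K\<^esub> h)"
    proof (rule rc[OF h, symmetric])
      show "bilinear_form H H (\<lambda>x z. sw z (\<lambda>u v. ?t x u v))"
        by (intro bilinear_formI) (simp_all add: linear_formD[OF trilinear_formD(2)[OF t3]])
      show "tensor_form (\<lambda>u v. t x u v) (\<Delta>\<^bsub>?K\<^esub> z) = sw z (\<lambda>u v. ?t x u v)" if "x \<in> A" "z \<in> A" for x z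
        using that by (intro rc trilinear_formD(1)[OF t3]) (simp_all add: p(3) Ac)
    qed
    finally show "tensor_form (\<lambda>x z. tensor_form (\<lambda>u v. t u v z) (\<Delta>\<^bsub>?K\<^esub> x)) (\<Delta>\<^bsub>?K\<^esub> h) =
       tensor_form (\<lambda>x z. tensor_form (\<lambda>u v. t x u v) (\<Delta>\<^bsub>?K\<^esub> z)) (\<Delta>\<^bsub>?K\<^esub> h)" .
  next
    fix \<phi> h assume \<phi>: "linear_form ?K \<phi>" and "h \<in> carrier ?K"
    then have h: "h \<in> A" "h \<in> carrier H" using Ac by auto
    let ?\<phi> = "\<lambda>x. \<phi> (p x)"
    note \<phi>' = ext1[OF \<phi>] and \<phi>D = linear_formD[OF ext1[OF \<phi>]]
    have "tensor_form (\<lambda>x y. \<epsilon> x * \<phi> y) (\<Delta>\<^bsub>?K\<^esub> h) = sw h (\<lambda>x y. \<epsilon> x * ?\<phi> y)"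
      by (rule rc[OF h(1)], intro bilinear_formI) (simp_all add: lin \<phi>D p(3))
    then show "tensor_form (\<lambda>x y. \<epsilon>\<^bsub>?K\<^esub> x * \<phi> y) (\<Delta>\<^bsub>?K\<^esub> h) = \<phi> h"
      using counit_sw(1)[OF \<phi>' h(2)] p(3)[OF h(1)] by (simp del: restrict_hopf_simps(9))
    have "tensor_form (\<lambda>x y. \<epsilon> y * \<phi> x) (\<Delta>\<^bsub>?K\<^esub> h) = sw h (\<lambda>x y. \<epsilon> y * ?\<phi> x)"
      by (rule rc[OF h(1)], intro bilinear_formI) (simp_all add: lin \<phi>D p(3))
    then show "tensor_form (\<lambda>x y. \<epsilon>\<^bsub>?K\<^esub> y * \<phi> x) (\<Delta>\<^bsub>?K\<^esub> h) = \<phi> h"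
      using counit_sw(2)[OF \<phi>' h(2)] p(3)[OF h(1)] by (simp del: restrict_hopf_simps(9))
    have "tensor_form (\<lambda>x y. \<phi> (\<S> x \<otimes> y)) (\<Delta>\<^bsub>?K\<^esub> h) = sw h (\<lambda>x y. ?\<phi> (\<S> x \<otimes> y))"
      by (rule rc[OF h(1)], intro bilinear_formI) (simp_all add: lin \<phi>D p(3) AD(4,5))
    then show "tensor_form (\<lambda>x y. \<phi> (\<S>\<^bsub>?K\<^esub> x \<otimes>\<^bsub>?K\<^esub> y)) (\<Delta>\<^bsub>?K\<^esub> h) = \<epsilon>\<^bsub>?K\<^esub> h * \<phi> \<one>\<^bsub>?K\<^esub>"
      using antipode_sw(1)[OF \<phi>' h(2)] p(3)[OF AD(3)] by (simp del: restrict_hopf_simps(9))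
    have "tensor_form (\<lambda>x y. \<phi> (x \<otimes> \<S> y)) (\<Delta>\<^bsub>?K\<^esub> h) = sw h (\<lambda>x y. ?\<phi> (x \<otimes> \<S> y))"
      by (rule rc[OF h(1)], intro bilinear_formI) (simp_all add: lin \<phi>D p(3) AD(4,5))
    then show "tensor_form (\<lambda>x y. \<phi> (x \<otimes>\<^bsub>?K\<^esub> \<S>\<^bsub>?K\<^esub> y)) (\<Delta>\<^bsub>?K\<^esub> h) = \<epsilon>\<^bsub>?K\<^esub> h * \<phi> \<one>\<^bsub>?K\<^esub>"
      using antipode_sw(2)[OF \<phi>' h(2)] p(3)[OF AD(3)] by (simp del: restrict_hopf_simps(9))
  qed
  then show ?thesis using fdK by (simp add: fdhopf_def)
qed

end

section \<open>Normal Hopf subalgebras and their products\<close>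

context fd_hopf
begin

definition adj_left :: "'a \<Rightarrow> 'a \<Rightarrow> 'a" where
  "adj_left h a = sweedler H (\<lambda>x y. x \<otimes> a \<otimes> \<S> y) (\<Delta> h)"

definition adj_right :: "'a \<Rightarrow> 'a \<Rightarrow> 'a" where
  "adj_right h a = sweedler H (\<lambda>x y. \<S> x \<otimes> a \<otimes> y) (\<Delta> h)"

lemma normal_iff:
  "normal_hopf_subalgebra A H \<longleftrightarrow> hopf_subalgebra A H \<and>
     (\<forall>h\<in>carrier H. \<forall>a\<in>A. adj_left h a \<in> A \<and> adj_right h a \<in> A)"
  unfolding normal_hopf_subalgebra_def adj_left_def adj_right_def ..

lemma adj_closed [simp]:
  assumes "h \<in> carrier H" "a \<in> carrier H"
  shows "adj_left h a \<in> carrier H" "adj_right h a \<in> carrier H"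
  unfolding adj_left_def adj_right_def using assms
  by (auto intro!: sweedler_closed[OF vspace_axioms comult_closed])

lemma adj_form:
  assumes h: "h \<in> carrier H" and a: "a \<in> carrier H" and \<phi>: "linear_form H \<phi>"
  shows "\<phi> (adj_left h a) = sw h (\<lambda>x y. \<phi> (x \<otimes> (a \<otimes> \<S> y)))"
    "\<phi> (adj_right h a) = sw h (\<lambda>x y. \<phi> (\<S> x \<otimes> (a \<otimes> y)))"
proof -
  note \<phi>D = linear_formD[OF \<phi>]
  have 1: "bilinear_form H H (\<lambda>x y. \<phi> (x \<otimes> a \<otimes> \<S> y))" "bilinear_form H H (\<lambda>x y. \<phi> (\<S> x \<otimes> a \<otimes> y))"
    using a by - (intro bilinear_formI; simp add: lin \<phi>D)+
  show "\<phi> (adj_left h a) = sw h (\<lambda>x y. \<phi> (x \<otimes> (a \<otimes> \<S> y)))"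
    unfolding adj_left_def using h a by (subst sweedler_sw[OF h \<phi> _ 1(1)]) (simp_all add: m_assoc)
  show "\<phi> (adj_right h a) = sw h (\<lambda>x y. \<phi> (\<S> x \<otimes> (a \<otimes> y)))"
    unfolding adj_right_def using h a by (subst sweedler_sw[OF h \<phi> _ 1(2)]) (simp_all add: m_assoc)
qed

lemma counit_adj:
  assumes h: "h \<in> carrier H" and a: "a \<in> carrier H"
  shows "\<epsilon> (adj_right h a) = \<epsilon> h * \<epsilon> a"
proof -
  have "\<epsilon> (adj_right h a) = sw h (\<lambda>x y. \<epsilon> a * (\<epsilon> x * \<epsilon> y))"
    unfolding adj_form(2)[OF h a counit_form] using a by (intro sw_cong refl) simp
  also have "\<dots> = \<epsilon> a * \<epsilon> h" using counit_sw(1)[OF counit_form h] by simp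
  finally show ?thesis by simp
qed

subsection \<open>Products of subspaces\<close>

lemma ideal_prod_subspace:
  assumes M: "submodule M scalars H" and N: "N \<subseteq> carrier H" "y \<in> N"
  shows "submodule (ideal_prod H M N) scalars H"
proof (rule subspaceI)
  note MD = subspaceD[OF M]
  show "ideal_prod H M N \<subseteq> carrier H"
  proof
    fix z assume "z \<in> ideal_prod H M N"
    then show "z \<in> carrier H" using MD(1) N(1) by induction auto
  qed
  have "\<zero> \<otimes> y \<in> ideal_prod H M N" by (rule ideal_prod.prod[OF MD(2) N(2)])
  then show "\<zero> \<in> ideal_prod H M N" using N by (simp add: subset_iff)
  show "x \<oplus> y \<in> ideal_prod H M N" if "x \<in> ideal_prod H M N" "y \<in> ideal_prod H M N" for x y
    using that by (rule ideal_prod.sum)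
  show "c \<odot> x \<in> ideal_prod H M N" if "x \<in> ideal_prod H M N" for c x
    using that
  proof induction
    case (prod i j)
    then have "c \<odot> (i \<otimes> j) = (c \<odot> i) \<otimes> j" using MD(1) N by (simp add: smult_mult subset_iff)
    then show ?case using ideal_prod.prod[OF MD(4)[OF prod(1)] prod(2)] by simp
  next
    case (sum s1 s2)
    have "s \<in> carrier H" if "s \<in> ideal_prod H M N" for s
      using that MD(1) N(1) by induction auto
    then show ?case using sum by (simp add: vs_distr ideal_prod.sum)
  qed
qed

lemma ideal_prod_kill:
  assumes "M \<subseteq> carrier H" "N \<subseteq> carrier H" and \<phi>: "linear_form H \<phi>"
    and "\<And>x y. x \<in> M \<Longrightarrow> y \<in> N \<Longrightarrow> \<phi> (x \<otimes> y) = 0" and z: "z \<in> ideal_prod H M N"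
  shows "\<phi> z = 0"
proof -
  have "z \<in> carrier H \<and> \<phi> z = 0" using z
    by induction (use assms(1,2,4) linear_formD[OF \<phi>] in \<open>auto simp: subset_iff\<close>)
  then show ?thesis by simp
qed

lemma mult_linear_forms:
  assumes "linear_form H \<phi>" "x \<in> carrier H"
  shows "linear_form H (\<lambda>w. \<phi> (x \<otimes> w))" "linear_form H (\<lambda>w. \<phi> (w \<otimes> x))"
  using assms by (auto intro!: linI simp: lin linear_formD)

context
  fixes A C
  assumes A: "normal_hopf_subalgebra A H" and C: "hopf_subalgebra C H"
begin

lemma prod_inclusions:
  "hopf_subalgebra A H" "A \<subseteq> carrier H" "C \<subseteq> carrier H" "submodule (ideal_prod H A C) scalars H"
  "A \<subseteq> ideal_prod H A C" "C \<subseteq> ideal_prod H A C"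
proof -
  show A': "hopf_subalgebra A H" using A by (simp add: normal_hopf_subalgebra_def)
  note AD = hopf_subalgebraD[OF A'] and CD = hopf_subalgebraD[OF C]
  show "A \<subseteq> carrier H" "C \<subseteq> carrier H" by (fact AD(2) CD(2))+
  show "submodule (ideal_prod H A C) scalars H" by (rule ideal_prod_subspace[OF AD(1) CD(2,3)])
  show "A \<subseteq> ideal_prod H A C" using ideal_prod.prod[OF _ CD(3), of _ A H] AD(2) by (auto simp: subset_iff)
  show "C \<subseteq> ideal_prod H A C" using ideal_prod.prod[OF AD(3), of _ C H] CD(2) by (auto simp: subset_iff)
qed

text \<open>\<open>b a = (b\<^sub>1 a S(b\<^sub>2)) b\<^sub>3\<close>, where the bracket is in \<open>A\<close> by normality and \<open>b\<^sub>3\<close> in \<open>C\<close>.\<close>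

lemma prod_swap_mem:
  assumes b: "b \<in> C" and a: "a \<in> A"
  shows "b \<otimes> a \<in> ideal_prod H A C"
proof (rule mem_if_annihilated'[OF prod_inclusions(4)])
  note AD = hopf_subalgebraD[OF prod_inclusions(1)] and CD = hopf_subalgebraD[OF C]
  have ac: "a \<in> carrier H" and bc: "b \<in> carrier H" using a b AD CD by auto
  then show "b \<otimes> a \<in> carrier H" by simp
  fix \<phi> assume \<phi>: "linear_form H \<phi>" "\<And>w. w \<in> ideal_prod H A C \<Longrightarrow> \<phi> w = 0"
  note \<phi>D = linear_formD[OF \<phi>(1)]
  have "\<phi> (b \<otimes> a) = sw b (\<lambda>x r. \<epsilon> r * \<phi> (x \<otimes> a))"
    using mult_linear_forms(2)[OF \<phi>(1) ac] bc by (simp add: counit_sw(2))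
  also have "\<dots> = sw b (\<lambda>x r. sw r (\<lambda>y v. \<phi> (x \<otimes> (a \<otimes> (\<S> y \<otimes> v)))))"
  proof (rule sw_cong[OF refl])
    fix x r assume xr: "x \<in> carrier H" "r \<in> carrier H"
    have "linear_form H (\<lambda>w. \<phi> (x \<otimes> (a \<otimes> w)))" using xr ac by (intro linI) (simp_all add: lin \<phi>D)
    from antipode_sw(1)[OF this xr(2)]
    show "\<epsilon> r * \<phi> (x \<otimes> a) = sw r (\<lambda>y v. \<phi> (x \<otimes> (a \<otimes> (\<S> y \<otimes> v))))" using ac by simp
  qed
  also have "\<dots> = sw b (\<lambda>u v. sw u (\<lambda>x y. \<phi> (x \<otimes> (a \<otimes> (\<S> y \<otimes> v)))))"
    using ac bc by (intro coassoc_sw[symmetric] trilinear_formI) (simp_all add: lin \<phi>D)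
  also have "\<dots> = 0"
  proof (rule subcoalgebraD(2)[OF CD(6) b])
    show "bilinear_form H H (\<lambda>u v. sw u (\<lambda>x y. \<phi> (x \<otimes> (a \<otimes> (\<S> y \<otimes> v)))))"
      using ac by (intro bilinear_formI) (simp_all add: lin \<phi>D)
    fix u v assume uv: "u \<in> C" "v \<in> C"
    have uvc: "u \<in> carrier H" "v \<in> carrier H" using uv CD by auto
    have "sw u (\<lambda>x y. \<phi> (x \<otimes> (a \<otimes> (\<S> y \<otimes> v)))) = sw u (\<lambda>x y. \<phi> ((x \<otimes> (a \<otimes> \<S> y)) \<otimes> v))"
      using ac uvc by (simp add: m_assoc)
    also have "\<dots> = \<phi> (adj_left u a \<otimes> v)"
      by (rule adj_form(1)[symmetric, OF uvc(1) ac mult_linear_forms(2)[OF \<phi>(1) uvc(2)]])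
    also have "\<dots> = 0"
    proof -
      have "adj_left u a \<in> A" using A uvc(1) a by (simp add: normal_iff)
      then show ?thesis using uv by (intro \<phi>(2) ideal_prod.prod)
    qed
    finally show "sw u (\<lambda>x y. \<phi> (x \<otimes> (a \<otimes> (\<S> y \<otimes> v)))) = 0" .
  qed
  finally show "\<phi> (b \<otimes> a) = 0" .
qed

text \<open>\<open>(a b) (a' b') = a (b a') b'\<close>, and \<open>b a'\<close> can be rewritten with the factor from \<open>A\<close> in front.\<close>

lemma prod_mult_closed:
  assumes "x \<in> ideal_prod H A C" "y \<in> ideal_prod H A C"
  shows "x \<otimes> y \<in> ideal_prod H A C"
proof (rule mem_if_annihilated'[OF prod_inclusions(4)])
  let ?P = "ideal_prod H A C"
  note AD = hopf_subalgebraD[OF prod_inclusions(1)] and CD = hopf_subalgebraD[OF C]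
  have Pc: "?P \<subseteq> carrier H" using subspaceD(1)[OF prod_inclusions(4)] .
  have Ac: "x \<in> A \<Longrightarrow> x \<in> carrier H" and Cc: "x \<in> C \<Longrightarrow> x \<in> carrier H" for x using AD(2) CD(2) by auto
  show "x \<otimes> y \<in> carrier H" using assms Pc by auto
  fix \<phi> assume \<phi>: "linear_form H \<phi>" "\<And>w. w \<in> ?P \<Longrightarrow> \<phi> w = 0"
  note kill = ideal_prod_kill[OF AD(2) CD(2)]
  have 1: "\<phi> (a \<otimes> (w \<otimes> b)) = 0" if "a \<in> A" "b \<in> C" "w \<in> ?P" for a b w
  proof (rule kill[OF _ _ that(3)])
    show "linear_form H (\<lambda>w. \<phi> (a \<otimes> (w \<otimes> b)))"
      using that Ac Cc by (intro linI) (simp_all add: lin linear_formD[OF \<phi>(1)])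
    fix a' b' assume *: "a' \<in> A" "b' \<in> C"
    have "a \<otimes> ((a' \<otimes> b') \<otimes> b) = (a \<otimes> a') \<otimes> (b' \<otimes> b)" using * that Ac Cc by (simp add: m_assoc)
    then show "\<phi> (a \<otimes> ((a' \<otimes> b') \<otimes> b)) = 0"
      using ideal_prod.prod[of "a \<otimes> a'" A "b' \<otimes> b" C H] * that AD(4) CD(4) \<phi>(2) by simp
  qed
  have 2: "\<phi> (x \<otimes> (a' \<otimes> b')) = 0" if "a' \<in> A" "b' \<in> C" for a' b'
  proof (rule kill[OF mult_linear_forms(2)[OF \<phi>(1)] _ assms(1)])
    show "a' \<otimes> b' \<in> carrier H" using that Ac Cc by simp
    fix a b assume *: "a \<in> A" "b \<in> C"
    have "a \<otimes> b \<otimes> (a' \<otimes> b') = a \<otimes> ((b \<otimes> a') \<otimes> b')" using * that Ac Cc by (simp add: m_assoc)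
    then show "\<phi> (a \<otimes> b \<otimes> (a' \<otimes> b')) = 0" using 1[OF *(1) that(2) prod_swap_mem[OF *(2) that(1)]] by simp
  qed
  show "\<phi> (x \<otimes> y) = 0"
    by (rule kill[OF mult_linear_forms(1)[OF \<phi>(1)] _ assms(2)]) (use 2 assms Pc in auto)
qed

lemma prod_hopf_subalgebra: "hopf_subalgebra (ideal_prod H A C) H"
proof (rule hopf_subalgebraI)
  let ?P = "ideal_prod H A C"
  note AD = hopf_subalgebraD[OF prod_inclusions(1)] and CD = hopf_subalgebraD[OF C]
  have Pc: "?P \<subseteq> carrier H" using subspaceD(1)[OF prod_inclusions(4)] .
  have Ac: "x \<in> A \<Longrightarrow> x \<in> carrier H" and Cc: "x \<in> C \<Longrightarrow> x \<in> carrier H" for x using AD(2) CD(2) by auto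
  note kill = ideal_prod_kill[OF AD(2) CD(2)]
  show "\<one> \<in> ?P" using prod_inclusions(5) AD(3) by auto
  show "x \<otimes> y \<in> ?P" if "x \<in> ?P" "y \<in> ?P" for x y using that by (rule prod_mult_closed)
  show "subcoalgebra ?P" unfolding subcoalgebra_def
  proof (intro conjI prod_inclusions(4) ballI allI impI)
    fix z b assume z: "z \<in> ?P" and b: "bilinear_form H H b" and v: "\<forall>x\<in>?P. \<forall>y\<in>?P. b x y = 0"
    note bD = bilinear_formD(3-)[OF b]
    show "sw z b = 0"
    proof (rule kill[OF _ _ z])
      show "linear_form H (\<lambda>z. sw z b)" by (intro linI) simp_all
      fix a c assume ac: "a \<in> A" "c \<in> C"
      have "sw (a \<otimes> c) b = sw a (\<lambda>u v. sw c (\<lambda>u' v'. b (u \<otimes> u') (v \<otimes> v')))"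
        using ac Ac Cc by (intro sw_mult[OF b])
      also have "\<dots> = 0"
      proof (rule subcoalgebraD(2)[OF AD(6) ac(1)])
        show "bilinear_form H H (\<lambda>u v. sw c (\<lambda>u' v'. b (u \<otimes> u') (v \<otimes> v')))"
          by (intro bilinear_formI) (simp_all add: lin bD)
        fix u w assume uw: "u \<in> A" "w \<in> A"
        show "sw c (\<lambda>u' v'. b (u \<otimes> u') (w \<otimes> v')) = 0"
        proof (rule subcoalgebraD(2)[OF CD(6) ac(2)])
          show "bilinear_form H H (\<lambda>u' v'. b (u \<otimes> u') (w \<otimes> v'))"
            using uw Ac by (intro bilinear_formI) (simp_all add: lin bD)
          show "b (u \<otimes> u') (w \<otimes> v') = 0" if "u' \<in> C" "v' \<in> C" for u' v'
            using v ideal_prod.prod[OF uw(1) that(1)] ideal_prod.prod[OF uw(2) that(2)] by blast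
        qed
      qed
      finally show "sw (a \<otimes> c) b = 0" .
    qed
  qed
  fix x assume x: "x \<in> ?P"
  show "\<S> x \<in> ?P"
  proof (rule mem_if_annihilated'[OF prod_inclusions(4)])
    show "\<S> x \<in> carrier H" using x Pc by auto
    fix \<phi> assume \<phi>: "linear_form H \<phi>" "\<And>w. w \<in> ?P \<Longrightarrow> \<phi> w = 0"
    show "\<phi> (\<S> x) = 0"
    proof (rule kill[OF _ _ x])
      show "linear_form H (\<lambda>w. \<phi> (\<S> w))" by (intro linI) (simp_all add: lin linear_formD[OF \<phi>(1)])
      fix a c assume ac: "a \<in> A" "c \<in> C"
      have "\<S> c \<otimes> \<S> a \<in> ?P" using ac AD(5) CD(5) by (intro prod_swap_mem)
      then show "\<phi> (\<S> (a \<otimes> c)) = 0" using ac Ac Cc \<phi>(2) by (simp add: antipode_mult)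
    qed
  qed
qed

end

text \<open>The adjoint actions are compatible with products: in \<open>h\<^sub>1 a S(h\<^sub>2) h\<^sub>3 c S(h\<^sub>4)\<close> the middle cancels.\<close>

lemma adj_mult_form:
  assumes \<phi>: "linear_form H \<phi>" and h: "h \<in> carrier H" and a: "a \<in> carrier H" "c \<in> carrier H"
  shows "\<phi> (adj_left h (a \<otimes> c)) = sw h (\<lambda>u w. \<phi> (adj_left u a \<otimes> adj_left w c))"
    "\<phi> (adj_right h (a \<otimes> c)) = sw h (\<lambda>u w. \<phi> (adj_right u a \<otimes> adj_right w c))"
proof -
  note \<phi>D = linear_formD[OF \<phi>]
  have "sw h (\<lambda>u w. \<phi> (adj_left u a \<otimes> adj_left w c)) =
      sw h (\<lambda>u w. sw u (\<lambda>x y. sw w (\<lambda>z t. \<phi> (x \<otimes> (a \<otimes> (\<S> y \<otimes> (z \<otimes> (c \<otimes> \<S> t))))))))"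
  proof (rule sw_cong[OF refl])
    fix u w assume uw: "u \<in> carrier H" "w \<in> carrier H"
    have "\<phi> (adj_left u a \<otimes> adj_left w c) = sw u (\<lambda>x y. \<phi> ((x \<otimes> (a \<otimes> \<S> y)) \<otimes> adj_left w c))"
      by (rule adj_form(1)[OF uw(1) a(1) mult_linear_forms(2)[OF \<phi>]]) (use uw a in simp)
    also have "\<dots> = sw u (\<lambda>x y. sw w (\<lambda>z t. \<phi> ((x \<otimes> (a \<otimes> \<S> y)) \<otimes> (z \<otimes> (c \<otimes> \<S> t)))))"
      by (rule sw_cong[OF refl], rule adj_form(1)[OF uw(2) a(2) mult_linear_forms(1)[OF \<phi>]]) (use a in simp)
    finally show "\<phi> (adj_left u a \<otimes> adj_left w c) =
        sw u (\<lambda>x y. sw w (\<lambda>z t. \<phi> (x \<otimes> (a \<otimes> (\<S> y \<otimes> (z \<otimes> (c \<otimes> \<S> t)))))))" using a by (simp add: m_assoc)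
  qed
  also have "\<dots> = sw h (\<lambda>x r. sw r (\<lambda>y w. sw w (\<lambda>z t. \<phi> (x \<otimes> (a \<otimes> (\<S> y \<otimes> (z \<otimes> (c \<otimes> \<S> t))))))))"
    using a by (intro coassoc_sw[OF _ h] trilinear_formI) (simp_all add: lin \<phi>D)
  also have "\<dots> = sw h (\<lambda>x r. \<phi> (x \<otimes> ((a \<otimes> c) \<otimes> \<S> r)))"
  proof (rule sw_cong[OF refl])
    fix x r assume xr: "x \<in> carrier H" "r \<in> carrier H"
    have "sw r (\<lambda>y w. sw w (\<lambda>z t. \<phi> (x \<otimes> (a \<otimes> (\<S> y \<otimes> (z \<otimes> (c \<otimes> \<S> t))))))) =
       sw r (\<lambda>q t. sw q (\<lambda>y z. \<phi> (x \<otimes> (a \<otimes> (\<S> y \<otimes> (z \<otimes> (c \<otimes> \<S> t)))))))"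
      using a xr by (intro coassoc_sw[symmetric] trilinear_formI) (simp_all add: lin \<phi>D)
    also have "\<dots> = sw r (\<lambda>q t. \<epsilon> q * \<phi> (x \<otimes> (a \<otimes> (c \<otimes> \<S> t))))"
    proof (rule sw_cong[OF refl])
      fix q t assume qt: "q \<in> carrier H" "t \<in> carrier H"
      have "linear_form H (\<lambda>w. \<phi> (x \<otimes> (a \<otimes> (w \<otimes> (c \<otimes> \<S> t)))))"
        using a xr qt by (intro linI) (simp_all add: lin \<phi>D)
      from antipode_sw(1)[OF this qt(1)]
      show "sw q (\<lambda>y z. \<phi> (x \<otimes> (a \<otimes> (\<S> y \<otimes> (z \<otimes> (c \<otimes> \<S> t)))))) = \<epsilon> q * \<phi> (x \<otimes> (a \<otimes> (c \<otimes> \<S> t)))"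
        using a xr qt by (simp add: m_assoc)
    qed
    also have "\<dots> = \<phi> (x \<otimes> (a \<otimes> (c \<otimes> \<S> r)))"
      using a xr by (intro counit_sw(1) linI) (simp_all add: lin \<phi>D)
    finally show "sw r (\<lambda>y w. sw w (\<lambda>z t. \<phi> (x \<otimes> (a \<otimes> (\<S> y \<otimes> (z \<otimes> (c \<otimes> \<S> t))))))) = \<phi> (x \<otimes> ((a \<otimes> c) \<otimes> \<S> r))"
      using a xr by (simp add: m_assoc)
  qed
  also have "\<dots> = \<phi> (adj_left h (a \<otimes> c))" using adj_form(1)[OF h _ \<phi>, of "a \<otimes> c"] a by simp
  finally show "\<phi> (adj_left h (a \<otimes> c)) = sw h (\<lambda>u w. \<phi> (adj_left u a \<otimes> adj_left w c))" ..
  have "sw h (\<lambda>u w. \<phi> (adj_right u a \<otimes> adj_right w c)) =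
      sw h (\<lambda>u w. sw u (\<lambda>x y. sw w (\<lambda>z t. \<phi> (\<S> x \<otimes> (a \<otimes> (y \<otimes> (\<S> z \<otimes> (c \<otimes> t))))))))"
  proof (rule sw_cong[OF refl])
    fix u w assume uw: "u \<in> carrier H" "w \<in> carrier H"
    have "\<phi> (adj_right u a \<otimes> adj_right w c) = sw u (\<lambda>x y. \<phi> ((\<S> x \<otimes> (a \<otimes> y)) \<otimes> adj_right w c))"
      by (rule adj_form(2)[OF uw(1) a(1) mult_linear_forms(2)[OF \<phi>]]) (use uw a in simp)
    also have "\<dots> = sw u (\<lambda>x y. sw w (\<lambda>z t. \<phi> ((\<S> x \<otimes> (a \<otimes> y)) \<otimes> (\<S> z \<otimes> (c \<otimes> t)))))"
      by (rule sw_cong[OF refl], rule adj_form(2)[OF uw(2) a(2) mult_linear_forms(1)[OF \<phi>]]) (use a in simp)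
    finally show "\<phi> (adj_right u a \<otimes> adj_right w c) =
        sw u (\<lambda>x y. sw w (\<lambda>z t. \<phi> (\<S> x \<otimes> (a \<otimes> (y \<otimes> (\<S> z \<otimes> (c \<otimes> t)))))))" using a by (simp add: m_assoc)
  qed
  also have "\<dots> = sw h (\<lambda>x r. sw r (\<lambda>y w. sw w (\<lambda>z t. \<phi> (\<S> x \<otimes> (a \<otimes> (y \<otimes> (\<S> z \<otimes> (c \<otimes> t))))))))"
    using a by (intro coassoc_sw[OF _ h] trilinear_formI) (simp_all add: lin \<phi>D)
  also have "\<dots> = sw h (\<lambda>x r. \<phi> (\<S> x \<otimes> ((a \<otimes> c) \<otimes> r)))"
  proof (rule sw_cong[OF refl])
    fix x r assume xr: "x \<in> carrier H" "r \<in> carrier H"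
    have "sw r (\<lambda>y w. sw w (\<lambda>z t. \<phi> (\<S> x \<otimes> (a \<otimes> (y \<otimes> (\<S> z \<otimes> (c \<otimes> t))))))) =
       sw r (\<lambda>q t. sw q (\<lambda>y z. \<phi> (\<S> x \<otimes> (a \<otimes> (y \<otimes> (\<S> z \<otimes> (c \<otimes> t)))))))"
      using a xr by (intro coassoc_sw[symmetric] trilinear_formI) (simp_all add: lin \<phi>D)
    also have "\<dots> = sw r (\<lambda>q t. \<epsilon> q * \<phi> (\<S> x \<otimes> (a \<otimes> (c \<otimes> t))))"
    proof (rule sw_cong[OF refl])
      fix q t assume qt: "q \<in> carrier H" "t \<in> carrier H"
      have "linear_form H (\<lambda>w. \<phi> (\<S> x \<otimes> (a \<otimes> (w \<otimes> (c \<otimes> t)))))"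
        using a xr qt by (intro linI) (simp_all add: lin \<phi>D)
      from antipode_sw(2)[OF this qt(1)]
      show "sw q (\<lambda>y z. \<phi> (\<S> x \<otimes> (a \<otimes> (y \<otimes> (\<S> z \<otimes> (c \<otimes> t)))))) = \<epsilon> q * \<phi> (\<S> x \<otimes> (a \<otimes> (c \<otimes> t)))"
        using a xr qt by (simp add: m_assoc)
    qed
    also have "\<dots> = \<phi> (\<S> x \<otimes> (a \<otimes> (c \<otimes> r)))"
      using a xr by (intro counit_sw(1) linI) (simp_all add: lin \<phi>D)
    finally show "sw r (\<lambda>y w. sw w (\<lambda>z t. \<phi> (\<S> x \<otimes> (a \<otimes> (y \<otimes> (\<S> z \<otimes> (c \<otimes> t))))))) = \<phi> (\<S> x \<otimes> ((a \<otimes> c) \<otimes> r))"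
      using a xr by (simp add: m_assoc)
  qed
  also have "\<dots> = \<phi> (adj_right h (a \<otimes> c))" using adj_form(2)[OF h _ \<phi>, of "a \<otimes> c"] a by simp
  finally show "\<phi> (adj_right h (a \<otimes> c)) = sw h (\<lambda>u w. \<phi> (adj_right u a \<otimes> adj_right w c))" ..
qed

lemma adj_linear_form:
  assumes \<phi>: "linear_form H \<phi>" and h: "h \<in> carrier H"
  shows "linear_form H (\<lambda>x. \<phi> (adj_left h x))" "linear_form H (\<lambda>x. \<phi> (adj_right h x))"
  using h by (auto intro!: linI simp: adj_form[OF h _ \<phi>] lin linear_formD[OF \<phi>])

lemma prod_normal:
  assumes A: "normal_hopf_subalgebra A H" and C: "normal_hopf_subalgebra C H"
  shows "normal_hopf_subalgebra (ideal_prod H A C) H"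
proof -
  let ?P = "ideal_prod H A C"
  have C': "hopf_subalgebra C H" using C by (simp add: normal_hopf_subalgebra_def)
  note pset = prod_inclusions[OF A C'] and AD = hopf_subalgebraD[OF prod_inclusions(1)[OF A C']] and CD = hopf_subalgebraD[OF C']
  have Pc: "?P \<subseteq> carrier H" using subspaceD(1)[OF pset(4)] .
  have Ac: "x \<in> A \<Longrightarrow> x \<in> carrier H" and Cc: "x \<in> C \<Longrightarrow> x \<in> carrier H" for x using AD(2) CD(2) by auto
  have "adj_left h z \<in> ?P" "adj_right h z \<in> ?P" if h: "h \<in> carrier H" and z: "z \<in> ?P" for h z
  proof -
    have zc: "z \<in> carrier H" using z Pc by auto
    note kill = ideal_prod_kill[OF AD(2) CD(2) _ _ z]
    show "adj_left h z \<in> ?P"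
    proof (rule mem_if_annihilated'[OF pset(4) adj_closed(1)[OF h zc]])
      fix \<phi> assume \<phi>: "linear_form H \<phi>" "\<And>w. w \<in> ?P \<Longrightarrow> \<phi> w = 0"
      show "\<phi> (adj_left h z) = 0"
      proof (rule kill[OF adj_linear_form(1)[OF \<phi>(1) h]])
        fix a c assume ac: "a \<in> A" "c \<in> C"
        have "adj_left u a \<otimes> adj_left w c \<in> ?P" if "u \<in> carrier H" "w \<in> carrier H" for u w
          using A C ac that unfolding normal_iff by (intro ideal_prod.prod) auto
        then show "\<phi> (adj_left h (a \<otimes> c)) = 0"
          using adj_mult_form(1)[OF \<phi>(1) h Ac[OF ac(1)] Cc[OF ac(2)]] \<phi>(2) by simp
      qed
    qed
    show "adj_right h z \<in> ?P"
    proof (rule mem_if_annihilated'[OF pset(4) adj_closed(2)[OF h zc]])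
      fix \<phi> assume \<phi>: "linear_form H \<phi>" "\<And>w. w \<in> ?P \<Longrightarrow> \<phi> w = 0"
      show "\<phi> (adj_right h z) = 0"
      proof (rule kill[OF adj_linear_form(2)[OF \<phi>(1) h]])
        fix a c assume ac: "a \<in> A" "c \<in> C"
        have "adj_right u a \<otimes> adj_right w c \<in> ?P" if "u \<in> carrier H" "w \<in> carrier H" for u w
          using A C ac that unfolding normal_iff by (intro ideal_prod.prod) auto
        then show "\<phi> (adj_right h (a \<otimes> c)) = 0"
          using adj_mult_form(2)[OF \<phi>(1) h Ac[OF ac(1)] Cc[OF ac(2)]] \<phi>(2) by simp
      qed
    qed
  qed
  then show ?thesis unfolding normal_iff using prod_hopf_subalgebra[OF A C'] by blast
qed

subsection \<open>The Hopf ideal of a normal Hopf subalgebra\<close>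

text \<open>The last clause is the coideal condition \<open>\<Delta>(I) \<subseteq> I \<otimes> H + H \<otimes> I\<close>, tested by forms.\<close>

definition hopf_ideal :: "'a set \<Rightarrow> bool" where
  "hopf_ideal I \<longleftrightarrow> submodule I scalars H \<and> (\<forall>x\<in>I. \<forall>h\<in>carrier H. h \<otimes> x \<in> I \<and> x \<otimes> h \<in> I) \<and>
     (\<forall>x\<in>I. \<epsilon> x = 0 \<and> \<S> x \<in> I) \<and>
     (\<forall>x\<in>I. \<forall>b. bilinear_form H H b \<longrightarrow> (\<forall>u\<in>I. \<forall>v\<in>carrier H. b u v = 0 \<and> b v u = 0) \<longrightarrow> sw x b = 0)"

lemma HAplus_mem: "h \<in> carrier H \<Longrightarrow> a \<in> A \<Longrightarrow> \<epsilon> a = 0 \<Longrightarrow> h \<otimes> a \<in> HAplus H A"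
  unfolding HAplus_def by (rule ideal_prod.prod) auto

lemma HAplus_kill:
  assumes "A \<subseteq> carrier H" "linear_form H \<phi>"
    and "\<And>h a. h \<in> carrier H \<Longrightarrow> a \<in> A \<Longrightarrow> \<epsilon> a = 0 \<Longrightarrow> \<phi> (h \<otimes> a) = 0" and z: "z \<in> HAplus H A"
  shows "\<phi> z = 0"
  using z unfolding HAplus_def by (rule ideal_prod_kill[rotated -1]) (use assms in auto)

lemma HAplus_subspace:
  assumes "hopf_subalgebra A H" shows "submodule (HAplus H A) scalars H"
  unfolding HAplus_def
proof (rule ideal_prod_subspace[OF carrier_subspace])
  note AD = hopf_subalgebraD[OF assms]
  show "{a \<in> A. \<epsilon> a = 0} \<subseteq> carrier H" using AD(2) by auto
  show "\<zero> \<in> {a \<in> A. \<epsilon> a = 0}" using subspaceD(2)[OF AD(1)] linear_form_zero[OF counit_form] by simp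
qed

text \<open>Normality makes the left ideal \<open>HA\<^sup>+\<close> two-sided, since \<open>h a g = h g\<^sub>1 (S(g\<^sub>2) a g\<^sub>3)\<close> and the bracket is in \<open>A\<^sup>+\<close>.
  For the coideal condition, \<open>\<Delta>(h a)\<close> is \<open>h\<^sub>1 a\<^sub>1 \<otimes> h\<^sub>2 a\<^sub>2\<close>; modulo \<open>HA\<^sup>+ \<otimes> H\<close> it equals \<open>h\<^sub>1 \<otimes> h\<^sub>2 a\<close>, which
  lies in \<open>H \<otimes> HA\<^sup>+\<close>.\<close>

lemma HAplus_hopf_ideal:
  assumes A: "normal_hopf_subalgebra A H"
  shows "hopf_ideal (HAplus H A)"
proof -
  let ?I = "HAplus H A"
  have A': "hopf_subalgebra A H" using A by (simp add: normal_hopf_subalgebra_def)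
  note AD = hopf_subalgebraD[OF A']
  have Ac: "x \<in> A \<Longrightarrow> x \<in> carrier H" for x using AD(2) by auto
  note sub = HAplus_subspace[OF A'] and kill = HAplus_kill[OF AD(2)]
  note ID = subspaceD[OF HAplus_subspace[OF A']]
  have Ic: "x \<in> ?I \<Longrightarrow> x \<in> carrier H" for x using ID(1) by auto
  have aI: "a \<in> A \<Longrightarrow> \<epsilon> a = 0 \<Longrightarrow> a \<in> ?I" for a using HAplus_mem[of \<one> a A] Ac by simp
  have left: "h \<otimes> x \<in> ?I" if h: "h \<in> carrier H" and x: "x \<in> ?I" for h x
  proof (rule mem_if_annihilated'[OF sub])
    show "h \<otimes> x \<in> carrier H" using that Ic by simp
    fix \<phi> assume \<phi>: "linear_form H \<phi>" "\<And>w. w \<in> ?I \<Longrightarrow> \<phi> w = 0"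
    show "\<phi> (h \<otimes> x) = 0"
    proof (rule kill[OF mult_linear_forms(1)[OF \<phi>(1) h] _ x])
      fix g a assume "g \<in> carrier H" "a \<in> A" "\<epsilon> a = 0"
      then show "\<phi> (h \<otimes> (g \<otimes> a)) = 0" using \<phi>(2) HAplus_mem[of "h \<otimes> g" a A] h Ac by (simp add: m_assoc)
    qed
  qed
  have right: "x \<otimes> g \<in> ?I" if g: "g \<in> carrier H" and x: "x \<in> ?I" for g x
  proof (rule mem_if_annihilated'[OF sub])
    show "x \<otimes> g \<in> carrier H" using that Ic by simp
    fix \<phi> assume \<phi>: "linear_form H \<phi>" "\<And>w. w \<in> ?I \<Longrightarrow> \<phi> w = 0"
    note \<phi>D = linear_formD[OF \<phi>(1)]
    show "\<phi> (x \<otimes> g) = 0"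
    proof (rule kill[OF mult_linear_forms(2)[OF \<phi>(1) g] _ x])
      fix h a assume ha: "h \<in> carrier H" "a \<in> A" "\<epsilon> a = 0"
      note ac = Ac[OF ha(2)]
      have "\<phi> (h \<otimes> a \<otimes> g) = sw g (\<lambda>q z. \<epsilon> q * \<phi> (h \<otimes> (a \<otimes> z)))"
      proof -
        have "linear_form H (\<lambda>z. \<phi> (h \<otimes> (a \<otimes> z)))" using ha ac by (intro linI) (simp_all add: lin \<phi>D)
        from counit_sw(1)[OF this g] show ?thesis using ha ac g by (simp add: m_assoc)
      qed
      also have "\<dots> = sw g (\<lambda>q z. sw q (\<lambda>x y. \<phi> (h \<otimes> (x \<otimes> (\<S> y \<otimes> (a \<otimes> z))))))"
      proof (rule sw_cong[OF refl])
        fix q z assume qz: "q \<in> carrier H" "z \<in> carrier H"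
        have "linear_form H (\<lambda>w. \<phi> (h \<otimes> (w \<otimes> (a \<otimes> z))))" using ha ac qz by (intro linI) (simp_all add: lin \<phi>D)
        from antipode_sw(2)[OF this qz(1)]
        show "\<epsilon> q * \<phi> (h \<otimes> (a \<otimes> z)) = sw q (\<lambda>x y. \<phi> (h \<otimes> (x \<otimes> (\<S> y \<otimes> (a \<otimes> z)))))"
          using ha ac qz by (simp add: m_assoc)
      qed
      also have "\<dots> = sw g (\<lambda>x r. sw r (\<lambda>y z. \<phi> (h \<otimes> (x \<otimes> (\<S> y \<otimes> (a \<otimes> z))))))"
        using ha ac by (intro coassoc_sw[OF _ g] trilinear_formI) (simp_all add: lin \<phi>D)
      also have "\<dots> = sw g (\<lambda>x r. 0)"
      proof (rule sw_cong[OF refl])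
        fix x r assume xr: "x \<in> carrier H" "r \<in> carrier H"
        have lf: "linear_form H (\<lambda>w. \<phi> (h \<otimes> (x \<otimes> w)))" using ha xr by (intro linI) (simp_all add: lin \<phi>D)
        have "adj_right r a \<in> A" using A xr ha by (simp add: normal_iff)
        moreover have "\<epsilon> (adj_right r a) = 0" using counit_adj[OF xr(2) ac] ha by simp
        ultimately have "\<phi> (h \<otimes> (x \<otimes> adj_right r a)) = 0"
          using \<phi>(2) left[OF ha(1) HAplus_mem[OF xr(1)]] by blast
        then show "sw r (\<lambda>y z. \<phi> (h \<otimes> (x \<otimes> (\<S> y \<otimes> (a \<otimes> z))))) = 0"
          using adj_form(2)[OF xr(2) ac lf] by simp
      qed
      finally show "\<phi> (h \<otimes> a \<otimes> g) = 0" by simp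
    qed
  qed
  have eps: "\<epsilon> x = 0" if "x \<in> ?I" for x
    by (rule kill[OF counit_form _ that]) (simp add: Ac)
  have anti: "\<S> x \<in> ?I" if x: "x \<in> ?I" for x
  proof (rule mem_if_annihilated'[OF sub])
    show "\<S> x \<in> carrier H" using that Ic by simp
    fix \<phi> assume \<phi>: "linear_form H \<phi>" "\<And>w. w \<in> ?I \<Longrightarrow> \<phi> w = 0"
    show "\<phi> (\<S> x) = 0"
    proof (rule kill[OF _ _ x])
      show "linear_form H (\<lambda>w. \<phi> (\<S> w))" by (intro linI) (simp_all add: lin linear_formD[OF \<phi>(1)])
      fix h a assume ha: "h \<in> carrier H" "a \<in> A" "\<epsilon> a = 0"
      have "\<S> a \<otimes> \<S> h \<in> ?I" using ha AD(5) Ac by (intro right aI) auto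
      then show "\<phi> (\<S> (h \<otimes> a)) = 0" using ha Ac \<phi>(2) by (simp add: antipode_mult)
    qed
  qed
  have coideal: "sw z b = 0" if z: "z \<in> ?I" and b: "bilinear_form H H b"
     and v: "\<forall>u\<in>?I. \<forall>v\<in>carrier H. b u v = 0 \<and> b v u = 0" for z b
  proof (rule kill[OF _ _ z])
    note bD = bilinear_formD(3-)[OF b]
    show "linear_form H (\<lambda>z. sw z b)" by (intro linI) simp_all
    fix h a assume ha: "h \<in> carrier H" "a \<in> A" "\<epsilon> a = 0"
    note ac = Ac[OF ha(2)]
    have "sw (h \<otimes> a) b = sw h (\<lambda>u v. sw a (\<lambda>p q. b (u \<otimes> p) (v \<otimes> q)))"
      using ha ac by (intro sw_mult[OF b])
    also have "\<dots> = sw h (\<lambda>u v. 0)"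
    proof (rule sw_cong[OF refl])
      fix u v' assume uv: "u \<in> carrier H" "v' \<in> carrier H"
      have "sw a (\<lambda>p q. b (u \<otimes> p) (v' \<otimes> q)) = sw a (\<lambda>p q. \<epsilon> p * b u (v' \<otimes> q))"
      proof (rule subcoalgebra_sw_cong[OF AD(6) ha(2)])
        show "bilinear_form H H (\<lambda>p q. b (u \<otimes> p) (v' \<otimes> q))" "bilinear_form H H (\<lambda>p q. \<epsilon> p * b u (v' \<otimes> q))"
          using uv by - (intro bilinear_formI; simp add: lin bD)+
        fix p q assume pq: "p \<in> A" "q \<in> A"
        have pc: "p \<in> carrier H" "q \<in> carrier H" using pq Ac by auto
        let ?p = "p \<oplus> (- \<epsilon> p) \<odot> \<one>"
        have "?p \<in> A" using pq AD(3) subspaceD(3,4)[OF AD(1)] by blast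
        moreover have "\<epsilon> ?p = 0" using pc by simp
        ultimately have "u \<otimes> ?p \<in> ?I" using uv by (intro HAplus_mem)
        then have "b (u \<otimes> ?p) (v' \<otimes> q) = 0" using v uv pc by blast
        then show "b (u \<otimes> p) (v' \<otimes> q) = \<epsilon> p * b u (v' \<otimes> q)"
          using uv pc by (simp add: r_distr smult_mult bD)
      qed
      also have "\<dots> = b u (v' \<otimes> a)"
        using uv by (intro counit_sw(1)[OF _ ac] linI) (simp_all add: lin bD)
      also have "\<dots> = 0" using v uv HAplus_mem[OF uv(2) ha(2,3)] by blast
      finally show "sw a (\<lambda>p q. b (u \<otimes> p) (v' \<otimes> q)) = 0" .
    qed
    finally show "sw (h \<otimes> a) b = 0" by simp
  qed
  show ?thesis unfolding hopf_ideal_def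
    by (intro conjI ballI allI impI; (rule sub left right eps anti coideal; assumption)?)
qed

end

section \<open>Hopf algebra homomorphisms and quotients\<close>

text \<open>The structure needed for comultiplications to be determined by forms. Quotients have it before they are known
  to be Hopf algebras.\<close>

definition prehopf :: "('k::field, 'a) hopf \<Rightarrow> bool" where
  "prehopf H \<longleftrightarrow> vspace H \<and> (\<forall>h\<in>carrier H. \<Delta>\<^bsub>H\<^esub> h \<in> carrier (tensor H H))"

text \<open>The condition on comultiplications is \<open>\<Delta>(\<pi>(h)) = (\<pi> \<otimes> \<pi>)(\<Delta>(h))\<close>, tested by forms.\<close>

definition hopf_hom :: "('k::field, 'a) hopf \<Rightarrow> ('k, 'b) hopf \<Rightarrow> ('a \<Rightarrow> 'b) \<Rightarrow> bool" where
  "hopf_hom H L \<pi> \<longleftrightarrow> \<pi> \<in> ring_hom H L \<and> linear_map H L \<pi> \<and>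
     (\<forall>h\<in>carrier H. (\<forall>b. bilinear_form L L b \<longrightarrow>
         tensor_form b (\<Delta>\<^bsub>L\<^esub> (\<pi> h)) = tensor_form (\<lambda>x y. b (\<pi> x) (\<pi> y)) (\<Delta>\<^bsub>H\<^esub> h)) \<and>
       \<epsilon>\<^bsub>L\<^esub> (\<pi> h) = \<epsilon>\<^bsub>H\<^esub> h \<and> \<S>\<^bsub>L\<^esub> (\<pi> h) = \<pi> (\<S>\<^bsub>H\<^esub> h))"

lemma (in hopf_algebra) prehopf: "prehopf H"
  using vspace_axioms comult_closed by (simp add: prehopf_def)

lemma fdhopf_prehopf: "fdhopf H \<Longrightarrow> prehopf H"
  using hopf_algebra.prehopf by (auto simp: fdhopf_def)

lemma hopf_homD:
  assumes "hopf_hom H L \<pi>"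
  shows "linear_map H L \<pi>" "h \<in> carrier H \<Longrightarrow> \<pi> h \<in> carrier L"
    "x \<in> carrier H \<Longrightarrow> y \<in> carrier H \<Longrightarrow> \<pi> (x \<otimes>\<^bsub>H\<^esub> y) = \<pi> x \<otimes>\<^bsub>L\<^esub> \<pi> y"
    "x \<in> carrier H \<Longrightarrow> y \<in> carrier H \<Longrightarrow> \<pi> (x \<oplus>\<^bsub>H\<^esub> y) = \<pi> x \<oplus>\<^bsub>L\<^esub> \<pi> y"
    "x \<in> carrier H \<Longrightarrow> \<pi> (c \<odot>\<^bsub>H\<^esub> x) = c \<odot>\<^bsub>L\<^esub> \<pi> x"
    "\<pi> \<one>\<^bsub>H\<^esub> = \<one>\<^bsub>L\<^esub>"
    "h \<in> carrier H \<Longrightarrow> bilinear_form L L b \<Longrightarrow> tensor_form b (\<Delta>\<^bsub>L\<^esub> (\<pi> h)) = tensor_form (\<lambda>x y. b (\<pi> x) (\<pi> y)) (\<Delta>\<^bsub>H\<^esub> h)"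
    "h \<in> carrier H \<Longrightarrow> \<epsilon>\<^bsub>L\<^esub> (\<pi> h) = \<epsilon>\<^bsub>H\<^esub> h" "h \<in> carrier H \<Longrightarrow> \<S>\<^bsub>L\<^esub> (\<pi> h) = \<pi> (\<S>\<^bsub>H\<^esub> h)"
proof -
  have r: "\<pi> \<in> ring_hom H L" and l: "linear_map H L \<pi>" using assms by (auto simp: hopf_hom_def)
  show "linear_map H L \<pi>" by fact
  show "h \<in> carrier H \<Longrightarrow> \<pi> h \<in> carrier L" "x \<in> carrier H \<Longrightarrow> y \<in> carrier H \<Longrightarrow> \<pi> (x \<oplus>\<^bsub>H\<^esub> y) = \<pi> x \<oplus>\<^bsub>L\<^esub> \<pi> y"
    "x \<in> carrier H \<Longrightarrow> \<pi> (c \<odot>\<^bsub>H\<^esub> x) = c \<odot>\<^bsub>L\<^esub> \<pi> x" using linear_mapD[OF l] by auto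
  show "x \<in> carrier H \<Longrightarrow> y \<in> carrier H \<Longrightarrow> \<pi> (x \<otimes>\<^bsub>H\<^esub> y) = \<pi> x \<otimes>\<^bsub>L\<^esub> \<pi> y" "\<pi> \<one>\<^bsub>H\<^esub> = \<one>\<^bsub>L\<^esub>"
    using ring_hom_mult[OF r] ring_hom_one[OF r] by auto
  show "h \<in> carrier H \<Longrightarrow> bilinear_form L L b \<Longrightarrow> tensor_form b (\<Delta>\<^bsub>L\<^esub> (\<pi> h)) = tensor_form (\<lambda>x y. b (\<pi> x) (\<pi> y)) (\<Delta>\<^bsub>H\<^esub> h)"
    "h \<in> carrier H \<Longrightarrow> \<epsilon>\<^bsub>L\<^esub> (\<pi> h) = \<epsilon>\<^bsub>H\<^esub> h" "h \<in> carrier H \<Longrightarrow> \<S>\<^bsub>L\<^esub> (\<pi> h) = \<pi> (\<S>\<^bsub>H\<^esub> h)"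
    using assms unfolding hopf_hom_def by blast+
qed

lemma hopf_homI:
  assumes "linear_map H L \<pi>" "\<And>x y. x \<in> carrier H \<Longrightarrow> y \<in> carrier H \<Longrightarrow> \<pi> (x \<otimes>\<^bsub>H\<^esub> y) = \<pi> x \<otimes>\<^bsub>L\<^esub> \<pi> y"
    "\<pi> \<one>\<^bsub>H\<^esub> = \<one>\<^bsub>L\<^esub>"
    "\<And>h b. h \<in> carrier H \<Longrightarrow> bilinear_form L L b \<Longrightarrow> tensor_form b (\<Delta>\<^bsub>L\<^esub> (\<pi> h)) = tensor_form (\<lambda>x y. b (\<pi> x) (\<pi> y)) (\<Delta>\<^bsub>H\<^esub> h)"
    "\<And>h. h \<in> carrier H \<Longrightarrow> \<epsilon>\<^bsub>L\<^esub> (\<pi> h) = \<epsilon>\<^bsub>H\<^esub> h" "\<And>h. h \<in> carrier H \<Longrightarrow> \<S>\<^bsub>L\<^esub> (\<pi> h) = \<pi> (\<S>\<^bsub>H\<^esub> h)"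
  shows "hopf_hom H L \<pi>"
  unfolding hopf_hom_def using assms linear_mapD[OF assms(1)] by (auto intro!: ring_hom_memI)

lemma bilinear_form_comp:
  assumes "linear_map V V' p" "linear_map W W' q" "bilinear_form V' W' b"
  shows "bilinear_form V W (\<lambda>x y. b (p x) (q y))"
  by (intro bilinear_formI) (simp_all add: linear_mapD[OF assms(1)] linear_mapD[OF assms(2)] bilinear_formD(3-)[OF assms(3)])

lemma linear_form_comp:
  assumes "linear_map V V' p" "linear_form V' \<phi>"
  shows "linear_form V (\<lambda>x. \<phi> (p x))"
  by (simp add: linear_form_def linear_mapD[OF assms(1)] linear_formD[OF assms(2)])

lemma hopf_hom_comp:
  assumes 1: "hopf_hom H L \<pi>" and 2: "hopf_hom L M \<rho>"
  shows "hopf_hom H M (\<lambda>x. \<rho> (\<pi> x))"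
proof (rule hopf_homI)
  note D = hopf_homD[OF 1] and E = hopf_homD[OF 2]
  show "linear_map H M (\<lambda>x. \<rho> (\<pi> x))" by (rule linear_mapI) (simp_all add: D E)
  show "tensor_form b (\<Delta>\<^bsub>M\<^esub> (\<rho> (\<pi> h))) = tensor_form (\<lambda>x y. b (\<rho> (\<pi> x)) (\<rho> (\<pi> y))) (\<Delta>\<^bsub>H\<^esub> h)"
    if "h \<in> carrier H" "bilinear_form M M b" for h b
    using that D(2) E(7)[OF _ that(2), of "\<pi> h"] D(7)[OF that(1) bilinear_form_comp[OF E(1,1) that(2)]] by simp
qed (simp_all add: hopf_homD[OF 1] hopf_homD[OF 2])

lemma hopf_hom_sweedler:
  assumes H: "prehopf H" and L: "prehopf L" and l: "linear_map H L \<pi>" and h: "h \<in> carrier H"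
  shows "\<Delta>\<^bsub>L\<^esub> (\<pi> h) = sweedler (tensor L L) (\<lambda>x y. pure_tensor L L (\<pi> x) (\<pi> y)) (\<Delta>\<^bsub>H\<^esub> h) \<longleftrightarrow>
    (\<forall>b. bilinear_form L L b \<longrightarrow> tensor_form b (\<Delta>\<^bsub>L\<^esub> (\<pi> h)) = tensor_form (\<lambda>x y. b (\<pi> x) (\<pi> y)) (\<Delta>\<^bsub>H\<^esub> h))"
proof -
  let ?s = "sweedler (tensor L L) (\<lambda>x y. pure_tensor L L (\<pi> x) (\<pi> y)) (\<Delta>\<^bsub>H\<^esub> h)"
  have \<Delta>h: "\<Delta>\<^bsub>H\<^esub> h \<in> carrier (tensor H H)" using H h by (simp add: prehopf_def)
  note pc = linear_mapD(1)[OF l]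
  have s: "?s \<in> carrier (tensor L L)"
    using pc by (intro sweedler_closed[OF tensor_vspace \<Delta>h] pure_tensor_closed)
  have sb: "tensor_form b ?s = tensor_form (\<lambda>x y. b (\<pi> x) (\<pi> y)) (\<Delta>\<^bsub>H\<^esub> h)" if b: "bilinear_form L L b" for b
  proof -
    have "tensor_form b ?s = tensor_form (\<lambda>x y. tensor_form b (pure_tensor L L (\<pi> x) (\<pi> y))) (\<Delta>\<^bsub>H\<^esub> h)"
      using pc by (intro sweedler_form[OF tensor_vspace \<Delta>h tensor_form_linear[OF b]] pure_tensor_closed)
    also have "\<dots> = tensor_form (\<lambda>x y. b (\<pi> x) (\<pi> y)) (\<Delta>\<^bsub>H\<^esub> h)"
      by (intro tensor_form_cong[OF \<Delta>h]) (simp add: tensor_form_pure[OF b] pc)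
    finally show ?thesis .
  qed
  have cl: "\<Delta>\<^bsub>L\<^esub> (\<pi> h) \<in> carrier (tensor L L)" using L pc h by (simp add: prehopf_def)
  show ?thesis
  proof (intro iffI allI impI)
    assume "\<Delta>\<^bsub>L\<^esub> (\<pi> h) = ?s"
    then show "tensor_form b (\<Delta>\<^bsub>L\<^esub> (\<pi> h)) = tensor_form (\<lambda>x y. b (\<pi> x) (\<pi> y)) (\<Delta>\<^bsub>H\<^esub> h)"
      if "bilinear_form L L b" for b using sb[OF that] by (simp only:)
  next
    assume "\<forall>b. bilinear_form L L b \<longrightarrow> tensor_form b (\<Delta>\<^bsub>L\<^esub> (\<pi> h)) = tensor_form (\<lambda>x y. b (\<pi> x) (\<pi> y)) (\<Delta>\<^bsub>H\<^esub> h)"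
    then show "\<Delta>\<^bsub>L\<^esub> (\<pi> h) = ?s" by (intro tensor_eqI[OF cl s]) (simp only: sb)
  qed
qed

lemma hopf_iso_iff:
  assumes "prehopf H" "prehopf L"
  shows "\<phi> \<in> hopf_iso H L \<longleftrightarrow> hopf_hom H L \<phi> \<and> bij_betw \<phi> (carrier H) (carrier L)"
proof -
  have "(\<forall>h\<in>carrier H. \<Delta>\<^bsub>L\<^esub> (\<phi> h) = sweedler (tensor L L) (\<lambda>x y. pure_tensor L L (\<phi> x) (\<phi> y)) (\<Delta>\<^bsub>H\<^esub> h) \<and>
        \<epsilon>\<^bsub>L\<^esub> (\<phi> h) = \<epsilon>\<^bsub>H\<^esub> h \<and> \<S>\<^bsub>L\<^esub> (\<phi> h) = \<phi> (\<S>\<^bsub>H\<^esub> h)) \<longleftrightarrow>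
    (\<forall>h\<in>carrier H. (\<forall>b. bilinear_form L L b \<longrightarrow>
         tensor_form b (\<Delta>\<^bsub>L\<^esub> (\<phi> h)) = tensor_form (\<lambda>x y. b (\<phi> x) (\<phi> y)) (\<Delta>\<^bsub>H\<^esub> h)) \<and>
       \<epsilon>\<^bsub>L\<^esub> (\<phi> h) = \<epsilon>\<^bsub>H\<^esub> h \<and> \<S>\<^bsub>L\<^esub> (\<phi> h) = \<phi> (\<S>\<^bsub>H\<^esub> h))" if l: "linear_map H L \<phi>"
    by (rule ball_cong[OF refl], subst hopf_hom_sweedler[OF assms l]) (assumption, rule refl)
  then show ?thesis
    unfolding hopf_iso_def hopf_hom_def ring_iso_def mem_Collect_eq by argo
qed

lemma hopf_isomorphic_iff:
  assumes "prehopf H" "prehopf L"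
  shows "H \<cong>\<^sub>H L \<longleftrightarrow> (\<exists>\<phi>. hopf_hom H L \<phi> \<and> bij_betw \<phi> (carrier H) (carrier L))"
  unfolding hopf_isomorphic_def using hopf_iso_iff[OF assms] by auto

lemma hopf_hom_kernel:
  assumes "vspace H" "vspace L" "hopf_hom H L \<pi>"
  shows "submodule {x \<in> carrier H. \<pi> x = \<zero>\<^bsub>L\<^esub>} scalars H"
    "x \<in> carrier H \<Longrightarrow> y \<in> carrier H \<Longrightarrow> \<pi> x = \<pi> y \<longleftrightarrow> \<pi> (x \<ominus>\<^bsub>H\<^esub> y) = \<zero>\<^bsub>L\<^esub>"
proof -
  interpret L: vspace L by fact
  interpret H: vspace H by fact
  show "submodule {x \<in> carrier H. \<pi> x = \<zero>\<^bsub>L\<^esub>} scalars H"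
    using linear_preimage_subspace[OF assms(1,2) hopf_homD(1)[OF assms(3)] L.zero_subspace] by simp
  show "x \<in> carrier H \<Longrightarrow> y \<in> carrier H \<Longrightarrow> \<pi> x = \<pi> y \<longleftrightarrow> \<pi> (x \<ominus>\<^bsub>H\<^esub> y) = \<zero>\<^bsub>L\<^esub>"
    using H.linear_map_minus[OF assms(2) hopf_homD(1)[OF assms(3)]] L.diff_eq_zero_iff hopf_homD(2)[OF assms(3)]
    by simp
qed

lemma hopf_hom_factor:
  assumes H: "hopf_algebra H" and Q: "prehopf Q" and L: "prehopf L"
    and q: "hopf_hom H Q q" "q ` carrier H = carrier Q" and \<pi>: "hopf_hom H L \<pi>"
    and ker: "\<And>x. x \<in> carrier H \<Longrightarrow> q x = \<zero>\<^bsub>Q\<^esub> \<Longrightarrow> \<pi> x = \<zero>\<^bsub>L\<^esub>"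
  obtains \<psi> where "hopf_hom Q L \<psi>" "\<And>x. x \<in> carrier H \<Longrightarrow> \<psi> (q x) = \<pi> x"
proof -
  interpret H: hopf_algebra H by fact
  have V: "vspace H" "vspace Q" "vspace L" using assms H.vspace_axioms by (auto simp: prehopf_def)
  define \<psi> where "\<psi> c = \<pi> (inv_into (carrier H) q c)" for c
  note qD = hopf_homD[OF q(1)] and \<pi>D = hopf_homD[OF \<pi>]
  have \<psi>: "\<psi> (q x) = \<pi> x" if x: "x \<in> carrier H" for x
  proof -
    let ?y = "inv_into (carrier H) q (q x)"
    have y: "?y \<in> carrier H" "q ?y = q x" using x by (auto intro: inv_into_into f_inv_into_f)
    then have "q (?y \<ominus>\<^bsub>H\<^esub> x) = \<zero>\<^bsub>Q\<^esub>" using hopf_hom_kernel(2)[OF V(1,2) q(1)] x by blast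
    then have "\<pi> (?y \<ominus>\<^bsub>H\<^esub> x) = \<zero>\<^bsub>L\<^esub>" using ker y x by simp
    then show ?thesis unfolding \<psi>_def using hopf_hom_kernel(2)[OF V(1,3) \<pi>] y x by blast
  qed
  have rep: "\<exists>x\<in>carrier H. c = q x" if "c \<in> carrier Q" for c using that q(2) by blast
  have lin: "linear_map Q L \<psi>"
  proof (rule linear_mapI)
    fix c assume "c \<in> carrier Q"
    then obtain x where x: "x \<in> carrier H" "c = q x" using rep by blast
    show "\<psi> c \<in> carrier L" using x \<psi> \<pi>D(2) by simp
    show "\<psi> (k \<odot>\<^bsub>Q\<^esub> c) = k \<odot>\<^bsub>L\<^esub> \<psi> c" for k using x \<psi>[of "k \<odot>\<^bsub>H\<^esub> x"] \<psi> qD(5) \<pi>D(5) by simp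
    fix c' assume "c' \<in> carrier Q"
    then obtain y where y: "y \<in> carrier H" "c' = q y" using rep by blast
    show "\<psi> (c \<oplus>\<^bsub>Q\<^esub> c') = \<psi> c \<oplus>\<^bsub>L\<^esub> \<psi> c'" using x y \<psi>[of "x \<oplus>\<^bsub>H\<^esub> y"] \<psi> qD(4) \<pi>D(4) by simp
  qed
  have "hopf_hom Q L \<psi>"
  proof (rule hopf_homI[OF lin])
    fix c assume "c \<in> carrier Q"
    then obtain x where x: "x \<in> carrier H" "c = q x" using rep by blast
    show "\<epsilon>\<^bsub>L\<^esub> (\<psi> c) = \<epsilon>\<^bsub>Q\<^esub> c" using x \<psi> qD(8) \<pi>D(8) by simp
    show "\<S>\<^bsub>L\<^esub> (\<psi> c) = \<psi> (\<S>\<^bsub>Q\<^esub> c)" using x \<psi> qD(9) \<pi>D(9) by simp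
    show "tensor_form b (\<Delta>\<^bsub>L\<^esub> (\<psi> c)) = tensor_form (\<lambda>x y. b (\<psi> x) (\<psi> y)) (\<Delta>\<^bsub>Q\<^esub> c)" if b: "bilinear_form L L b" for b
    proof -
      have "tensor_form (\<lambda>x y. b (\<psi> x) (\<psi> y)) (\<Delta>\<^bsub>Q\<^esub> c) = tensor_form (\<lambda>x y. b (\<psi> (q x)) (\<psi> (q y))) (\<Delta>\<^bsub>H\<^esub> x)"
        using qD(7)[OF x(1) bilinear_form_comp[OF lin lin b]] x by simp
      also have "\<dots> = tensor_form (\<lambda>x y. b (\<pi> x) (\<pi> y)) (\<Delta>\<^bsub>H\<^esub> x)"
        using x \<psi> by (intro tensor_form_cong[OF H.comult_closed]) auto
      finally show ?thesis using \<pi>D(7)[OF x(1) b] x \<psi> by simp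
    qed
    fix c' assume "c' \<in> carrier Q"
    then obtain y where y: "y \<in> carrier H" "c' = q y" using rep by blast
    show "\<psi> (c \<otimes>\<^bsub>Q\<^esub> c') = \<psi> c \<otimes>\<^bsub>L\<^esub> \<psi> c'" using x y \<psi>[of "x \<otimes>\<^bsub>H\<^esub> y"] \<psi> qD(3) \<pi>D(3) by simp
  next
    show "\<psi> \<one>\<^bsub>Q\<^esub> = \<one>\<^bsub>L\<^esub>" using \<psi>[of "\<one>\<^bsub>H\<^esub>"] qD(6) \<pi>D(6) by simp
  qed
  then show ?thesis using \<psi> by (rule that)
qed

lemma hopf_isomorphic_if_same_kernel:
  assumes H: "hopf_algebra H" and Q: "prehopf Q" and L: "prehopf L"
    and q: "hopf_hom H Q q" "q ` carrier H = carrier Q" and \<pi>: "hopf_hom H L \<pi>" "\<pi> ` carrier H = carrier L"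
    and ker: "\<And>x. x \<in> carrier H \<Longrightarrow> q x = \<zero>\<^bsub>Q\<^esub> \<longleftrightarrow> \<pi> x = \<zero>\<^bsub>L\<^esub>"
  shows "Q \<cong>\<^sub>H L"
proof -
  interpret H: hopf_algebra H by fact
  have V: "vspace H" "vspace Q" "vspace L" using assms H.vspace_axioms by (auto simp: prehopf_def)
  have ker': "x \<in> carrier H \<Longrightarrow> q x = \<zero>\<^bsub>Q\<^esub> \<Longrightarrow> \<pi> x = \<zero>\<^bsub>L\<^esub>" for x using ker by simp
  obtain \<psi> where \<psi>: "hopf_hom Q L \<psi>" "\<And>x. x \<in> carrier H \<Longrightarrow> \<psi> (q x) = \<pi> x"
    using hopf_hom_factor[OF H Q L q \<pi>(1) ker'] by blast
  have "bij_betw \<psi> (carrier Q) (carrier L)"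
    unfolding bij_betw_def
  proof
    show "inj_on \<psi> (carrier Q)"
    proof (rule inj_onI)
      fix c c' assume c: "c \<in> carrier Q" "c' \<in> carrier Q" "\<psi> c = \<psi> c'"
      obtain x where x: "x \<in> carrier H" "c = q x" using c(1) q(2) by blast
      obtain y where y: "y \<in> carrier H" "c' = q y" using c(2) q(2) by blast
      have "\<pi> x = \<pi> y" using c(3) x y \<psi>(2) by simp
      then have "\<pi> (x \<ominus>\<^bsub>H\<^esub> y) = \<zero>\<^bsub>L\<^esub>" using hopf_hom_kernel(2)[OF V(1,3) \<pi>(1) x(1) y(1)] by simp
      then have "q (x \<ominus>\<^bsub>H\<^esub> y) = \<zero>\<^bsub>Q\<^esub>" using ker x y by simp
      then show "c = c'" using hopf_hom_kernel(2)[OF V(1,2) q(1) x(1) y(1)] x y by simp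
    qed
    show "\<psi> ` carrier Q = carrier L"
      unfolding q(2)[symmetric] \<pi>(2)[symmetric] image_image using \<psi>(2) by simp
  qed
  then show ?thesis using \<psi>(1) hopf_isomorphic_iff[OF Q L] by blast
qed

lemma hopf_hom_id: "hopf_hom H H (\<lambda>x. x)"
  by (rule hopf_homI) (auto simp: linear_map_def)

lemma hopf_isomorphic_refl: "prehopf H \<Longrightarrow> H \<cong>\<^sub>H H"
  using hopf_hom_id[of H] by (auto simp: hopf_isomorphic_iff bij_betw_def inj_on_def intro!: exI[of _ "\<lambda>x. x"])

lemma hopf_isomorphic_sym:
  assumes H: "hopf_algebra H" and L: "prehopf L" and iso: "H \<cong>\<^sub>H L"
  shows "L \<cong>\<^sub>H H"
proof -
  interpret H: hopf_algebra H by fact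
  have V: "vspace H" "vspace L" using L H.vspace_axioms by (auto simp: prehopf_def)
  obtain \<phi> where \<phi>: "hopf_hom H L \<phi>" "bij_betw \<phi> (carrier H) (carrier L)"
    using iso hopf_isomorphic_iff[OF H.prehopf L] by blast
  have "\<phi> x = \<zero>\<^bsub>L\<^esub> \<longleftrightarrow> x = \<zero>\<^bsub>H\<^esub>" if "x \<in> carrier H" for x
    using inj_on_eq_iff[OF bij_betw_imp_inj_on[OF \<phi>(2)] that H.zero_closed]
      H.linear_map_zero[OF V(2) hopf_homD(1)[OF \<phi>(1)]] by simp
  then show ?thesis
    using bij_betw_imp_surj_on[OF \<phi>(2)]
    by (intro hopf_isomorphic_if_same_kernel[OF H L H.prehopf \<phi>(1) _ hopf_hom_id]) auto
qed

lemma hopf_isomorphic_trans: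
  assumes "prehopf H" "prehopf L" "prehopf M" "H \<cong>\<^sub>H L" "L \<cong>\<^sub>H M"
  shows "H \<cong>\<^sub>H M"
proof -
  obtain \<phi> \<psi> where "hopf_hom H L \<phi>" "bij_betw \<phi> (carrier H) (carrier L)"
      "hopf_hom L M \<psi>" "bij_betw \<psi> (carrier L) (carrier M)"
    using assms hopf_isomorphic_iff by metis
  then have "hopf_hom H M (\<lambda>x. \<psi> (\<phi> x))" "bij_betw (\<lambda>x. \<psi> (\<phi> x)) (carrier H) (carrier M)"
    using hopf_hom_comp bij_betw_trans[of \<phi> _ _ \<psi>] by (auto simp: comp_def)
  then show ?thesis using hopf_isomorphic_iff[OF assms(1,3)] by blast
qed

subsection \<open>Surjective images\<close>

lemma kalgebra_image:
  fixes H :: "('k::field, 'a, 'm) module_scheme" and L :: "('k, 'b, 'n) module_scheme"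
  assumes H: "kalgebra H" and \<pi>: "linear_map H L \<pi>" and surj: "\<pi> ` carrier H = carrier L"
    and mult: "\<And>x y. x \<in> carrier H \<Longrightarrow> y \<in> carrier H \<Longrightarrow> \<pi> (x \<otimes>\<^bsub>H\<^esub> y) = \<pi> x \<otimes>\<^bsub>L\<^esub> \<pi> y"
    and one: "\<pi> \<one>\<^bsub>H\<^esub> = \<one>\<^bsub>L\<^esub>" and zero: "\<pi> \<zero>\<^bsub>H\<^esub> = \<zero>\<^bsub>L\<^esub>"
  shows "kalgebra L"
proof -
  interpret H: kalgebra H by fact
  note sym = linear_mapD(2,3)[OF \<pi>, symmetric] mult[symmetric] one[symmetric] zero[symmetric]
  have ag: "abelian_group L"
  proof (rule abelian_groupI; unfold surj[symmetric])
    fix x assume "x \<in> \<pi> ` carrier H"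
    then obtain u where u: "u \<in> carrier H" "x = \<pi> u" by blast
    then show "\<exists>y\<in>\<pi> ` carrier H. y \<oplus>\<^bsub>L\<^esub> x = \<zero>\<^bsub>L\<^esub>"
      by (intro bexI[of _ "\<pi> (\<ominus>\<^bsub>H\<^esub> u)"]) (simp_all add: sym H.l_neg)
  qed (auto simp: sym H.a_ac)
  have "vspace L" unfolding vspace_def
    by (rule moduleI[OF cring_from_type_algebra ag]; unfold surj[symmetric]) (auto simp: sym H.vs_distr)
  moreover have "Group.monoid L"
    by (rule monoidI; unfold surj[symmetric]) (auto simp: sym H.m_assoc)
  then have "ring L"
    by (intro ringI[OF ag]; (assumption | unfold surj[symmetric])) (auto simp: sym H.l_distr H.r_distr)
  moreover have "kalgebra_axioms L"
    by (rule kalgebra_axioms.intro; unfold surj[symmetric]) (auto simp: sym H.smult_mult)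
  ultimately show ?thesis by (intro kalgebra.intro)
qed

text \<open>Every identity required in \<open>L\<close> concerns images of elements of \<open>H\<close>, and pulling the forms back along \<open>\<pi>\<close> reduces
  it to the same identity in \<open>H\<close>.\<close>

lemma fdhopf_image:
  assumes H: "fdhopf H" and L: "prehopf L" and \<pi>: "hopf_hom H L \<pi>" and surj: "\<pi> ` carrier H = carrier L"
  shows "fdhopf L"
proof -
  obtain B d where "fd_hopf H B d" using fdhopf_basis[OF H] .
  then interpret H: fd_hopf H B d .
  have VL: "vspace L" using L by (simp add: prehopf_def)
  then interpret VL: vspace L .
  note D = hopf_homD[OF \<pi>]
  have zero: "\<pi> \<zero>\<^bsub>H\<^esub> = \<zero>\<^bsub>L\<^esub>" by (rule H.linear_map_zero[OF VL D(1)])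
  have alg: "kalgebra L" by (rule kalgebra_image[OF H.kalgebra_axioms D(1) surj D(3,6) zero])
  interpret LL: kalgebra L by (rule alg)
  have fdL: "finite_dimensional L" by (rule finite_dimensional_image[OF H.vspace_axioms VL D(1) surj H.fd])
  have rep: "\<exists>h\<in>carrier H. c = \<pi> h" if "c \<in> carrier L" for c using that surj by blast
  have bl: "bilinear_form H H (\<lambda>x y. b (\<pi> x) (\<pi> y))" if "bilinear_form L L b" for b
    using bilinear_form_comp[OF D(1,1) that] .
  have sw: "tensor_form b (\<Delta>\<^bsub>L\<^esub> (\<pi> h)) = H.sw h (\<lambda>x y. b (\<pi> x) (\<pi> y))" if "bilinear_form L L b" "h \<in> carrier H" for b h
    using D(7)[OF that(2,1)] H.sw_eq[OF bl[OF that(1)] that(2)] by simp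
  have cl: "\<Delta>\<^bsub>L\<^esub> h \<in> carrier (tensor L L)" if "h \<in> carrier L" for h using L that by (simp add: prehopf_def)
  have eL: "\<epsilon>\<^bsub>L\<^esub> (x \<oplus>\<^bsub>L\<^esub> y) = \<epsilon>\<^bsub>L\<^esub> x + \<epsilon>\<^bsub>L\<^esub> y" "\<epsilon>\<^bsub>L\<^esub> (c \<odot>\<^bsub>L\<^esub> x) = c * \<epsilon>\<^bsub>L\<^esub> x"
    "\<S>\<^bsub>L\<^esub> (x \<oplus>\<^bsub>L\<^esub> y) = \<S>\<^bsub>L\<^esub> x \<oplus>\<^bsub>L\<^esub> \<S>\<^bsub>L\<^esub> y" "\<S>\<^bsub>L\<^esub> (c \<odot>\<^bsub>L\<^esub> x) = c \<odot>\<^bsub>L\<^esub> \<S>\<^bsub>L\<^esub> x" "\<S>\<^bsub>L\<^esub> x \<in> carrier L"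
    if xy: "x \<in> carrier L" "y \<in> carrier L" for x y c
  proof -
    obtain u v where uv: "u \<in> carrier H" "x = \<pi> u" "v \<in> carrier H" "y = \<pi> v"
      using rep[OF xy(1)] rep[OF xy(2)] by blast
    show "\<epsilon>\<^bsub>L\<^esub> (x \<oplus>\<^bsub>L\<^esub> y) = \<epsilon>\<^bsub>L\<^esub> x + \<epsilon>\<^bsub>L\<^esub> y" using uv D(8)[of "u \<oplus>\<^bsub>H\<^esub> v"] by (simp add: D(4,8))
    show "\<epsilon>\<^bsub>L\<^esub> (c \<odot>\<^bsub>L\<^esub> x) = c * \<epsilon>\<^bsub>L\<^esub> x" using uv D(8)[of "c \<odot>\<^bsub>H\<^esub> u"] by (simp add: D(5,8))
    show "\<S>\<^bsub>L\<^esub> (x \<oplus>\<^bsub>L\<^esub> y) = \<S>\<^bsub>L\<^esub> x \<oplus>\<^bsub>L\<^esub> \<S>\<^bsub>L\<^esub> y"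
      using uv D(9)[of "u \<oplus>\<^bsub>H\<^esub> v"] by (simp add: D(4,9) H.antipode_lin)
    show "\<S>\<^bsub>L\<^esub> (c \<odot>\<^bsub>L\<^esub> x) = c \<odot>\<^bsub>L\<^esub> \<S>\<^bsub>L\<^esub> x" using uv D(9)[of "c \<odot>\<^bsub>H\<^esub> u"] by (simp add: D(5,9) H.antipode_lin)
    show "\<S>\<^bsub>L\<^esub> x \<in> carrier L" using uv by (simp add: D)
  qed
  have "hopf_algebra L"
  proof (rule hopf_algebraI[OF alg fdL cl])
    fix b assume b: "bilinear_form L L b"
    note bD = bilinear_formD(3-)[OF b]
    show "linear_form L (\<lambda>h. tensor_form b (\<Delta>\<^bsub>L\<^esub> h))"
      unfolding linear_form_def
    proof (intro conjI ballI allI)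
      fix x c assume "x \<in> carrier L"
      then obtain u where u: "u \<in> carrier H" "x = \<pi> u" using rep by blast
      show "tensor_form b (\<Delta>\<^bsub>L\<^esub> (c \<odot>\<^bsub>L\<^esub> x)) = c * tensor_form b (\<Delta>\<^bsub>L\<^esub> x)"
        using u sw[OF b, of "c \<odot>\<^bsub>H\<^esub> u"] by (simp add: D(5) sw[OF b])
      fix y assume "y \<in> carrier L"
      then obtain v where v: "v \<in> carrier H" "y = \<pi> v" using rep by blast
      show "tensor_form b (\<Delta>\<^bsub>L\<^esub> (x \<oplus>\<^bsub>L\<^esub> y)) = tensor_form b (\<Delta>\<^bsub>L\<^esub> x) + tensor_form b (\<Delta>\<^bsub>L\<^esub> y)"
        using u v sw[OF b, of "u \<oplus>\<^bsub>H\<^esub> v"] by (simp add: D(4) sw[OF b])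
    qed
    show "tensor_form b (\<Delta>\<^bsub>L\<^esub> \<one>\<^bsub>L\<^esub>) = b \<one>\<^bsub>L\<^esub> \<one>\<^bsub>L\<^esub>"
      using sw[OF b, of "\<one>\<^bsub>H\<^esub>"] H.sw_one[OF bl[OF b]] by (simp add: D(6))
    fix x y assume xy: "x \<in> carrier L" "y \<in> carrier L"
    obtain u v where uv: "u \<in> carrier H" "x = \<pi> u" "v \<in> carrier H" "y = \<pi> v"
      using rep[OF xy(1)] rep[OF xy(2)] by blast
    have in1: "bilinear_form L L (\<lambda>p' q'. b (p \<otimes>\<^bsub>L\<^esub> p') (q \<otimes>\<^bsub>L\<^esub> q'))" if "p \<in> carrier L" "q \<in> carrier L" for p q
      using that by (intro bilinear_formI) (simp_all add: LL.r_distr LL.smult_mult bD)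
    have out: "bilinear_form L L (\<lambda>p q. H.sw v (\<lambda>p' q'. b (p \<otimes>\<^bsub>L\<^esub> \<pi> p') (q \<otimes>\<^bsub>L\<^esub> \<pi> q')))"
      by (intro bilinear_formI) (simp_all add: LL.l_distr LL.smult_mult bD D(2))
    have "tensor_form (\<lambda>p q. tensor_form (\<lambda>p' q'. b (p \<otimes>\<^bsub>L\<^esub> p') (q \<otimes>\<^bsub>L\<^esub> q')) (\<Delta>\<^bsub>L\<^esub> y)) (\<Delta>\<^bsub>L\<^esub> x) =
        tensor_form (\<lambda>p q. H.sw v (\<lambda>p' q'. b (p \<otimes>\<^bsub>L\<^esub> \<pi> p') (q \<otimes>\<^bsub>L\<^esub> \<pi> q'))) (\<Delta>\<^bsub>L\<^esub> x)"
      using uv sw[OF in1 uv(3)] D(2) by (intro tensor_form_cong[OF cl]) auto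
    also have "\<dots> = H.sw u (\<lambda>p q. H.sw v (\<lambda>p' q'. b (\<pi> (p \<otimes>\<^bsub>H\<^esub> p')) (\<pi> (q \<otimes>\<^bsub>H\<^esub> q'))))"
      using sw[OF out uv(1)] uv by (simp add: D(3))
    also have "\<dots> = H.sw (u \<otimes>\<^bsub>H\<^esub> v) (\<lambda>p q. b (\<pi> p) (\<pi> q))"
      using uv by (simp add: H.sw_mult[OF bl[OF b]])
    also have "\<dots> = tensor_form b (\<Delta>\<^bsub>L\<^esub> (x \<otimes>\<^bsub>L\<^esub> y))" using sw[OF b, of "u \<otimes>\<^bsub>H\<^esub> v"] uv by (simp add: D(3))
    finally show "tensor_form b (\<Delta>\<^bsub>L\<^esub> (x \<otimes>\<^bsub>L\<^esub> y)) =
      tensor_form (\<lambda>p q. tensor_form (\<lambda>p' q'. b (p \<otimes>\<^bsub>L\<^esub> p') (q \<otimes>\<^bsub>L\<^esub> q')) (\<Delta>\<^bsub>L\<^esub> y)) (\<Delta>\<^bsub>L\<^esub> x)" ..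
  next
    show "linear_form L \<epsilon>\<^bsub>L\<^esub>" by (simp add: linear_form_def eL)
    show "\<epsilon>\<^bsub>L\<^esub> \<one>\<^bsub>L\<^esub> = 1" using D(8)[of "\<one>\<^bsub>H\<^esub>"] by (simp add: D(6))
    show "\<epsilon>\<^bsub>L\<^esub> (x \<otimes>\<^bsub>L\<^esub> y) = \<epsilon>\<^bsub>L\<^esub> x * \<epsilon>\<^bsub>L\<^esub> y" if xy: "x \<in> carrier L" "y \<in> carrier L" for x y
    proof -
      obtain u v where uv: "u \<in> carrier H" "x = \<pi> u" "v \<in> carrier H" "y = \<pi> v"
        using rep[OF xy(1)] rep[OF xy(2)] by blast
      then show ?thesis using D(8)[of "u \<otimes>\<^bsub>H\<^esub> v"] by (simp add: D(3) D(8)[OF uv(1)] D(8)[OF uv(3)])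
    qed
    show "linear_map L L \<S>\<^bsub>L\<^esub>" by (rule linear_mapI) (simp_all add: eL)
  next
    fix t h assume t: "trilinear_form L t" and "h \<in> carrier L"
    then obtain u where u: "u \<in> carrier H" "h = \<pi> u" using rep by blast
    let ?t = "\<lambda>x y z. t (\<pi> x) (\<pi> y) (\<pi> z)"
    note tD = bilinear_formD(3-)[OF trilinear_formD(1)[OF t]] linear_formD[OF trilinear_formD(2)[OF t]]
    have t3: "trilinear_form H ?t" by (intro trilinear_formI) (simp_all add: D tD)
    have inl: "tensor_form (\<lambda>u v. t u v z) (\<Delta>\<^bsub>L\<^esub> (\<pi> x)) = H.sw x (\<lambda>u v. t (\<pi> u) (\<pi> v) z)"
      if "x \<in> carrier H" "z \<in> carrier L" for x z
      using that by (intro sw trilinear_formD(5)[OF t])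
    have outl: "bilinear_form L L (\<lambda>x z. tensor_form (\<lambda>u v. t u v z) (\<Delta>\<^bsub>L\<^esub> x))"
    proof (rule bilinear_formI)
      fix c x z assume "x \<in> carrier L" and z: "z \<in> carrier L"
      then obtain u where u: "u \<in> carrier H" "x = \<pi> u" using rep by blast
      show "tensor_form (\<lambda>u v. t u v z) (\<Delta>\<^bsub>L\<^esub> (c \<odot>\<^bsub>L\<^esub> x)) = c * tensor_form (\<lambda>u v. t u v z) (\<Delta>\<^bsub>L\<^esub> x)"
        using u inl[of "c \<odot>\<^bsub>H\<^esub> u"] z by (simp add: D(5) inl)
      show "tensor_form (\<lambda>u v. t u v (c \<odot>\<^bsub>L\<^esub> z)) (\<Delta>\<^bsub>L\<^esub> x) = c * tensor_form (\<lambda>u v. t u v z) (\<Delta>\<^bsub>L\<^esub> x)"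
        using u z by (simp add: inl tD D(2))
      fix y assume "y \<in> carrier L"
      then show "tensor_form (\<lambda>u v. t u v (z \<oplus>\<^bsub>L\<^esub> y)) (\<Delta>\<^bsub>L\<^esub> x) =
          tensor_form (\<lambda>u v. t u v z) (\<Delta>\<^bsub>L\<^esub> x) + tensor_form (\<lambda>u v. t u v y) (\<Delta>\<^bsub>L\<^esub> x)"
        using u z by (simp add: inl tD D(2))
    next
      fix x y z assume xy: "x \<in> carrier L" "y \<in> carrier L" and z: "z \<in> carrier L"
      obtain u v where uv: "u \<in> carrier H" "x = \<pi> u" "v \<in> carrier H" "y = \<pi> v"
        using rep[OF xy(1)] rep[OF xy(2)] by blast
      show "tensor_form (\<lambda>u v. t u v z) (\<Delta>\<^bsub>L\<^esub> (x \<oplus>\<^bsub>L\<^esub> y)) =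
          tensor_form (\<lambda>u v. t u v z) (\<Delta>\<^bsub>L\<^esub> x) + tensor_form (\<lambda>u v. t u v z) (\<Delta>\<^bsub>L\<^esub> y)"
        using uv z inl[of "u \<oplus>\<^bsub>H\<^esub> v"] by (simp add: D(4) inl)
    qed
    have inr: "tensor_form (\<lambda>u v. t x u v) (\<Delta>\<^bsub>L\<^esub> (\<pi> z)) = H.sw z (\<lambda>u v. t x (\<pi> u) (\<pi> v))"
      if "x \<in> carrier L" "z \<in> carrier H" for x z
      using that by (intro sw trilinear_formD(1)[OF t])
    have outr: "bilinear_form L L (\<lambda>x z. tensor_form (\<lambda>u v. t x u v) (\<Delta>\<^bsub>L\<^esub> z))"
    proof (rule bilinear_formI)
      fix c x z assume "x \<in> carrier L" and z: "z \<in> carrier L"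
      then obtain u where u: "u \<in> carrier H" "z = \<pi> u" using rep by blast
      note x = \<open>x \<in> carrier L\<close>
      show "tensor_form (\<lambda>u v. t x u v) (\<Delta>\<^bsub>L\<^esub> (c \<odot>\<^bsub>L\<^esub> z)) = c * tensor_form (\<lambda>u v. t x u v) (\<Delta>\<^bsub>L\<^esub> z)"
        using u inr[of x "c \<odot>\<^bsub>H\<^esub> u"] x by (simp add: D(5) inr)
      show "tensor_form (\<lambda>u v. t (c \<odot>\<^bsub>L\<^esub> x) u v) (\<Delta>\<^bsub>L\<^esub> z) = c * tensor_form (\<lambda>u v. t x u v) (\<Delta>\<^bsub>L\<^esub> z)"
        using u x by (simp add: inr tD D(2))
      fix y assume "y \<in> carrier L"
      then show "tensor_form (\<lambda>u v. t (x \<oplus>\<^bsub>L\<^esub> y) u v) (\<Delta>\<^bsub>L\<^esub> z) =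
          tensor_form (\<lambda>u v. t x u v) (\<Delta>\<^bsub>L\<^esub> z) + tensor_form (\<lambda>u v. t y u v) (\<Delta>\<^bsub>L\<^esub> z)"
        using u x by (simp add: inr tD D(2))
    next
      fix x y z assume x: "x \<in> carrier L" and yz: "y \<in> carrier L" "z \<in> carrier L"
      obtain u v where uv: "u \<in> carrier H" "y = \<pi> u" "v \<in> carrier H" "z = \<pi> v"
        using rep[OF yz(1)] rep[OF yz(2)] by blast
      show "tensor_form (\<lambda>u v. t x u v) (\<Delta>\<^bsub>L\<^esub> (y \<oplus>\<^bsub>L\<^esub> z)) =
          tensor_form (\<lambda>u v. t x u v) (\<Delta>\<^bsub>L\<^esub> y) + tensor_form (\<lambda>u v. t x u v) (\<Delta>\<^bsub>L\<^esub> z)"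
        using uv x inr[of x "u \<oplus>\<^bsub>H\<^esub> v"] by (simp add: D(4) inr)
    qed
    show "tensor_form (\<lambda>x z. tensor_form (\<lambda>u v. t u v z) (\<Delta>\<^bsub>L\<^esub> x)) (\<Delta>\<^bsub>L\<^esub> h) =
       tensor_form (\<lambda>x z. tensor_form (\<lambda>u v. t x u v) (\<Delta>\<^bsub>L\<^esub> z)) (\<Delta>\<^bsub>L\<^esub> h)"
      using sw[OF outl u(1)] sw[OF outr u(1)] H.coassoc_sw[OF t3 u(1)] u(2) D(2)
      by (simp add: inl inr)
  next
    fix \<phi> h assume \<phi>: "linear_form L \<phi>" and "h \<in> carrier L"
    then obtain u where u: "u \<in> carrier H" "h = \<pi> u" using rep by blast
    note \<phi>' = linear_form_comp[OF D(1) \<phi>] and \<phi>D = linear_formD[OF \<phi>]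
    have "bilinear_form L L (\<lambda>x y. \<epsilon>\<^bsub>L\<^esub> x * \<phi> y)" "bilinear_form L L (\<lambda>x y. \<epsilon>\<^bsub>L\<^esub> y * \<phi> x)"
      "bilinear_form L L (\<lambda>x y. \<phi> (\<S>\<^bsub>L\<^esub> x \<otimes>\<^bsub>L\<^esub> y))" "bilinear_form L L (\<lambda>x y. \<phi> (x \<otimes>\<^bsub>L\<^esub> \<S>\<^bsub>L\<^esub> y))"
      by (rule bilinear_formI; simp add: eL \<phi>D distrib_left distrib_right mult.left_commute mult.assoc
          LL.l_distr LL.r_distr LL.smult_mult)+
    note s = this[THEN sw, OF u(1)]
    show "tensor_form (\<lambda>x y. \<epsilon>\<^bsub>L\<^esub> x * \<phi> y) (\<Delta>\<^bsub>L\<^esub> h) = \<phi> h"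
      using s(1) H.counit_sw(1)[OF \<phi>' u(1)] u(2) by (simp add: D(8))
    show "tensor_form (\<lambda>x y. \<epsilon>\<^bsub>L\<^esub> y * \<phi> x) (\<Delta>\<^bsub>L\<^esub> h) = \<phi> h"
      using s(2) H.counit_sw(2)[OF \<phi>' u(1)] u(2) by (simp add: D(8))
    show "tensor_form (\<lambda>x y. \<phi> (\<S>\<^bsub>L\<^esub> x \<otimes>\<^bsub>L\<^esub> y)) (\<Delta>\<^bsub>L\<^esub> h) = \<epsilon>\<^bsub>L\<^esub> h * \<phi> \<one>\<^bsub>L\<^esub>"
      using s(3) H.antipode_sw(1)[OF \<phi>' u(1)] u by (simp add: D(8,9) D(3,6)[symmetric])
    show "tensor_form (\<lambda>x y. \<phi> (x \<otimes>\<^bsub>L\<^esub> \<S>\<^bsub>L\<^esub> y)) (\<Delta>\<^bsub>L\<^esub> h) = \<epsilon>\<^bsub>L\<^esub> h * \<phi> \<one>\<^bsub>L\<^esub>"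
      using s(4) H.antipode_sw(2)[OF \<phi>' u(1)] u by (simp add: D(8,9) D(3,6)[symmetric])
  qed
  then show ?thesis using fdL by (simp add: fdhopf_def)
qed

section \<open>Subalgebras under homomorphisms\<close>

lemma restrict_restrict:
  fixes H :: "('k::field, 'a) hopf"
  assumes "D \<subseteq> E"
  shows "restrict_hopf (restrict_hopf H E) D = restrict_hopf H D"
proof -
  have "(Poly_Mapping.keys f \<subseteq> E \<times> E \<and> Poly_Mapping.keys f \<subseteq> D \<times> D) = (Poly_Mapping.keys f \<subseteq> D \<times> D)"
    for f :: "('a \<times> 'a) \<Rightarrow>\<^sub>0 'k" using assms by blast
  then show ?thesis by (simp add: restrict_hopf_def)
qed

lemma image_hopf_subalgebra:
  assumes H: "fdhopf H" and L: "fdhopf L" and \<pi>: "hopf_hom H L \<pi>" and A: "hopf_subalgebra A H"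
  shows "hopf_subalgebra (\<pi> ` A) L"
proof -
  obtain B d where "fd_hopf H B d" using fdhopf_basis[OF H] .
  then interpret H: fd_hopf H B d .
  obtain B' d' where "fd_hopf L B' d'" using fdhopf_basis[OF L] .
  then interpret L: fd_hopf L B' d' .
  note D = hopf_homD[OF \<pi>] and AD = H.hopf_subalgebraD[OF A]
  have Ac: "a \<in> A \<Longrightarrow> a \<in> carrier H" for a using AD(2) by auto
  show ?thesis
  proof (rule L.hopf_subalgebraI)
    show "L.subcoalgebra (\<pi> ` A)" unfolding L.subcoalgebra_def
    proof (intro conjI ballI allI impI)
      show "submodule (\<pi> ` A) scalars L"
        by (rule linear_image_subspace[OF H.vspace_axioms L.vspace_axioms D(1) AD(1)])
      fix c b assume c: "c \<in> \<pi> ` A" and b: "bilinear_form L L b" and z: "\<forall>x\<in>\<pi> ` A. \<forall>y\<in>\<pi> ` A. b x y = 0"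
      obtain a where a: "a \<in> A" "c = \<pi> a" using c by blast
      note b' = bilinear_form_comp[OF D(1,1) b]
      have "L.sw c b = tensor_form (\<lambda>x y. b (\<pi> x) (\<pi> y)) (\<Delta>\<^bsub>H\<^esub> a)"
        using a Ac D(7)[OF _ b] by (simp add: L.sw_eq[OF b] D(2))
      also have "\<dots> = H.sw a (\<lambda>x y. b (\<pi> x) (\<pi> y))" using H.sw_eq[OF b'] a Ac by simp
      also have "\<dots> = 0" by (rule H.subcoalgebraD(2)[OF AD(6) a(1) b']) (use z in blast)
      finally show "L.sw c b = 0" .
    qed
    show "\<one>\<^bsub>L\<^esub> \<in> \<pi> ` A" using imageI[OF AD(3), of \<pi>] D(6) by simp
    show "x \<otimes>\<^bsub>L\<^esub> y \<in> \<pi> ` A" if xy: "x \<in> \<pi> ` A" "y \<in> \<pi> ` A" for x y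
    proof -
      obtain u v where "x = \<pi> u" "y = \<pi> v" "u \<in> A" "v \<in> A" using xy by blast
      then have "x \<otimes>\<^bsub>L\<^esub> y = \<pi> (u \<otimes>\<^bsub>H\<^esub> v)" "u \<otimes>\<^bsub>H\<^esub> v \<in> A" using D(3) Ac AD(4) by auto
      then show ?thesis by blast
    qed
    show "\<S>\<^bsub>L\<^esub> x \<in> \<pi> ` A" if x: "x \<in> \<pi> ` A" for x
    proof -
      obtain u where "x = \<pi> u" "u \<in> A" using x by blast
      then have "\<S>\<^bsub>L\<^esub> x = \<pi> (\<S>\<^bsub>H\<^esub> u)" "\<S>\<^bsub>H\<^esub> u \<in> A" using D(9) Ac AD(5) by auto
      then show ?thesis by blast
    qed
  qed
qed

lemma hopf_hom_restrict_domain: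
  assumes H: "fdhopf H" and \<pi>: "hopf_hom H L \<pi>" and A: "hopf_subalgebra A H"
  shows "hopf_hom (restrict_hopf H A) L \<pi>"
proof -
  obtain B d where "fd_hopf H B d" using fdhopf_basis[OF H] .
  then interpret H: fd_hopf H B d .
  note D = hopf_homD[OF \<pi>] and AD = H.hopf_subalgebraD[OF A]
  have Ac: "a \<in> A \<Longrightarrow> a \<in> carrier H" for a using AD(2) by auto
  show ?thesis
  proof (rule hopf_homI)
    show "linear_map (restrict_hopf H A) L \<pi>" by (rule linear_mapI) (simp_all add: Ac D)
    fix h b assume h: "h \<in> carrier (restrict_hopf H A)" and b: "bilinear_form L L b"
    note b' = bilinear_form_comp[OF D(1,1) b]
    have "h \<in> A" "h \<in> carrier H" using h Ac by auto
    then show "tensor_form b (\<Delta>\<^bsub>L\<^esub> (\<pi> h)) = tensor_form (\<lambda>x y. b (\<pi> x) (\<pi> y)) (\<Delta>\<^bsub>restrict_hopf H A\<^esub> h)"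
      using H.restrict_comult(2)[OF A _ b'] H.sw_eq[OF b'] D(7)[OF _ b] by (simp del: restrict_hopf_simps(9))
  qed (simp_all add: Ac D del: restrict_hopf_simps(9))
qed

lemma hopf_hom_restrict_codomain:
  assumes H: "hopf_algebra H" and L: "fdhopf L" and \<pi>: "hopf_hom H L \<pi>" and C: "hopf_subalgebra C L" "\<pi> ` carrier H \<subseteq> C"
  shows "hopf_hom H (restrict_hopf L C) \<pi>"
proof -
  interpret H: hopf_algebra H by fact
  obtain B d where "fd_hopf L B d" using fdhopf_basis[OF L] .
  then interpret L: fd_hopf L B d .
  note D = hopf_homD[OF \<pi>] and CD = L.hopf_subalgebraD[OF C(1)]
  have \<pi>C: "h \<in> carrier H \<Longrightarrow> \<pi> h \<in> C" for h using C(2) by auto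
  show ?thesis
  proof (rule hopf_homI)
    show "linear_map H (restrict_hopf L C) \<pi>" by (rule linear_mapI) (simp_all add: \<pi>C D)
    fix h b assume h: "h \<in> carrier H" and b: "bilinear_form (restrict_hopf L C) (restrict_hopf L C) b"
    obtain b' where b': "bilinear_form L L b'" "\<And>x y. x \<in> C \<Longrightarrow> y \<in> C \<Longrightarrow> b' x y = b x y"
      using L.bilinear_form_extend[OF CD(1) b] by blast
    have "tensor_form b (\<Delta>\<^bsub>restrict_hopf L C\<^esub> (\<pi> h)) = L.sw (\<pi> h) b'"
      using b'(2) by (intro L.restrict_form_cong[OF C(1) \<pi>C[OF h] b'(1)]) simp
    also have "\<dots> = tensor_form (\<lambda>x y. b' (\<pi> x) (\<pi> y)) (\<Delta>\<^bsub>H\<^esub> h)"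
      using L.sw_eq[OF b'(1) D(2)[OF h]] D(7)[OF h b'(1)] by simp
    also have "\<dots> = tensor_form (\<lambda>x y. b (\<pi> x) (\<pi> y)) (\<Delta>\<^bsub>H\<^esub> h)"
      using h \<pi>C b'(2) by (intro tensor_form_cong[OF H.comult_closed]) auto
    finally show "tensor_form b (\<Delta>\<^bsub>restrict_hopf L C\<^esub> (\<pi> h)) = tensor_form (\<lambda>x y. b (\<pi> x) (\<pi> y)) (\<Delta>\<^bsub>H\<^esub> h)" .
  qed (simp_all add: D del: restrict_hopf_simps(9))
qed

lemma hopf_subalgebra_restrict:
  assumes H: "fdhopf H" and E: "hopf_subalgebra E H" and D: "hopf_subalgebra D H" "D \<subseteq> E"
  shows "hopf_subalgebra D (restrict_hopf H E)"
proof -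
  obtain B d where "fd_hopf H B d" using fdhopf_basis[OF H] .
  then interpret H: fd_hopf H B d .
  obtain B' d' where "fd_hopf (restrict_hopf H E) B' d'" using fdhopf_basis[OF H.fdhopf_restrict[OF E]] .
  then interpret K: fd_hopf "restrict_hopf H E" B' d' .
  note DD = H.hopf_subalgebraD[OF D(1)] and ED = H.hopf_subalgebraD[OF E]
  show ?thesis
  proof (rule K.hopf_subalgebraI)
    show "K.subcoalgebra D" unfolding K.subcoalgebra_def
    proof (intro conjI ballI allI impI)
      show "submodule D scalars (restrict_hopf H E)"
        using H.subspaceD[OF DD(1)] D(2) by (intro K.subspaceI) auto
      fix a b assume a: "a \<in> D" and b: "bilinear_form (restrict_hopf H E) (restrict_hopf H E) b"
        and z: "\<forall>x\<in>D. \<forall>y\<in>D. b x y = 0"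
      obtain b' where b': "bilinear_form H H b'" "\<And>x y. x \<in> E \<Longrightarrow> y \<in> E \<Longrightarrow> b' x y = b x y"
        using H.bilinear_form_extend[OF ED(1) b] by blast
      have aE: "a \<in> E" using a D(2) by auto
      have "K.sw a b = tensor_form b (\<Delta>\<^bsub>restrict_hopf H E\<^esub> a)" using K.sw_eq[OF b] aE by (simp del: restrict_hopf_simps(9))
      also have "\<dots> = H.sw a b'" using b'(2) by (intro H.restrict_form_cong[OF E aE b'(1)]) simp
      also have "\<dots> = 0"
        by (rule H.subcoalgebraD(2)[OF DD(6) a b'(1)]) (use z b'(2) D(2) in \<open>auto simp: subset_iff\<close>)
      finally show "K.sw a b = 0" .
    qed
  qed (use DD in simp_all)
qed

text \<open>The adjoint actions of \<open>E\<close> on itself are the restrictions of those of \<open>H\<close>. So they preserve \<open>E\<close>, and \<open>A\<close> by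
  normality.\<close>

lemma normal_Int_restrict:
  assumes H: "fdhopf H" and E: "hopf_subalgebra E H" and A: "normal_hopf_subalgebra A H"
  shows "normal_hopf_subalgebra (A \<inter> E) (restrict_hopf H E)"
proof -
  obtain B d where "fd_hopf H B d" using fdhopf_basis[OF H] .
  then interpret H: fd_hopf H B d .
  obtain B' d' where "fd_hopf (restrict_hopf H E) B' d'" using fdhopf_basis[OF H.fdhopf_restrict[OF E]] .
  then interpret K: fd_hopf "restrict_hopf H E" B' d' .
  have A': "hopf_subalgebra A H" using A by (simp add: normal_hopf_subalgebra_def)
  note AD = H.hopf_subalgebraD[OF A'] and ED = H.hopf_subalgebraD[OF E]
  have Ec: "a \<in> E \<Longrightarrow> a \<in> carrier H" for a using ED(2) by auto
  let ?K = "restrict_hopf H E"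
  have adj: "K.adj_left h a = H.adj_left h a \<and> K.adj_right h a = H.adj_right h a"
    if h: "h \<in> E" and a: "a \<in> E" for h a
  proof -
    note hc = Ec[OF h] and ac = Ec[OF a]
    have mem: "H.adj_left h a \<in> E" "H.adj_right h a \<in> E"
    proof -
      show "H.adj_left h a \<in> E"
      proof (rule H.mem_if_annihilated'[OF ED(1) H.adj_closed(1)[OF hc ac]])
        fix \<phi> assume \<phi>: "linear_form H \<phi>" "\<And>w. w \<in> E \<Longrightarrow> \<phi> w = 0"
        have "bilinear_form H H (\<lambda>x y. \<phi> (x \<otimes>\<^bsub>H\<^esub> (a \<otimes>\<^bsub>H\<^esub> \<S>\<^bsub>H\<^esub> y)))"
          using ac by (intro bilinear_formI) (simp_all add: H.lin linear_formD[OF \<phi>(1)])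
        from H.subcoalgebraD(2)[OF ED(6) h this] show "\<phi> (H.adj_left h a) = 0"
          using \<phi>(2) ED(4,5) a by (simp add: H.adj_form(1)[OF hc ac \<phi>(1)])
      qed
      show "H.adj_right h a \<in> E"
      proof (rule H.mem_if_annihilated'[OF ED(1) H.adj_closed(2)[OF hc ac]])
        fix \<phi> assume \<phi>: "linear_form H \<phi>" "\<And>w. w \<in> E \<Longrightarrow> \<phi> w = 0"
        have "bilinear_form H H (\<lambda>x y. \<phi> (\<S>\<^bsub>H\<^esub> x \<otimes>\<^bsub>H\<^esub> (a \<otimes>\<^bsub>H\<^esub> y)))"
          using ac by (intro bilinear_formI) (simp_all add: H.lin linear_formD[OF \<phi>(1)])
        from H.subcoalgebraD(2)[OF ED(6) h this] show "\<phi> (H.adj_right h a) = 0"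
          using \<phi>(2) ED(4,5) a by (simp add: H.adj_form(2)[OF hc ac \<phi>(1)])
      qed
    qed
    have "\<phi> (K.adj_left h a) = \<phi> (H.adj_left h a) \<and> \<phi> (K.adj_right h a) = \<phi> (H.adj_right h a)"
      if \<phi>: "linear_form ?K \<phi>" for \<phi>
    proof -
      have "linear_form (H\<lparr>carrier := E\<rparr>) \<phi>" using \<phi> by (simp add: linear_form_def)
      then obtain \<psi> where \<psi>: "linear_form H \<psi>" "\<And>x. x \<in> E \<Longrightarrow> \<psi> x = \<phi> x"
        using H.linear_form_extension[OF H.fd ED(1)] by blast
      note \<psi>D = linear_formD[OF \<psi>(1)]
      have hK: "h \<in> carrier ?K" "a \<in> carrier ?K" using h a by auto
      have bl: "bilinear_form H H (\<lambda>x y. \<psi> (x \<otimes>\<^bsub>H\<^esub> (a \<otimes>\<^bsub>H\<^esub> \<S>\<^bsub>H\<^esub> y)))" "bilinear_form H H (\<lambda>x y. \<psi> (\<S>\<^bsub>H\<^esub> x \<otimes>\<^bsub>H\<^esub> (a \<otimes>\<^bsub>H\<^esub> y)))"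
        using ac by - (intro bilinear_formI; simp add: H.lin \<psi>D)+
      have bk: "bilinear_form ?K ?K (\<lambda>x y. \<phi> (x \<otimes>\<^bsub>?K\<^esub> (a \<otimes>\<^bsub>?K\<^esub> \<S>\<^bsub>?K\<^esub> y)))"
          "bilinear_form ?K ?K (\<lambda>x y. \<phi> (\<S>\<^bsub>?K\<^esub> x \<otimes>\<^bsub>?K\<^esub> (a \<otimes>\<^bsub>?K\<^esub> y)))"
        using hK(2) by - (intro bilinear_formI; simp add: K.lin linear_formD[OF \<phi>] del: restrict_hopf_simps)+
      have "\<phi> (K.adj_left h a) = tensor_form (\<lambda>x y. \<phi> (x \<otimes>\<^bsub>?K\<^esub> (a \<otimes>\<^bsub>?K\<^esub> \<S>\<^bsub>?K\<^esub> y))) (\<Delta>\<^bsub>?K\<^esub> h)"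
        using K.adj_form(1)[OF hK \<phi>] K.sw_eq[OF bk(1) hK(1)] by simp
      also have "\<dots> = H.sw h (\<lambda>x y. \<psi> (x \<otimes>\<^bsub>H\<^esub> (a \<otimes>\<^bsub>H\<^esub> \<S>\<^bsub>H\<^esub> y)))"
        using a ED(4,5) \<psi>(2) by (intro H.restrict_form_cong[OF E h bl(1)]) simp
      also have "\<dots> = \<phi> (H.adj_left h a)" using H.adj_form(1)[OF hc ac \<psi>(1)] \<psi>(2) mem by simp
      finally have 1: "\<phi> (K.adj_left h a) = \<phi> (H.adj_left h a)" .
      have "\<phi> (K.adj_right h a) = tensor_form (\<lambda>x y. \<phi> (\<S>\<^bsub>?K\<^esub> x \<otimes>\<^bsub>?K\<^esub> (a \<otimes>\<^bsub>?K\<^esub> y))) (\<Delta>\<^bsub>?K\<^esub> h)"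
        using K.adj_form(2)[OF hK \<phi>] K.sw_eq[OF bk(2) hK(1)] by simp
      also have "\<dots> = H.sw h (\<lambda>x y. \<psi> (\<S>\<^bsub>H\<^esub> x \<otimes>\<^bsub>H\<^esub> (a \<otimes>\<^bsub>H\<^esub> y)))"
        using a ED(4,5) \<psi>(2) by (intro H.restrict_form_cong[OF E h bl(2)]) simp
      also have "\<dots> = \<phi> (H.adj_right h a)" using H.adj_form(2)[OF hc ac \<psi>(1)] \<psi>(2) mem by simp
      finally show ?thesis using 1 by simp
    qed
    then show ?thesis
      using K.adj_closed[of h a] mem h a K.eq_if_forms_eq[OF K.fd] by simp
  qed
  have "hopf_subalgebra (A \<inter> E) ?K"
    by (rule hopf_subalgebra_restrict[OF H E H.hopf_subalgebra_Int[OF A' E]]) simp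
  moreover have "H.adj_left h a \<in> A" "H.adj_right h a \<in> A" if "h \<in> carrier H" "a \<in> A" for h a
    using A that unfolding H.normal_iff by auto
  ultimately show ?thesis
    unfolding K.normal_iff using adj K.adj_closed Ec by auto
qed

text \<open>\<open>\<pi>\<close> intertwines the adjoint actions, and every element of \<open>L\<close> that acts is the image of one in \<open>H\<close>.\<close>

lemma image_normal:
  assumes H: "fdhopf H" and L: "fdhopf L" and \<pi>: "hopf_hom H L \<pi>" "\<pi> ` carrier H = carrier L"
    and A: "normal_hopf_subalgebra A H"
  shows "normal_hopf_subalgebra (\<pi> ` A) L"
proof -
  obtain B d where "fd_hopf H B d" using fdhopf_basis[OF H] .
  then interpret H: fd_hopf H B d .
  obtain B' d' where "fd_hopf L B' d'" using fdhopf_basis[OF L] .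
  then interpret L: fd_hopf L B' d' .
  have A': "hopf_subalgebra A H" using A by (simp add: normal_hopf_subalgebra_def)
  note D = hopf_homD[OF \<pi>(1)] and AD = H.hopf_subalgebraD[OF A']
  have adj: "L.adj_left (\<pi> h) (\<pi> a) = \<pi> (H.adj_left h a)" "L.adj_right (\<pi> h) (\<pi> a) = \<pi> (H.adj_right h a)"
    if h: "h \<in> carrier H" and a: "a \<in> carrier H" for h a
  proof -
    note \<pi>h = D(2)[OF h] and \<pi>a = D(2)[OF a]
    show "L.adj_left (\<pi> h) (\<pi> a) = \<pi> (H.adj_left h a)"
    proof (rule L.eq_if_forms_eq[OF L.fd])
      fix \<phi> assume \<phi>: "linear_form L \<phi>"
      note \<phi>' = linear_form_comp[OF D(1) \<phi>]
      have bl: "bilinear_form L L (\<lambda>x y. \<phi> (x \<otimes>\<^bsub>L\<^esub> (\<pi> a \<otimes>\<^bsub>L\<^esub> \<S>\<^bsub>L\<^esub> y)))"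
        using \<pi>a by (intro bilinear_formI) (simp_all add: L.lin linear_formD[OF \<phi>])
      have "\<phi> (L.adj_left (\<pi> h) (\<pi> a)) = tensor_form (\<lambda>x y. \<phi> (\<pi> x \<otimes>\<^bsub>L\<^esub> (\<pi> a \<otimes>\<^bsub>L\<^esub> \<S>\<^bsub>L\<^esub> (\<pi> y)))) (\<Delta>\<^bsub>H\<^esub> h)"
        using L.adj_form(1)[OF \<pi>h \<pi>a \<phi>] L.sw_eq[OF bl \<pi>h] D(7)[OF h bl] by simp
      also have "\<dots> = tensor_form (\<lambda>x y. \<phi> (\<pi> (x \<otimes>\<^bsub>H\<^esub> (a \<otimes>\<^bsub>H\<^esub> \<S>\<^bsub>H\<^esub> y)))) (\<Delta>\<^bsub>H\<^esub> h)"
        using a by (intro tensor_form_cong[OF H.comult_closed[OF h]]) (simp add: D)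
      also have "\<dots> = H.sw h (\<lambda>x y. \<phi> (\<pi> (x \<otimes>\<^bsub>H\<^esub> (a \<otimes>\<^bsub>H\<^esub> \<S>\<^bsub>H\<^esub> y))))"
        using a by (intro H.sw_eq[symmetric, OF _ h] bilinear_formI) (simp_all add: H.lin linear_formD[OF \<phi>'])
      also have "\<dots> = \<phi> (\<pi> (H.adj_left h a))" using H.adj_form(1)[OF h a \<phi>'] by simp
      finally show "\<phi> (L.adj_left (\<pi> h) (\<pi> a)) = \<phi> (\<pi> (H.adj_left h a))" .
    qed (use h a D(2) in auto)
    show "L.adj_right (\<pi> h) (\<pi> a) = \<pi> (H.adj_right h a)"
    proof (rule L.eq_if_forms_eq[OF L.fd])
      fix \<phi> assume \<phi>: "linear_form L \<phi>"
      note \<phi>' = linear_form_comp[OF D(1) \<phi>]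
      have bl: "bilinear_form L L (\<lambda>x y. \<phi> (\<S>\<^bsub>L\<^esub> x \<otimes>\<^bsub>L\<^esub> (\<pi> a \<otimes>\<^bsub>L\<^esub> y)))"
        using \<pi>a by (intro bilinear_formI) (simp_all add: L.lin linear_formD[OF \<phi>])
      have "\<phi> (L.adj_right (\<pi> h) (\<pi> a)) = tensor_form (\<lambda>x y. \<phi> (\<S>\<^bsub>L\<^esub> (\<pi> x) \<otimes>\<^bsub>L\<^esub> (\<pi> a \<otimes>\<^bsub>L\<^esub> \<pi> y))) (\<Delta>\<^bsub>H\<^esub> h)"
        using L.adj_form(2)[OF \<pi>h \<pi>a \<phi>] L.sw_eq[OF bl \<pi>h] D(7)[OF h bl] by simp
      also have "\<dots> = tensor_form (\<lambda>x y. \<phi> (\<pi> (\<S>\<^bsub>H\<^esub> x \<otimes>\<^bsub>H\<^esub> (a \<otimes>\<^bsub>H\<^esub> y)))) (\<Delta>\<^bsub>H\<^esub> h)"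
        using a by (intro tensor_form_cong[OF H.comult_closed[OF h]]) (simp add: D)
      also have "\<dots> = H.sw h (\<lambda>x y. \<phi> (\<pi> (\<S>\<^bsub>H\<^esub> x \<otimes>\<^bsub>H\<^esub> (a \<otimes>\<^bsub>H\<^esub> y))))"
        using a by (intro H.sw_eq[symmetric, OF _ h] bilinear_formI) (simp_all add: H.lin linear_formD[OF \<phi>'])
      also have "\<dots> = \<phi> (\<pi> (H.adj_right h a))" using H.adj_form(2)[OF h a \<phi>'] by simp
      finally show "\<phi> (L.adj_right (\<pi> h) (\<pi> a)) = \<phi> (\<pi> (H.adj_right h a))" .
    qed (use h a D(2) in auto)
  qed
  have "L.adj_left c e \<in> \<pi> ` A \<and> L.adj_right c e \<in> \<pi> ` A" if c: "c \<in> carrier L" and e: "e \<in> \<pi> ` A" for c e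
  proof -
    obtain h where h: "h \<in> carrier H" "c = \<pi> h" using c \<pi>(2) by blast
    obtain a where a: "a \<in> A" "e = \<pi> a" using e by blast
    have "H.adj_left h a \<in> A" "H.adj_right h a \<in> A" using A h a unfolding H.normal_iff by auto
    then show ?thesis using adj[OF h(1), of a] a h AD(2) by (auto simp: subset_iff)
  qed
  then show ?thesis unfolding L.normal_iff using image_hopf_subalgebra[OF H L \<pi>(1) A'] by blast
qed

section \<open>Quotients by Hopf ideals\<close>

lemma tensor_cong_structure:
  fixes V :: "('k::field, 'a, 'm) module_scheme" and V' :: "('k, 'a, 'n) module_scheme"
  assumes "carrier V = carrier V'" "monoid.mult V = monoid.mult V'" "\<one>\<^bsub>V\<^esub> = \<one>\<^bsub>V'\<^esub>" "add V = add V'"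
    "module.smult V = module.smult V'"
  shows "tensor V V = tensor V' V'" "pure_tensor V V = pure_tensor V' V'"
proof -
  have f: "fsums V V = (fsums V' V' :: (('a \<times> 'a) \<Rightarrow>\<^sub>0 'k) set)" by (simp add: fsums_def assms(1))
  have m: "fmult V V = (fmult V' V' :: _ \<Rightarrow> _ \<Rightarrow> (('a \<times> 'a) \<Rightarrow>\<^sub>0 'k))" by (simp add: fmult_def[abs_def] assms(2))
  have r: "bilinear_rels V V = bilinear_rels V' V'" unfolding bilinear_rels_def assms ..
  have t: "tclass V V = tclass V' V'" by (simp add: tclass_def[abs_def] f r)
  note 1 = t f m
  show pt: "pure_tensor V V = pure_tensor V' V'" by (simp add: pure_tensor_def[abs_def] t)
  show "tensor V V = tensor V' V'" unfolding tensor_def f m t pt assms(3) ..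
qed

context fd_hopf
begin

lemma hopf_idealD:
  assumes "hopf_ideal I"
  shows "submodule I scalars H" "x \<in> I \<Longrightarrow> h \<in> carrier H \<Longrightarrow> h \<otimes> x \<in> I" "x \<in> I \<Longrightarrow> h \<in> carrier H \<Longrightarrow> x \<otimes> h \<in> I"
    "x \<in> I \<Longrightarrow> \<epsilon> x = 0" "x \<in> I \<Longrightarrow> \<S> x \<in> I"
    "x \<in> I \<Longrightarrow> bilinear_form H H b \<Longrightarrow> (\<And>u v. u \<in> I \<Longrightarrow> v \<in> carrier H \<Longrightarrow> b u v = 0) \<Longrightarrow>
       (\<And>u v. u \<in> I \<Longrightarrow> v \<in> carrier H \<Longrightarrow> b v u = 0) \<Longrightarrow> sw x b = 0"
proof -
  note D = assms[unfolded hopf_ideal_def]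
  show "submodule I scalars H" using D by (rule conjunct1)
  note D1 = D[THEN conjunct2, THEN conjunct1] and D2 = D[THEN conjunct2, THEN conjunct2, THEN conjunct1]
    and D3 = D[THEN conjunct2, THEN conjunct2, THEN conjunct2]
  show "h \<otimes> x \<in> I" if "x \<in> I" "h \<in> carrier H" using bspec[OF bspec[OF D1 that(1)] that(2)] by (rule conjunct1)
  show "x \<otimes> h \<in> I" if "x \<in> I" "h \<in> carrier H" using bspec[OF bspec[OF D1 that(1)] that(2)] by (rule conjunct2)
  show "\<epsilon> x = 0" if "x \<in> I" using bspec[OF D2 that] by (rule conjunct1)
  show "\<S> x \<in> I" if "x \<in> I" using bspec[OF D2 that] by (rule conjunct2)
  show "sw x b = 0" if "x \<in> I" "bilinear_form H H b" and z: "\<And>u v. u \<in> I \<Longrightarrow> v \<in> carrier H \<Longrightarrow> b u v = 0"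
    "\<And>u v. u \<in> I \<Longrightarrow> v \<in> carrier H \<Longrightarrow> b v u = 0"
  proof -
    have "\<forall>u\<in>I. \<forall>v\<in>carrier H. b u v = 0 \<and> b v u = 0" by (intro ballI conjI z)
    then show ?thesis by (rule mp[OF mp[OF spec[OF bspec[OF D3 that(1)]] that(2)]])
  qed
qed

lemma quotient_hopf_simps:
  "carrier (quotient_hopf H I) = a_rcosets I"
  "monoid.mult (quotient_hopf H I) = rcoset_mult H I" "\<one>\<^bsub>quotient_hopf H I\<^esub> = I +> \<one>"
  "\<zero>\<^bsub>quotient_hopf H I\<^esub> = I" "add (quotient_hopf H I) = set_add H"
  "module.smult (quotient_hopf H I) = (\<lambda>c C. \<Union>x\<in>C. I +> (c \<odot> x))"
  "comult (quotient_hopf H I) = (\<lambda>C. \<Union>x\<in>C. sweedler (tensor (quotient_hopf H I) (quotient_hopf H I))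
            (\<lambda>u v. pure_tensor (quotient_hopf H I) (quotient_hopf H I) (I +> u) (I +> v)) (\<Delta> x))"
  "counit (quotient_hopf H I) = (\<lambda>C. \<epsilon> (SOME x. x \<in> C))"
  "antipode (quotient_hopf H I) = (\<lambda>C. \<Union>x\<in>C. I +> \<S> x)"
proof -
  let ?QA = "quotient_algebra H I" and ?Q = "quotient_hopf H I"
  have s: "carrier ?Q = carrier ?QA" "monoid.mult ?Q = monoid.mult ?QA" "\<one>\<^bsub>?Q\<^esub> = \<one>\<^bsub>?QA\<^esub>" "\<zero>\<^bsub>?Q\<^esub> = \<zero>\<^bsub>?QA\<^esub>" "add ?Q = add ?QA"
    "module.smult ?Q = module.smult ?QA"
    by (simp_all add: quotient_hopf_def module.defs hopf.defs)
  note t = tensor_cong_structure[OF s(1-3,5,6)]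
  show "carrier ?Q = a_rcosets I" "monoid.mult ?Q = rcoset_mult H I" "\<one>\<^bsub>?Q\<^esub> = I +> \<one>"
    "\<zero>\<^bsub>?Q\<^esub> = I" "add ?Q = set_add H"
    "module.smult ?Q = (\<lambda>c C. \<Union>x\<in>C. I +> (c \<odot> x))"
    unfolding s by (simp_all add: quotient_algebra_def FactRing_def)
  show "comult ?Q = (\<lambda>C. \<Union>x\<in>C. sweedler (tensor ?Q ?Q) (\<lambda>u v. pure_tensor ?Q ?Q (I +> u) (I +> v)) (\<Delta> x))"
    unfolding t by (simp add: quotient_hopf_def module.defs hopf.defs)
  show "counit ?Q = (\<lambda>C. \<epsilon> (SOME x. x \<in> C))" "antipode ?Q = (\<lambda>C. \<Union>x\<in>C. I +> \<S> x)"
    by (simp_all add: quotient_hopf_def module.defs hopf.defs)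
qed

lemma hopf_hom_of_comult:
  fixes L :: "('k, 'b) hopf" and \<pi> :: "'a \<Rightarrow> 'b"
  assumes VL: "vspace L" and lin: "linear_map H L \<pi>" "\<pi> ` carrier H = carrier L"
    and mult: "\<And>x y. x \<in> carrier H \<Longrightarrow> y \<in> carrier H \<Longrightarrow> \<pi> (x \<otimes> y) = \<pi> x \<otimes>\<^bsub>L\<^esub> \<pi> y" and one: "\<pi> \<one> = \<one>\<^bsub>L\<^esub>"
    and comult: "\<And>x. x \<in> carrier H \<Longrightarrow>
      \<Delta>\<^bsub>L\<^esub> (\<pi> x) = sweedler (tensor L L) (\<lambda>u v. pure_tensor L L (\<pi> u) (\<pi> v)) (\<Delta> x)"
    and counit: "\<And>x. x \<in> carrier H \<Longrightarrow> \<epsilon>\<^bsub>L\<^esub> (\<pi> x) = \<epsilon> x"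
    and antipode: "\<And>x. x \<in> carrier H \<Longrightarrow> \<S>\<^bsub>L\<^esub> (\<pi> x) = \<pi> (\<S> x)"
  shows "prehopf L" "hopf_hom H L \<pi>"
proof -
  note \<pi>D = linear_mapD[OF lin(1)]
  have cl: "sweedler (tensor L L) (\<lambda>u v. pure_tensor L L (\<pi> u) (\<pi> v)) (\<Delta> y) \<in> carrier (tensor L L)"
    if "y \<in> carrier H" for y
    using that \<pi>D(1) by (intro sweedler_closed[OF tensor_vspace comult_closed] pure_tensor_closed)
  show L: "prehopf L" unfolding prehopf_def
  proof (intro conjI ballI VL)
    fix h assume "h \<in> carrier L"
    then obtain x where x: "x \<in> carrier H" "h = \<pi> x" unfolding lin(2)[symmetric] by blast
    then show "\<Delta>\<^bsub>L\<^esub> h \<in> carrier (tensor L L)" using comult[OF x(1)] cl by simp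
  qed
  show "hopf_hom H L \<pi>"
    by (rule hopf_homI[OF lin(1) mult one])
      (use comult counit antipode hopf_hom_sweedler[OF prehopf L lin(1)] in blast)+
qed

text \<open>By the coideal condition, \<open>(\<pi> \<otimes> \<pi>)(\<Delta>(h))\<close> depends only on the coset of \<open>h\<close>.\<close>

lemma comult_ideal_cong:
  fixes L :: "('k, 'b, 'm) module_scheme" and \<pi> :: "'a \<Rightarrow> 'b"
  assumes I: "hopf_ideal I" and VL: "vspace L" and lin: "linear_map H L \<pi>" and ker: "\<And>x. x \<in> I \<Longrightarrow> \<pi> x = \<zero>\<^bsub>L\<^esub>"
    and xy: "x \<in> carrier H" "y \<in> carrier H" "y \<ominus> x \<in> I"
  shows "sweedler (tensor L L) (\<lambda>u v. pure_tensor L L (\<pi> u) (\<pi> v)) (\<Delta> y) =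
    sweedler (tensor L L) (\<lambda>u v. pure_tensor L L (\<pi> u) (\<pi> v)) (\<Delta> x)"
proof (rule tensor_eqI)
  note ID = hopf_idealD[OF I] and \<pi>D = linear_mapD[OF lin]
  show "sweedler (tensor L L) (\<lambda>u v. pure_tensor L L (\<pi> u) (\<pi> v)) (\<Delta> y) \<in> carrier (tensor L L)"
    "sweedler (tensor L L) (\<lambda>u v. pure_tensor L L (\<pi> u) (\<pi> v)) (\<Delta> x) \<in> carrier (tensor L L)"
    using xy \<pi>D(1) by - (intro sweedler_closed[OF tensor_vspace comult_closed] pure_tensor_closed; assumption)+
  fix b assume b: "bilinear_form L L b"
  note b' = bilinear_form_comp[OF lin lin b]
  have eq: "tensor_form b (sweedler (tensor L L) (\<lambda>u v. pure_tensor L L (\<pi> u) (\<pi> v)) (\<Delta> z)) =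
      sw z (\<lambda>u v. b (\<pi> u) (\<pi> v))" if z: "z \<in> carrier H" for z
  proof -
    have "tensor_form b (sweedler (tensor L L) (\<lambda>u v. pure_tensor L L (\<pi> u) (\<pi> v)) (\<Delta> z)) =
        tensor_form (\<lambda>u v. tensor_form b (pure_tensor L L (\<pi> u) (\<pi> v))) (\<Delta> z)"
      using z \<pi>D(1)
      by (intro sweedler_form[OF tensor_vspace comult_closed tensor_form_linear[OF b]] pure_tensor_closed)
    also have "\<dots> = tensor_form (\<lambda>u v. b (\<pi> u) (\<pi> v)) (\<Delta> z)"
      using z \<pi>D(1) by (intro tensor_form_cong[OF comult_closed]) (auto simp: tensor_form_pure[OF b])
    also have "\<dots> = sw z (\<lambda>u v. b (\<pi> u) (\<pi> v))" using sw_eq[OF b' z] by simp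
    finally show ?thesis .
  qed
  have z: "b \<zero>\<^bsub>L\<^esub> w = 0" "b w \<zero>\<^bsub>L\<^esub> = 0" if "w \<in> carrier L" for w
    using vspace.linear_form_zero[OF VL bilinear_formD(1)[OF b that]]
      vspace.linear_form_zero[OF VL bilinear_formD(2)[OF b that]] by auto
  have "sw (y \<ominus> x) (\<lambda>u v. b (\<pi> u) (\<pi> v)) = 0"
    by (rule ID(6)[OF xy(3) b']) (simp_all add: ker z \<pi>D(1))
  moreover have "linear_form H (\<lambda>x. sw x (\<lambda>u v. b (\<pi> u) (\<pi> v)))" by (intro linI) simp_all
  ultimately have "sw y (\<lambda>u v. b (\<pi> u) (\<pi> v)) = sw x (\<lambda>u v. b (\<pi> u) (\<pi> v))"
    using linear_form_minus[OF _ xy(2,1), of "\<lambda>x. sw x (\<lambda>u v. b (\<pi> u) (\<pi> v))"] by simp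
  then show "tensor_form b (sweedler (tensor L L) (\<lambda>u v. pure_tensor L L (\<pi> u) (\<pi> v)) (\<Delta> y)) =
    tensor_form b (sweedler (tensor L L) (\<lambda>u v. pure_tensor L L (\<pi> u) (\<pi> v)) (\<Delta> x))"
    unfolding eq[OF xy(1)] eq[OF xy(2)] .
qed

lemma hopf_ideal_ideal:
  assumes "hopf_ideal I" shows "ideal I H"
  using hopf_idealD[OF assms] by (intro idealI ring_axioms submodule.axioms(1)[of I scalars H])

lemma quotient_projection:
  assumes I: "hopf_ideal I"
  defines "Q \<equiv> quotient_hopf H I"
  shows "prehopf Q" "hopf_hom H Q (\<lambda>x. I +> x)" "(\<lambda>x. I +> x) ` carrier H = carrier Q"
    "x \<in> carrier H \<Longrightarrow> I +> x = \<zero>\<^bsub>Q\<^esub> \<longleftrightarrow> x \<in> I"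
proof -
  note ID = hopf_idealD[OF I]
  interpret I: ideal I H by (rule hopf_ideal_ideal[OF I])
  note subI = subspaceD[OF ID(1)]
  have Ic: "i \<in> I \<Longrightarrow> i \<in> carrier H" for i using subI(1) by auto
  let ?q = "\<lambda>x. I +> x"
  have eqI: "?q x = ?q y \<longleftrightarrow> x \<ominus> y \<in> I" if "x \<in> carrier H" "y \<in> carrier H" for x y
    using quotient_eq_iff_same_a_r_cos[OF I.is_ideal that] by simp
  have mem: "y \<in> carrier H \<and> y \<ominus> x \<in> I" if x: "x \<in> carrier H" and y: "y \<in> ?q x" for x y
  proof -
    obtain i where i: "i \<in> I" "y = i \<oplus> x" using y unfolding a_r_coset_def' by blast
    then have "y \<ominus> x = i" using x Ic by (simp add: a_minus_def a_assoc r_neg)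
    then show ?thesis using i x Ic by simp
  qed
  have self: "x \<in> ?q x" if "x \<in> carrier H" for x
    using subI(2) that unfolding a_r_coset_def' by (intro UN_I[of \<zero>]) auto
  have one_set: "(\<Union>y\<in>?q x. F y) = F x" if "x \<in> carrier H" "\<And>y. y \<in> carrier H \<Longrightarrow> y \<ominus> x \<in> I \<Longrightarrow> F y = F x" for F :: "_ \<Rightarrow> 'z set" and x
    using that mem[OF that(1)] by (intro UN_const[OF self[OF that(1)]]) blast
  have carr: "?q ` carrier H = carrier Q"
    unfolding Q_def quotient_hopf_simps A_RCOSETS_def' by auto
  have smult: "?q (c \<odot> x) = c \<odot>\<^bsub>Q\<^esub> ?q x" if x: "x \<in> carrier H" for c x
    unfolding Q_def quotient_hopf_simps
  proof (rule one_set[symmetric, OF x])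
    fix y assume y: "y \<in> carrier H" "y \<ominus> x \<in> I"
    have "c \<odot> y \<ominus> c \<odot> x = c \<odot> (y \<ominus> x)" using y x by (simp add: a_minus_def vs_distr)
    then show "?q (c \<odot> y) = ?q (c \<odot> x)" using eqI[of "c \<odot> y" "c \<odot> x"] subI(4) y x by simp
  qed
  have lin: "linear_map H Q ?q"
  proof (rule linear_mapI)
    show "?q x \<in> carrier Q" if "x \<in> carrier H" for x using that carr by blast
    show "?q (x \<oplus> y) = ?q x \<oplus>\<^bsub>Q\<^esub> ?q y" if "x \<in> carrier H" "y \<in> carrier H" for x y
      unfolding Q_def quotient_hopf_simps using I.a_rcos_sum[OF that] by simp
  qed (rule smult)
  have mult: "?q (x \<otimes> y) = ?q x \<otimes>\<^bsub>Q\<^esub> ?q y" if "x \<in> carrier H" "y \<in> carrier H" for x y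
    unfolding Q_def quotient_hopf_simps using I.rcoset_mult_add[OF that] by simp
  have one: "?q \<one> = \<one>\<^bsub>Q\<^esub>" unfolding Q_def quotient_hopf_simps ..
  have zero: "?q \<zero> = \<zero>\<^bsub>Q\<^esub>" unfolding Q_def quotient_hopf_simps using a_rcos_zero[OF I.is_ideal subI(2)] .
  have "kalgebra Q" by (rule kalgebra_image[OF kalgebra_axioms lin carr mult one zero])
  then have VQ: "vspace Q" by (simp add: kalgebra_def)
  have ker: "?q x = \<zero>\<^bsub>Q\<^esub> \<longleftrightarrow> x \<in> I" if "x \<in> carrier H" for x
    using eqI[OF that, of \<zero>] that by (simp add: zero a_minus_def)
  then show "x \<in> carrier H \<Longrightarrow> ?q x = \<zero>\<^bsub>Q\<^esub> \<longleftrightarrow> x \<in> I" .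
  have antipode: "\<S>\<^bsub>Q\<^esub> (?q x) = ?q (\<S> x)" if x: "x \<in> carrier H" for x
    unfolding Q_def quotient_hopf_simps
  proof (rule one_set[OF x])
    fix y assume y: "y \<in> carrier H" "y \<ominus> x \<in> I"
    have "\<S> y \<ominus> \<S> x = \<S> (y \<ominus> x)" using linear_map_minus[OF vspace_axioms antipode_linear y(1) x] by simp
    then show "?q (\<S> y) = ?q (\<S> x)" using eqI[of "\<S> y" "\<S> x"] ID(5)[OF y(2)] y x by simp
  qed
  have counit: "\<epsilon>\<^bsub>Q\<^esub> (?q x) = \<epsilon> x" if x: "x \<in> carrier H" for x
  proof -
    have "(SOME y. y \<in> ?q x) \<in> ?q x" using self[OF x] by (rule someI)
    then have "\<epsilon> (SOME y. y \<in> ?q x) = \<epsilon> x"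
      using mem[OF x] ID(4) linear_form_minus[OF counit_form _ x] by fastforce
    then show ?thesis unfolding Q_def quotient_hopf_simps .
  qed
  have comult: "\<Delta>\<^bsub>Q\<^esub> (?q x) = sweedler (tensor Q Q) (\<lambda>u v. pure_tensor Q Q (?q u) (?q v)) (\<Delta> x)"
    if x: "x \<in> carrier H" for x
  proof -
    have "\<Delta>\<^bsub>Q\<^esub> (?q x) = (\<Union>y\<in>?q x. sweedler (tensor Q Q) (\<lambda>u v. pure_tensor Q Q (?q u) (?q v)) (\<Delta> y))"
      unfolding Q_def quotient_hopf_simps ..
    also have "\<dots> = sweedler (tensor Q Q) (\<lambda>u v. pure_tensor Q Q (?q u) (?q v)) (\<Delta> x)"
    proof (rule one_set[OF x])
      fix y assume y: "y \<in> carrier H" "y \<ominus> x \<in> I"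
      show "sweedler (tensor Q Q) (\<lambda>u v. pure_tensor Q Q (?q u) (?q v)) (\<Delta> y) =
          sweedler (tensor Q Q) (\<lambda>u v. pure_tensor Q Q (?q u) (?q v)) (\<Delta> x)"
        using ker Ic by (intro comult_ideal_cong[OF I VQ lin _ x y]) blast
    qed
    finally show ?thesis .
  qed
  show "prehopf Q" "hopf_hom H Q ?q"
    using hopf_hom_of_comult[OF VQ lin carr mult one comult counit antipode] by auto
  show "?q ` carrier H = carrier Q" by (rule carr)
qed

text \<open>For a projection \<open>p\<close> onto \<open>I\<close>, the map \<open>\<sigma> = id - p\<close> selects an element of each coset. Its range carries the
  structure of the quotient and consists of elements of \<open>H\<close> itself.\<close>

lemma quotient_copy:
  assumes I: "hopf_ideal I"
  obtains L :: "('k, 'a) hopf" and \<pi> where "prehopf L" "hopf_hom H L \<pi>" "\<pi> ` carrier H = carrier L"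
    "\<And>x. x \<in> carrier H \<Longrightarrow> \<pi> x = \<zero>\<^bsub>L\<^esub> \<longleftrightarrow> x \<in> I"
proof -
  note ID = hopf_idealD[OF I]
  note subI = subspaceD[OF ID(1)]
  have Ic: "i \<in> I \<Longrightarrow> i \<in> carrier H" for i using subI(1) by auto
  obtain p where p: "linear_map H H p" "\<And>x. x \<in> carrier H \<Longrightarrow> p x \<in> I" "\<And>x. x \<in> I \<Longrightarrow> p x = x"
    using projection_exists[OF fd ID(1)] by blast
  note pD = linear_mapD[OF p(1)]
  define \<sigma> where "\<sigma> x = x \<oplus> (- 1) \<odot> p x" for x
  have \<sigma>c: "\<sigma> x \<in> carrier H" if "x \<in> carrier H" for x using that pD(1) by (simp add: \<sigma>_def)
  have \<sigma>add: "\<sigma> (x \<oplus> y) = \<sigma> x \<oplus> \<sigma> y" if "x \<in> carrier H" "y \<in> carrier H" for x y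
    using that pD by (simp add: \<sigma>_def vs_distr(1) a_ac)
  have \<sigma>sm: "\<sigma> (c \<odot> x) = c \<odot> \<sigma> x" if "x \<in> carrier H" for x c
  proof -
    have "(- 1) \<odot> (c \<odot> p x) = c \<odot> ((- 1) \<odot> p x)" using that pD(1) by (simp add: vs_distr(3))
    then show ?thesis using that pD by (simp add: \<sigma>_def vs_distr(1))
  qed
  have \<sigma>0: "\<sigma> x = \<zero> \<longleftrightarrow> x \<in> I" if "x \<in> carrier H" for x
  proof -
    have "\<sigma> x = x \<ominus> p x" using that pD(1) by (simp add: \<sigma>_def a_minus_def minus_smult)
    then have "\<sigma> x = \<zero> \<longleftrightarrow> x = p x" using diff_eq_zero_iff[OF that pD(1)[OF that]] by simp
    then show ?thesis using p(2)[OF that] p(3)[of x] by auto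
  qed
  have \<sigma>p: "x \<ominus> \<sigma> x \<in> I" "\<sigma> x \<ominus> x \<in> I" if "x \<in> carrier H" for x
  proof -
    have "\<sigma> (x \<oplus> (- 1) \<odot> \<sigma> x) = \<zero> \<and> \<sigma> (\<sigma> x \<oplus> (- 1) \<odot> x) = \<zero>"
    proof -
      have "\<sigma> (p x) = \<zero>" using \<sigma>0 p(2) Ic that by blast
      moreover have "\<sigma> (\<sigma> x) = \<sigma> (x \<oplus> (- 1) \<odot> p x)" by (simp add: \<sigma>_def[of x])
      ultimately have "\<sigma> (\<sigma> x) = \<sigma> x" using that pD(1) by (simp add: \<sigma>add \<sigma>sm \<sigma>c)
      then show ?thesis using that \<sigma>c by (simp add: \<sigma>add \<sigma>sm) (simp add: minus_smult[symmetric] M.r_neg)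
    qed
    moreover have "x \<ominus> \<sigma> x = x \<oplus> (- 1) \<odot> \<sigma> x" "\<sigma> x \<ominus> x = \<sigma> x \<oplus> (- 1) \<odot> x"
      using that \<sigma>c by (simp_all add: a_minus_def minus_smult)
    ultimately show "x \<ominus> \<sigma> x \<in> I" "\<sigma> x \<ominus> x \<in> I" using \<sigma>0 that \<sigma>c by (metis minus_closed)+
  qed
  have \<sigma>eq: "\<sigma> x = \<sigma> y" if "x \<ominus> y \<in> I" "x \<in> carrier H" "y \<in> carrier H" for x y
  proof -
    have "\<sigma> (x \<ominus> y) = \<zero>" using \<sigma>0 that by simp
    then have "\<sigma> x \<ominus> \<sigma> y = \<zero>" using that \<sigma>c by (simp add: a_minus_def minus_smult \<sigma>add \<sigma>sm)
    then show ?thesis using diff_eq_zero_iff \<sigma>c that by simp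
  qed
  \<comment> \<open>The algebra alone: the comultiplication of \<open>L\<close> takes values in a tensor product over it.\<close>
  define L0 :: "('k, 'a) module" where
    "L0 = \<lparr>carrier = \<sigma> ` carrier H, monoid.mult = (\<lambda>x y. \<sigma> (x \<otimes> y)), one = \<sigma> \<one>, ring.zero = \<zero>,
      add = (\<oplus>), module.smult = (\<odot>)\<rparr>"
  define L :: "('k, 'a) hopf" where
    "L = \<lparr>carrier = \<sigma> ` carrier H, monoid.mult = (\<lambda>x y. \<sigma> (x \<otimes> y)), one = \<sigma> \<one>, ring.zero = \<zero>,
      add = (\<oplus>), module.smult = (\<odot>),
      comult = (\<lambda>c. sweedler (tensor L0 L0) (\<lambda>u v. pure_tensor L0 L0 (\<sigma> u) (\<sigma> v)) (\<Delta> c)),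
      counit = \<epsilon>, antipode = (\<lambda>c. \<sigma> (\<S> c))\<rparr>"
  have Ls: "carrier L = \<sigma> ` carrier H" "monoid.mult L = (\<lambda>x y. \<sigma> (x \<otimes> y))" "\<one>\<^bsub>L\<^esub> = \<sigma> \<one>" "\<zero>\<^bsub>L\<^esub> = \<zero>"
     "add L = (\<oplus>)" "module.smult L = (\<odot>)" "counit L = \<epsilon>" "antipode L = (\<lambda>c. \<sigma> (\<S> c))"
    by (simp_all add: L_def)
  have tensors: "tensor L0 L0 = tensor L L" "pure_tensor L0 L0 = pure_tensor L L"
    by (rule tensor_cong_structure; simp add: L_def L0_def)+
  have Lcomult: "\<Delta>\<^bsub>L\<^esub> c = sweedler (tensor L L) (\<lambda>u v. pure_tensor L L (\<sigma> u) (\<sigma> v)) (\<Delta> c)" for c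
    unfolding tensors[symmetric] by (simp add: L_def)
  have lin: "linear_map H L \<sigma>" by (rule linear_mapI) (simp_all add: Ls \<sigma>add \<sigma>sm)
  have mult: "\<sigma> (x \<otimes> y) = \<sigma> x \<otimes>\<^bsub>L\<^esub> \<sigma> y" if xy: "x \<in> carrier H" "y \<in> carrier H" for x y
  proof -
    have "\<sigma> (x \<otimes> y) = \<sigma> (x \<otimes> \<sigma> y)"
    proof (rule \<sigma>eq)
      have "x \<otimes> y \<ominus> x \<otimes> \<sigma> y = x \<otimes> (y \<ominus> \<sigma> y)" using xy \<sigma>c by (simp add: a_minus_def r_distr r_minus)
      then show "x \<otimes> y \<ominus> x \<otimes> \<sigma> y \<in> I" using ID(2) \<sigma>p(1) xy by simp
    qed (use xy \<sigma>c in auto)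
    also have "\<dots> = \<sigma> (\<sigma> x \<otimes> \<sigma> y)"
    proof (rule \<sigma>eq)
      have "x \<otimes> \<sigma> y \<ominus> \<sigma> x \<otimes> \<sigma> y = (x \<ominus> \<sigma> x) \<otimes> \<sigma> y" using xy \<sigma>c by (simp add: a_minus_def l_distr l_minus)
      then show "x \<otimes> \<sigma> y \<ominus> \<sigma> x \<otimes> \<sigma> y \<in> I" using ID(3) \<sigma>p(1) xy \<sigma>c by simp
    qed (use xy \<sigma>c in auto)
    finally show ?thesis by (simp add: Ls)
  qed
  have zero: "\<sigma> \<zero> = \<zero>" using \<sigma>0 subI(2) by simp
  have "kalgebra L" by (rule kalgebra_image[OF kalgebra_axioms lin _ mult]) (simp_all add: Ls zero)
  then have VL: "vspace L" by (simp add: kalgebra_def)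
  have counit: "\<epsilon>\<^bsub>L\<^esub> (\<sigma> x) = \<epsilon> x" if x: "x \<in> carrier H" for x
    using ID(4)[OF \<sigma>p(2)[OF x]] linear_form_minus[OF counit_form \<sigma>c[OF x] x] by (simp add: Ls)
  have antipode: "\<S>\<^bsub>L\<^esub> (\<sigma> x) = \<sigma> (\<S> x)" if x: "x \<in> carrier H" for x
  proof -
    have "\<S> (\<sigma> x) \<ominus> \<S> x \<in> I"
      using ID(5)[OF \<sigma>p(2)[OF x]] linear_map_minus[OF vspace_axioms antipode_linear \<sigma>c[OF x] x] by simp
    then show ?thesis using x \<sigma>c by (simp add: Ls \<sigma>eq)
  qed
  have comult: "\<Delta>\<^bsub>L\<^esub> (\<sigma> x) = sweedler (tensor L L) (\<lambda>u v. pure_tensor L L (\<sigma> u) (\<sigma> v)) (\<Delta> x)" if x: "x \<in> carrier H" for x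
    unfolding Lcomult using \<sigma>0 Ic
    by (intro comult_ideal_cong[OF I VL lin _ x \<sigma>c[OF x] \<sigma>p(2)[OF x]]) (simp add: Ls)
  show ?thesis
    by (rule that[OF hopf_hom_of_comult[OF VL lin _ mult _ comult counit antipode]]) (simp_all add: Ls \<sigma>0)
qed

end

text \<open>\<open>L\<close> is a copy of \<open>H / HA\<^sup>+\<close> with projection \<open>\<pi>\<close>. Unlike the coset structure, this notion is closed under restriction
  and composition.\<close>

definition is_quotient :: "('k::field, 'a) hopf \<Rightarrow> 'a set \<Rightarrow> ('k, 'b) hopf \<Rightarrow> ('a \<Rightarrow> 'b) \<Rightarrow> bool" where
  "is_quotient H A L \<pi> \<longleftrightarrow> hopf_hom H L \<pi> \<and> \<pi> ` carrier H = carrier L \<and>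
     (\<forall>x\<in>carrier H. \<pi> x = \<zero>\<^bsub>L\<^esub> \<longleftrightarrow> x \<in> HAplus H A)"

lemma is_quotient_iff:
  assumes H: "fdhopf H" and A: "normal_hopf_subalgebra A H" and L: "prehopf L"
  shows "quotient_hopf H (HAplus H A) \<cong>\<^sub>H L \<longleftrightarrow> (\<exists>\<pi>. is_quotient H A L \<pi>)"
proof -
  obtain B d where "fd_hopf H B d" using fdhopf_basis[OF H] .
  then interpret H: fd_hopf H B d .
  let ?I = "HAplus H A" and ?Q = "quotient_hopf H (HAplus H A)"
  note q = H.quotient_projection[OF H.HAplus_hopf_ideal[OF A]]
  show ?thesis
  proof
    assume "?Q \<cong>\<^sub>H L"
    then obtain \<psi> where \<psi>: "hopf_hom ?Q L \<psi>" "bij_betw \<psi> (carrier ?Q) (carrier L)"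
      using hopf_isomorphic_iff[OF q(1) L] by blast
    have V: "vspace ?Q" "vspace L" using q(1) L by (auto simp: prehopf_def)
    let ?\<pi> = "\<lambda>x. \<psi> (?I +>\<^bsub>H\<^esub> x)"
    have "\<psi> \<zero>\<^bsub>?Q\<^esub> = \<zero>\<^bsub>L\<^esub>" by (rule vspace.linear_map_zero[OF V(1,2) hopf_homD(1)[OF \<psi>(1)]])
    moreover have "\<zero>\<^bsub>?Q\<^esub> \<in> carrier ?Q" using V(1) by (simp add: vspace_def module_def abelian_group_def abelian_monoid.zero_closed)
    ultimately have ker: "\<psi> c = \<zero>\<^bsub>L\<^esub> \<longleftrightarrow> c = \<zero>\<^bsub>?Q\<^esub>" if "c \<in> carrier ?Q" for c
      using inj_on_eq_iff[OF bij_betw_imp_inj_on[OF \<psi>(2)] that] by metis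
    have "is_quotient H A L ?\<pi>"
      unfolding is_quotient_def
    proof (intro conjI ballI)
      show "hopf_hom H L ?\<pi>" by (rule hopf_hom_comp[OF q(2) \<psi>(1)])
      have "?\<pi> ` carrier H = \<psi> ` ((\<lambda>x. ?I +>\<^bsub>H\<^esub> x) ` carrier H)" by (simp add: image_image)
      then show "?\<pi> ` carrier H = carrier L" using q(3) bij_betw_imp_surj_on[OF \<psi>(2)] by simp
      fix x assume x: "x \<in> carrier H"
      have "?I +>\<^bsub>H\<^esub> x \<in> carrier ?Q" using q(3) x by blast
      then show "?\<pi> x = \<zero>\<^bsub>L\<^esub> \<longleftrightarrow> x \<in> ?I" using ker q(4)[OF x] by simp
    qed
    then show "\<exists>\<pi>. is_quotient H A L \<pi>" by blast
  next
    assume "\<exists>\<pi>. is_quotient H A L \<pi>"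
    then obtain \<pi> where \<pi>: "hopf_hom H L \<pi>" "\<pi> ` carrier H = carrier L"
      "\<And>x. x \<in> carrier H \<Longrightarrow> \<pi> x = \<zero>\<^bsub>L\<^esub> \<longleftrightarrow> x \<in> ?I" unfolding is_quotient_def by blast
    show "?Q \<cong>\<^sub>H L"
      by (rule hopf_isomorphic_if_same_kernel[OF H.hopf_algebra_axioms q(1) L q(2,3) \<pi>(1,2)])
        (simp add: \<pi>(3) q(4))
  qed
qed

lemma quotient_exists:
  fixes H :: "('k::field, 'a) hopf"
  assumes H: "fdhopf H" and A: "normal_hopf_subalgebra A H"
  obtains L :: "('k, 'a) hopf" and \<pi> where "fdhopf L" "is_quotient H A L \<pi>"
proof -
  obtain B d where "fd_hopf H B d" using fdhopf_basis[OF H] .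
  then interpret H: fd_hopf H B d .
  obtain L :: "('k, 'a) hopf" and \<pi> where L: "prehopf L" "hopf_hom H L \<pi>" "\<pi> ` carrier H = carrier L"
    "\<And>x. x \<in> carrier H \<Longrightarrow> \<pi> x = \<zero>\<^bsub>L\<^esub> \<longleftrightarrow> x \<in> HAplus H A"
    using H.quotient_copy[OF H.HAplus_hopf_ideal[OF A]] by blast
  then have "fdhopf L" "is_quotient H A L \<pi>"
    using fdhopf_image[OF H] unfolding is_quotient_def by auto
  then show ?thesis by (rule that)
qed

section \<open>Retractions and coinvariants\<close>

context fd_hopf
begin

text \<open>An integral \<open>l\<close> of \<open>A\<close> is nondegenerate, so the form \<open>l(p(a h))\<close> in \<open>a \<in> A\<close>, for any projection \<open>p\<close> onto \<open>A\<close>, is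
  \<open>l(a z)\<close> for a unique \<open>z \<in> A\<close>. Uniqueness makes \<open>z\<close> linear over \<open>A\<close> as a function of \<open>h\<close>.\<close>

lemma module_retraction:
  assumes A: "hopf_subalgebra A H"
  obtains r where "linear_map H H r" "\<And>h. h \<in> carrier H \<Longrightarrow> r h \<in> A" "\<And>a. a \<in> A \<Longrightarrow> r a = a"
    "\<And>a h. a \<in> A \<Longrightarrow> h \<in> carrier H \<Longrightarrow> r (a \<otimes> h) = a \<otimes> r h"
proof -
  let ?K = "restrict_hopf H A"
  note AD = hopf_subalgebraD[OF A]
  note subA = subspaceD[OF AD(1)]
  have Ac: "a \<in> A \<Longrightarrow> a \<in> carrier H" for a using AD(2) by auto
  obtain B' d' where "fd_hopf ?K B' d'" using fdhopf_basis[OF fdhopf_restrict[OF A]] .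
  then interpret K: fd_hopf ?K B' d' .
  obtain l k where l: "K.left_integral l" "k \<in> carrier ?K" "l k \<noteq> 0" using K.nonzero_integral_exists .
  have lf: "linear_form ?K l" using l(1) by (simp add: K.left_integral_def)
  note lD = linear_formD[OF lf, simplified]
  obtain p where p: "linear_map H H p" "\<And>x. x \<in> carrier H \<Longrightarrow> p x \<in> A" "\<And>x. x \<in> A \<Longrightarrow> p x = x"
    using projection_exists[OF fd AD(1)] by blast
  note pD = linear_mapD[OF p(1)]
  define P where "P h z \<longleftrightarrow> z \<in> A \<and> (\<forall>a\<in>A. l (a \<otimes> z) = l (p (a \<otimes> h)))" for h z
  have ex: "\<exists>z. P h z" if h: "h \<in> carrier H" for h
  proof -
    have "linear_form ?K (\<lambda>a. l (p (a \<otimes> h)))"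
      using h Ac by (simp add: linear_form_def l_distr smult_mult pD lD p(2))
    from K.integral_represents_forms[OF l this] obtain z where "z \<in> A" "\<And>a. a \<in> A \<Longrightarrow> l (a \<otimes> z) = l (p (a \<otimes> h))"
      by auto
    then show ?thesis unfolding P_def by blast
  qed
  have uniq: "z = z'" if "P h z" "P h z'" for h z z'
  proof -
    have z: "z \<in> A" "z' \<in> A" using that by (auto simp: P_def)
    have "l (a \<otimes> (z \<ominus> z')) = 0" if a: "a \<in> A" for a
    proof -
      have "a \<otimes> (z \<ominus> z') = a \<otimes> z \<oplus> (- 1) \<odot> (a \<otimes> z')"
        using a z Ac by (simp add: a_minus_def r_distr minus_smult smult_mult)
      then show ?thesis using a z AD(4) subA(4) \<open>P h z\<close> \<open>P h z'\<close> by (simp add: lD P_def)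
    qed
    then have "z \<ominus> z' = \<zero>" using K.integral_nondegenerate[OF l, of "z \<ominus> z'"] subA(6)[OF z] by simp
    then show ?thesis using diff_eq_zero_iff z Ac by simp
  qed
  define r where "r h = (THE z. P h z)" for h
  have r: "r h = z" if "P h z" for h z
    unfolding r_def using that uniq by (intro the_equality)
  have Pr: "P h (r h)" if "h \<in> carrier H" for h using ex[OF that] r by metis
  have rA: "r h \<in> A" if "h \<in> carrier H" for h using Pr[OF that] by (simp add: P_def)
  have rl: "l (a \<otimes> r h) = l (p (a \<otimes> h))" if "h \<in> carrier H" "a \<in> A" for h a
    using Pr[OF that(1)] that(2) by (simp add: P_def)
  show ?thesis
  proof (rule that[of r])
    show "linear_map H H r"
    proof (rule linear_mapI)
      show "r h \<in> carrier H" if "h \<in> carrier H" for h using rA[OF that] Ac by simp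
      show "r (x \<oplus> y) = r x \<oplus> r y" if xy: "x \<in> carrier H" "y \<in> carrier H" for x y
        by (rule r) (use xy rA Ac subA(3) AD(4) in \<open>simp add: P_def r_distr lD rl pD p(2)\<close>)
      show "r (c \<odot> x) = c \<odot> r x" if x: "x \<in> carrier H" for c x
        by (rule r) (use x rA Ac subA(4) AD(4) in \<open>simp add: P_def smult_mult lD rl pD p(2)\<close>)
    qed
    show "r h \<in> A" if "h \<in> carrier H" for h by (rule rA[OF that])
    show "r a = a" if "a \<in> A" for a by (rule r) (use that AD(4) p(3) in \<open>simp add: P_def\<close>)
    show "r (a \<otimes> h) = a \<otimes> r h" if ah: "a \<in> A" "h \<in> carrier H" for a h
    proof (rule r, unfold P_def, intro conjI ballI)
      show "a \<otimes> r h \<in> A" using ah rA AD(4) by simp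
      fix a' assume a': "a' \<in> A"
      have "a' \<otimes> (a \<otimes> r h) = (a' \<otimes> a) \<otimes> r h" "a' \<otimes> (a \<otimes> h) = (a' \<otimes> a) \<otimes> h"
        using ah a' rA Ac by (simp_all add: m_assoc)
      then show "l (a' \<otimes> (a \<otimes> r h)) = l (p (a' \<otimes> (a \<otimes> h)))" using rl[OF ah(2) AD(4)[OF a' ah(1)]] by simp
    qed
  qed
qed

text \<open>The hypothesis is \<open>h\<^sub>1 \<otimes> h\<^sub>2 = 1 \<otimes> h\<close> in \<open>H/HA\<^sup>+ \<otimes> H\<close>. For a retraction \<open>r\<close> that is linear over \<open>A\<close>, the map
  sending \<open>y \<otimes> x\<close> to \<open>y\<^sub>1 r(S(y\<^sub>2) x)\<close> factors through \<open>H/HA\<^sup>+ \<otimes> H\<close>: for \<open>y = g a\<close> it contains the factor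
  \<open>a\<^sub>1 S(a\<^sub>2) = \<epsilon>(a)\<close>. It sends \<open>\<Delta>(h)\<close> to \<open>h\<close> and \<open>1 \<otimes> h\<close> to \<open>r(h)\<close>, so \<open>h = r(h) \<in> A\<close>.\<close>

lemma coinvariant_mem:
  assumes A: "hopf_subalgebra A H" and h: "h \<in> carrier H"
    and coinv: "\<And>b. bilinear_form H H b \<Longrightarrow> (\<And>x y. x \<in> HAplus H A \<Longrightarrow> y \<in> carrier H \<Longrightarrow> b x y = 0) \<Longrightarrow> sw h b = b \<one> h"
  shows "h \<in> A"
proof -
  note AD = hopf_subalgebraD[OF A]
  have Ac: "a \<in> A \<Longrightarrow> a \<in> carrier H" for a using AD(2) by auto
  obtain r where r: "linear_map H H r" "\<And>h. h \<in> carrier H \<Longrightarrow> r h \<in> A" "\<And>a. a \<in> A \<Longrightarrow> r a = a"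
    "\<And>a h. a \<in> A \<Longrightarrow> h \<in> carrier H \<Longrightarrow> r (a \<otimes> h) = a \<otimes> r h" using module_retraction[OF A] by blast
  note rD = linear_mapD[OF r(1)]
  have "h = r h"
  proof (rule eq_if_forms_eq[OF fd h])
    show "r h \<in> carrier H" using rD(1)[OF h] .
    fix \<phi> assume \<phi>: "linear_form H \<phi>"
    note \<phi>D = linear_formD[OF \<phi>]
    let ?b = "\<lambda>y x. sw y (\<lambda>u v. \<phi> (u \<otimes> r (\<S> v \<otimes> x)))"
    have b: "bilinear_form H H ?b" by (intro bilinear_formI) (simp_all add: lin rD \<phi>D)
    have bl: "bilinear_form H H (\<lambda>u v. \<phi> (u \<otimes> r (\<S> v \<otimes> x)))" if "x \<in> carrier H" for x
      using that by (intro bilinear_formI) (simp_all add: lin rD \<phi>D)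
    have "sw h ?b = ?b \<one> h"
    proof (rule coinv[OF b])
      fix y x assume y: "y \<in> HAplus H A" and x: "x \<in> carrier H"
      show "?b y x = 0"
      proof (rule HAplus_kill[OF AD(2) bilinear_formD(1)[OF b x] _ y])
        fix g a assume ga: "g \<in> carrier H" "a \<in> A" "\<epsilon> a = 0"
        have "sw (g \<otimes> a) (\<lambda>u v. \<phi> (u \<otimes> r (\<S> v \<otimes> x))) =
            sw g (\<lambda>u v. sw a (\<lambda>u' v'. \<phi> ((u \<otimes> u') \<otimes> r (\<S> (v \<otimes> v') \<otimes> x))))"
          using ga Ac by (intro sw_mult[OF bl[OF x]]) auto
        also have "\<dots> = sw g (\<lambda>u v. 0)"
        proof (rule sw_cong[OF refl])
          fix u v assume uv: "u \<in> carrier H" "v \<in> carrier H"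
          have "sw a (\<lambda>u' v'. \<phi> ((u \<otimes> u') \<otimes> r (\<S> (v \<otimes> v') \<otimes> x))) =
              sw a (\<lambda>u' v'. \<phi> (u \<otimes> r ((u' \<otimes> \<S> v') \<otimes> (\<S> v \<otimes> x))))"
          proof (rule subcoalgebra_sw_cong[OF AD(6) ga(2)])
            show "bilinear_form H H (\<lambda>u' v'. \<phi> ((u \<otimes> u') \<otimes> r (\<S> (v \<otimes> v') \<otimes> x)))"
              "bilinear_form H H (\<lambda>u' v'. \<phi> (u \<otimes> r ((u' \<otimes> \<S> v') \<otimes> (\<S> v \<otimes> x))))"
              using uv x by - (intro bilinear_formI; simp add: lin rD \<phi>D)+
            fix u' v' assume uv': "u' \<in> A" "v' \<in> A"
            show "\<phi> ((u \<otimes> u') \<otimes> r (\<S> (v \<otimes> v') \<otimes> x)) = \<phi> (u \<otimes> r ((u' \<otimes> \<S> v') \<otimes> (\<S> v \<otimes> x)))"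
              using uv uv' x Ac AD(5) rD(1) r(4)[OF uv'(1)] by (simp add: antipode_mult m_assoc)
          qed
          also have "\<dots> = \<epsilon> a * \<phi> (u \<otimes> r (\<one> \<otimes> (\<S> v \<otimes> x)))"
            using uv x ga(2) Ac by (intro antipode_sw(2) linI) (simp_all add: lin rD \<phi>D)
          finally show "sw a (\<lambda>u' v'. \<phi> ((u \<otimes> u') \<otimes> r (\<S> (v \<otimes> v') \<otimes> x))) = 0" using ga(3) by simp
        qed
        finally show "?b (g \<otimes> a) x = 0" by simp
      qed
    qed
    also have "?b \<one> h = \<phi> (r h)" using sw_one[OF bl[OF h]] h rD(1) by simp
    also have "sw h ?b = sw h (\<lambda>u w. sw w (\<lambda>v x. \<phi> (u \<otimes> r (\<S> v \<otimes> x))))"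
      by (intro coassoc_sw[OF _ h] trilinear_formI) (simp_all add: lin rD \<phi>D)
    also have "\<dots> = sw h (\<lambda>u w. \<epsilon> w * \<phi> (u \<otimes> r \<one>))"
      by (rule sw_cong[OF refl], rule antipode_sw(1), rule linI) (simp_all add: lin rD \<phi>D)
    also have "\<dots> = sw h (\<lambda>u w. \<epsilon> w * \<phi> u)" using r(3)[OF AD(3)] by simp
    also have "\<dots> = \<phi> h" by (rule counit_sw(2)[OF \<phi> h])
    finally show "\<phi> h = \<phi> (r h)" .
  qed
  then show ?thesis using r(2)[OF h] by simp
qed

text \<open>When \<open>HA\<^sup>+\<close> is the whole augmentation ideal, \<open>y \<otimes> x\<close> and \<open>\<epsilon>(y) 1 \<otimes> x\<close> agree modulo \<open>HA\<^sup>+ \<otimes> H\<close>, so that every element is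
  coinvariant.\<close>

lemma eq_carrier_if_HAplus_eq_augmentation:
  assumes A: "hopf_subalgebra A H" and aug: "\<And>h. h \<in> carrier H \<Longrightarrow> \<epsilon> h = 0 \<Longrightarrow> h \<in> HAplus H A"
  shows "A = carrier H"
proof -
  note AD = hopf_subalgebraD[OF A]
  have "h \<in> A" if h: "h \<in> carrier H" for h
  proof (rule coinvariant_mem[OF A h])
    fix b assume b: "bilinear_form H H b" and z: "\<And>x y. x \<in> HAplus H A \<Longrightarrow> y \<in> carrier H \<Longrightarrow> b x y = 0"
    note bD = bilinear_formD(3-)[OF b]
    have "sw h b = sw h (\<lambda>x y. \<epsilon> x * b \<one> y)"
    proof (rule sw_cong[OF refl])
      fix x y assume xy: "x \<in> carrier H" "y \<in> carrier H"
      have "x \<oplus> (- \<epsilon> x) \<odot> \<one> \<in> HAplus H A" using xy by (intro aug) simp_all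
      from z[OF this xy(2)] show "b x y = \<epsilon> x * b \<one> y" using xy by (simp add: bD)
    qed
    also have "\<dots> = b \<one> h" by (rule counit_sw(1)[OF bilinear_formD(2)[OF b] h]) simp
    finally show "sw h b = b \<one> h" .
  qed
  then show ?thesis using AD(2) by auto
qed

end

section \<open>The kernel of a surjection is generated by coinvariants\<close>

locale hopf_surjection = K: fd_hopf K B d + C: fd_hopf C B' d'
  for K :: "('k::field, 'a) hopf" and B d and C :: "('k, 'b) hopf" and B' d' +
  fixes \<pi> :: "'a \<Rightarrow> 'b"
  assumes hom: "hopf_hom K C \<pi>" and surj: "\<pi> ` carrier K = carrier C"
begin

lemmas homD = hopf_homD[OF hom]

(* Both Sweedler sums are instances of one constant, for which a single congruence rule is active. *)
declare K.sw_cong [cong]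

lemma sw_image:
  assumes "bilinear_form C C b" "h \<in> carrier K"
  shows "C.sw (\<pi> h) b = K.sw h (\<lambda>x y. b (\<pi> x) (\<pi> y))"
  using homD(7)[OF assms(2,1)] C.sw_eq[OF assms(1) homD(2)[OF assms(2)]]
    K.sw_eq[OF bilinear_form_comp[OF homD(1) homD(1) assms(1)] assms(2)] by simp

lemma sw_swap2: "K.sw h (\<lambda>x y. C.sw g (\<lambda>u v. t x y u v)) = C.sw g (\<lambda>u v. K.sw h (\<lambda>x y. t x y u v))"
proof -
  have "K.sw h (\<lambda>x y. C.sw g (\<lambda>u v. t x y u v)) =
     (\<Sum>i\<in>B'. \<Sum>j\<in>B'. tensor_form (\<lambda>x y. d' i x * d' j y) (\<Delta>\<^bsub>C\<^esub> g) * K.sw h (\<lambda>x y. t x y i j))"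
    by (subst C.sw_def) (simp only: K.sw_sum K.sw_fun)
  then show ?thesis by (simp only: C.sw_def[of g])
qed

text \<open>\<open>\<pi>(h\<^sub>1) \<otimes> h\<^sub>2 = 1 \<otimes> h\<close>, tested by forms.\<close>

definition coinvariants :: "'a set" where
  "coinvariants = {h \<in> carrier K. \<forall>b. bilinear_form C K b \<longrightarrow> K.sw h (\<lambda>u v. b (\<pi> u) v) = b \<one>\<^bsub>C\<^esub> h}"

lemma mixed_bilinear: "bilinear_form C K b \<Longrightarrow> bilinear_form K K (\<lambda>u v. b (\<pi> u) v)"
  by (intro bilinear_formI) (simp_all add: homD bilinear_formD(3-))

lemma coinvariants_subspace: "submodule coinvariants scalars K" "\<one>\<^bsub>K\<^esub> \<in> coinvariants"
proof -
  show "submodule coinvariants scalars K"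
  proof (rule K.subspaceI)
    show "coinvariants \<subseteq> carrier K" by (auto simp: coinvariants_def)
    have "K.sw \<zero>\<^bsub>K\<^esub> b = 0" for b using K.sw_elem(2)[of "\<zero>\<^bsub>K\<^esub>" 0 b] by simp
    then show "\<zero>\<^bsub>K\<^esub> \<in> coinvariants"
      using K.linear_form_zero[OF bilinear_formD(2)[OF _ C.one_closed]] by (simp add: coinvariants_def)
    show "x \<oplus>\<^bsub>K\<^esub> y \<in> coinvariants" if "x \<in> coinvariants" "y \<in> coinvariants" for x y
      using that by (auto simp: coinvariants_def bilinear_formD(4))
    show "c \<odot>\<^bsub>K\<^esub> x \<in> coinvariants" if "x \<in> coinvariants" for c x
      using that by (auto simp: coinvariants_def bilinear_formD(6))
  qed
  show "\<one>\<^bsub>K\<^esub> \<in> coinvariants"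
    using K.sw_one[OF mixed_bilinear] by (auto simp: coinvariants_def homD(6))
qed

text \<open>The section is \<open>s(c) = l(c S(\<pi>(L\<^sub>1))) L\<^sub>2\<close> for an integral \<open>l\<close> on \<open>C\<close> and an element \<open>L\<close> over the Frobenius element \<open>\<Lambda>\<close>.
  It is colinear by invariance of \<open>l\<close>, and \<open>\<pi>(s(c)) = c\<^sub>1 l(c\<^sub>2 S(\<Lambda>)) = c\<close>.\<close>

lemma colinear_section:
  obtains s where "linear_map C K s" "\<And>c. c \<in> carrier C \<Longrightarrow> \<pi> (s c) = c"
    "\<And>b c. bilinear_form C K b \<Longrightarrow> c \<in> carrier C \<Longrightarrow>
       K.sw (s c) (\<lambda>u v. b (\<pi> u) v) = C.sw c (\<lambda>p q. b p (s q))"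
proof -
  obtain l k where l: "C.left_integral l" "k \<in> carrier C" "l k \<noteq> 0" using C.nonzero_integral_exists .
  have lf: "linear_form C l" using l(1) by (simp add: C.left_integral_def)
  note lD = linear_formD[OF lf]
  obtain \<Lambda> where \<Lambda>: "\<Lambda> \<in> carrier C" "\<And>y. y \<in> carrier C \<Longrightarrow> l (y \<otimes>\<^bsub>C\<^esub> \<S>\<^bsub>C\<^esub> \<Lambda>) = \<epsilon>\<^bsub>C\<^esub> y"
    using C.frobenius_element[OF l] by blast
  obtain L where L: "L \<in> carrier K" "\<pi> L = \<Lambda>" using \<Lambda>(1) surj by (metis imageE)
  define f where "f c u = l (c \<otimes>\<^bsub>C\<^esub> \<S>\<^bsub>C\<^esub> (\<pi> u))" for c u
  have ff: "linear_form K (f c)" if "c \<in> carrier C" for c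
    using that by (intro K.linI) (simp_all add: f_def homD C.lin lD)
  have ff': "c' \<in> carrier C \<Longrightarrow> f (c \<oplus>\<^bsub>C\<^esub> c') u = f c u + f c' u" "f (x \<odot>\<^bsub>C\<^esub> c) u = x * f c u"
    if "c \<in> carrier C" "u \<in> carrier K" for c c' u x
    using that by (simp_all add: f_def homD C.lin lD)
  define s where "s c = K.contract_left (f c) L" for c
  have sc: "s c \<in> carrier K" for c unfolding s_def by (rule K.contract_closed(1)[OF L(1)])
  have s\<phi>: "\<phi> (s c) = K.sw L (\<lambda>u v. f c u * \<phi> v)" if "c \<in> carrier C" "linear_form K \<phi>" for c \<phi>
    unfolding s_def by (rule K.contract_form(1)[OF L(1) ff[OF that(1)] that(2)])
  have lin: "linear_map C K s"
  proof (rule linear_mapI)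
    show "s c \<in> carrier K" for c by (rule sc)
    fix c assume c: "c \<in> carrier C"
    show "s (x \<odot>\<^bsub>C\<^esub> c) = x \<odot>\<^bsub>K\<^esub> s c" for x
    proof (rule K.eq_if_forms_eq[OF K.fd])
      fix \<phi> assume \<phi>: "linear_form K \<phi>"
      show "\<phi> (s (x \<odot>\<^bsub>C\<^esub> c)) = \<phi> (x \<odot>\<^bsub>K\<^esub> s c)"
        using c sc by (simp add: linear_formD[OF \<phi>] s\<phi>[OF _ \<phi>] ff' mult.assoc)
    qed (use sc in auto)
    fix c' assume c': "c' \<in> carrier C"
    show "s (c \<oplus>\<^bsub>C\<^esub> c') = s c \<oplus>\<^bsub>K\<^esub> s c'"
    proof (rule K.eq_if_forms_eq[OF K.fd])
      fix \<phi> assume \<phi>: "linear_form K \<phi>"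
      show "\<phi> (s (c \<oplus>\<^bsub>C\<^esub> c')) = \<phi> (s c \<oplus>\<^bsub>K\<^esub> s c')"
        using c c' sc by (simp add: linear_formD[OF \<phi>] s\<phi>[OF _ \<phi>] ff' distrib_right)
    qed (use sc in auto)
  qed
  have sect: "\<pi> (s c) = c" if c: "c \<in> carrier C" for c
  proof (rule C.eq_if_forms_eq[OF C.fd _ c])
    show "\<pi> (s c) \<in> carrier C" using homD(2)[OF sc] .
    fix \<psi> assume \<psi>: "linear_form C \<psi>"
    have bl: "bilinear_form C C (\<lambda>x y. l (c \<otimes>\<^bsub>C\<^esub> \<S>\<^bsub>C\<^esub> x) * \<psi> y)"
      using c by (intro bilinear_formI) (simp_all add: C.lin lD linear_formD[OF \<psi>])
    have "\<psi> (\<pi> (s c)) = K.sw L (\<lambda>u v. l (c \<otimes>\<^bsub>C\<^esub> \<S>\<^bsub>C\<^esub> (\<pi> u)) * \<psi> (\<pi> v))"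
      using s\<phi>[OF c linear_form_comp[OF homD(1) \<psi>]] by (simp add: f_def)
    also have "\<dots> = C.sw \<Lambda> (\<lambda>x y. l (c \<otimes>\<^bsub>C\<^esub> \<S>\<^bsub>C\<^esub> x) * \<psi> y)"
      using sw_image[OF bl L(1)] L(2) by simp
    also have "\<dots> = C.sw c (\<lambda>p q. \<psi> p * l (q \<otimes>\<^bsub>C\<^esub> \<S>\<^bsub>C\<^esub> \<Lambda>))"
      by (rule C.integral_antipode_shift[OF l(1) \<psi> \<Lambda>(1) c])
    also have "\<dots> = \<psi> c" using C.counit_sw(4)[OF \<psi> c] by (simp add: \<Lambda>(2) cong: C.sw_cong)
    finally show "\<psi> (\<pi> (s c)) = \<psi> c" .
  qed
  have colin: "K.sw (s c) (\<lambda>u v. b (\<pi> u) v) = C.sw c (\<lambda>p q. b p (s q))"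
    if b: "bilinear_form C K b" and c: "c \<in> carrier C" for b c
  proof -
    note bD = bilinear_formD(3-)[OF b]
    have "K.sw (s c) (\<lambda>u v. b (\<pi> u) v) = K.sw L (\<lambda>x y. f c x * K.sw y (\<lambda>u v. b (\<pi> u) v))"
      by (rule s\<phi>[OF c]) (intro K.linI, simp_all)
    also have "\<dots> = K.sw L (\<lambda>x y. K.sw y (\<lambda>u v. f c x * b (\<pi> u) v))" by simp
    also have "\<dots> = K.sw L (\<lambda>r v. K.sw r (\<lambda>x u. f c x * b (\<pi> u) v))"
      using c by (intro K.coassoc_sw[symmetric, OF _ L(1)] trilinear_formI)
        (simp_all add: homD bD linear_formD[OF ff[OF c]] distrib_left distrib_right mult.assoc mult.left_commute)
    also have "\<dots> = K.sw L (\<lambda>r v. C.sw c (\<lambda>p q. b p v * l (q \<otimes>\<^bsub>C\<^esub> \<S>\<^bsub>C\<^esub> (\<pi> r))))"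
    proof (rule K.sw_cong[OF refl])
      fix r v assume rv: "r \<in> carrier K" "v \<in> carrier K"
      note \<phi> = bilinear_formD(1)[OF b rv(2)]
      have bl: "bilinear_form C C (\<lambda>x y. l (c \<otimes>\<^bsub>C\<^esub> \<S>\<^bsub>C\<^esub> x) * b y v)"
        using c by (intro bilinear_formI) (simp_all add: C.lin lD linear_formD[OF \<phi>])
      show "K.sw r (\<lambda>x u. f c x * b (\<pi> u) v) = C.sw c (\<lambda>p q. b p v * l (q \<otimes>\<^bsub>C\<^esub> \<S>\<^bsub>C\<^esub> (\<pi> r)))"
        using sw_image[OF bl rv(1)] C.integral_antipode_shift[OF l(1) \<phi> homD(2)[OF rv(1)] c]
        by (simp add: f_def)
    qed
    also have "\<dots> = C.sw c (\<lambda>p q. K.sw L (\<lambda>r v. b p v * l (q \<otimes>\<^bsub>C\<^esub> \<S>\<^bsub>C\<^esub> (\<pi> r))))" by (rule sw_swap2)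
    also have "\<dots> = C.sw c (\<lambda>p q. b p (s q))"
    proof (rule C.sw_cong[OF refl])
      fix p q assume "p \<in> carrier C" "q \<in> carrier C"
      then show "K.sw L (\<lambda>r v. b p v * l (q \<otimes>\<^bsub>C\<^esub> \<S>\<^bsub>C\<^esub> (\<pi> r))) = b p (s q)"
        using s\<phi>[of q "b p"] bilinear_formD(2)[OF b] by (simp add: f_def mult.commute)
    qed
    finally show ?thesis .
  qed
  show ?thesis using lin sect colin by (rule that)
qed

text \<open>Let \<open>q(a) = S(a\<^sub>1) s(\<pi>(a\<^sub>2))\<close> for a colinear section \<open>s\<close>. Colinearity makes \<open>q(a)\<close> coinvariant, and \<open>\<epsilon>(q(a)) = \<epsilon>(a)\<close>.
  Modulo the ideal, \<open>a = a\<^sub>1 \<epsilon>(a\<^sub>2)\<close> equals \<open>a\<^sub>1 q(a\<^sub>2) = s(\<pi>(a))\<close>, which is \<open>0\<close> on the kernel.\<close>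

lemma kernel_generated_by_coinvariants:
  assumes a: "a \<in> carrier K" "\<pi> a = \<zero>\<^bsub>C\<^esub>"
  shows "a \<in> ideal_prod K (carrier K) {x \<in> coinvariants. \<epsilon>\<^bsub>K\<^esub> x = 0}"
proof -
  let ?D = "{x \<in> coinvariants. \<epsilon>\<^bsub>K\<^esub> x = 0}"
  note DS = K.subspaceD[OF coinvariants_subspace(1)]
  obtain s where s: "linear_map C K s" "\<And>c. c \<in> carrier C \<Longrightarrow> \<pi> (s c) = c"
    "\<And>b c. bilinear_form C K b \<Longrightarrow> c \<in> carrier C \<Longrightarrow>
       K.sw (s c) (\<lambda>u v. b (\<pi> u) v) = C.sw c (\<lambda>p q. b p (s q))" using colinear_section by blast
  note sD = linear_mapD[OF s(1)]
  define q where "q a = sweedler K (\<lambda>x y. \<S>\<^bsub>K\<^esub> x \<otimes>\<^bsub>K\<^esub> s (\<pi> y)) (\<Delta>\<^bsub>K\<^esub> a)" for a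
  have qc: "q a \<in> carrier K" if "a \<in> carrier K" for a
    unfolding q_def using that sD(1) homD(2)
    by (intro sweedler_closed[OF K.vspace_axioms K.comult_closed]) auto
  have q\<phi>: "\<phi> (q a) = K.sw a (\<lambda>x y. \<phi> (\<S>\<^bsub>K\<^esub> x \<otimes>\<^bsub>K\<^esub> s (\<pi> y)))" if "a \<in> carrier K" "linear_form K \<phi>" for a \<phi>
    unfolding q_def using sD(1) homD(2)
    by (intro K.sweedler_sw[OF that]) (auto intro!: bilinear_formI simp: K.lin sD homD linear_formD[OF that(2)])
  have \<epsilon>s: "\<epsilon>\<^bsub>K\<^esub> (s c) = \<epsilon>\<^bsub>C\<^esub> c" if "c \<in> carrier C" for c
    using homD(8)[OF sD(1)[OF that]] s(2)[OF that] by simp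
  have \<epsilon>q: "\<epsilon>\<^bsub>K\<^esub> (q a) = \<epsilon>\<^bsub>K\<^esub> a" if a: "a \<in> carrier K" for a
  proof -
    have "\<epsilon>\<^bsub>K\<^esub> (q a) = K.sw a (\<lambda>x y. \<epsilon>\<^bsub>K\<^esub> x * \<epsilon>\<^bsub>K\<^esub> y)"
      unfolding q\<phi>[OF a K.counit_form] by (intro K.sw_cong refl) (simp add: sD(1) homD(2,8) \<epsilon>s)
    also have "\<dots> = \<epsilon>\<^bsub>K\<^esub> a" by (rule K.counit_sw(1)[OF K.counit_form a])
    finally show ?thesis .
  qed
  have qD: "q a \<in> coinvariants" if a: "a \<in> carrier K" for a
    unfolding coinvariants_def
  proof (intro CollectI conjI allI impI qc[OF a])
    fix b assume b: "bilinear_form C K b"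
    note bD = bilinear_formD(3-)[OF b]
    let ?T = "\<lambda>x1 x2 y1 y2. b (\<pi> (\<S>\<^bsub>K\<^esub> x2 \<otimes>\<^bsub>K\<^esub> y1)) (\<S>\<^bsub>K\<^esub> x1 \<otimes>\<^bsub>K\<^esub> s (\<pi> y2))"
    have "K.sw (q a) (\<lambda>u v. b (\<pi> u) v) = K.sw a (\<lambda>x y. K.sw (\<S>\<^bsub>K\<^esub> x \<otimes>\<^bsub>K\<^esub> s (\<pi> y)) (\<lambda>u v. b (\<pi> u) v))"
      by (rule q\<phi>[OF a]) (intro K.linI, simp_all)
    also have "\<dots> = K.sw a (\<lambda>x y. K.sw x (\<lambda>x1 x2. K.sw y (\<lambda>y1 y2. ?T x1 x2 y1 y2)))"
    proof (rule K.sw_cong[OF refl])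
      fix x y assume xy: "x \<in> carrier K" "y \<in> carrier K"
      note \<pi>y = homD(2)[OF xy(2)]
      have "K.sw (\<S>\<^bsub>K\<^esub> x \<otimes>\<^bsub>K\<^esub> s (\<pi> y)) (\<lambda>u v. b (\<pi> u) v) =
          K.sw (\<S>\<^bsub>K\<^esub> x) (\<lambda>u v. K.sw (s (\<pi> y)) (\<lambda>u' v'. b (\<pi> (u \<otimes>\<^bsub>K\<^esub> u')) (v \<otimes>\<^bsub>K\<^esub> v')))"
        using xy sD(1) \<pi>y by (intro K.sw_mult[OF mixed_bilinear[OF b]]) auto
      also have "\<dots> = K.sw x (\<lambda>x1 x2. K.sw (s (\<pi> y)) (\<lambda>u' v'. b (\<pi> (\<S>\<^bsub>K\<^esub> x2 \<otimes>\<^bsub>K\<^esub> u')) (\<S>\<^bsub>K\<^esub> x1 \<otimes>\<^bsub>K\<^esub> v')))"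
      proof (rule K.sw_antipode[OF bilinear_formI xy(1)])
        fix u v assume uv: "u \<in> carrier K" "v \<in> carrier K"
        show "K.sw (s (\<pi> y)) (\<lambda>u' v'. b (\<pi> ((k \<odot>\<^bsub>K\<^esub> u) \<otimes>\<^bsub>K\<^esub> u')) (v \<otimes>\<^bsub>K\<^esub> v')) =
            k * K.sw (s (\<pi> y)) (\<lambda>u' v'. b (\<pi> (u \<otimes>\<^bsub>K\<^esub> u')) (v \<otimes>\<^bsub>K\<^esub> v'))" for k
          using uv by (simp add: C.lin homD bD)
        show "K.sw (s (\<pi> y)) (\<lambda>u' v'. b (\<pi> (u \<otimes>\<^bsub>K\<^esub> u')) ((k \<odot>\<^bsub>K\<^esub> v) \<otimes>\<^bsub>K\<^esub> v')) =
            k * K.sw (s (\<pi> y)) (\<lambda>u' v'. b (\<pi> (u \<otimes>\<^bsub>K\<^esub> u')) (v \<otimes>\<^bsub>K\<^esub> v'))" for k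
          using uv by (simp add: K.lin homD bD)
        fix w assume w: "w \<in> carrier K"
        show "K.sw (s (\<pi> y)) (\<lambda>u' v'. b (\<pi> ((u \<oplus>\<^bsub>K\<^esub> v) \<otimes>\<^bsub>K\<^esub> u')) (w \<otimes>\<^bsub>K\<^esub> v')) =
            K.sw (s (\<pi> y)) (\<lambda>u' v'. b (\<pi> (u \<otimes>\<^bsub>K\<^esub> u')) (w \<otimes>\<^bsub>K\<^esub> v')) +
            K.sw (s (\<pi> y)) (\<lambda>u' v'. b (\<pi> (v \<otimes>\<^bsub>K\<^esub> u')) (w \<otimes>\<^bsub>K\<^esub> v'))"
          using uv w by (simp add: C.lin homD bD)
        show "K.sw (s (\<pi> y)) (\<lambda>u' v'. b (\<pi> (u \<otimes>\<^bsub>K\<^esub> u')) ((v \<oplus>\<^bsub>K\<^esub> w) \<otimes>\<^bsub>K\<^esub> v')) =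
            K.sw (s (\<pi> y)) (\<lambda>u' v'. b (\<pi> (u \<otimes>\<^bsub>K\<^esub> u')) (v \<otimes>\<^bsub>K\<^esub> v')) +
            K.sw (s (\<pi> y)) (\<lambda>u' v'. b (\<pi> (u \<otimes>\<^bsub>K\<^esub> u')) (w \<otimes>\<^bsub>K\<^esub> v'))"
          using uv w by (simp add: K.lin homD bD)
      qed
      also have "\<dots> = K.sw x (\<lambda>x1 x2. K.sw y (\<lambda>y1 y2. ?T x1 x2 y1 y2))"
      proof (rule K.sw_cong[OF refl])
        fix x1 x2 assume x12: "x1 \<in> carrier K" "x2 \<in> carrier K"
        let ?b = "\<lambda>p v. b (\<pi> (\<S>\<^bsub>K\<^esub> x2) \<otimes>\<^bsub>C\<^esub> p) (\<S>\<^bsub>K\<^esub> x1 \<otimes>\<^bsub>K\<^esub> v)"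
        have b1: "bilinear_form C K ?b"
          using x12 by (intro bilinear_formI) (simp_all add: K.lin C.lin homD bD)
        have b2: "bilinear_form C C (\<lambda>p q. ?b p (s q))"
          by (intro bilinear_formI) (simp_all add: bilinear_formD(3-)[OF b1] sD)
        have "K.sw (s (\<pi> y)) (\<lambda>u' v'. b (\<pi> (\<S>\<^bsub>K\<^esub> x2 \<otimes>\<^bsub>K\<^esub> u')) (\<S>\<^bsub>K\<^esub> x1 \<otimes>\<^bsub>K\<^esub> v')) = K.sw (s (\<pi> y)) (\<lambda>u v. ?b (\<pi> u) v)"
          using x12 by (intro K.sw_cong refl) (simp add: homD)
        also have "\<dots> = C.sw (\<pi> y) (\<lambda>p q. ?b p (s q))" by (rule s(3)[OF b1 \<pi>y])
        also have "\<dots> = K.sw y (\<lambda>y1 y2. ?b (\<pi> y1) (s (\<pi> y2)))" by (rule sw_image[OF b2 xy(2)])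
        also have "\<dots> = K.sw y (\<lambda>y1 y2. ?T x1 x2 y1 y2)"
          using x12 by (intro K.sw_cong refl) (simp add: homD)
        finally show "K.sw (s (\<pi> y)) (\<lambda>u' v'. b (\<pi> (\<S>\<^bsub>K\<^esub> x2 \<otimes>\<^bsub>K\<^esub> u')) (\<S>\<^bsub>K\<^esub> x1 \<otimes>\<^bsub>K\<^esub> v')) =
            K.sw y (\<lambda>y1 y2. ?T x1 x2 y1 y2)" .
      qed
      finally show "K.sw (\<S>\<^bsub>K\<^esub> x \<otimes>\<^bsub>K\<^esub> s (\<pi> y)) (\<lambda>u v. b (\<pi> u) v) = K.sw x (\<lambda>x1 x2. K.sw y (\<lambda>y1 y2. ?T x1 x2 y1 y2))" .
    qed
    also have "\<dots> = K.sw a (\<lambda>x1 r. K.sw r (\<lambda>x2 y. K.sw y (\<lambda>y1 y2. ?T x1 x2 y1 y2)))"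
      by (intro K.coassoc_sw[OF _ a] trilinear_formI) (simp_all add: K.lin C.lin homD bD sD)
    also have "\<dots> = K.sw a (\<lambda>x1 r. b \<one>\<^bsub>C\<^esub> (\<S>\<^bsub>K\<^esub> x1 \<otimes>\<^bsub>K\<^esub> s (\<pi> r)))"
    proof (rule K.sw_cong[OF refl])
      fix x1 r assume x: "x1 \<in> carrier K" "r \<in> carrier K"
      have "K.sw r (\<lambda>x2 y. K.sw y (\<lambda>y1 y2. ?T x1 x2 y1 y2)) = K.sw r (\<lambda>z y2. K.sw z (\<lambda>x2 y1. ?T x1 x2 y1 y2))"
        using x by (intro K.coassoc_sw[symmetric] trilinear_formI) (simp_all add: K.lin C.lin homD bD sD)
      also have "\<dots> = K.sw r (\<lambda>z y2. \<epsilon>\<^bsub>K\<^esub> z * b (\<pi> \<one>\<^bsub>K\<^esub>) (\<S>\<^bsub>K\<^esub> x1 \<otimes>\<^bsub>K\<^esub> s (\<pi> y2)))"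
        using x by (intro K.sw_cong refl K.antipode_sw(1) K.linI) (simp_all add: K.lin C.lin homD bD sD)
      also have "\<dots> = b (\<pi> \<one>\<^bsub>K\<^esub>) (\<S>\<^bsub>K\<^esub> x1 \<otimes>\<^bsub>K\<^esub> s (\<pi> r))"
        using x by (intro K.counit_sw(1) K.linI) (simp_all add: K.lin C.lin homD bD sD)
      finally show "K.sw r (\<lambda>x2 y. K.sw y (\<lambda>y1 y2. ?T x1 x2 y1 y2)) = b \<one>\<^bsub>C\<^esub> (\<S>\<^bsub>K\<^esub> x1 \<otimes>\<^bsub>K\<^esub> s (\<pi> r))"
        by (simp add: homD(6))
    qed
    also have "\<dots> = b \<one>\<^bsub>C\<^esub> (q a)" by (rule q\<phi>[symmetric, OF a bilinear_formD(2)[OF b]]) simp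
    finally show "K.sw (q a) (\<lambda>u v. b (\<pi> u) v) = b \<one>\<^bsub>C\<^esub> (q a)" .
  qed
  have D0: "\<zero>\<^bsub>K\<^esub> \<in> ?D" using DS(2) K.linear_form_zero[OF K.counit_form] by simp
  have Dc: "?D \<subseteq> carrier K" using DS(1) by auto
  have sub: "submodule (ideal_prod K (carrier K) ?D) scalars K"
    by (rule K.ideal_prod_subspace[OF K.carrier_subspace Dc D0])
  show ?thesis
  proof (rule K.mem_if_annihilated'[OF sub a(1)])
    fix \<phi> assume \<phi>: "linear_form K \<phi>" "\<And>w. w \<in> ideal_prod K (carrier K) ?D \<Longrightarrow> \<phi> w = 0"
    note \<phi>D = linear_formD[OF \<phi>(1)]
    have step: "\<phi> (x \<otimes>\<^bsub>K\<^esub> q y) = \<phi> x * \<epsilon>\<^bsub>K\<^esub> y" if xy: "x \<in> carrier K" "y \<in> carrier K" for x y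
    proof -
      let ?z = "q y \<oplus>\<^bsub>K\<^esub> (- \<epsilon>\<^bsub>K\<^esub> y) \<odot>\<^bsub>K\<^esub> \<one>\<^bsub>K\<^esub>"
      have "?z \<in> ?D" using DS(3,4) qD[OF xy(2)] coinvariants_subspace(2) qc[OF xy(2)] \<epsilon>q[OF xy(2)] by simp
      then have "\<phi> (x \<otimes>\<^bsub>K\<^esub> ?z) = 0" using xy(1) by (intro \<phi>(2) ideal_prod.prod)
      then show ?thesis using xy qc by (simp add: K.r_distr K.smult_mult \<phi>D)
    qed
    have "\<phi> a = K.sw a (\<lambda>x y. \<phi> x * \<epsilon>\<^bsub>K\<^esub> y)" using K.counit_sw(4)[OF \<phi>(1) a(1)] by simp
    also have "\<dots> = K.sw a (\<lambda>x y. \<phi> (x \<otimes>\<^bsub>K\<^esub> q y))" by (intro K.sw_cong refl) (simp add: step)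
    also have "\<dots> = K.sw a (\<lambda>x y. K.sw y (\<lambda>y1 y2. \<phi> (x \<otimes>\<^bsub>K\<^esub> (\<S>\<^bsub>K\<^esub> y1 \<otimes>\<^bsub>K\<^esub> s (\<pi> y2)))))"
      by (rule K.sw_cong[OF refl], rule q\<phi>[OF _ K.mult_linear_forms(1)[OF \<phi>(1)]])
    also have "\<dots> = K.sw a (\<lambda>r y2. K.sw r (\<lambda>x y1. \<phi> (x \<otimes>\<^bsub>K\<^esub> (\<S>\<^bsub>K\<^esub> y1 \<otimes>\<^bsub>K\<^esub> s (\<pi> y2)))))"
      by (intro K.coassoc_sw[symmetric, OF _ a(1)] trilinear_formI) (simp_all add: K.lin homD sD \<phi>D)
    also have "\<dots> = K.sw a (\<lambda>r y2. \<epsilon>\<^bsub>K\<^esub> r * \<phi> (s (\<pi> y2)))"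
    proof (rule K.sw_cong[OF refl])
      fix r y assume ry: "r \<in> carrier K" "y \<in> carrier K"
      have sy: "s (\<pi> y) \<in> carrier K" using sD(1) homD(2)[OF ry(2)] .
      from K.antipode_sw(2)[OF K.mult_linear_forms(2)[OF \<phi>(1) sy] ry(1)]
      show "K.sw r (\<lambda>x y1. \<phi> (x \<otimes>\<^bsub>K\<^esub> (\<S>\<^bsub>K\<^esub> y1 \<otimes>\<^bsub>K\<^esub> s (\<pi> y)))) = \<epsilon>\<^bsub>K\<^esub> r * \<phi> (s (\<pi> y))"
        using sy by (simp add: K.m_assoc)
    qed
    also have "\<dots> = \<phi> (s (\<pi> a))"
      by (intro K.counit_sw(1)[OF _ a(1)] K.linI) (simp_all add: homD sD \<phi>D)
    also have "\<dots> = 0"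
      unfolding a(2) C.linear_map_zero[OF K.vspace_axioms s(1)] by (rule K.linear_form_zero[OF \<phi>(1)])
    finally show "\<phi> a = 0" .
  qed
qed

end

lemma ideal_prod_mono:
  assumes "N \<subseteq> N'" "z \<in> ideal_prod R M N"
  shows "z \<in> ideal_prod R M N'"
  using assms(2)
proof induction
  case (prod i j)
  then show ?case using assms(1) by (blast intro: ideal_prod.prod)
next
  case (sum s1 s2)
  then show ?case by (blast intro: ideal_prod.sum)
qed

text \<open>The kernel of the surjection from \<open>E\<close> to \<open>\<pi>(E)\<close> is generated by its coinvariants. These are also coinvariant for
  the projection of \<open>H\<close>, hence lie in \<open>A\<close>.\<close>

lemma kernel_on_subalgebra:
  assumes H: "fdhopf H" and A: "normal_hopf_subalgebra A H" and E: "hopf_subalgebra E H"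
    and Q: "fdhopf Q" "is_quotient H A Q \<pi>" and e: "e \<in> E" "\<pi> e = \<zero>\<^bsub>Q\<^esub>"
  shows "e \<in> HAplus (restrict_hopf H E) (A \<inter> E)"
proof -
  have \<pi>: "hopf_hom H Q \<pi>" "\<pi> ` carrier H = carrier Q" "\<And>x. x \<in> carrier H \<Longrightarrow> \<pi> x = \<zero>\<^bsub>Q\<^esub> \<longleftrightarrow> x \<in> HAplus H A"
    using Q(2) unfolding is_quotient_def by auto
  have A': "hopf_subalgebra A H" using A by (simp add: normal_hopf_subalgebra_def)
  let ?K = "restrict_hopf H E" and ?C = "restrict_hopf Q (\<pi> ` E)"
  obtain B d where "fd_hopf H B d" using fdhopf_basis[OF H] .
  then interpret H: fd_hopf H B d .
  obtain B' d' where "fd_hopf Q B' d'" using fdhopf_basis[OF Q(1)] .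
  then interpret Q: fd_hopf Q B' d' .
  note \<pi>E = image_hopf_subalgebra[OF H Q(1) \<pi>(1) E]
  note fK = H.fdhopf_restrict[OF E] and fC = Q.fdhopf_restrict[OF \<pi>E]
  obtain B1 d1 where K: "fd_hopf ?K B1 d1" using fdhopf_basis[OF fK] .
  obtain B2 d2 where C: "fd_hopf ?C B2 d2" using fdhopf_basis[OF fC] .
  interpret K: fd_hopf ?K B1 d1 by (rule K)
  have "hopf_hom ?K Q \<pi>" by (rule hopf_hom_restrict_domain[OF H \<pi>(1) E])
  then have "hopf_hom ?K ?C \<pi>"
    by (rule hopf_hom_restrict_codomain[OF K.hopf_algebra_axioms Q(1) _ \<pi>E]) simp
  then interpret S: hopf_surjection ?K B1 d1 ?C B2 d2 \<pi>
    using K C by (intro hopf_surjection.intro hopf_surjection_axioms.intro) simp_all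
  note ED = H.hopf_subalgebraD[OF E]
  have Ec: "x \<in> E \<Longrightarrow> x \<in> carrier H" for x using ED(2) by auto
  have "S.coinvariants \<subseteq> A \<inter> E"
  proof
    fix x assume x: "x \<in> S.coinvariants"
    then have xE: "x \<in> E" by (simp add: S.coinvariants_def)
    have "x \<in> A"
    proof (rule H.coinvariant_mem[OF A' Ec[OF xE]])
      fix b assume b: "bilinear_form H H b" and z: "\<And>u v. u \<in> HAplus H A \<Longrightarrow> v \<in> carrier H \<Longrightarrow> b u v = 0"
      note bD = bilinear_formD(3-)[OF b]
      \<comment> \<open>\<open>b\<close> vanishes on \<open>HA\<^sup>+ \<times> H\<close>, so it factors through \<open>\<pi>\<close> in the first argument.\<close>
      define b' where "b' c v = b (inv_into (carrier H) \<pi> c) v" for c v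
      have b': "b' (\<pi> u) v = b u v" if u: "u \<in> carrier H" and v: "v \<in> carrier H" for u v
      proof -
        let ?u = "inv_into (carrier H) \<pi> (\<pi> u)"
        have y: "?u \<in> carrier H" "\<pi> ?u = \<pi> u" using u by (auto intro: inv_into_into f_inv_into_f)
        then have "\<pi> (?u \<ominus>\<^bsub>H\<^esub> u) = \<zero>\<^bsub>Q\<^esub>"
          using hopf_hom_kernel(2)[OF H.vspace_axioms Q.vspace_axioms \<pi>(1) y(1) u] by simp
        then have "b (?u \<ominus>\<^bsub>H\<^esub> u) v = 0" using z[OF _ v] \<pi>(3) y u by simp
        then show ?thesis
          using H.linear_form_minus[OF bilinear_formD(1)[OF b v] y(1) u] by (simp add: b'_def)
      qed
      have bl: "bilinear_form ?C ?K b'"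
      proof (rule bilinear_formI)
        fix c c' v k assume "c \<in> carrier ?C" "v \<in> carrier ?K"
        then obtain u where u: "u \<in> E" "c = \<pi> u" and v: "v \<in> E" by auto
        show "b' (k \<odot>\<^bsub>?C\<^esub> c) v = k * b' c v"
          using u v Ec b'[of "k \<odot>\<^bsub>H\<^esub> u" v] by (simp add: b' bD hopf_homD(5)[OF \<pi>(1)])
        show "b' c (k \<odot>\<^bsub>?K\<^esub> v) = k * b' c v"
          using u v Ec by (simp add: b' bD)
        fix v' assume "v' \<in> carrier ?K"
        then show "b' c (v \<oplus>\<^bsub>?K\<^esub> v') = b' c v + b' c v'"
          using u v Ec by (simp add: b' bD)
      next
        fix c c' v assume "c \<in> carrier ?C" "c' \<in> carrier ?C" "v \<in> carrier ?K"
        then obtain u u' where u: "u \<in> E" "c = \<pi> u" "u' \<in> E" "c' = \<pi> u'" and v: "v \<in> E" by auto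
        show "b' (c \<oplus>\<^bsub>?C\<^esub> c') v = b' c v + b' c' v"
          using u v Ec b'[of "u \<oplus>\<^bsub>H\<^esub> u'" v] by (simp add: b' bD hopf_homD(4)[OF \<pi>(1)])
      qed
      have "H.sw x b = tensor_form b (\<Delta>\<^bsub>?K\<^esub> x)" using H.restrict_comult(2)[OF E xE b] by simp
      also have "\<dots> = tensor_form (\<lambda>u v. b' (\<pi> u) v) (\<Delta>\<^bsub>?K\<^esub> x)"
        using xE Ec b' by (intro tensor_form_cong[OF H.restrict_comult(1)[OF E xE]]) simp
      also have "\<dots> = K.sw x (\<lambda>u v. b' (\<pi> u) v)"
        using K.sw_eq[OF S.mixed_bilinear[OF bl]] xE by (simp del: restrict_hopf_simps(9))
      also have "\<dots> = b' \<one>\<^bsub>?C\<^esub> x" using x bl by (simp add: S.coinvariants_def)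
      also have "\<dots> = b \<one>\<^bsub>H\<^esub> x" using b'[of "\<one>\<^bsub>H\<^esub>" x] Ec[OF xE] hopf_homD(6)[OF \<pi>(1)] by simp
      finally show "H.sw x b = b \<one>\<^bsub>H\<^esub> x" .
    qed
    then show "x \<in> A \<inter> E" using xE by simp
  qed
  then have sub: "{x \<in> S.coinvariants. \<epsilon>\<^bsub>?K\<^esub> x = 0} \<subseteq> {a \<in> A \<inter> E. \<epsilon>\<^bsub>?K\<^esub> a = 0}" by blast
  have "e \<in> ideal_prod ?K (carrier ?K) {x \<in> S.coinvariants. \<epsilon>\<^bsub>?K\<^esub> x = 0}"
    using e by (intro S.kernel_generated_by_coinvariants) simp_all
  then show ?thesis unfolding HAplus_def by (rule ideal_prod_mono[OF sub])
qed

section \<open>The isomorphism theorems\<close>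

lemma fdhopf_vspace: "fdhopf H \<Longrightarrow> vspace H"
  using fdhopf_prehopf[of H] by (simp add: prehopf_def)

lemma fdhopf_restrict:
  assumes "fdhopf H" "hopf_subalgebra A H" shows "fdhopf (restrict_hopf H A)"
proof -
  obtain B d where "fd_hopf H B d" using fdhopf_basis[OF assms(1)] .
  then interpret fd_hopf H B d .
  show ?thesis by (rule fdhopf_restrict[OF assms(2)])
qed

lemma normal_hopf_subalgebraD: "normal_hopf_subalgebra A H \<Longrightarrow> hopf_subalgebra A H"
  by (simp add: normal_hopf_subalgebra_def)

lemma HAplus_mono:
  assumes "A \<subseteq> E" "z \<in> HAplus H A" shows "z \<in> HAplus H E"
  using assms(2) unfolding HAplus_def by (rule ideal_prod_mono[rotated]) (use assms(1) in blast)

lemma HAplus_restrict: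
  assumes "E \<subseteq> carrier H" "A \<subseteq> E" "z \<in> HAplus (restrict_hopf H E) A"
  shows "z \<in> HAplus H A"
  using assms(3) unfolding HAplus_def
proof induction
  case (prod i j)
  then show ?case using assms(1) ideal_prod.prod[of i "carrier H" j "{a \<in> A. \<epsilon>\<^bsub>H\<^esub> a = 0}" H] by auto
next
  case (sum x y)
  then show ?case using ideal_prod.sum[of x H "carrier H" "{a \<in> A. \<epsilon>\<^bsub>H\<^esub> a = 0}" y] by simp
qed

lemma is_quotientD:
  assumes "is_quotient H A Q \<pi>"
  shows "hopf_hom H Q \<pi>" "\<pi> ` carrier H = carrier Q" "x \<in> carrier H \<Longrightarrow> \<pi> x = \<zero>\<^bsub>Q\<^esub> \<longleftrightarrow> x \<in> HAplus H A"
  using assms by (auto simp: is_quotient_def)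

lemma HAplus_image:
  assumes H: "fdhopf H" and \<pi>: "hopf_hom H L \<pi>" "\<pi> ` carrier H = carrier L" and E: "hopf_subalgebra E H"
  shows "HAplus L (\<pi> ` E) = \<pi> ` HAplus H E"
proof -
  obtain B d where "fd_hopf H B d" using fdhopf_basis[OF H] .
  then interpret H: fd_hopf H B d .
  note ED = H.hopf_subalgebraD[OF E] and \<pi>D = hopf_homD[OF \<pi>(1)]
  note IS = H.subspaceD[OF H.HAplus_subspace[OF E]]
  have Ec: "x \<in> E \<Longrightarrow> x \<in> carrier H" for x using ED(2) by auto
  have Ic: "x \<in> HAplus H E \<Longrightarrow> x \<in> carrier H" for x using IS(1) by auto
  have 1: "y \<in> \<pi> ` HAplus H E" if "y \<in> HAplus L (\<pi> ` E)" for y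
    using that unfolding HAplus_def[of L]
  proof induction
    case (prod l a)
    obtain h e where h: "h \<in> carrier H" "l = \<pi> h" and e: "e \<in> E" "a = \<pi> e"
      using prod \<pi>(2) by blast
    have "h \<otimes>\<^bsub>H\<^esub> e \<in> HAplus H E" using h e prod \<pi>D(8)[OF Ec[OF e(1)]] by (intro H.HAplus_mem) auto
    moreover have "l \<otimes>\<^bsub>L\<^esub> a = \<pi> (h \<otimes>\<^bsub>H\<^esub> e)" using h e Ec by (simp add: \<pi>D(3))
    ultimately show ?case by blast
  next
    case (sum y z)
    then obtain u v where "u \<in> HAplus H E" "y = \<pi> u" "v \<in> HAplus H E" "z = \<pi> v" by blast
    then have "y \<oplus>\<^bsub>L\<^esub> z = \<pi> (u \<oplus>\<^bsub>H\<^esub> v)" "u \<oplus>\<^bsub>H\<^esub> v \<in> HAplus H E" using IS(3) Ic \<pi>D(4) by auto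
    then show ?case by blast
  qed
  have 2: "\<pi> x \<in> HAplus L (\<pi> ` E) \<and> x \<in> carrier H" if "x \<in> HAplus H E" for x
    using that unfolding HAplus_def
  proof induction
    case (prod h e)
    then have e: "e \<in> E" "\<epsilon>\<^bsub>H\<^esub> e = 0" by auto
    have "\<pi> h \<otimes>\<^bsub>L\<^esub> \<pi> e \<in> ideal_prod L (carrier L) {a \<in> \<pi> ` E. \<epsilon>\<^bsub>L\<^esub> a = 0}"
      using prod(1) e Ec by (intro ideal_prod.prod) (auto simp: \<pi>D)
    then show ?case using prod(1) e Ec by (simp add: \<pi>D)
  next
    case (sum x y)
    then show ?case using ideal_prod.sum[of "\<pi> x" L] by (simp add: \<pi>D)
  qed
  show ?thesis using 1 2 by blast
qed

text \<open>The kernel of the composite is the preimage of \<open>\<pi>(HE\<^sup>+)\<close>. It is \<open>HE\<^sup>+ + HA\<^sup>+\<close>, and \<open>HA\<^sup>+ \<subseteq> HE\<^sup>+\<close>.\<close>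

lemma is_quotient_comp:
  assumes H: "fdhopf H" and A: "normal_hopf_subalgebra A H" and E: "hopf_subalgebra E H" "A \<subseteq> E"
    and Q: "fdhopf Q" "is_quotient H A Q \<pi>" and R: "is_quotient Q (\<pi> ` E) R \<rho>"
  shows "is_quotient H E R (\<lambda>x. \<rho> (\<pi> x))"
proof -
  obtain B d where "fd_hopf H B d" using fdhopf_basis[OF H] .
  then interpret H: fd_hopf H B d .
  note q = is_quotientD[OF Q(2)] and r = is_quotientD[OF R]
  note IS = H.subspaceD[OF H.HAplus_subspace[OF E(1)]]
  have Ic: "x \<in> HAplus H E \<Longrightarrow> x \<in> carrier H" for x using IS(1) by auto
  have ker: "\<rho> (\<pi> x) = \<zero>\<^bsub>R\<^esub> \<longleftrightarrow> x \<in> HAplus H E" if x: "x \<in> carrier H" for x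
  proof -
    have "\<rho> (\<pi> x) = \<zero>\<^bsub>R\<^esub> \<longleftrightarrow> \<pi> x \<in> \<pi> ` HAplus H E"
      using r(3)[OF hopf_homD(2)[OF q(1) x]] HAplus_image[OF H q(1,2) E(1)] by simp
    also have "\<dots> \<longleftrightarrow> x \<in> HAplus H E"
    proof
      assume "\<pi> x \<in> \<pi> ` HAplus H E"
      then obtain y where y: "y \<in> HAplus H E" "\<pi> x = \<pi> y" by blast
      have "\<pi> (x \<ominus>\<^bsub>H\<^esub> y) = \<zero>\<^bsub>Q\<^esub>"
        using hopf_hom_kernel(2)[OF H.vspace_axioms fdhopf_vspace[OF Q(1)] q(1) x Ic[OF y(1)]] y(2) by simp
      then have "x \<ominus>\<^bsub>H\<^esub> y \<in> HAplus H E"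
        using q(3)[of "x \<ominus>\<^bsub>H\<^esub> y"] x Ic[OF y(1)] HAplus_mono[OF E(2)] by simp
      then have "(x \<ominus>\<^bsub>H\<^esub> y) \<oplus>\<^bsub>H\<^esub> y \<in> HAplus H E" using IS(3) y(1) by blast
      then show "x \<in> HAplus H E" using x Ic[OF y(1)] by (simp add: H.minus_eq H.a_assoc H.l_neg)
    qed blast
    finally show ?thesis .
  qed
  have "(\<lambda>x. \<rho> (\<pi> x)) ` carrier H = carrier R" using q(2) r(2) by (auto simp flip: image_image)
  then show ?thesis unfolding is_quotient_def using hopf_hom_comp[OF q(1) r(1)] ker by simp
qed

lemma is_quotient_restrict_kernel:
  assumes H: "fdhopf H" and A: "normal_hopf_subalgebra A H" and E: "hopf_subalgebra E H"
    and Q: "fdhopf Q" "is_quotient H A Q \<pi>" and e: "e \<in> E"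
  shows "\<pi> e = \<zero>\<^bsub>Q\<^esub> \<longleftrightarrow> e \<in> HAplus (restrict_hopf H E) (A \<inter> E)"
proof
  obtain B d where "fd_hopf H B d" using fdhopf_basis[OF H] .
  then interpret H: fd_hopf H B d .
  have Ec: "E \<subseteq> carrier H" by (rule H.hopf_subalgebraD(2)[OF E])
  show "e \<in> HAplus (restrict_hopf H E) (A \<inter> E)" if "\<pi> e = \<zero>\<^bsub>Q\<^esub>"
    by (rule kernel_on_subalgebra[OF H A E Q e that])
  assume "e \<in> HAplus (restrict_hopf H E) (A \<inter> E)"
  then have "e \<in> HAplus H (A \<inter> E)" by (intro HAplus_restrict[OF Ec]) auto
  then have "e \<in> HAplus H A" by (rule HAplus_mono[rotated]) auto
  then show "\<pi> e = \<zero>\<^bsub>Q\<^esub>" using is_quotientD(3)[OF Q(2)] Ec e by blast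
qed

lemma is_quotient_restrict:
  assumes H: "fdhopf H" and A: "normal_hopf_subalgebra A H" and E: "hopf_subalgebra E H"
    and Q: "fdhopf Q" "is_quotient H A Q \<pi>"
  shows "is_quotient (restrict_hopf H E) (A \<inter> E) (restrict_hopf Q (\<pi> ` E)) \<pi>"
proof -
  note q = is_quotientD[OF Q(2)]
  have K: "hopf_algebra (restrict_hopf H E)" using fdhopf_restrict[OF H E] by (simp add: fdhopf_def)
  have "hopf_hom (restrict_hopf H E) (restrict_hopf Q (\<pi> ` E)) \<pi>"
    by (rule hopf_hom_restrict_codomain[OF K Q(1) hopf_hom_restrict_domain[OF H q(1) E]
          image_hopf_subalgebra[OF H Q(1) q(1) E]]) simp
  then show ?thesis using is_quotient_restrict_kernel[OF H A E Q] by (simp add: is_quotient_def)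
qed

lemma is_quotient_restrict_onto:
  assumes H: "fdhopf H" and A: "normal_hopf_subalgebra A H" and E: "hopf_subalgebra E H"
    and Q: "fdhopf Q" "is_quotient H A Q \<pi>" and onto: "\<pi> ` E = carrier Q"
  shows "is_quotient (restrict_hopf H E) (A \<inter> E) Q \<pi>"
  using is_quotient_restrict_kernel[OF H A E Q] onto
    hopf_hom_restrict_domain[OF H is_quotientD(1)[OF Q(2)] E] by (simp add: is_quotient_def)

lemma quotient_unique:
  assumes H: "fdhopf H" and Q: "fdhopf Q" "is_quotient H A Q \<pi>" and Q': "fdhopf Q'" "is_quotient H A Q' \<pi>'"
  shows "Q \<cong>\<^sub>H Q'"
  using H is_quotientD[OF Q(2)] is_quotientD[OF Q'(2)] fdhopf_prehopf[OF Q(1)] fdhopf_prehopf[OF Q'(1)]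
  by (intro hopf_isomorphic_if_same_kernel[of H Q Q' \<pi> \<pi>']) (auto simp: fdhopf_def)

text \<open>\<open>a - \<epsilon>(a) 1\<close> lies in \<open>A\<^sup>+\<close>.\<close>

lemma quotient_on_normal:
  assumes H: "fdhopf H" and A: "hopf_subalgebra A H" and Q: "fdhopf Q" "is_quotient H A Q \<pi>" and a: "a \<in> A"
  shows "\<pi> a = \<epsilon>\<^bsub>H\<^esub> a \<odot>\<^bsub>Q\<^esub> \<one>\<^bsub>Q\<^esub>"
proof -
  obtain B d where "fd_hopf H B d" using fdhopf_basis[OF H] .
  then interpret H: fd_hopf H B d .
  note q = is_quotientD[OF Q(2)] and AD = H.hopf_subalgebraD[OF A]
  note AS = H.subspaceD[OF AD(1)]
  have ac: "a \<in> carrier H" using a AD(2) by auto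
  let ?x = "a \<ominus>\<^bsub>H\<^esub> \<epsilon>\<^bsub>H\<^esub> a \<odot>\<^bsub>H\<^esub> \<one>\<^bsub>H\<^esub>"
  have xc: "?x \<in> carrier H" using ac by simp
  have x: "?x = a \<oplus>\<^bsub>H\<^esub> (- \<epsilon>\<^bsub>H\<^esub> a) \<odot>\<^bsub>H\<^esub> \<one>\<^bsub>H\<^esub>" using ac by (simp add: H.minus_eq H.minus_smult H.smult_assoc1[symmetric] del: H.vs_simps)
  have "?x \<in> A" "\<epsilon>\<^bsub>H\<^esub> ?x = 0" unfolding x using AS AD(3) a ac by (simp_all add: H.counit_simps)
  then have "\<one>\<^bsub>H\<^esub> \<otimes>\<^bsub>H\<^esub> ?x \<in> HAplus H A" by (intro H.HAplus_mem) auto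
  then have "\<pi> ?x = \<zero>\<^bsub>Q\<^esub>" using q(3)[OF xc] xc by simp
  then have "\<pi> a = \<pi> (\<epsilon>\<^bsub>H\<^esub> a \<odot>\<^bsub>H\<^esub> \<one>\<^bsub>H\<^esub>)"
    using hopf_hom_kernel(2)[OF H.vspace_axioms fdhopf_vspace[OF Q(1)] q(1) ac] ac by simp
  then show ?thesis by (simp add: hopf_homD(5,6)[OF q(1)])
qed

lemma HAplus_trivial:
  assumes H: "fdhopf H" and A: "A = {c \<odot>\<^bsub>H\<^esub> \<one>\<^bsub>H\<^esub> | c. True}" and x: "x \<in> HAplus H A"
  shows "x = \<zero>\<^bsub>H\<^esub>"
proof -
  obtain B d where "fd_hopf H B d" using fdhopf_basis[OF H] .
  then interpret H: fd_hopf H B d .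
  show ?thesis using x unfolding HAplus_def
  proof induction
    case (prod h a)
    then obtain c where "a = c \<odot>\<^bsub>H\<^esub> \<one>\<^bsub>H\<^esub>" "\<epsilon>\<^bsub>H\<^esub> a = 0" using A by blast
    then have "a = \<zero>\<^bsub>H\<^esub>" by (simp add: H.counit_simps)
    then show ?case using prod(1) by simp
  qed simp
qed

lemma scalars_subset:
  assumes "fdhopf H" "hopf_subalgebra A H"
  shows "{c \<odot>\<^bsub>H\<^esub> \<one>\<^bsub>H\<^esub> | c. True} \<subseteq> A"
proof -
  obtain B d where "fd_hopf H B d" using fdhopf_basis[OF assms(1)] .
  then interpret H: fd_hopf H B d .
  note AD = H.hopf_subalgebraD[OF assms(2)]
  show ?thesis using H.subspaceD(4)[OF AD(1) AD(3)] by auto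
qed

lemma eq_carrier_if_HAplus:
  assumes "fdhopf H" "hopf_subalgebra A H" "\<And>h. h \<in> carrier H \<Longrightarrow> \<epsilon>\<^bsub>H\<^esub> h = 0 \<Longrightarrow> h \<in> HAplus H A"
  shows "A = carrier H"
proof -
  obtain B d where "fd_hopf H B d" using fdhopf_basis[OF assms(1)] .
  then interpret H: fd_hopf H B d .
  show ?thesis by (rule H.eq_carrier_if_HAplus_eq_augmentation[OF assms(2,3)])
qed

text \<open>If \<open>\<pi>(E)\<close> consisted of scalars, \<open>EA\<^sup>+\<close> would be the augmentation ideal of \<open>E\<close>; if it were all of \<open>Q\<close>, \<open>HE\<^sup>+\<close> would be
  that of \<open>H\<close>. Neither is possible for a proper Hopf subalgebra.\<close>

lemma image_proper_nontrivial:
  assumes H: "fdhopf H" and A: "normal_hopf_subalgebra A H" and E: "hopf_subalgebra E H" "A \<subset> E" "E \<noteq> carrier H"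
    and Q: "fdhopf Q" "is_quotient H A Q \<pi>"
  shows "proper_nontrivial (\<pi> ` E) Q"
proof -
  obtain B d where "fd_hopf H B d" using fdhopf_basis[OF H] .
  then interpret H: fd_hopf H B d .
  obtain B' d' where "fd_hopf Q B' d'" using fdhopf_basis[OF Q(1)] .
  then interpret Q: fd_hopf Q B' d' .
  note q = is_quotientD[OF Q(2)]
  note ED = H.hopf_subalgebraD[OF E(1)] and IS = H.subspaceD[OF H.HAplus_subspace[OF E(1)]]
  have A': "hopf_subalgebra A H" by (rule normal_hopf_subalgebraD[OF A])
  have Ec: "x \<in> E \<Longrightarrow> x \<in> carrier H" for x using ED(2) by auto
  have FE: "hopf_subalgebra (\<pi> ` E) Q" by (rule image_hopf_subalgebra[OF H Q(1) q(1) E(1)])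
  have AE: "A \<inter> E = A" using E(2) by auto
  have 1: "\<pi> ` E \<noteq> {c \<odot>\<^bsub>Q\<^esub> \<one>\<^bsub>Q\<^esub> | c. True}"
  proof
    assume eq: "\<pi> ` E = {c \<odot>\<^bsub>Q\<^esub> \<one>\<^bsub>Q\<^esub> | c. True}"
    have "A = carrier (restrict_hopf H E)"
    proof (rule eq_carrier_if_HAplus[OF fdhopf_restrict[OF H E(1)]])
      show "hopf_subalgebra A (restrict_hopf H E)" using hopf_subalgebra_restrict[OF H E(1) A'] E(2) by blast
      fix e assume "e \<in> carrier (restrict_hopf H E)" "\<epsilon>\<^bsub>restrict_hopf H E\<^esub> e = 0"
      then have e: "e \<in> E" "\<epsilon>\<^bsub>H\<^esub> e = 0" by simp_all
      obtain c where c: "\<pi> e = c \<odot>\<^bsub>Q\<^esub> \<one>\<^bsub>Q\<^esub>" using e(1) eq by blast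
      then have "c = \<epsilon>\<^bsub>Q\<^esub> (\<pi> e)" by (simp add: Q.counit_simps)
      then have "c = 0" using hopf_homD(8)[OF q(1) Ec[OF e(1)]] e(2) by simp
      then have "\<pi> e = \<zero>\<^bsub>Q\<^esub>" using c by simp
      then show "e \<in> HAplus (restrict_hopf H E) A"
        using is_quotient_restrict_kernel[OF H A E(1) Q e(1)] AE by simp
    qed
    then show False using E(2) by simp
  qed
  have 2: "\<pi> ` E \<noteq> carrier Q"
  proof
    assume eq: "\<pi> ` E = carrier Q"
    have "E = carrier H"
    proof (rule eq_carrier_if_HAplus[OF H E(1)])
      fix h assume h: "h \<in> carrier H" "\<epsilon>\<^bsub>H\<^esub> h = 0"
      obtain e where e: "e \<in> E" "\<pi> h = \<pi> e" using hopf_homD(2)[OF q(1) h(1)] eq by (metis imageE)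
      note ec = Ec[OF e(1)]
      have "\<epsilon>\<^bsub>H\<^esub> e = 0" using hopf_homD(8)[OF q(1) ec] hopf_homD(8)[OF q(1) h(1)] e(2) h(2) by simp
      then have "\<one>\<^bsub>H\<^esub> \<otimes>\<^bsub>H\<^esub> e \<in> HAplus H E" using e(1) by (intro H.HAplus_mem) auto
      then have eI: "e \<in> HAplus H E" using ec by simp
      have "\<pi> (h \<ominus>\<^bsub>H\<^esub> e) = \<zero>\<^bsub>Q\<^esub>"
        using hopf_hom_kernel(2)[OF H.vspace_axioms Q.vspace_axioms q(1) h(1) ec] e(2) by simp
      then have "h \<ominus>\<^bsub>H\<^esub> e \<in> HAplus H E"
        using q(3)[of "h \<ominus>\<^bsub>H\<^esub> e"] h(1) ec HAplus_mono[of A E] E(2) by auto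
      then have "(h \<ominus>\<^bsub>H\<^esub> e) \<oplus>\<^bsub>H\<^esub> e \<in> HAplus H E" using IS(3) eI by blast
      then show "h \<in> HAplus H E" using h(1) ec by (simp add: H.minus_eq H.a_assoc H.l_neg)
    qed
    then show False using E(3) by simp
  qed
  show ?thesis unfolding proper_nontrivial_def
    using 1 2 scalars_subset[OF Q(1) FE] Q.hopf_subalgebraD(2)[OF FE] by blast
qed

lemma vdim_restrict_less:
  assumes H: "fdhopf H" and A: "hopf_subalgebra A H" "A \<noteq> carrier H"
  shows "vdim (restrict_hopf H A) < vdim H"
proof -
  obtain B d where "fd_hopf H B d" using fdhopf_basis[OF H] .
  then interpret H: fd_hopf H B d .
  note AD = H.hopf_subalgebraD[OF A(1)]
  obtain p where p: "linear_map H H p" "\<And>x. x \<in> carrier H \<Longrightarrow> p x \<in> A" "\<And>x. x \<in> A \<Longrightarrow> p x = x"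
    using H.projection_exists[OF H.fd AD(1)] by blast
  have lin: "linear_map H (restrict_hopf H A) p" using p by (simp add: linear_map_def)
  obtain x where x: "x \<in> carrier H" "x \<notin> A" using A AD(2) by blast
  have px: "p x \<in> carrier H" "p x \<in> A" using p(2)[OF x(1)] AD(2) by auto
  have "p (x \<ominus>\<^bsub>H\<^esub> p x) = \<zero>\<^bsub>H\<^esub>"
    using H.linear_map_minus[OF H.vspace_axioms p(1) x(1) px(1)] p(3)[OF px(2)] px(1) by simp
  moreover have "x \<ominus>\<^bsub>H\<^esub> p x \<noteq> \<zero>\<^bsub>H\<^esub>" using H.diff_eq_zero_iff[OF x(1) px(1)] x(2) px(2) by auto
  moreover have "p ` carrier H = carrier (restrict_hopf H A)" using p(2,3) AD(2) by force
  ultimately show ?thesis using x px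
    by (intro vdim_image_less[OF H.vspace_axioms fdhopf_vspace[OF fdhopf_restrict[OF H A(1)]] lin _ H.fd,
          of "x \<ominus>\<^bsub>H\<^esub> p x"]) simp_all
qed

lemma vdim_quotient_less:
  assumes H: "fdhopf H" and A: "hopf_subalgebra A H" "{c \<odot>\<^bsub>H\<^esub> \<one>\<^bsub>H\<^esub> | c. True} \<subset> A"
    and Q: "fdhopf Q" "is_quotient H A Q \<pi>"
  shows "vdim Q < vdim H"
proof -
  obtain B d where "fd_hopf H B d" using fdhopf_basis[OF H] .
  then interpret H: fd_hopf H B d .
  note q = is_quotientD[OF Q(2)]
  obtain a where a: "a \<in> A" "a \<notin> {c \<odot>\<^bsub>H\<^esub> \<one>\<^bsub>H\<^esub> | c. True}" using A(2) by blast
  have ac: "a \<in> carrier H" using a H.hopf_subalgebraD(2)[OF A(1)] by auto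
  let ?u = "\<epsilon>\<^bsub>H\<^esub> a \<odot>\<^bsub>H\<^esub> \<one>\<^bsub>H\<^esub>"
  have "\<pi> a = \<pi> ?u"
    using quotient_on_normal[OF H A(1) Q a(1)] by (simp add: hopf_homD(5,6)[OF q(1)])
  then have "\<pi> (a \<ominus>\<^bsub>H\<^esub> ?u) = \<zero>\<^bsub>Q\<^esub>"
    using hopf_hom_kernel(2)[OF H.vspace_axioms fdhopf_vspace[OF Q(1)] q(1) ac, of ?u] by simp
  moreover have "a \<ominus>\<^bsub>H\<^esub> ?u \<noteq> \<zero>\<^bsub>H\<^esub>" using H.diff_eq_zero_iff[OF ac, of ?u] a(2) by auto
  ultimately show ?thesis using ac
    by (intro vdim_image_less[OF H.vspace_axioms fdhopf_vspace[OF Q(1)] hopf_homD(1)[OF q(1)] q(2) H.fd,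
          of "a \<ominus>\<^bsub>H\<^esub> ?u"]) simp_all
qed

lemma ideal_prod_subset:
  assumes H: "fdhopf H" and E: "hopf_subalgebra E H" "A \<subseteq> E" "C \<subseteq> E"
  shows "ideal_prod H A C \<subseteq> E"
proof
  obtain B d where "fd_hopf H B d" using fdhopf_basis[OF H] .
  then interpret H: fd_hopf H B d .
  note ED = H.hopf_subalgebraD[OF E(1)]
  fix x assume "x \<in> ideal_prod H A C"
  then show "x \<in> E"
  proof induction
    case (prod a c)
    then show ?case using E(2,3) ED(4) by blast
  next
    case (sum x y)
    then show ?case using H.subspaceD(3)[OF ED(1)] by blast
  qed
qed

text \<open>\<open>\<pi>(a c) = \<epsilon>(a) \<pi>(c)\<close> when \<open>\<pi>\<close> is the quotient map for \<open>A\<close>, and \<open>\<pi>(a c) = \<epsilon>(c) \<pi>(a)\<close> when it is the one for \<open>C\<close>.\<close>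

lemma ideal_prod_image:
  assumes H: "fdhopf H" and A: "hopf_subalgebra A H" and C: "hopf_subalgebra C H"
    and gen: "carrier H = ideal_prod H A C" and Q: "fdhopf Q"
  shows "is_quotient H A Q \<pi> \<Longrightarrow> \<pi> ` C = carrier Q" "is_quotient H C Q \<pi> \<Longrightarrow> \<pi> ` A = carrier Q"
proof -
  obtain B d where "fd_hopf H B d" using fdhopf_basis[OF H] .
  then interpret H: fd_hopf H B d .
  obtain B' d' where "fd_hopf Q B' d'" using fdhopf_basis[OF Q] .
  then interpret Q: fd_hopf Q B' d' .
  note AD = H.hopf_subalgebraD[OF A] and CD = H.hopf_subalgebraD[OF C]
  note AS = H.subspaceD[OF AD(1)] and CS = H.subspaceD[OF CD(1)]
  have Ac: "x \<in> A \<Longrightarrow> x \<in> carrier H" and Cc: "x \<in> C \<Longrightarrow> x \<in> carrier H" for x using AD(2) CD(2) by auto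
  show "\<pi> ` C = carrier Q" if quot: "is_quotient H A Q \<pi>"
  proof -
    note q = is_quotientD[OF quot] and \<pi>D = hopf_homD[OF is_quotientD(1)[OF quot]]
    have im: "x \<in> carrier H \<and> \<pi> x \<in> \<pi> ` C" if "x \<in> ideal_prod H A C" for x
      using that
    proof induction
      case (prod a c)
      note ac = Ac[OF prod(1)] and cc = Cc[OF prod(2)]
      have "\<pi> (a \<otimes>\<^bsub>H\<^esub> c) = \<pi> (\<epsilon>\<^bsub>H\<^esub> a \<odot>\<^bsub>H\<^esub> c)"
        using ac cc \<pi>D(2)[OF cc] quotient_on_normal[OF H A Q quot prod(1)] by (simp add: \<pi>D(3,5) Q.smult_mult)
      then show ?case using CS(4)[OF prod(2)] ac cc by auto
    next
      case (sum x y)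
      then obtain u v where uv: "u \<in> C" "\<pi> x = \<pi> u" "v \<in> C" "\<pi> y = \<pi> v" by blast
      then have "\<pi> (x \<oplus>\<^bsub>H\<^esub> y) = \<pi> (u \<oplus>\<^bsub>H\<^esub> v)" using sum Cc by (simp add: \<pi>D(4))
      then show ?case using CS(3)[OF uv(1,3)] sum by auto
    qed
    show ?thesis
    proof
      show "\<pi> ` C \<subseteq> carrier Q" using \<pi>D(2) Cc by blast
      show "carrier Q \<subseteq> \<pi> ` C"
      proof
        fix y assume "y \<in> carrier Q"
        then obtain x where "x \<in> carrier H" "y = \<pi> x" using q(2) by blast
        then show "y \<in> \<pi> ` C" using im[of x] gen by simp
      qed
    qed
  qed
  show "\<pi> ` A = carrier Q" if quot: "is_quotient H C Q \<pi>"
  proof -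
    note q = is_quotientD[OF quot] and \<pi>D = hopf_homD[OF is_quotientD(1)[OF quot]]
    have im: "x \<in> carrier H \<and> \<pi> x \<in> \<pi> ` A" if "x \<in> ideal_prod H A C" for x
      using that
    proof induction
      case (prod a c)
      note ac = Ac[OF prod(1)] and cc = Cc[OF prod(2)]
      have "\<pi> (a \<otimes>\<^bsub>H\<^esub> c) = \<pi> (\<epsilon>\<^bsub>H\<^esub> c \<odot>\<^bsub>H\<^esub> a)"
        using ac cc \<pi>D(2)[OF ac] quotient_on_normal[OF H C Q quot prod(2)] by (simp add: \<pi>D(3,5) Q.smult_mult)
      then show ?case using AS(4)[OF prod(1)] ac cc by auto
    next
      case (sum x y)
      then obtain u v where uv: "u \<in> A" "\<pi> x = \<pi> u" "v \<in> A" "\<pi> y = \<pi> v" by blast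
      then have "\<pi> (x \<oplus>\<^bsub>H\<^esub> y) = \<pi> (u \<oplus>\<^bsub>H\<^esub> v)" using sum Ac by (simp add: \<pi>D(4))
      then show ?case using AS(3)[OF uv(1,3)] sum by auto
    qed
    show ?thesis
    proof
      show "\<pi> ` A \<subseteq> carrier Q" using \<pi>D(2) Ac by blast
      show "carrier Q \<subseteq> \<pi> ` A"
      proof
        fix y assume "y \<in> carrier Q"
        then obtain x where "x \<in> carrier H" "y = \<pi> x" using q(2) by blast
        then show "y \<in> \<pi> ` A" using im[of x] gen by simp
      qed
    qed
  qed
qed

section \<open>Composition series\<close>

lemma series_extension:
  fixes H B :: "('k::field, 'a) hopf"
  assumes "fdhopf H" "normal_hopf_subalgebra A H" "proper_nontrivial A H" "fdhopf B" "is_quotient H A B \<pi>"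
    "composition_series (restrict_hopf H A) As" "composition_series B Bs"
  shows "composition_series H (As @ Bs)"
  using assms is_quotient_iff[OF assms(1,2) fdhopf_prehopf[OF assms(4)]]
  by (intro composition_series.extension[of A H B]) (auto simp: fdhopf_def)

lemma series_cases:
  fixes H :: "('k::field, 'a) hopf"
  assumes H: "fdhopf H" and Hs: "composition_series H Hs"
  obtains "simple_hopf H" "Hs = [H]"
  | A B \<pi> As Bs where "normal_hopf_subalgebra A H" "proper_nontrivial A H" "fdhopf B" "is_quotient H A B \<pi>"
      "composition_series (restrict_hopf H A) As" "composition_series B Bs" "Hs = As @ Bs"
  using Hs
proof cases
  case simple
  then show ?thesis using that(1) by blast
next
  case (extension A B As Bs)
  have B: "prehopf B" using extension(4) hopf_algebra.prehopf by blast
  then obtain \<pi> where \<pi>: "is_quotient H A B \<pi>"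
    using is_quotient_iff[OF H extension(2) B] extension(5) by blast
  have "fdhopf B" by (rule fdhopf_image[OF H B is_quotientD(1,2)[OF \<pi>]])
  then show ?thesis using that(2) extension \<pi> by blast
qed

lemma proper_nontrivialD:
  assumes "proper_nontrivial A H"
  shows "{c \<odot>\<^bsub>H\<^esub> \<one>\<^bsub>H\<^esub> | c. True} \<subset> A" "A \<noteq> carrier H"
  using assms by (auto simp: proper_nontrivial_def)

lemma series_exists:
  fixes H :: "('k::field, 'a) hopf"
  assumes "fdhopf H" shows "\<exists>Hs. composition_series H Hs"
  using assms
proof (induction "vdim H" arbitrary: H rule: less_induct)
  case less
  show ?case
  proof (cases "simple_hopf H")
    case True
    then show ?thesis using composition_series.simple by blast
  next
    case False
    then obtain A where A: "normal_hopf_subalgebra A H" "proper_nontrivial A H" by (auto simp: simple_hopf_def)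
    note A' = normal_hopf_subalgebraD[OF A(1)] and pn = proper_nontrivialD[OF A(2)]
    obtain B :: "('k, 'a) hopf" and \<pi> where B: "fdhopf B" "is_quotient H A B \<pi>"
      using quotient_exists[OF less(2) A(1)] by blast
    obtain As where "composition_series (restrict_hopf H A) As"
      using less(1)[OF vdim_restrict_less[OF less(2) A' pn(2)] fdhopf_restrict[OF less(2) A']] by blast
    moreover obtain Bs where "composition_series B Bs"
      using less(1)[OF vdim_quotient_less[OF less(2) A' pn(1) B] B(1)] by blast
    ultimately show ?thesis using series_extension[OF less(2) A B] by blast
  qed
qed

lemma series_fdhopf:
  fixes H :: "('k::field, 'a) hopf"
  assumes "fdhopf H" "composition_series H Hs" "L \<in> set Hs"
  shows "fdhopf L"
  using assms(2,1,3)
proof (induction arbitrary: L rule: composition_series.induct)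
  case (extension A H B As Bs)
  have B: "prehopf B" using extension(3) hopf_algebra.prehopf by blast
  then obtain \<pi> where \<pi>: "is_quotient H A B \<pi>"
    using is_quotient_iff[OF extension.prems(1) extension(1) B] extension(4) by blast
  have "fdhopf B" by (rule fdhopf_image[OF extension.prems(1) B is_quotientD(1,2)[OF \<pi>]])
  moreover have "fdhopf (restrict_hopf H A)"
    using fdhopf_restrict[OF extension.prems(1) normal_hopf_subalgebraD[OF extension(1)]] .
  ultimately show ?case using extension.IH extension.prems(2) by auto
qed simp

definition hiso :: "('k::field, 'a) hopf \<Rightarrow> ('k, 'a) hopf \<Rightarrow> bool" where
  "hiso H L \<longleftrightarrow> fdhopf H \<and> fdhopf L \<and> H \<cong>\<^sub>H L"

lemma hiso_refl: "fdhopf H \<Longrightarrow> hiso H H"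
  using hopf_isomorphic_refl[OF fdhopf_prehopf] by (simp add: hiso_def)

lemma hiso_sym: "hiso H L \<Longrightarrow> hiso L H"
  using hopf_isomorphic_sym[of H L] fdhopf_prehopf[of L] by (simp add: hiso_def fdhopf_def)

lemma hiso_trans: "hiso H L \<Longrightarrow> hiso L M \<Longrightarrow> hiso H M"
  using hopf_isomorphic_trans[of H L M] fdhopf_prehopf[of L] fdhopf_prehopf[of H] fdhopf_prehopf[of M]
  by (simp add: hiso_def)

definition similar :: "('k::field, 'a) hopf list \<Rightarrow> ('k, 'a) hopf list \<Rightarrow> bool" where
  "similar Hs Hs' \<longleftrightarrow> rel_mset hiso (mset Hs) (mset Hs')"

lemma similarI: "list_all2 hiso Hs Hs' \<Longrightarrow> similar Hs Hs'"
  by (auto simp: similar_def rel_mset_def)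

lemma similar_refl: "(\<And>L. L \<in> set Hs \<Longrightarrow> fdhopf L) \<Longrightarrow> similar Hs Hs"
  by (auto intro!: similarI list.rel_refl_strong hiso_refl)

lemma similar_sym:
  assumes "similar Hs Hs'" shows "similar Hs' Hs"
proof -
  have e: "hiso\<inverse>\<inverse> = hiso" using hiso_sym by (auto simp: fun_eq_iff)
  have c: "rel_mset hiso = (rel_mset hiso)\<inverse>\<inverse>" using multiset.rel_conversep[of hiso] unfolding e .
  moreover have "(rel_mset hiso)\<inverse>\<inverse> (mset Hs') (mset Hs)" using assms by (simp add: similar_def)
  ultimately show ?thesis unfolding similar_def by (subst c)
qed

lemma similar_trans [trans]:
  assumes "similar Hs Hs'" "similar Hs' Hs''" shows "similar Hs Hs''"
proof -
  have "rel_mset (hiso OO hiso) (mset Hs) (mset Hs'')"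
    using assms unfolding multiset.rel_compp similar_def by blast
  then show ?thesis unfolding similar_def
    by (rule multiset.rel_mono_strong) (use hiso_trans in blast)
qed

lemma similar_append:
  assumes "similar Hs Hs'" "similar Ks Ks'" shows "similar (Hs @ Ks) (Hs' @ Ks')"
proof -
  obtain xs ys us vs where "mset xs = mset Hs" "mset ys = mset Hs'" "list_all2 hiso xs ys"
    "mset us = mset Ks" "mset vs = mset Ks'" "list_all2 hiso us vs"
    using assms by (auto simp: similar_def rel_mset_def)
  then show ?thesis unfolding similar_def rel_mset_def
    by (intro exI[of _ "xs @ us"] exI[of _ "ys @ vs"]) (auto intro: list_all2_appendI)
qed

lemma similar_append_commute: "similar (Hs @ Ks) Ls \<longleftrightarrow> similar (Ks @ Hs) Ls" "similar Ls (Hs @ Ks) \<longleftrightarrow> similar Ls (Ks @ Hs)"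
  by (simp_all add: similar_def add.commute)

lemma similar_bijection:
  assumes "similar Hs Hs'"
  obtains f where "bij_betw f {..<length Hs} {..<length Hs'}" "\<And>i. i < length Hs \<Longrightarrow> Hs ! i \<cong>\<^sub>H Hs' ! f i"
proof -
  obtain xs ys where xy: "mset xs = mset Hs" "mset ys = mset Hs'" "list_all2 hiso xs ys"
    using assms by (auto simp: similar_def rel_mset_def)
  obtain Ks where Ks: "list_all2 hiso Hs Ks" "mset Ks = mset ys"
    using list_all2_reorder_left_invariance[OF xy(3), of Hs] xy(1) by auto
  have "mset Ks = mset Hs'" using Ks(2) xy(2) by simp
  then obtain p where p: "p permutes {..<length Hs'}" "permute_list p Hs' = Ks" by (rule mset_eq_permutation)
  have len: "length Hs = length Hs'" using Ks(1) p(2) list_all2_lengthD by fastforce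
  show ?thesis
  proof (rule that[of p])
    show "bij_betw p {..<length Hs} {..<length Hs'}" using permutes_imp_bij[OF p(1)] len by simp
    fix i assume i: "i < length Hs"
    have "Ks ! i = Hs' ! p i" using permute_list_nth[OF p(1), of i] p(2) len i by simp
    then show "Hs ! i \<cong>\<^sub>H Hs' ! p i" using list_all2_nthD[OF Ks(1) i] by (simp add: hiso_def)
  qed
qed

lemma hopf_isomorphismE:
  assumes "hiso H L"
  obtains \<phi> where "hopf_hom H L \<phi>" "bij_betw \<phi> (carrier H) (carrier L)"
  using assms hopf_isomorphic_iff[of H L] fdhopf_prehopf[of H] fdhopf_prehopf[of L] by (auto simp: hiso_def)

text \<open>The quotient map of \<open>H\<close> factors through \<open>\<phi>\<close>, which leaves \<open>Q\<close> unchanged.\<close>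

lemma is_quotient_transport:
  assumes H: "fdhopf H" and L: "fdhopf L" and \<phi>: "hopf_hom H L \<phi>" "bij_betw \<phi> (carrier H) (carrier L)"
    and A: "hopf_subalgebra A H" and Q: "fdhopf Q" "is_quotient H A Q \<pi>"
  obtains \<rho> where "is_quotient L (\<phi> ` A) Q \<rho>"
proof -
  note q = is_quotientD[OF Q(2)] and \<phi>D = hopf_homD[OF \<phi>(1)]
  obtain B d where "fd_hopf H B d" using fdhopf_basis[OF H] .
  then interpret H: fd_hopf H B d .
  have surj: "\<phi> ` carrier H = carrier L" using \<phi>(2) by (simp add: bij_betw_def)
  have Ic: "HAplus H A \<subseteq> carrier H" using H.subspaceD(1)[OF H.HAplus_subspace[OF A]] .
  have \<phi>0: "\<phi> \<zero>\<^bsub>H\<^esub> = \<zero>\<^bsub>L\<^esub>" by (rule H.linear_map_zero[OF fdhopf_vspace[OF L] \<phi>D(1)])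
  have \<pi>0: "\<pi> \<zero>\<^bsub>H\<^esub> = \<zero>\<^bsub>Q\<^esub>" by (rule H.linear_map_zero[OF fdhopf_vspace[OF Q(1)] hopf_homD(1)[OF q(1)]])
  have ker0: "\<pi> x = \<zero>\<^bsub>Q\<^esub>" if "x \<in> carrier H" "\<phi> x = \<zero>\<^bsub>L\<^esub>" for x
  proof -
    have "\<phi> x = \<phi> \<zero>\<^bsub>H\<^esub>" using that \<phi>0 by simp
    then have "x = \<zero>\<^bsub>H\<^esub>" using \<phi>(2) that(1) by (auto simp: bij_betw_def dest: inj_onD)
    then show ?thesis using \<pi>0 by simp
  qed
  obtain \<rho> where \<rho>: "hopf_hom L Q \<rho>" "\<And>x. x \<in> carrier H \<Longrightarrow> \<rho> (\<phi> x) = \<pi> x"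
    using hopf_hom_factor[OF H.hopf_algebra_axioms fdhopf_prehopf[OF L] fdhopf_prehopf[OF Q(1)] \<phi>(1) surj q(1) ker0]
    by blast
  have im1: "\<rho> ` carrier L = (\<lambda>x. \<rho> (\<phi> x)) ` carrier H" unfolding surj[symmetric] by (rule image_image)
  have im2: "(\<lambda>x. \<rho> (\<phi> x)) ` carrier H = \<pi> ` carrier H" by (rule image_cong[OF refl \<rho>(2)])
  have im: "\<rho> ` carrier L = carrier Q" unfolding im1 im2 by (rule q(2))
  have ker: "\<rho> y = \<zero>\<^bsub>Q\<^esub> \<longleftrightarrow> y \<in> HAplus L (\<phi> ` A)" if y: "y \<in> carrier L" for y
  proof -
    obtain x where x: "x \<in> carrier H" "y = \<phi> x" using y unfolding surj[symmetric] by blast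
    have "\<phi> x \<in> \<phi> ` HAplus H A \<longleftrightarrow> x \<in> HAplus H A"
      using bij_betw_imp_inj_on[OF \<phi>(2)] x(1) Ic by (rule inj_on_image_mem_iff)
    then show ?thesis using x \<rho>(2) q(3)[OF x(1)] HAplus_image[OF H \<phi>(1) surj A] by simp
  qed
  have "is_quotient L (\<phi> ` A) Q \<rho>" unfolding is_quotient_def using \<rho>(1) im ker by blast
  then show ?thesis by (rule that)
qed

lemma proper_nontrivial_transport:
  assumes H: "fdhopf H" and L: "fdhopf L" and \<phi>: "hopf_hom H L \<phi>" "bij_betw \<phi> (carrier H) (carrier L)"
    and A: "proper_nontrivial A H"
  shows "proper_nontrivial (\<phi> ` A) L"
proof -
  obtain B d where "fd_hopf H B d" using fdhopf_basis[OF H] .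
  then interpret H: fd_hopf H B d .
  have im: "\<phi> ` {c \<odot>\<^bsub>H\<^esub> \<one>\<^bsub>H\<^esub> | c. True} = {c \<odot>\<^bsub>L\<^esub> \<one>\<^bsub>L\<^esub> | c. True}"
    using hopf_homD(5,6)[OF \<phi>(1)] by (auto simp: image_iff) (metis H.one_closed)
  have inj: "inj_on \<phi> (carrier H)" and surj: "\<phi> ` carrier H = carrier L" using \<phi>(2) by (auto simp: bij_betw_def)
  have A': "{c \<odot>\<^bsub>H\<^esub> \<one>\<^bsub>H\<^esub> | c. True} \<subset> A" "A \<subset> carrier H" using A by (auto simp: proper_nontrivial_def)
  show ?thesis unfolding proper_nontrivial_def im[symmetric] surj[symmetric]
    using image_strict_mono[OF inj_on_subset[OF inj psubset_imp_subset[OF A'(2)]] A'(1)]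
      image_strict_mono[OF inj A'(2)] by blast
qed

lemma hiso_restrict:
  assumes H: "fdhopf H" and L: "fdhopf L" and \<phi>: "hopf_hom H L \<phi>" "bij_betw \<phi> (carrier H) (carrier L)"
    and A: "hopf_subalgebra A H"
  shows "hiso (restrict_hopf H A) (restrict_hopf L (\<phi> ` A))"
proof -
  obtain B d where "fd_hopf H B d" using fdhopf_basis[OF H] .
  then interpret H: fd_hopf H B d .
  note FA = fdhopf_restrict[OF H A] and \<phi>A = image_hopf_subalgebra[OF H L \<phi>(1) A]
  have K: "hopf_algebra (restrict_hopf H A)" using FA by (simp add: fdhopf_def)
  have "hopf_hom (restrict_hopf H A) (restrict_hopf L (\<phi> ` A)) \<phi>"
    by (rule hopf_hom_restrict_codomain[OF K L hopf_hom_restrict_domain[OF H \<phi>(1) A] \<phi>A]) simp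
  moreover have "bij_betw \<phi> A (\<phi> ` A)"
    using \<phi>(2) H.hopf_subalgebraD(2)[OF A] by (auto simp: bij_betw_def inj_on_subset)
  ultimately show ?thesis unfolding hiso_def
    using FA fdhopf_restrict[OF L \<phi>A] hopf_isomorphic_iff[OF fdhopf_prehopf fdhopf_prehopf, of "restrict_hopf H A" "restrict_hopf L (\<phi> ` A)"]
    by auto
qed

lemma simple_transport:
  assumes "hiso H L" "simple_hopf H"
  shows "simple_hopf L"
proof (rule ccontr)
  assume "\<not> simple_hopf L"
  then obtain A where A: "normal_hopf_subalgebra A L" "proper_nontrivial A L" by (auto simp: simple_hopf_def)
  have F: "fdhopf H" "fdhopf L" using assms(1) by (auto simp: hiso_def)
  obtain \<phi> where \<phi>: "hopf_hom L H \<phi>" "bij_betw \<phi> (carrier L) (carrier H)" using hopf_isomorphismE[OF hiso_sym[OF assms(1)]] .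
  have "normal_hopf_subalgebra (\<phi> ` A) H" using image_normal[OF F(2,1) \<phi>(1) _ A(1)] \<phi>(2) by (simp add: bij_betw_def)
  moreover have "proper_nontrivial (\<phi> ` A) H" by (rule proper_nontrivial_transport[OF F(2,1) \<phi> A(2)])
  ultimately show False using assms(2) by (auto simp: simple_hopf_def)
qed

text \<open>The normal Hopf subalgebra is moved along the isomorphism, while the quotient \<open>B\<close> can be kept.\<close>

lemma series_transport:
  fixes H L :: "('k::field, 'a) hopf"
  assumes "composition_series H Hs" "hiso H L"
  shows "\<exists>Ls. composition_series L Ls \<and> similar Hs Ls"
  using assms
proof (induction arbitrary: L rule: composition_series.induct)
  case (simple H)
  then show ?case using simple_transport[of H L] composition_series.simple[of L]
    by (intro exI[of _ "[L]"] conjI similarI) simp_all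
next
  case (extension A H B As Bs)
  have F: "fdhopf H" "fdhopf L" using extension.prems by (auto simp: hiso_def)
  obtain \<phi> where \<phi>: "hopf_hom H L \<phi>" "bij_betw \<phi> (carrier H) (carrier L)" using hopf_isomorphismE[OF extension.prems] .
  have surj: "\<phi> ` carrier H = carrier L" using \<phi>(2) by (simp add: bij_betw_def)
  have preB: "prehopf B" using extension(3) hopf_algebra.prehopf by blast
  then obtain \<pi> where \<pi>: "is_quotient H A B \<pi>"
    using is_quotient_iff[OF F(1) extension(1) preB] extension(4) by blast
  have B: "fdhopf B" by (rule fdhopf_image[OF F(1) preB is_quotientD(1,2)[OF \<pi>]])
  note A = normal_hopf_subalgebraD[OF extension(1)]
  obtain As' where As': "composition_series (restrict_hopf L (\<phi> ` A)) As'" "similar As As'"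
    using extension.IH(1)[OF hiso_restrict[OF F \<phi> A]] by blast
  obtain \<rho> where \<rho>: "is_quotient L (\<phi> ` A) B \<rho>" by (rule is_quotient_transport[OF F \<phi> A B \<pi>])
  have "composition_series L (As' @ Bs)"
    by (rule series_extension[OF F(2) image_normal[OF F \<phi>(1) surj extension(1)]
          proper_nontrivial_transport[OF F \<phi> extension(2)] B \<rho> As'(1)]) (rule extension)
  moreover have "similar (As @ Bs) (As' @ Bs)"
    by (intro similar_append As'(2) similar_refl series_fdhopf[OF B]) (rule extension)
  ultimately have "composition_series L (As' @ Bs) \<and> similar (As @ Bs) (As' @ Bs)" by (rule conjI)
  then show ?case by (rule exI)
qed

section \<open>Uniqueness of composition series\<close>

definition unique_series :: "('k::field, 'a) hopf \<Rightarrow> bool" where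
  "unique_series H \<longleftrightarrow> (\<forall>Hs Hs'. composition_series H Hs \<longrightarrow> composition_series H Hs' \<longrightarrow> similar Hs Hs')"

lemma unique_seriesD: "unique_series H \<Longrightarrow> composition_series H Hs \<Longrightarrow> composition_series H Hs' \<Longrightarrow> similar Hs Hs'"
  by (simp add: unique_series_def)

lemma unique_series_hiso:
  fixes H L :: "('k::field, 'a) hopf"
  assumes "unique_series H" "composition_series H Hs" "composition_series L Ls" "hiso L H"
  shows "similar Hs Ls"
proof -
  obtain Hs' where "composition_series H Hs'" "similar Ls Hs'" using series_transport[OF assms(3,4)] by blast
  then show ?thesis using unique_seriesD[OF assms(1,2)] similar_sym similar_trans by blast
qed

text \<open>For \<open>A \<subset> E\<close>, refine the chain \<open>A \<subset> E \<subset> H\<close>: the quotient \<open>E / A\<close> is a normal Hopf subalgebra \<open>F\<close> of \<open>B = H / A\<close>, with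
  \<open>B / F \<cong> H / E\<close>. A series \<open>Qs\<close> of \<open>F\<close> completes \<open>As\<close> to a series of \<open>E\<close>, and \<open>Rs\<close> is completed by \<open>Qs\<close> to one of \<open>B\<close>,
  up to isomorphism.\<close>

lemma series_refine:
  fixes H B R :: "('k::field, 'a) hopf"
  assumes H: "fdhopf H"
    and A: "normal_hopf_subalgebra A H" "proper_nontrivial A H"
    and B: "fdhopf B" "is_quotient H A B \<pi>" "unique_series B"
    and E: "normal_hopf_subalgebra E H" "A \<subseteq> E" "E \<noteq> carrier H" "unique_series (restrict_hopf H E)"
    and R: "fdhopf R" "is_quotient H E R \<rho>"
    and As: "composition_series (restrict_hopf H A) As" and Bs: "composition_series B Bs"
    and Es: "composition_series (restrict_hopf H E) Es" and Rs: "composition_series R Rs"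
  shows "similar (As @ Bs) (Es @ Rs)"
proof (cases "A = E")
  case True
  have "hiso R B" using quotient_unique[OF H R B(1)] B(1,2) R(1) True by (auto simp: hiso_def)
  then have "similar Bs Rs" by (rule unique_series_hiso[OF B(3) Bs Rs])
  moreover have "similar As Es" using unique_seriesD[OF E(4) _ Es] As True by simp
  ultimately show ?thesis by (intro similar_append)
next
  case False
  then have AE: "A \<subset> E" "A \<inter> E = A" using E(2) by auto
  let ?F = "\<pi> ` E" and ?K = "restrict_hopf H E"
  note q = is_quotientD[OF B(2)] and E' = normal_hopf_subalgebraD[OF E(1)] and A' = normal_hopf_subalgebraD[OF A(1)]
  note K = fdhopf_restrict[OF H E']
  have F: "normal_hopf_subalgebra ?F B" by (rule image_normal[OF H B(1) q(1,2) E(1)])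
  have Fp: "proper_nontrivial ?F B" by (rule image_proper_nontrivial[OF H A(1) E' AE(1) E(3) B(1,2)])
  have FB: "fdhopf (restrict_hopf B ?F)" by (rule fdhopf_restrict[OF B(1) normal_hopf_subalgebraD[OF F]])
  obtain Qs where Qs: "composition_series (restrict_hopf B ?F) Qs" using series_exists[OF FB] by blast
  obtain R' :: "('k, 'a) hopf" and \<sigma> where R': "fdhopf R'" "is_quotient B ?F R' \<sigma>"
    using quotient_exists[OF B(1) F] by blast
  have "is_quotient H E R' (\<lambda>x. \<sigma> (\<pi> x))" by (rule is_quotient_comp[OF H A(1) E' E(2) B(1,2) R'(2)])
  then have "hiso R R'" using quotient_unique[OF H R R'(1)] R(1) R'(1) by (simp add: hiso_def)
  then obtain Rs' where Rs': "composition_series R' Rs'" "similar Rs Rs'" using series_transport[OF Rs] by blast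
  have AK: "normal_hopf_subalgebra A ?K" using normal_Int_restrict[OF H E' A(1)] AE(2) by simp
  have AKp: "proper_nontrivial A ?K" using A(2) AE(1) by (simp add: proper_nontrivial_def)
  have "is_quotient ?K A (restrict_hopf B ?F) \<pi>"
    using is_quotient_restrict[OF H A(1) E' B(1,2)] AE(2) by simp
  then have AQs: "composition_series ?K (As @ Qs)"
    using As restrict_restrict[OF E(2), of H] by (intro series_extension[OF K AK AKp FB _ _ Qs]) simp_all
  have "similar Bs (Qs @ Rs')"
    by (rule unique_seriesD[OF B(3) Bs series_extension[OF B(1) F Fp R' Qs Rs'(1)]])
  then have "similar (As @ Bs) (As @ (Qs @ Rs'))"
    using series_fdhopf[OF fdhopf_restrict[OF H A'] As] by (intro similar_append similar_refl)
  then have "similar (As @ Bs) ((As @ Qs) @ Rs')" by simp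
  also have "similar \<dots> (Es @ Rs)"
    by (intro similar_append unique_seriesD[OF E(4) AQs Es] similar_sym[OF Rs'(2)])
  finally show ?thesis .
qed

lemma hiso_if_trivial_kernel:
  fixes H Q :: "('k::field, 'a) hopf"
  assumes H: "fdhopf H" and Q: "fdhopf Q" "is_quotient H {c \<odot>\<^bsub>H\<^esub> \<one>\<^bsub>H\<^esub> | c. True} Q \<pi>"
  shows "hiso H Q"
proof -
  note q = is_quotientD[OF Q(2)]
  have V: "vspace H" "vspace Q" by (rule fdhopf_vspace, fact)+
  interpret vspace H by (rule V)
  have "inj_on \<pi> (carrier H)"
  proof (rule inj_onI)
    fix x y assume xy: "x \<in> carrier H" "y \<in> carrier H" "\<pi> x = \<pi> y"
    then have "\<pi> (x \<ominus>\<^bsub>H\<^esub> y) = \<zero>\<^bsub>Q\<^esub>" using hopf_hom_kernel(2)[OF V q(1)] by blast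
    then have "x \<ominus>\<^bsub>H\<^esub> y = \<zero>\<^bsub>H\<^esub>" using HAplus_trivial[OF H refl] q(3)[of "x \<ominus>\<^bsub>H\<^esub> y"] xy by simp
    then show "x = y" using diff_eq_zero_iff[OF xy(1,2)] by simp
  qed
  then have "bij_betw \<pi> (carrier H) (carrier Q)" using q(2) by (simp add: bij_betw_def)
  then show ?thesis unfolding hiso_def
    using H Q(1) q(1) hopf_isomorphic_iff[OF fdhopf_prehopf[OF H] fdhopf_prehopf[OF Q(1)]] by blast
qed

text \<open>With \<open>D = A \<inter> A\<^sub>1\<close> and a series \<open>Ds\<close> of \<open>D\<close>, the isomorphisms \<open>A / D \<cong> B\<^sub>1\<close> and \<open>A\<^sub>1 / D \<cong> B\<close> give \<open>As ~ Ds @ Bs\<^sub>1\<close>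
  and \<open>As\<^sub>1 ~ Ds @ Bs\<close>, so both series of \<open>H\<close> are similar to \<open>Ds @ Bs @ Bs\<^sub>1\<close>. For \<open>D = k\<close> there is no series \<open>Ds\<close>
  to insert, but then \<open>A \<cong> B\<^sub>1\<close> and \<open>A\<^sub>1 \<cong> B\<close>.\<close>

lemma series_complementary:
  fixes H B B1 :: "('k::field, 'a) hopf"
  assumes H: "fdhopf H"
    and A: "normal_hopf_subalgebra A H" "proper_nontrivial A H" "unique_series (restrict_hopf H A)"
    and B: "fdhopf B" "is_quotient H A B \<pi>"
    and A1: "normal_hopf_subalgebra A1 H" "proper_nontrivial A1 H" "unique_series (restrict_hopf H A1)"
    and B1: "fdhopf B1" "is_quotient H A1 B1 \<pi>1"
    and gen: "carrier H = ideal_prod H A A1"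
    and As: "composition_series (restrict_hopf H A) As" and Bs: "composition_series B Bs"
    and As1: "composition_series (restrict_hopf H A1) As1" and Bs1: "composition_series B1 Bs1"
  shows "similar (As @ Bs) (As1 @ Bs1)"
proof -
  note A' = normal_hopf_subalgebraD[OF A(1)] and A1' = normal_hopf_subalgebraD[OF A1(1)]
  note K = fdhopf_restrict[OF H A'] and K1 = fdhopf_restrict[OF H A1']
  obtain S d where "fd_hopf H S d" using fdhopf_basis[OF H] .
  then interpret H: fd_hopf H S d .
  let ?D = "A \<inter> A1"
  have onto: "\<pi> ` A1 = carrier B" "\<pi>1 ` A = carrier B1"
    by (rule ideal_prod_image(1)[OF H A' A1' gen B] ideal_prod_image(2)[OF H A' A1' gen B1])+
  have q1: "is_quotient (restrict_hopf H A1) ?D B \<pi>"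
    by (rule is_quotient_restrict_onto[OF H A(1) A1' B onto(1)])
  have q: "is_quotient (restrict_hopf H A) ?D B1 \<pi>1"
    using is_quotient_restrict_onto[OF H A1(1) A' B1 onto(2)] by (simp add: Int_commute)
  have D: "hopf_subalgebra ?D H" by (rule H.hopf_subalgebra_Int[OF A' A1'])
  show ?thesis
  proof (cases "?D = {c \<odot>\<^bsub>H\<^esub> \<one>\<^bsub>H\<^esub> | c. True}")
    case True
    have "hiso (restrict_hopf H A1) B" using q1 True by (intro hiso_if_trivial_kernel[OF K1 B(1)]) simp
    then have 1: "similar As1 Bs" by (rule unique_series_hiso[OF A1(3) As1 Bs hiso_sym])
    have "hiso (restrict_hopf H A) B1" using q True by (intro hiso_if_trivial_kernel[OF K B1(1)]) simp
    then have "similar As Bs1" by (rule unique_series_hiso[OF A(3) As Bs1 hiso_sym])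
    then have "similar (As @ Bs) (Bs1 @ As1)" using similar_sym[OF 1] by (rule similar_append)
    then show ?thesis using similar_append_commute(2) by blast
  next
    case False
    then have sc: "{c \<odot>\<^bsub>H\<^esub> \<one>\<^bsub>H\<^esub> | c. True} \<subset> ?D" using scalars_subset[OF H D] by blast
    have "?D \<noteq> A"
      using ideal_prod_subset[OF H A1', of A A1] gen A1(2) by (auto simp: proper_nontrivial_def)
    then have p: "proper_nontrivial ?D (restrict_hopf H A)" using sc by (simp add: proper_nontrivial_def) blast
    have "?D \<noteq> A1"
      using ideal_prod_subset[OF H A', of A A1] gen A(2) by (auto simp: proper_nontrivial_def)
    then have p1: "proper_nontrivial ?D (restrict_hopf H A1)" using sc by (simp add: proper_nontrivial_def) blast
    have n1: "normal_hopf_subalgebra ?D (restrict_hopf H A1)" by (rule normal_Int_restrict[OF H A1' A(1)])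
    have n: "normal_hopf_subalgebra ?D (restrict_hopf H A)"
      using normal_Int_restrict[OF H A' A1(1)] by (simp add: Int_commute)
    obtain Ds where Ds: "composition_series (restrict_hopf H ?D) Ds"
      using series_exists[OF fdhopf_restrict[OF H D]] by blast
    have "composition_series (restrict_hopf H A1) (Ds @ Bs)"
      using Ds by (intro series_extension[OF K1 n1 p1 B(1) q1 _ Bs]) (simp add: restrict_restrict)
    then have 1: "similar (Ds @ Bs) As1" by (rule unique_seriesD[OF A1(3) _ As1])
    have "composition_series (restrict_hopf H A) (Ds @ Bs1)"
      using Ds by (intro series_extension[OF K n p B1(1) q _ Bs1]) (simp add: restrict_restrict)
    then have "similar As (Ds @ Bs1)" by (rule unique_seriesD[OF A(3) As])
    then have "similar (As @ Bs) ((Ds @ Bs1) @ Bs)"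
      by (intro similar_append similar_refl series_fdhopf[OF B(1) Bs])
    then have "similar (As @ Bs) ((Ds @ Bs) @ Bs1)" by (simp add: similar_def ac_simps)
    also have "similar \<dots> (As1 @ Bs1)"
      by (intro similar_append 1 similar_refl series_fdhopf[OF B1(1) Bs1])
    finally show ?thesis .
  qed
qed

text \<open>The induction on the dimension covers \<open>A\<close>, \<open>A\<^sub>1\<close>, their quotients, and the product \<open>E\<close> when it is proper. If it is,
  both series are refined through \<open>E\<close>.\<close>

lemma composition_series_unique:
  fixes H :: "('k::field, 'a) hopf"
  assumes "fdhopf H" shows "unique_series H"
  using assms
proof (induction "vdim H" arbitrary: H rule: less_induct)
  case (less H)
  note H = less(2)
  have sub: "unique_series (restrict_hopf H A)" if "hopf_subalgebra A H" "A \<noteq> carrier H" for A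
    using less(1)[OF vdim_restrict_less[OF H that] fdhopf_restrict[OF H that(1)]] .
  have quot: "unique_series B" if "hopf_subalgebra A H" "proper_nontrivial A H" "fdhopf B" "is_quotient H A B \<pi>"
    for A and B :: "('k, 'a) hopf" and \<pi>
    using less(1)[OF vdim_quotient_less[OF H that(1) proper_nontrivialD(1)[OF that(2)] that(3,4)] that(3)] .
  have "similar Hs Hs'" if Hs: "composition_series H Hs" and Hs': "composition_series H Hs'" for Hs Hs'
    using series_cases[OF H Hs]
  proof cases
    case 1
    have "Hs' = [H]" using series_cases[OF H Hs'] by cases (use 1(1) in \<open>auto simp: simple_hopf_def\<close>)
    then show ?thesis using 1(2) H by (auto intro!: similar_refl)
  next
    case (2 A B \<pi> As Bs)
    note s = 2
    show ?thesis using series_cases[OF H Hs']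
    proof cases
      case 1
      then show ?thesis using s(1,2) by (auto simp: simple_hopf_def)
    next
      case (2 A1 B1 \<pi>1 As1 Bs1)
      note A' = normal_hopf_subalgebraD[OF s(1)] and A1' = normal_hopf_subalgebraD[OF 2(1)]
      note pA = proper_nontrivialD(2)[OF s(2)] and pA1 = proper_nontrivialD(2)[OF 2(2)]
      obtain S d where "fd_hopf H S d" using fdhopf_basis[OF H] .
      then interpret H: fd_hopf H S d .
      let ?E = "ideal_prod H A A1"
      note E = H.prod_normal[OF s(1) 2(1)] and incl = H.prod_inclusions(5,6)[OF s(1) A1']
      note E' = normal_hopf_subalgebraD[OF E]
      show ?thesis
      proof (cases "?E = carrier H")
        case True
        show ?thesis unfolding s(7) 2(7)
          by (rule series_complementary[OF H s(1,2) sub[OF A' pA] s(3,4) 2(1,2) sub[OF A1' pA1] 2(3,4)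
                True[symmetric] s(5,6) 2(5,6)])
      next
        case False
        obtain R :: "('k, 'a) hopf" and \<rho> where R: "fdhopf R" "is_quotient H ?E R \<rho>"
          using quotient_exists[OF H E] by blast
        obtain Rs where Rs: "composition_series R Rs" using series_exists[OF R(1)] by blast
        obtain Es where Es: "composition_series (restrict_hopf H ?E) Es"
          using series_exists[OF fdhopf_restrict[OF H E']] by blast
        have "similar (As @ Bs) (Es @ Rs)"
          by (rule series_refine[OF H s(1,2,3,4) quot[OF A' s(2,3,4)] E incl(1) False sub[OF E' False] R
                s(5,6) Es Rs])
        moreover have "similar (As1 @ Bs1) (Es @ Rs)"
          by (rule series_refine[OF H 2(1,2,3,4) quot[OF A1' 2(2,3,4)] E incl(2) False sub[OF E' False] R
                2(5,6) Es Rs])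
        ultimately show ?thesis unfolding s(7) 2(7) using similar_sym similar_trans by blast
      qed
    qed
  qed
  then show ?case by (simp add: unique_series_def)
qed

theorem theorem1p2:
  fixes H :: "('k::field, 'a) hopf" and Hs Hs' :: "('k, 'a) hopf list"
  assumes "hopf_algebra H"
    and "finite_dimensional H"
    and "composition_series H Hs"
    and "composition_series H Hs'"
  shows "\<exists>f. bij_betw f {..<length Hs} {..<length Hs'} \<and>
             (\<forall>i<length Hs. Hs ! i \<cong>\<^sub>H Hs' ! f i)"
proof -
  have "fdhopf H" using assms(1,2) by (simp add: fdhopf_def)
  then have "similar Hs Hs'" using unique_seriesD[OF composition_series_unique assms(3,4)] by blast
  then obtain f where "bij_betw f {..<length Hs} {..<length Hs'}" "\<And>i. i < length Hs \<Longrightarrow> Hs ! i \<cong>\<^sub>H Hs' ! f i"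
    using similar_bijection by blast
  then show ?thesis by blast
qed

end
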